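(* Let $G$ be a locally compact group, $I$ a non-empty set, and $S=M^{0}(G,I)$ the Brandt semigroup over $G$ with index set $I$. Then the following are equivalent: (i) $\ell^{1}(S)$ is strong pseudo-amenable; (ii) $G$ is amenable and $I$ is finite; (iii) $\ell^{1}(S)$ is approximately amenable.
   Context: Amenability of $G$ is the usual notion for locally compact groups (existence of a left-invariant mean on $L^\infty(G)$). Brandt semigroup: $M^0(G,I)=\{(g)_{i,j}: g\in G,\ i,j\in I\}\cup\{0\}$, where $(g)_{i,j}$ is the $I\times I$ matrix with $g$ in position $(i,j)$ and zero elsewhere, with product $(g)_{i,j}*(h)_{k,l}=(gh)_{i,l}$ if $j=k$ and $0$ if $j\ne k$, and $0$ absorbing. $\ell^1(S)$ is the semigroup algebra of $S$, i.e. the Banach algebra with convolution product determined by $\delta_s\delta_t=\delta_{st}$. Strong pseudo-amenability: for a Banach algebra $A$, $A\otimes_p A$ is the projective tensor product, a Banach $A$-bimodule via $a\cdot(b\otimes c)=ab\otimes c$, $(b\otimes c)\cdot a=b\otimes ca$; $\pi_A:A\otimes_pA\to A$ is the bounded linear map with $\pi_A(a\otimes b)=ab$. For a Banach $A$-bimodule $X$, $X^*$ is a Banach $A$-bimodule via $(a\cdot f)(x)=f(x\cdot a)$, $(f\cdot a)(x)=f(a\cdot x)$; iterating, $(A\otimes_pA)^{**}$ and $A^{**}$ are Banach $A$-bimodules, and $A\subseteq A^{**}$ canonically. $A$ is strong pseudo-amenable if there is a (not necessarily bounded) net $(m_\alpha)$ in $(A\otimes_pA)^{**}$ such that for every $a\in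 A$: $a\cdot m_\alpha-m_\alpha\cdot a\to 0$ in norm, $a\,\pi_A^{**}(m_\alpha)=\pi_A^{**}(m_\alpha)\,a$ for all $\alpha$, and $\pi_A^{**}(m_\alpha)\,a\to a$ in norm. Approximate amenability: $A$ is approximately amenable if for each Banach $A$-bimodule $X$ and each bounded derivation $D:A\to X^*$ there is a net $(x_\alpha)$ in $X^*$ with $D(a)=\lim_\alpha (a\cdot x_\alpha-x_\alpha\cdot a)$ for every $a\in A$.
   Formalization: In (ii), "G is amenable" is read as amenability of G with the discrete topology; for the given topology only (i)⇒(ii) and (iii)⇒(ii) hold, since the converse fails for a non-discrete G (SO(3) with |I|=1 is compact, but ℓ¹(S) has neither property). *)

theory Defs
  imports "HOL-Analysis.Analysis" "HOL-Algebra.Module"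
begin

section \<open>Complex Banach spaces on carrier sets\<close>

text \<open>
  The bimodules below (duals, biduals, projective tensor products, and the arbitrary bimodules in
  approximate amenability) are not given by types of a fixed class, so spaces are records with a
  carrier, extending the module record of HOL-Algebra by a norm. As in HOL-Algebra, the
  ring fields \<open>mult\<close> and \<open>one\<close> are unused when the record is only a vector space; when it is an
  algebra, \<open>mult\<close> is its product. No unit is assumed, and \<open>one\<close> is never used except in the scalars.
\<close>

record 'v nspace = "(complex, 'v) module" +
  vnorm :: "'v \<Rightarrow> real"

definition complex_space :: "complex nspace" where
  "complex_space = \<lparr>carrier = UNIV, mult = (*), one = 1, zero = 0, add = (+), smult = (*),
     vnorm = cmod\<rparr>"

definition normed_space :: "('v, 'm) nspace_scheme \<Rightarrow> bool" where
  "normed_space V \<longleftrightarrow> Module.module complex_space V \<and>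
     (\<forall>x\<in>carrier V. 0 \<le> vnorm V x \<and> (vnorm V x = 0 \<longleftrightarrow> x = \<zero>\<^bsub>V\<^esub>)) \<and>
     (\<forall>x\<in>carrier V. \<forall>y\<in>carrier V. vnorm V (x \<oplus>\<^bsub>V\<^esub> y) \<le> vnorm V x + vnorm V y) \<and>
     (\<forall>c. \<forall>x\<in>carrier V. vnorm V (c \<odot>\<^bsub>V\<^esub> x) = cmod c * vnorm V x)"

definition banach_space :: "('v, 'm) nspace_scheme \<Rightarrow> bool" where
  "banach_space V \<longleftrightarrow> normed_space V \<and>
     (\<forall>\<sigma> :: nat \<Rightarrow> 'v. range \<sigma> \<subseteq> carrier V \<and>
        (\<forall>e>0. \<exists>N. \<forall>n\<ge>N. \<forall>k\<ge>N. vnorm V (\<sigma> n \<ominus>\<^bsub>V\<^esub> \<sigma> k) < e) \<longrightarrow>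
        (\<exists>x\<in>carrier V. (\<lambda>n. vnorm V (\<sigma> n \<ominus>\<^bsub>V\<^esub> x)) \<longlonglongrightarrow> 0))"

definition bounded_linear_map ::
  "('v, 'm) nspace_scheme \<Rightarrow> ('w, 'k) nspace_scheme \<Rightarrow> ('v \<Rightarrow> 'w) \<Rightarrow> bool" where
  "bounded_linear_map V W T \<longleftrightarrow> T \<in> carrier V \<rightarrow> carrier W \<and>
     (\<forall>x\<in>carrier V. \<forall>y\<in>carrier V. T (x \<oplus>\<^bsub>V\<^esub> y) = T x \<oplus>\<^bsub>W\<^esub> T y) \<and>
     (\<forall>c. \<forall>x\<in>carrier V. T (c \<odot>\<^bsub>V\<^esub> x) = c \<odot>\<^bsub>W\<^esub> T x) \<and>
     (\<exists>K. \<forall>x\<in>carrier V. vnorm W (T x) \<le> K * vnorm V x)"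

section \<open>Banach bimodules and their duals\<close>

record ('a, 'x) bimodule = "'x nspace" +
  lact :: "'a \<Rightarrow> 'x \<Rightarrow> 'x"
  ract :: "'x \<Rightarrow> 'a \<Rightarrow> 'x"

definition banach_bimodule :: "('a, 'm) nspace_scheme \<Rightarrow> ('a, 'x) bimodule \<Rightarrow> bool" where
  "banach_bimodule A X \<longleftrightarrow> banach_space X \<and>
     (\<forall>a\<in>carrier A. bounded_linear_map X X (lact X a) \<and> bounded_linear_map X X (\<lambda>x. ract X x a)) \<and>
     (\<forall>x\<in>carrier X. bounded_linear_map A X (\<lambda>a. lact X a x) \<and> bounded_linear_map A X (ract X x)) \<and>
     (\<forall>a\<in>carrier A. \<forall>b\<in>carrier A. \<forall>x\<in>carrier X.
        lact X (a \<otimes>\<^bsub>A\<^esub> b) x = lact X a (lact X b x) \<and>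
        ract X x (a \<otimes>\<^bsub>A\<^esub> b) = ract X (ract X x a) b \<and>
        lact X a (ract X x b) = ract X (lact X a x) b) \<and>
     (\<exists>K. \<forall>a\<in>carrier A. \<forall>x\<in>carrier X.
        vnorm X (lact X a x) \<le> K * vnorm A a * vnorm X x \<and>
        vnorm X (ract X x a) \<le> K * vnorm A a * vnorm X x)"

text \<open>Functionals are extensional (\<open>undefined\<close> off the carrier), so that each one is represented
  by exactly one HOL function.\<close>

definition dual_bimodule :: "('a, 'x) bimodule \<Rightarrow> ('a, 'x \<Rightarrow> complex) bimodule" where
  "dual_bimodule X =
     \<lparr>carrier = {f \<in> extensional (carrier X). bounded_linear_map X complex_space f},
      mult = undefined, one = undefined,
      zero = (\<lambda>x\<in>carrier X. 0),
      add = (\<lambda>f g. \<lambda>x\<in>carrier X. f x + g x),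
      smult = (\<lambda>c f. \<lambda>x\<in>carrier X. c * f x),
      vnorm = (\<lambda>f. Sup {cmod (f x) | x. x \<in> carrier X \<and> vnorm X x \<le> 1}),
      lact = (\<lambda>a f. \<lambda>x\<in>carrier X. f (ract X x a)),
      ract = (\<lambda>f a. \<lambda>x\<in>carrier X. f (lact X a x))\<rparr>"

definition canonical_embedding :: "('a, 'x) bimodule \<Rightarrow> 'x \<Rightarrow> ('x \<Rightarrow> complex) \<Rightarrow> complex" where
  "canonical_embedding X x = (\<lambda>f\<in>carrier (dual_bimodule X). f x)"

text \<open>The adjoint \<open>Y\<^sup>* \<rightarrow> X\<^sup>*\<close> of \<open>T : X \<rightarrow> Y\<close>.\<close>

definition adjoint_map ::
  "('a, 'x) bimodule \<Rightarrow> ('a, 'y) bimodule \<Rightarrow> ('x \<Rightarrow> 'y) \<Rightarrow> ('y \<Rightarrow> complex) \<Rightarrow> 'x \<Rightarrow> complex" where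
  "adjoint_map X Y T = (\<lambda>f\<in>carrier (dual_bimodule Y). \<lambda>x\<in>carrier X. f (T x))"

definition self_bimodule :: "('a, 'm) nspace_scheme \<Rightarrow> ('a, 'a) bimodule" where
  "self_bimodule A =
     \<lparr>carrier = carrier A, mult = mult A, one = one A, zero = zero A, add = add A,
      smult = smult A, vnorm = vnorm A, lact = mult A, ract = mult A\<rparr>"

section \<open>The projective tensor product of an algebra with itself\<close>

definition bilinear_forms :: "('a, 'm) nspace_scheme \<Rightarrow> ('a \<times> 'a \<Rightarrow> complex) set" where
  "bilinear_forms A = {\<beta> \<in> extensional (carrier A \<times> carrier A).
     (\<forall>x\<in>carrier A. bounded_linear_map A complex_space (\<lambda>y. \<beta> (x, y)) \<and>
                    bounded_linear_map A complex_space (\<lambda>y. \<beta> (y, x))) \<and>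
     (\<exists>K. \<forall>x\<in>carrier A. \<forall>y\<in>carrier A. cmod (\<beta> (x, y)) \<le> K * vnorm A x * vnorm A y)}"

text \<open>
  The elements of the projective tensor product are exactly the sums \<open>\<Sum>n. a n \<otimes> b n\<close> with
  \<open>\<Sum>n. \<parallel>a n\<parallel> * \<parallel>b n\<parallel> < \<infinity>\<close>, and the projective norm is the infimum of the latter sums over all such
  representations. Two sums denote the same element iff all bounded bilinear forms agree on them,
  because these forms make up the dual space; so an element is encoded by its evaluation
  functional on bounded bilinear forms, with \<open>a \<otimes> b\<close> being evaluation at \<open>(a, b)\<close>.
\<close>

type_synonym 'a tensor = "('a \<times> 'a \<Rightarrow> complex) \<Rightarrow> complex"

definition elementary_tensor :: "('a, 'm) nspace_scheme \<Rightarrow> 'a \<Rightarrow> 'a \<Rightarrow> 'a tensor" where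
  "elementary_tensor A a b = (\<lambda>\<beta>\<in>bilinear_forms A. \<beta> (a, b))"

definition tensor_series ::
  "('a, 'm) nspace_scheme \<Rightarrow> (nat \<Rightarrow> 'a) \<Rightarrow> (nat \<Rightarrow> 'a) \<Rightarrow> 'a tensor \<Rightarrow> bool" where
  "tensor_series A a b u \<longleftrightarrow> range a \<subseteq> carrier A \<and> range b \<subseteq> carrier A \<and>
     summable (\<lambda>n. vnorm A (a n) * vnorm A (b n)) \<and>
     u = (\<lambda>\<beta>\<in>bilinear_forms A. \<Sum>n. elementary_tensor A (a n) (b n) \<beta>)"

text \<open>The actions are the transposes of \<open>(x, y) \<mapsto> (a x, y)\<close> and \<open>(x, y) \<mapsto> (x, y a)\<close>; on
  elementary tensors they are \<open>a \<cdot> (b \<otimes> c) = ab \<otimes> c\<close> and \<open>(b \<otimes> c) \<cdot> a = b \<otimes> ca\<close>.\<close>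

definition proj_tensor :: "('a, 'm) nspace_scheme \<Rightarrow> ('a, 'a tensor) bimodule" where
  "proj_tensor A =
     \<lparr>carrier = {u. \<exists>a b. tensor_series A a b u},
      mult = undefined, one = undefined,
      zero = (\<lambda>\<beta>\<in>bilinear_forms A. 0),
      add = (\<lambda>u v. \<lambda>\<beta>\<in>bilinear_forms A. u \<beta> + v \<beta>),
      smult = (\<lambda>c u. \<lambda>\<beta>\<in>bilinear_forms A. c * u \<beta>),
      vnorm = (\<lambda>u. Inf {(\<Sum>n. vnorm A (a n) * vnorm A (b n)) | a b. tensor_series A a b u}),
      lact = (\<lambda>a u. \<lambda>\<beta>\<in>bilinear_forms A.
                u (\<lambda>(x, y)\<in>carrier A \<times> carrier A. \<beta> (a \<otimes>\<^bsub>A\<^esub> x, y))),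
      ract = (\<lambda>u a. \<lambda>\<beta>\<in>bilinear_forms A.
                u (\<lambda>(x, y)\<in>carrier A \<times> carrier A. \<beta> (x, y \<otimes>\<^bsub>A\<^esub> a)))\<rparr>"

definition product_map :: "('a, 'm) nspace_scheme \<Rightarrow> 'a tensor \<Rightarrow> 'a" where
  "product_map A = (THE T. T \<in> extensional (carrier (proj_tensor A)) \<and>
     bounded_linear_map (proj_tensor A) A T \<and>
     (\<forall>a\<in>carrier A. \<forall>b\<in>carrier A. T (elementary_tensor A a b) = a \<otimes>\<^bsub>A\<^esub> b))"

definition product_map_bidual ::
  "('a, 'm) nspace_scheme \<Rightarrow> (('a tensor \<Rightarrow> complex) \<Rightarrow> complex) \<Rightarrow> ('a \<Rightarrow> complex) \<Rightarrow> complex" where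
  "product_map_bidual A =
     adjoint_map (dual_bimodule (self_bimodule A)) (dual_bimodule (proj_tensor A))
       (adjoint_map (proj_tensor A) (self_bimodule A) (product_map A))"

section \<open>Strong pseudo-amenability and approximate amenability\<close>

text \<open>
  Nets are rendered by proper filters on the space: a net corresponds to the image under it of its
  tail filter, and a property of all members of the net to a property that holds eventually. No
  boundedness is imposed.
\<close>

definition strong_pseudo_amenable :: "('a, 'm) nspace_scheme \<Rightarrow> bool" where
  "strong_pseudo_amenable A \<longleftrightarrow>
     (let T = dual_bimodule (dual_bimodule (proj_tensor A));
          B = dual_bimodule (dual_bimodule (self_bimodule A));
          P = product_map_bidual A
      in \<exists>F. F \<noteq> bot \<and>
           (\<forall>\<^sub>F m in F. m \<in> carrier T \<and> (\<forall>a\<in>carrier A. lact B a (P m) = ract B (P m) a)) \<and>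
           (\<forall>a\<in>carrier A.
              ((\<lambda>m. vnorm T (lact T a m \<ominus>\<^bsub>T\<^esub> ract T m a)) \<longlongrightarrow> 0) F \<and>
              ((\<lambda>m. vnorm B (ract B (P m) a \<ominus>\<^bsub>B\<^esub> canonical_embedding (self_bimodule A) a)) \<longlongrightarrow> 0) F))"

definition derivation ::
  "('a, 'm) nspace_scheme \<Rightarrow> ('a, 'x) bimodule \<Rightarrow> ('a \<Rightarrow> 'x) \<Rightarrow> bool" where
  "derivation A X D \<longleftrightarrow> bounded_linear_map A X D \<and>
     (\<forall>a\<in>carrier A. \<forall>b\<in>carrier A. D (a \<otimes>\<^bsub>A\<^esub> b) = lact X a (D b) \<oplus>\<^bsub>X\<^esub> ract X (D a) b)"

text \<open>
  HOL cannot quantify over all Banach bimodules at once, so the type \<open>'x\<close> that contains their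
  carriers is a parameter. A small type would weaken the notion (a one-element type makes it
  trivial), but the notion does not depend on \<open>'x\<close> as soon as \<open>'x\<close> is at least as large as
  \<open>carrier A\<close>: by weak* compactness it suffices to test bimodules whose cardinality is at most that
  of \<open>A\<close>. A statement about \<open>TYPE('x + 'u)\<close>, for one type \<open>'u\<close> that is large enough and an arbitrary
  type variable \<open>'x\<close>, therefore is about the class of all bimodules: any bimodule has an isomorphic
  copy with carrier in \<open>'x + 'u\<close> for a suitable \<open>'x\<close>.
\<close>

definition approximately_amenable :: "'x itself \<Rightarrow> ('a, 'm) nspace_scheme \<Rightarrow> bool" where
  "approximately_amenable _ A \<longleftrightarrow>
     (\<forall>(X :: ('a, 'x) bimodule) D. banach_bimodule A X \<and> derivation A (dual_bimodule X) D \<longrightarrow>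
        (let Y = dual_bimodule X
         in \<exists>F. F \<noteq> bot \<and> (\<forall>\<^sub>F f in F. f \<in> carrier Y) \<and>
              (\<forall>a\<in>carrier A.
                 ((\<lambda>f. vnorm Y (D a \<ominus>\<^bsub>Y\<^esub> (lact Y a f \<ominus>\<^bsub>Y\<^esub> ract Y f a))) \<longlongrightarrow> 0) F)))"

section \<open>Amenable locally compact groups\<close>

definition locally_compact_group :: "('g, 'm) monoid_scheme \<Rightarrow> 'g topology \<Rightarrow> bool" where
  "locally_compact_group G \<tau> \<longleftrightarrow> Group.group G \<and> topspace \<tau> = carrier G \<and>
     continuous_map (prod_topology \<tau> \<tau>) \<tau> (\<lambda>(x, y). x \<otimes>\<^bsub>G\<^esub> y) \<and>
     continuous_map \<tau> \<tau> (\<lambda>x. inv\<^bsub>G\<^esub> x) \<and>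
     Hausdorff_space \<tau> \<and> locally_compact_space \<tau>"

definition left_haar_measure :: "('g, 'm) monoid_scheme \<Rightarrow> 'g topology \<Rightarrow> 'g measure \<Rightarrow> bool" where
  "left_haar_measure G \<tau> \<mu> \<longleftrightarrow>
     space \<mu> = carrier G \<and> sets \<mu> = sigma_sets (carrier G) {U. openin \<tau> U} \<and>
     emeasure \<mu> (carrier G) \<noteq> 0 \<and>
     (\<forall>K. compactin \<tau> K \<longrightarrow> emeasure \<mu> K < \<infinity>) \<and>
     (\<forall>B\<in>sets \<mu>. emeasure \<mu> B = (INF U\<in>{U. openin \<tau> U \<and> B \<subseteq> U}. emeasure \<mu> U)) \<and>
     (\<forall>U. openin \<tau> U \<longrightarrow> emeasure \<mu> U = (SUP K\<in>{K. compactin \<tau> K \<and> K \<subseteq> U}. emeasure \<mu> K)) \<and>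
     (\<forall>g\<in>carrier G. \<forall>B\<in>sets \<mu>. emeasure \<mu> ((\<lambda>x. g \<otimes>\<^bsub>G\<^esub> x) ` B) = emeasure \<mu> B)"

text \<open>Haar measure need not be sigma-finite, so \<open>L\<^sup>\<infinity>\<close> is formed, as usual, with locally measurable
  functions and bounds that hold locally almost everywhere.\<close>

definition loc_ess_bound :: "'g measure \<Rightarrow> ('g \<Rightarrow> complex) \<Rightarrow> real \<Rightarrow> bool" where
  "loc_ess_bound \<mu> f C \<longleftrightarrow> (\<forall>E\<in>fmeasurable \<mu>. AE x in \<mu>. x \<in> E \<longrightarrow> cmod (f x) \<le> C)"

definition L_infinity :: "'g measure \<Rightarrow> ('g \<Rightarrow> complex) set" where
  "L_infinity \<mu> = {f. (\<forall>E\<in>fmeasurable \<mu>. f \<in> borel_measurable (restrict_space \<mu> E)) \<and>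
     (\<exists>C. loc_ess_bound \<mu> f C)}"

text \<open>A mean is a linear functional \<open>m\<close> with \<open>\<parallel>m\<parallel> = m 1 = 1\<close>. The norm bound also makes \<open>m\<close>
  well-defined on classes of functions that agree locally almost everywhere.\<close>

definition left_invariant_mean ::
  "('g, 'm) monoid_scheme \<Rightarrow> 'g measure \<Rightarrow> (('g \<Rightarrow> complex) \<Rightarrow> complex) \<Rightarrow> bool" where
  "left_invariant_mean G \<mu> m \<longleftrightarrow>
     (\<forall>f\<in>L_infinity \<mu>. \<forall>h\<in>L_infinity \<mu>. m (\<lambda>x. f x + h x) = m f + m h) \<and>
     (\<forall>c. \<forall>f\<in>L_infinity \<mu>. m (\<lambda>x. c * f x) = c * m f) \<and>
     (\<forall>f\<in>L_infinity \<mu>. \<forall>C. loc_ess_bound \<mu> f C \<longrightarrow> 0 \<le> C \<longrightarrow> cmod (m f) \<le> C) \<and>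
     m (\<lambda>x. 1) = 1 \<and>
     (\<forall>g\<in>carrier G. \<forall>f\<in>L_infinity \<mu>. m (\<lambda>x. f (inv\<^bsub>G\<^esub> g \<otimes>\<^bsub>G\<^esub> x)) = m f)"

text \<open>A left Haar measure exists and is unique up to a positive factor, which does not affect
  \<open>L_infinity\<close>; so it does not matter whether one or every such measure is required.\<close>

definition amenable_group :: "('g, 'm) monoid_scheme \<Rightarrow> 'g topology \<Rightarrow> bool" where
  "amenable_group G \<tau> \<longleftrightarrow> locally_compact_group G \<tau> \<and>
     (\<forall>\<mu>. left_haar_measure G \<tau> \<mu> \<longrightarrow> (\<exists>m. left_invariant_mean G \<mu> m))"

section \<open>Brandt semigroups and their semigroup algebras\<close>

text \<open>\<open>BElt g i j\<close> is the matrix with \<open>g\<close> in position \<open>(i, j)\<close>.\<close>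

datatype ('g, 'i) brandt = BZero | BElt 'g 'i 'i

definition brandt_set :: "('g, 'm) monoid_scheme \<Rightarrow> 'i set \<Rightarrow> ('g, 'i) brandt set" where
  "brandt_set G I = insert BZero {BElt g i j | g i j. g \<in> carrier G \<and> i \<in> I \<and> j \<in> I}"

fun brandt_mult ::
  "('g, 'm) monoid_scheme \<Rightarrow> ('g, 'i) brandt \<Rightarrow> ('g, 'i) brandt \<Rightarrow> ('g, 'i) brandt" where
  "brandt_mult G (BElt g i j) (BElt h k l) = (if j = k then BElt (g \<otimes>\<^bsub>G\<^esub> h) i l else BZero)"
| "brandt_mult G _ _ = BZero"

text \<open>\<open>ell1 S op\<close> is the algebra of the semigroup with underlying set \<open>S\<close> and product \<open>op\<close>.\<close>

definition ell1 :: "'s set \<Rightarrow> ('s \<Rightarrow> 's \<Rightarrow> 's) \<Rightarrow> ('s \<Rightarrow> complex) nspace" where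
  "ell1 S op =
     \<lparr>carrier = {f. (\<forall>s. s \<notin> S \<longrightarrow> f s = 0) \<and> (\<lambda>s. cmod (f s)) summable_on S},
      mult = (\<lambda>f h s. \<Sum>\<^sub>\<infinity>(t, u)\<in>{(t, u). t \<in> S \<and> u \<in> S \<and> op t u = s}. f t * h u),
      one = undefined, zero = (\<lambda>s. 0), add = (\<lambda>f h s. f s + h s), smult = (\<lambda>c f s. c * f s),
      vnorm = (\<lambda>f. \<Sum>\<^sub>\<infinity>s\<in>S. cmod (f s))\<rparr>"

text \<open>
  For a locally compact group \<open>G\<close>, the algebra \<open>brandt_algebra G I\<close> depends only on the abstract
  group \<open>G\<close>: its elements are functions on the set \<open>S\<close>, summable with respect to counting measure.
  Hence amenability of \<open>G\<close> in a characterization of properties of this algebra has to be that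
  of \<open>G\<close> with the discrete topology, where \<open>L\<^sup>\<infinity>(G) = \<ell>\<^sup>\<infinity>(G)\<close>. It implies amenability in every
  other locally compact group topology, but not conversely: \<open>SO(3)\<close> is compact, hence amenable,
  whereas the discrete group \<open>SO(3)\<close> contains a free group of rank 2.
\<close>

abbreviation brandt_algebra ::
  "('g, 'm) monoid_scheme \<Rightarrow> 'i set \<Rightarrow> (('g, 'i) brandt \<Rightarrow> complex) nspace" where
  "brandt_algebra G I \<equiv> ell1 (brandt_set G I) (brandt_mult G)"

end

theory Submission
  imports Defs
begin

text \<open>
  Both amenability properties are turned into statements about functionals on bounded functions:
  a bounded function on \<open>S \<times> S\<close> is a bounded bilinear form on \<open>\<ell>\<^sup>1(S)\<close>, and bounded functions on a
  set with suitable left and right maps of \<open>S\<close> form a bimodule.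

  If \<open>\<ell>\<^sup>1(S)\<close> is strong pseudo-amenable, evaluating an approximate diagonal on the pairs with product
  \<open>(1)\<^sub>i\<^sub>i\<close> gives numbers that do not depend on \<open>i\<close>, are close to 1 and have bounded partial sums; so
  \<open>I\<close> is finite. If \<open>\<ell>\<^sup>1(S)\<close> is approximately amenable and \<open>I\<close> is infinite, a derivation into the dual
  of the functions on \<open>(I \<union> {*}) \<times> (I \<union> {*})\<close> is tested on two weighted sums of idempotents \<open>(1)\<^sub>i\<^sub>i\<close>,
  supported on alternating blocks of size \<open>4\<^sup>j\<close>. The averages of the implementing functional over
  the blocks then form a telescoping sum with small total, although they start near 1 and tend to 0.

  In both cases the restriction to one diagonal block gives functionals on \<open>\<ell>\<^sup>\<infinity>(G)\<close> that are almost
  invariant in norm; their normalized positive parts cluster at an invariant mean. Conversely, for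
  finite \<open>I\<close> and a mean \<open>m\<close>, the algebra is the direct product of \<open>\<complex>\<close> and a matrix algebra over
  \<open>\<ell>\<^sup>1(G)\<close>, and averaging \<open>g \<otimes> g\<inverse>\<close> over \<open>m\<close> gives a virtual diagonal.
\<close>

section \<open>Dual spaces\<close>

text \<open>Neither notion bounds its net, so the net itself need not have a weak* cluster point.
  For means, a functional n with n(1) near 1 has a positive part of mass at least 1/2 whatever its
  norm; dividing by that mass lands in a compact set. Almost-invariance passes from n to its
  positive part because the estimates are uniform over the unit ball. For approximate amenability
  and infinite I, one functional f of the net is used, and its norm is known only after the algebra
  elements have been fixed. The two elements have disjoint supports: at a pair (p,q) of adjacent
  blocks their errors, each divided by its weight, add up to a term in p minus a term in q, free of
  the unknown value of f at (p,q). The constants meet two demands: 4^j points of weight 8^-j have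
  the summable mass 2^-j, and dividing by a weight costs at most 8^(j+1), which is at most twice the
  number 4^j 4^(j+1) of pairs averaged over. The depth L of the telescope comes last, when 4^L can
  be taken larger than four times the bound of f.\<close>

definition pre_space :: "('v, 'm) nspace_scheme \<Rightarrow> bool" where
  "pre_space X \<longleftrightarrow> (\<forall>x\<in>carrier X. \<forall>y\<in>carrier X. x \<oplus>\<^bsub>X\<^esub> y \<in> carrier X) \<and>
     (\<forall>c. \<forall>x\<in>carrier X. c \<odot>\<^bsub>X\<^esub> x \<in> carrier X \<and> vnorm X (c \<odot>\<^bsub>X\<^esub> x) \<le> cmod c * vnorm X x) \<and>
     (\<forall>x\<in>carrier X. 0 \<le> vnorm X x) \<and> (\<exists>x\<in>carrier X. vnorm X x \<le> 1)"

lemma complex_space_simps [simp]: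
  "carrier complex_space = UNIV" "x \<oplus>\<^bsub>complex_space\<^esub> y = x + y" "\<zero>\<^bsub>complex_space\<^esub> = 0"
  "x \<odot>\<^bsub>complex_space\<^esub> y = x * y" "x \<otimes>\<^bsub>complex_space\<^esub> y = x * y" "\<one>\<^bsub>complex_space\<^esub> = 1"
  "vnorm complex_space x = cmod x"
  by (simp_all add: complex_space_def)

lemma complex_space_cring: "cring complex_space"
proof (intro cringI abelian_groupI comm_monoidI)
  show "\<exists>y\<in>carrier complex_space. y \<oplus>\<^bsub>complex_space\<^esub> x = \<zero>\<^bsub>complex_space\<^esub>" for x
    by (rule bexI [of _ "- x"]) auto
qed (auto simp: algebra_simps)

lemma dual_simps:
  "carrier (dual_bimodule X) = {f \<in> extensional (carrier X). bounded_linear_map X complex_space f}"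
  "\<zero>\<^bsub>dual_bimodule X\<^esub> = (\<lambda>x\<in>carrier X. 0)"
  "f \<oplus>\<^bsub>dual_bimodule X\<^esub> g = (\<lambda>x\<in>carrier X. f x + g x)"
  "c \<odot>\<^bsub>dual_bimodule X\<^esub> f = (\<lambda>x\<in>carrier X. c * f x)"
  "vnorm (dual_bimodule X) f = Sup {cmod (f x) | x. x \<in> carrier X \<and> vnorm X x \<le> 1}"
  "lact (dual_bimodule X) a f = (\<lambda>x\<in>carrier X. f (ract X x a))"
  "ract (dual_bimodule X) f a = (\<lambda>x\<in>carrier X. f (lact X a x))"
  by (simp_all add: dual_bimodule_def)

lemma blm_complexI:
  assumes "\<And>x y. x \<in> carrier V \<Longrightarrow> y \<in> carrier V \<Longrightarrow> T (x \<oplus>\<^bsub>V\<^esub> y) = T x + T y"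
    and "\<And>c x. x \<in> carrier V \<Longrightarrow> T (c \<odot>\<^bsub>V\<^esub> x) = c * T x"
    and "\<And>x. x \<in> carrier V \<Longrightarrow> cmod (T x) \<le> K * vnorm V x"
  shows "bounded_linear_map V complex_space T"
  unfolding bounded_linear_map_def complex_space_simps
  using assms by (intro conjI ballI allI exI [of _ K]) auto

lemma blmD:
  assumes "bounded_linear_map V W T"
  shows "x \<in> carrier V \<Longrightarrow> T x \<in> carrier W"
    and "x \<in> carrier V \<Longrightarrow> y \<in> carrier V \<Longrightarrow> T (x \<oplus>\<^bsub>V\<^esub> y) = T x \<oplus>\<^bsub>W\<^esub> T y"
    and "x \<in> carrier V \<Longrightarrow> T (c \<odot>\<^bsub>V\<^esub> x) = c \<odot>\<^bsub>W\<^esub> T x"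
  using assms unfolding bounded_linear_map_def by auto

lemma pre_spaceD:
  assumes "pre_space X"
  shows "x \<in> carrier X \<Longrightarrow> y \<in> carrier X \<Longrightarrow> x \<oplus>\<^bsub>X\<^esub> y \<in> carrier X"
    and "x \<in> carrier X \<Longrightarrow> c \<odot>\<^bsub>X\<^esub> x \<in> carrier X"
    and "x \<in> carrier X \<Longrightarrow> vnorm X (c \<odot>\<^bsub>X\<^esub> x) \<le> cmod c * vnorm X x"
    and "x \<in> carrier X \<Longrightarrow> 0 \<le> vnorm X x"
  using assms unfolding pre_space_def by auto

lemma blm_bound:
  assumes "bounded_linear_map V W T" "\<And>x. x \<in> carrier V \<Longrightarrow> 0 \<le> vnorm V x"
  obtains K where "K > 0" "\<And>x. x \<in> carrier V \<Longrightarrow> vnorm W (T x) \<le> K * vnorm V x"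
proof -
  obtain K where K: "\<And>x. x \<in> carrier V \<Longrightarrow> vnorm W (T x) \<le> K * vnorm V x"
    using assms(1) unfolding bounded_linear_map_def by blast
  have "vnorm W (T x) \<le> (\<bar>K\<bar> + 1) * vnorm V x" if "x \<in> carrier V" for x
    using K [OF that] assms(2) [OF that] mult_right_mono [of K "\<bar>K\<bar> + 1" "vnorm V x"] by linarith
  then show ?thesis by (rule that [rotated]) auto
qed

lemma blm_complex_bound:
  assumes "bounded_linear_map V complex_space T" "\<And>x. x \<in> carrier V \<Longrightarrow> 0 \<le> vnorm V x"
  obtains K where "K > 0" "\<And>x. x \<in> carrier V \<Longrightarrow> cmod (T x) \<le> K * vnorm V x"
  using blm_bound [OF assms] by (metis complex_space_simps(7))

text \<open>Closure of the carrier is demanded alongside linearity because the restriction of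
  \<open>T\<close> is \<open>undefined\<close> elsewhere; at a sum it has the value of
  \<open>T\<close> only if the sum lies in the carrier.\<close>

lemma dual_carrierI:
  assumes "\<And>x y. x \<in> carrier X \<Longrightarrow> y \<in> carrier X \<Longrightarrow> x \<oplus>\<^bsub>X\<^esub> y \<in> carrier X \<and> T (x \<oplus>\<^bsub>X\<^esub> y) = T x + T y"
    and "\<And>c x. x \<in> carrier X \<Longrightarrow> c \<odot>\<^bsub>X\<^esub> x \<in> carrier X \<and> T (c \<odot>\<^bsub>X\<^esub> x) = c * T x"
    and "\<And>x. x \<in> carrier X \<Longrightarrow> cmod (T x) \<le> K * vnorm X x"
  shows "(\<lambda>x\<in>carrier X. T x) \<in> carrier (dual_bimodule X)"
  using assms by (auto simp: dual_simps intro!: blm_complexI [where K = K])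

lemma dualD:
  assumes "f \<in> carrier (dual_bimodule X)"
  shows "f \<in> extensional (carrier X)" "bounded_linear_map X complex_space f"
    "x \<in> carrier X \<Longrightarrow> y \<in> carrier X \<Longrightarrow> f (x \<oplus>\<^bsub>X\<^esub> y) = f x + f y"
    "x \<in> carrier X \<Longrightarrow> f (c \<odot>\<^bsub>X\<^esub> x) = c * f x"
  using assms blmD [of X complex_space f] by (auto simp: dual_simps)

lemma dual_vnorm_ge:
  assumes "pre_space X" "f \<in> carrier (dual_bimodule X)" "x \<in> carrier X" "vnorm X x \<le> 1"
  shows "cmod (f x) \<le> vnorm (dual_bimodule X) f"
proof -
  obtain K where K: "K > 0" "\<And>x. x \<in> carrier X \<Longrightarrow> cmod (f x) \<le> K * vnorm X x"
    using blm_complex_bound [OF dualD(2) [OF assms(2)]] assms(1) unfolding pre_space_def by metis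
  have "cmod (f y) \<le> K" if "y \<in> carrier X" "vnorm X y \<le> 1" for y
    using K(2) [OF that(1)] mult_left_mono [OF that(2), of K] K(1) by linarith
  then have "bdd_above {cmod (f x) | x. x \<in> carrier X \<and> vnorm X x \<le> 1}"
    by (auto intro!: bdd_aboveI [where M = K])
  then show ?thesis unfolding dual_simps by (rule cSup_upper [rotated]) (use assms in auto)
qed

lemma dual_vnorm_le:
  assumes "pre_space X" "\<And>x. x \<in> carrier X \<Longrightarrow> vnorm X x \<le> 1 \<Longrightarrow> cmod (f x) \<le> C"
  shows "vnorm (dual_bimodule X) f \<le> C"
  unfolding dual_simps using assms unfolding pre_space_def by (intro cSup_least) auto

lemma dual_vnorm_nonneg:
  assumes "pre_space X" "f \<in> carrier (dual_bimodule X)"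
  shows "0 \<le> vnorm (dual_bimodule X) f"
proof -
  obtain x where "x \<in> carrier X" "vnorm X x \<le> 1"
    using assms(1) unfolding pre_space_def by auto
  then have "cmod (f x) \<le> vnorm (dual_bimodule X) f" using assms by (intro dual_vnorm_ge)
  then show ?thesis using norm_ge_zero order_trans by blast
qed

lemma dual_add_closed:
  assumes "pre_space X" "f \<in> carrier (dual_bimodule X)" "g \<in> carrier (dual_bimodule X)"
  shows "(\<lambda>x\<in>carrier X. f x + g x) \<in> carrier (dual_bimodule X)"
proof -
  have nn: "\<And>x. x \<in> carrier X \<Longrightarrow> 0 \<le> vnorm X x" using assms(1) unfolding pre_space_def by auto
  obtain K L where "\<And>x. x \<in> carrier X \<Longrightarrow> cmod (f x) \<le> K * vnorm X x"
    "\<And>x. x \<in> carrier X \<Longrightarrow> cmod (g x) \<le> L * vnorm X x"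
    using blm_complex_bound [OF dualD(2) [OF assms(2)] nn] blm_complex_bound [OF dualD(2) [OF assms(3)] nn]
    by metis
  then have "cmod (f x + g x) \<le> (K + L) * vnorm X x" if "x \<in> carrier X" for x
    using that norm_triangle_ineq [of "f x" "g x"] by (fastforce simp: algebra_simps)
  then show ?thesis
    using assms(1) unfolding pre_space_def
    by (intro dual_carrierI [where K = "K + L"])
      (auto simp: dualD [OF assms(2)] dualD [OF assms(3)] algebra_simps)
qed

lemma dual_smult_closed:
  assumes "pre_space X" "f \<in> carrier (dual_bimodule X)"
  shows "(\<lambda>x\<in>carrier X. c * f x) \<in> carrier (dual_bimodule X)"
proof -
  have nn: "\<And>x. x \<in> carrier X \<Longrightarrow> 0 \<le> vnorm X x" using assms(1) unfolding pre_space_def by auto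
  obtain K where K: "\<And>x. x \<in> carrier X \<Longrightarrow> cmod (f x) \<le> K * vnorm X x"
    using blm_complex_bound [OF dualD(2) [OF assms(2)] nn] by metis
  have "cmod (c * f x) \<le> (cmod c * K) * vnorm X x" if "x \<in> carrier X" for x
    using mult_left_mono [OF K [OF that], of "cmod c"] by (simp add: norm_mult mult.assoc)
  then show ?thesis
    using assms(1) unfolding pre_space_def
    by (intro dual_carrierI [where K = "cmod c * K"])
      (auto simp: dualD [OF assms(2)] algebra_simps)
qed

lemma dual_zero: "pre_space X \<Longrightarrow> (\<lambda>x\<in>carrier X. 0) \<in> carrier (dual_bimodule X)"
  unfolding pre_space_def by (intro dual_carrierI [where K = 0]) auto

lemma dual_vnorm_zero: "pre_space X \<Longrightarrow> vnorm (dual_bimodule X) (\<lambda>x\<in>carrier X. 0) = 0"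
  by (rule antisym [OF dual_vnorm_le dual_vnorm_nonneg [OF _ dual_zero]]) auto

text \<open>A \<open>pre_space\<close> may contain nonzero vectors of norm 0. They cannot be scaled
  to norm 1, but the bound that belongs to the functional forces the value 0 there.\<close>

lemma dual_bound:
  assumes "pre_space X" "f \<in> carrier (dual_bimodule X)" "x \<in> carrier X"
  shows "cmod (f x) \<le> vnorm (dual_bimodule X) f * vnorm X x"
proof (cases "vnorm X x = 0")
  case True
  obtain K where "\<And>x. x \<in> carrier X \<Longrightarrow> cmod (f x) \<le> K * vnorm X x"
    using blm_complex_bound [OF dualD(2) [OF assms(2)]] pre_spaceD(4) [OF assms(1)] by metis
  then show ?thesis using True assms(3) by fastforce
next
  case False
  then have pos: "vnorm X x > 0" using pre_spaceD(4) [OF assms(1,3)] by simp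
  let ?c = "complex_of_real (1 / vnorm X x)"
  have "vnorm X (?c \<odot>\<^bsub>X\<^esub> x) \<le> 1"
    using pre_spaceD(3) [OF assms(1,3), of ?c] pos by (simp add: norm_divide)
  then have "cmod (f (?c \<odot>\<^bsub>X\<^esub> x)) \<le> vnorm (dual_bimodule X) f"
    by (intro dual_vnorm_ge assms pre_spaceD(2) [OF assms(1)])
  then have "cmod (?c * f x) \<le> vnorm (dual_bimodule X) f"
    unfolding dualD(4) [OF assms(2,3)] .
  then show ?thesis
    using pos by (simp add: norm_mult norm_divide field_simps)
qed

lemma dual_smult_norm:
  assumes "pre_space X" "f \<in> carrier (dual_bimodule X)"
  shows "vnorm (dual_bimodule X) (\<lambda>x\<in>carrier X. c * f x) \<le> cmod c * vnorm (dual_bimodule X) f"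
  by (rule dual_vnorm_le [OF assms(1)])
    (use dual_vnorm_ge [OF assms] in \<open>auto simp: norm_mult intro: mult_left_mono\<close>)

text \<open>\<open>pre_space\<close> keeps just what makes the supremum in the dual norm behave:
  homogeneity as an inequality, nonnegativity, and a vector in the unit ball, so that the supremum
  runs over a nonempty set. In this form it passes to duals and hence to biduals.\<close>

lemma dual_pre_space:
  assumes "pre_space X" shows "pre_space (dual_bimodule X)"
  unfolding pre_space_def
proof (intro conjI ballI allI)
  show "\<exists>x\<in>carrier (dual_bimodule X). vnorm (dual_bimodule X) x \<le> 1"
    by (rule bexI [OF _ dual_zero [OF assms]]) (simp add: dual_vnorm_zero [OF assms])
qed (use assms dual_add_closed dual_smult_closed dual_vnorm_nonneg dual_smult_norm in \<open>auto simp: dual_simps(3,4)\<close>)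

text \<open>Both actions on a dual are adjoints of actions on the space below, so this one fact
  supplies the actions on every dual and bidual, and also the adjoint and the bidual of the product
  map.\<close>

lemma dual_adjoint_blm:
  assumes X: "pre_space X" and Y: "pre_space Y" and T: "bounded_linear_map X Y T"
  shows "bounded_linear_map (dual_bimodule Y) (dual_bimodule X) (\<lambda>f. \<lambda>x\<in>carrier X. f (T x))"
proof -
  obtain K where K: "K > 0" "\<And>x. x \<in> carrier X \<Longrightarrow> vnorm Y (T x) \<le> K * vnorm X x"
    using blm_bound [OF T] pre_spaceD(4) [OF X] by metis
  have bd: "cmod (f (T x)) \<le> (K * vnorm (dual_bimodule Y) f) * vnorm X x"
    if "f \<in> carrier (dual_bimodule Y)" "x \<in> carrier X" for f x
    using order_trans [OF dual_bound [OF Y that(1) blmD(1) [OF T that(2)]]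
        mult_left_mono [OF K(2) [OF that(2)] dual_vnorm_nonneg [OF Y that(1)]]]
    by (simp add: mult_ac)
  show ?thesis
    unfolding bounded_linear_map_def
  proof (intro conjI ballI allI exI funcsetI)
    fix f assume f: "f \<in> carrier (dual_bimodule Y)"
    show "(\<lambda>x\<in>carrier X. f (T x)) \<in> carrier (dual_bimodule X)"
      by (rule dual_carrierI [OF _ _ bd [OF f]])
        (use X f in \<open>auto simp: pre_spaceD blmD [OF T] dualD\<close>)
    show "vnorm (dual_bimodule X) (\<lambda>x\<in>carrier X. f (T x)) \<le> K * vnorm (dual_bimodule Y) f"
    proof (rule dual_vnorm_le [OF X])
      fix x assume x: "x \<in> carrier X" "vnorm X x \<le> 1"
      show "cmod ((\<lambda>x\<in>carrier X. f (T x)) x) \<le> K * vnorm (dual_bimodule Y) f"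
        using order_trans [OF bd [OF f x(1)] mult_left_mono [OF x(2)]] K(1) dual_vnorm_nonneg [OF Y f] x(1)
        by simp
    qed
  qed (use blmD(1) [OF T] in \<open>auto simp: dual_simps(3,4) restrict_def fun_eq_iff\<close>)
qed

lemma canonical_embedding_closed:
  assumes "pre_space X" "x \<in> carrier X"
  shows "canonical_embedding X x \<in> carrier (dual_bimodule (dual_bimodule X))"
  unfolding canonical_embedding_def
  by (rule dual_carrierI [where K = "vnorm X x"])
    (use assms in \<open>auto simp: dual_simps(3,4) pre_spaceD [OF dual_pre_space, unfolded dual_simps(3,4)]
      dual_add_closed dual_smult_closed dual_bound [of X, simplified mult.commute]\<close>)

text \<open>Subtraction is defined through a definite description of the additive inverse. The
  inverse is identified pointwise, so the dual does not first have to be shown to be an abelian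
  group.\<close>

lemma dual_minus:
  assumes "pre_space X" "f \<in> carrier (dual_bimodule X)" "g \<in> carrier (dual_bimodule X)"
  shows "f \<ominus>\<^bsub>dual_bimodule X\<^esub> g = (\<lambda>x\<in>carrier X. f x - g x)"
proof -
  let ?D = "dual_bimodule X"
  let ?h = "\<lambda>x\<in>carrier X. - g x"
  have h: "?h \<in> carrier ?D" using dual_smult_closed [OF assms(1,3), of "-1"] by simp
  have "\<ominus>\<^bsub>?D\<^esub> g = ?h"
    unfolding a_inv_def m_inv_def
  proof (rule the_equality)
    show "?h \<in> carrier (add_monoid ?D) \<and> g \<otimes>\<^bsub>add_monoid ?D\<^esub> ?h = \<one>\<^bsub>add_monoid ?D\<^esub> \<and>
       ?h \<otimes>\<^bsub>add_monoid ?D\<^esub> g = \<one>\<^bsub>add_monoid ?D\<^esub>"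
      using h by (auto simp: dual_simps(2,3))
    fix k assume k: "k \<in> carrier (add_monoid ?D) \<and> g \<otimes>\<^bsub>add_monoid ?D\<^esub> k = \<one>\<^bsub>add_monoid ?D\<^esub> \<and>
       k \<otimes>\<^bsub>add_monoid ?D\<^esub> g = \<one>\<^bsub>add_monoid ?D\<^esub>"
    then have "k \<in> extensional (carrier X)" using dualD(1) by auto
    moreover have "k x = ?h x" if "x \<in> carrier X" for x
    proof -
      have "(g \<otimes>\<^bsub>add_monoid ?D\<^esub> k) x = 0" using k that by (simp add: dual_simps(2))
      then show ?thesis using that by (simp add: dual_simps(3) add_eq_0_iff2 add.commute)
    qed
    ultimately show "k = ?h" by (intro extensionalityI [of _ "carrier X"]) auto
  qed
  then show ?thesis by (simp add: a_minus_def dual_simps(3) restrict_def fun_eq_iff)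
qed

lemma dual_minus_closed:
  assumes "pre_space X" "f \<in> carrier (dual_bimodule X)" "g \<in> carrier (dual_bimodule X)"
  shows "f \<ominus>\<^bsub>dual_bimodule X\<^esub> g \<in> carrier (dual_bimodule X)"
proof -
  have "(\<lambda>x\<in>carrier X. f x + (\<lambda>x\<in>carrier X. (-1) * g x) x) \<in> carrier (dual_bimodule X)"
    using assms by (intro dual_add_closed dual_smult_closed)
  then show ?thesis unfolding dual_minus [OF assms] by (simp add: restrict_def cong: if_cong)
qed

section \<open>Semigroup algebras\<close>

text \<open>The fibres of \<open>q\<close> partition \<open>P\<close>, so \<open>P\<close> is in
  bijection with a dependent sum over \<open>S\<close>, and summing fibre by fibre is Fubini for
  absolutely summable families. With \<open>P = S \<times> S\<close> and \<open>q\<close> the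
  semigroup product this is convolution.\<close>

lemma infsum_fibres:
  fixes g :: "'p \<Rightarrow> 'c :: banach"
  assumes g: "(\<lambda>p. norm (g p)) summable_on P" and q: "q ` P \<subseteq> S"
  shows abs_summable_fibres: "(\<lambda>s. norm (infsum g {p \<in> P. q p = s})) summable_on S"
    and infsum_norm_fibres: "infsum (\<lambda>s. norm (infsum g {p \<in> P. q p = s})) S \<le> infsum (\<lambda>p. norm (g p)) P"
    and infsum_infsum_fibres: "infsum (\<lambda>s. infsum g {p \<in> P. q p = s}) S = infsum g P"
proof -
  let ?F = "SIGMA s:S. {p \<in> P. q p = s}"
  have bij: "bij_betw snd ?F P"
    using q by (intro bij_betwI [where g = "\<lambda>p. (q p, p)"]) auto
  have abs: "(\<lambda>x. norm (g (snd x))) summable_on ?F"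
    using summable_on_reindex_bij_betw [OF bij, of "\<lambda>p. norm (g p)"] g by simp
  then have fib: "(\<lambda>p. norm (g p)) summable_on {p \<in> P. q p = s}" if "s \<in> S" for s
    using that Infinite_Sum.abs_summable_on_Sigma_iff [of "\<lambda>x. g (snd x)" S] by auto
  have sn: "(\<lambda>s. infsum (\<lambda>p. norm (g p)) {p \<in> P. q p = s}) summable_on S"
    using abs Infinite_Sum.abs_summable_on_Sigma_iff [of "\<lambda>x. g (snd x)" S] summable_on_iff_abs_summable_on_real
    by fastforce
  have le: "norm (infsum g {p \<in> P. q p = s}) \<le> infsum (\<lambda>p. norm (g p)) {p \<in> P. q p = s}"
    if "s \<in> S" for s
    by (rule norm_infsum_bound) (use fib [OF that] in auto)
  show s1: "(\<lambda>s. norm (infsum g {p \<in> P. q p = s})) summable_on S"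
    by (rule Infinite_Sum.abs_summable_on_comparison_test' [OF sn le])
  have "infsum (\<lambda>s. norm (infsum g {p \<in> P. q p = s})) S
      \<le> infsum (\<lambda>s. infsum (\<lambda>p. norm (g p)) {p \<in> P. q p = s}) S"
    by (rule infsum_mono [OF s1 sn le])
  also have "\<dots> = infsum (\<lambda>(s, p). norm (g p)) ?F"
    by (rule infsum_Sigma'_banach) (use abs in \<open>simp add: case_prod_unfold\<close>)
  also have "\<dots> = infsum (\<lambda>p. norm (g p)) P"
    using infsum_reindex_bij_betw [OF bij, of "\<lambda>p. norm (g p)"] by (simp add: case_prod_unfold)
  finally show "infsum (\<lambda>s. norm (infsum g {p \<in> P. q p = s})) S \<le> infsum (\<lambda>p. norm (g p)) P" .
  have "infsum (\<lambda>s. infsum g {p \<in> P. q p = s}) S = infsum (\<lambda>(s, p). g p) ?F"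
    by (rule infsum_Sigma'_banach) (use abs_summable_summable [OF abs] in \<open>simp add: case_prod_unfold\<close>)
  also have "\<dots> = infsum g P"
    using infsum_reindex_bij_betw [OF bij, of g] by (simp add: case_prod_unfold)
  finally show "infsum (\<lambda>s. infsum g {p \<in> P. q p = s}) S = infsum g P" .
qed

definition point_mass :: "'s \<Rightarrow> 's \<Rightarrow> complex" where
  "point_mass s = (\<lambda>t. if t = s then 1 else 0)"

locale ell1_algebra =
  fixes S :: "'s set" and op :: "'s \<Rightarrow> 's \<Rightarrow> 's"
  assumes op_closed: "s \<in> S \<Longrightarrow> t \<in> S \<Longrightarrow> op s t \<in> S"
begin

abbreviation "A \<equiv> ell1 S op"

text \<open>For bounded \<open>c\<close> this is the duality between summable and bounded functions;
  \<open>kform\<close> is its counterpart for bounded functions on \<open>S \<times> S\<close>.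
  Later facts about the algebra are computed through these two.\<close>

definition pairing :: "('s \<Rightarrow> complex) \<Rightarrow> ('s \<Rightarrow> complex) \<Rightarrow> complex" where
  "pairing c a = (\<Sum>\<^sub>\<infinity>s\<in>S. a s * c s)"

definition kform :: "('s \<times> 's \<Rightarrow> complex) \<Rightarrow> ('s \<Rightarrow> complex) \<Rightarrow> ('s \<Rightarrow> complex) \<Rightarrow> complex" where
  "kform K x y = (\<Sum>\<^sub>\<infinity>p\<in>S \<times> S. x (fst p) * y (snd p) * K p)"

lemma ell1_simps:
  "a \<in> carrier A \<longleftrightarrow> (\<forall>s. s \<notin> S \<longrightarrow> a s = 0) \<and> (\<lambda>s. cmod (a s)) summable_on S"
  "a \<oplus>\<^bsub>A\<^esub> b = (\<lambda>s. a s + b s)" "c \<odot>\<^bsub>A\<^esub> a = (\<lambda>s. c * a s)" "\<zero>\<^bsub>A\<^esub> = (\<lambda>s. 0)"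
  "vnorm A a = (\<Sum>\<^sub>\<infinity>s\<in>S. cmod (a s))"
  "(a \<otimes>\<^bsub>A\<^esub> b) s = (\<Sum>\<^sub>\<infinity>p\<in>{p \<in> S \<times> S. op (fst p) (snd p) = s}. a (fst p) * b (snd p))"
  by (auto simp: ell1_def case_prod_unfold intro!: arg_cong [where f = "infsum _"])

lemma ell1_summable: "a \<in> carrier A \<Longrightarrow> (\<lambda>s. cmod (a s)) summable_on S"
  by (simp add: ell1_simps)

lemma ell1_abs_summable_mult:
  assumes "a \<in> carrier A" "\<And>s. s \<in> S \<Longrightarrow> cmod (c s) \<le> C"
  shows "(\<lambda>s. cmod (a s * c s)) summable_on S"
proof (rule Infinite_Sum.abs_summable_on_comparison_test')
  show "(\<lambda>s. cmod (a s) * C) summable_on S"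
    using ell1_summable [OF assms(1)] by (rule summable_on_cmult_left)
qed (use assms(2) in \<open>auto simp: norm_mult intro: mult_left_mono\<close>)

lemma cmod_pairing_le:
  assumes "a \<in> carrier A" "\<And>s. s \<in> S \<Longrightarrow> cmod (c s) \<le> C"
  shows "cmod (pairing c a) \<le> C * vnorm A a"
proof -
  have "cmod (pairing c a) \<le> (\<Sum>\<^sub>\<infinity>s\<in>S. cmod (a s * c s))"
    unfolding pairing_def by (rule norm_infsum_bound) (rule ell1_abs_summable_mult [OF assms])
  also have "\<dots> \<le> (\<Sum>\<^sub>\<infinity>s\<in>S. cmod (a s) * C)"
    using ell1_summable [OF assms(1)]
    by (intro infsum_mono ell1_abs_summable_mult [OF assms] summable_on_cmult_left)
      (auto simp: norm_mult assms(2) intro: mult_left_mono)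
  also have "\<dots> = C * vnorm A a" by (simp add: infsum_cmult_left' ell1_simps)
  finally show ?thesis .
qed

lemma ell1_vnorm_nonneg: "0 \<le> vnorm A a"
  by (simp add: ell1_simps infsum_nonneg)

lemma ell1_add_closed:
  assumes "a \<in> carrier A" "b \<in> carrier A"
  shows "(\<lambda>s. a s + b s) \<in> carrier A"
proof -
  have s: "(\<lambda>s. cmod (a s) + cmod (b s)) summable_on S"
    using assms by (intro summable_on_add) (auto simp: ell1_simps)
  have "(\<lambda>s. cmod (a s + b s)) summable_on S"
    by (rule Infinite_Sum.abs_summable_on_comparison_test' [OF s norm_triangle_ineq])
  then show ?thesis using assms by (simp add: ell1_simps)
qed

lemma ell1_smult:
  assumes "a \<in> carrier A"
  shows ell1_smult_closed: "(\<lambda>s. c * a s) \<in> carrier A"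
    and ell1_smult_norm: "vnorm A (\<lambda>s. c * a s) = cmod c * vnorm A a"
  using assms by (auto simp: ell1_simps norm_mult infsum_cmult_right' intro: summable_on_cmult_right)

lemma ell1_zero: "(\<lambda>s. 0) \<in> carrier A" "vnorm A (\<lambda>s. 0) = 0"
  by (simp_all add: ell1_simps)

lemma ell1_pre_space: "pre_space A"
  unfolding pre_space_def
  by (intro conjI ballI allI bexI [of _ "\<lambda>s. 0"])
    (simp_all add: ell1_add_closed ell1_smult_closed ell1_smult_norm ell1_zero ell1_vnorm_nonneg ell1_simps(2,3))

lemma point_mass_ell1:
  assumes "s \<in> S" shows point_mass_closed: "point_mass s \<in> carrier A"
    and point_mass_norm: "vnorm A (point_mass s) = 1"
proof -
  have "((\<lambda>t. cmod (point_mass s t)) has_sum 1) S"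
    by (rule has_sum_finite_neutralI [of "{s}"]) (use assms in \<open>auto simp: point_mass_def\<close>)
  then show "point_mass s \<in> carrier A" "vnorm A (point_mass s) = 1"
    using assms by (auto simp: ell1_simps has_sum_imp_summable infsumI) (auto simp: point_mass_def)
qed

lemma infsum_point_mass:
  assumes "s \<in> S" shows "(\<Sum>\<^sub>\<infinity>t\<in>S. point_mass s t * c t) = c s"
  by (rule infsumI, rule has_sum_finite_neutralI [of "{s}"]) (use assms in \<open>auto simp: point_mass_def\<close>)

lemma pairing_point_mass: "s \<in> S \<Longrightarrow> pairing c (point_mass s) = c s"
  by (simp add: pairing_def infsum_point_mass)

text \<open>The finite truncations of \<open>a\<close> are combinations of point masses, and the
  remainder has as its norm the tail of the convergent sum of moduli. Boundedness of
  \<open>T\<close> turns this into convergence of the values.\<close>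

lemma functional_has_sum:
  assumes T: "bounded_linear_map A complex_space T" and a: "a \<in> carrier A"
  shows "((\<lambda>s. a s * T (point_mass s)) has_sum T a) S"
proof -
  obtain K where K: "K > 0" "\<And>x. x \<in> carrier A \<Longrightarrow> cmod (T x) \<le> K * vnorm A x"
    using blm_complex_bound [OF T] ell1_vnorm_nonneg by metis
  have add: "T (\<lambda>s. x s + y s) = T x + T y" if "x \<in> carrier A" "y \<in> carrier A" for x y
    using blmD(2) [OF T that] by (simp add: ell1_simps)
  have smult: "T (\<lambda>s. c * x s) = c * T x" if "x \<in> carrier A" for c x
    using blmD(3) [OF T that] by (simp add: ell1_simps)
  have fin: "(\<lambda>s. if s \<in> F then a s else 0) \<in> carrier A \<and>
      T (\<lambda>s. if s \<in> F then a s else 0) = (\<Sum>s\<in>F. a s * T (point_mass s))"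
    if "finite F" "F \<subseteq> S" for F
    using that
  proof (induction F)
    case empty
    then show ?case using smult [OF ell1_zero(1), of 0] by (simp add: ell1_zero)
  next
    case (insert r F)
    have "(\<lambda>s. if s \<in> insert r F then a s else 0)
       = (\<lambda>s. a r * point_mass r s + (if s \<in> F then a s else 0))"
      using insert by (auto simp: point_mass_def fun_eq_iff)
    moreover have "(\<lambda>s. a r * point_mass r s) \<in> carrier A"
      using insert by (intro ell1_smult_closed point_mass_closed) auto
    ultimately show ?case using insert
      by (auto simp: add smult point_mass_closed intro!: ell1_add_closed)
  qed
  have est: "cmod ((\<Sum>s\<in>F. a s * T (point_mass s)) - T a) \<le> K * (vnorm A a - (\<Sum>s\<in>F. cmod (a s)))"
    if F: "finite F" "F \<subseteq> S" for F
  proof -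
    let ?b = "\<lambda>s. if s \<in> F then a s else 0" and ?r = "\<lambda>s. if s \<in> F then 0 else a s"
    have "((\<lambda>s. cmod (?r s)) has_sum (vnorm A a - (\<Sum>s\<in>F. cmod (a s)))) S"
    proof -
      have "((\<lambda>s. cmod (a s)) has_sum (vnorm A a - (\<Sum>s\<in>F. cmod (a s)))) (S - F)"
        by (rule has_sum_Diff) (use a F in \<open>auto simp: ell1_simps has_sum_finite\<close>)
      then show ?thesis using F
        by (subst has_sum_cong_neutral [where T = "S - F" and g = "\<lambda>s. cmod (a s)"]) auto
    qed
    then have r: "?r \<in> carrier A" "vnorm A ?r = vnorm A a - (\<Sum>s\<in>F. cmod (a s))"
      using a by (auto simp: ell1_simps has_sum_imp_summable infsumI)
    have "a = (\<lambda>s. ?b s + ?r s)" by auto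
    then have "T a = T ?b + T ?r" using add [of ?b ?r] fin [OF F] r by simp
    then have "(\<Sum>s\<in>F. a s * T (point_mass s)) - T a = - T ?r" using fin [OF F] by simp
    then show ?thesis using K(2) [OF r(1)] r(2) by simp
  qed
  have "((\<lambda>s. cmod (a s)) has_sum vnorm A a) S" using a by (simp add: ell1_simps)
  then have "((\<lambda>F. K * (vnorm A a - (\<Sum>s\<in>F. cmod (a s)))) \<longlongrightarrow> 0) (finite_subsets_at_top S)"
    unfolding has_sum_def by (auto intro!: tendsto_eq_intros)
  then have "((\<lambda>F. (\<Sum>s\<in>F. a s * T (point_mass s)) - T a) \<longlongrightarrow> 0) (finite_subsets_at_top S)"
    by (rule Lim_null_comparison [rotated]) (auto intro!: eventually_finite_subsets_at_top_weakI est)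
  then show ?thesis unfolding has_sum_def by (simp add: LIM_zero_iff)
qed

lemma functional_eq_pairing:
  assumes "bounded_linear_map A complex_space T" "a \<in> carrier A"
  shows "T a = pairing (\<lambda>s. T (point_mass s)) a"
  unfolding pairing_def using infsumI [OF functional_has_sum [OF assms]] by simp

text \<open>Point masses span a dense subspace. Most identities for actions and products below are
  checked on point masses and extended by this rule or its bilinear version.\<close>

lemma functional_eqI:
  assumes "bounded_linear_map A complex_space T" "bounded_linear_map A complex_space U"
    and "\<And>s. s \<in> S \<Longrightarrow> T (point_mass s) = U (point_mass s)" and "a \<in> carrier A"
  shows "T a = U a"
  unfolding functional_eq_pairing [OF assms(1,4)] functional_eq_pairing [OF assms(2,4)] pairing_def
  using assms(3) by (intro infsum_cong) auto

lemma pairing_add: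
  assumes "a \<in> carrier A" "b \<in> carrier A" "\<And>s. s \<in> S \<Longrightarrow> cmod (c s) \<le> C"
  shows "pairing c (\<lambda>s. a s + b s) = pairing c a + pairing c b"
proof -
  have "(\<lambda>s. a s * c s) summable_on S" "(\<lambda>s. b s * c s) summable_on S"
    using ell1_abs_summable_mult [OF assms(1,3)] ell1_abs_summable_mult [OF assms(2,3)]
    by (auto intro: abs_summable_summable)
  then show ?thesis unfolding pairing_def by (simp add: infsum_add ring_distribs)
qed

lemma pairing_add_left:
  assumes "a \<in> carrier A" "\<And>s. s \<in> S \<Longrightarrow> cmod (c s) \<le> C" "\<And>s. s \<in> S \<Longrightarrow> cmod (d s) \<le> D"
  shows "pairing (\<lambda>s. c s + d s) a = pairing c a + pairing d a"
proof -
  have "(\<lambda>s. a s * c s) summable_on S" "(\<lambda>s. a s * d s) summable_on S"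
    using ell1_abs_summable_mult [OF assms(1,2)] ell1_abs_summable_mult [OF assms(1,3)]
    by (auto intro: abs_summable_summable)
  then show ?thesis unfolding pairing_def by (simp add: infsum_add ring_distribs)
qed

lemma pairing_smult: "pairing c (\<lambda>s. k * a s) = k * pairing c a"
  unfolding pairing_def by (simp add: mult.assoc infsum_cmult_right')

lemma pairing_smult_left: "pairing (\<lambda>s. k * c s) a = k * pairing c a"
  unfolding pairing_def by (simp add: mult.left_commute infsum_cmult_right')

lemma pairing_cong: "(\<And>s. s \<in> S \<Longrightarrow> c s = d s) \<Longrightarrow> pairing c a = pairing d a"
  unfolding pairing_def by (intro infsum_cong) auto

lemma pairing_blm:
  assumes "\<And>s. s \<in> S \<Longrightarrow> cmod (c s) \<le> C"
  shows "bounded_linear_map A complex_space (pairing c)"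
  by (rule blm_complexI [where K = C])
    (simp_all add: ell1_simps(2,3) pairing_add [OF _ _ assms] pairing_smult cmod_pairing_le [OF _ assms])

lemma pairing_indicator:
  assumes "s \<in> S" "a \<in> carrier A"
  shows "pairing (\<lambda>t. if t = s then 1 else 0) a = a s"
  unfolding pairing_def
  by (rule infsumI, rule has_sum_finite_neutralI [of "{s}"]) (use assms in auto)

lemma kform_summable:
  assumes "x \<in> carrier A" "y \<in> carrier A" "\<And>p. p \<in> S \<times> S \<Longrightarrow> cmod (K p) \<le> C"
  shows "(\<lambda>p. cmod (x (fst p) * y (snd p) * K p)) summable_on S \<times> S"
proof (rule Infinite_Sum.abs_summable_on_comparison_test')
  have "(\<lambda>p. cmod (x (fst p) * y (snd p))) summable_on S \<times> S"
    unfolding Infinite_Sum.abs_summable_on_Sigma_iff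
    using ell1_summable [OF assms(1)] ell1_summable [OF assms(2)]
    by (auto simp: norm_mult infsum_cmult_right' abs_mult intro!: summable_on_cmult_right summable_on_cmult_left)
  then show "(\<lambda>p. cmod (x (fst p) * y (snd p)) * C) summable_on S \<times> S"
    by (rule summable_on_cmult_left)
qed (use assms(3) in \<open>auto simp: norm_mult intro!: mult_left_mono\<close>)

text \<open>Fubini in both orders: linearity and bounds of the double sum in either variable become
  facts about \<open>pairing\<close>.\<close>

lemma kform_iterated:
  assumes "x \<in> carrier A" "y \<in> carrier A" "\<And>p. p \<in> S \<times> S \<Longrightarrow> cmod (K p) \<le> C"
  shows "kform K x y = pairing (\<lambda>s. pairing (\<lambda>t. K (s, t)) y) x"
    and "kform K x y = pairing (\<lambda>t. pairing (\<lambda>s. K (s, t)) x) y"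
proof -
  have s: "(\<lambda>(s, t). x s * y t * K (s, t)) summable_on S \<times> S"
    using abs_summable_summable [OF kform_summable [OF assms]] by (simp add: case_prod_unfold)
  have *: "(\<Sum>\<^sub>\<infinity>s\<in>S. \<Sum>\<^sub>\<infinity>t\<in>S. x s * y t * K (s, t)) = kform K x y"
    unfolding kform_def by (subst infsum_Sigma'_banach [OF s]) (simp add: case_prod_unfold)
  show "kform K x y = pairing (\<lambda>s. pairing (\<lambda>t. K (s, t)) y) x"
    unfolding * [symmetric] pairing_def by (simp add: infsum_cmult_right' mult.assoc)
  show "kform K x y = pairing (\<lambda>t. pairing (\<lambda>s. K (s, t)) x) y"
    unfolding * [symmetric] infsum_swap_banach [OF s] pairing_def infsum_cmult_right' [symmetric]
    by (intro infsum_cong) (simp add: mult_ac)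
qed

lemma cmod_kform_le:
  assumes "x \<in> carrier A" "y \<in> carrier A" "\<And>p. p \<in> S \<times> S \<Longrightarrow> cmod (K p) \<le> C"
  shows "cmod (kform K x y) \<le> C * vnorm A x * vnorm A y"
proof -
  have "cmod (pairing (\<lambda>t. K (s, t)) y) \<le> C * vnorm A y" if "s \<in> S" for s
    using that assms by (intro cmod_pairing_le) auto
  then have "cmod (pairing (\<lambda>s. pairing (\<lambda>t. K (s, t)) y) x) \<le> C * vnorm A y * vnorm A x"
    by (intro cmod_pairing_le [OF assms(1)])
  moreover have "kform K x y = pairing (\<lambda>s. pairing (\<lambda>t. K (s, t)) y) x"
    by (rule kform_iterated(1) [OF assms])
  ultimately show ?thesis by (simp add: mult_ac)
qed

lemma kform_blm:
  assumes "\<And>p. p \<in> S \<times> S \<Longrightarrow> cmod (K p) \<le> C"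
  shows "x \<in> carrier A \<Longrightarrow> bounded_linear_map A complex_space (kform K x)"
    and "y \<in> carrier A \<Longrightarrow> bounded_linear_map A complex_space (\<lambda>x. kform K x y)"
proof -
  assume x: "x \<in> carrier A"
  have "cmod (pairing (\<lambda>s. K (s, t)) x) \<le> C * vnorm A x" if "t \<in> S" for t
    using that x assms by (intro cmod_pairing_le) auto
  from pairing_blm [OF this] show "bounded_linear_map A complex_space (kform K x)"
    by (simp add: bounded_linear_map_def kform_iterated(2) [OF x _ assms]
        ell1_add_closed ell1_smult_closed ell1_simps(2,3))
next
  assume y: "y \<in> carrier A"
  have "cmod (pairing (\<lambda>t. K (s, t)) y) \<le> C * vnorm A y" if "s \<in> S" for s
    using that y assms by (intro cmod_pairing_le) auto
  from pairing_blm [OF this] show "bounded_linear_map A complex_space (\<lambda>x. kform K x y)"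
    by (simp add: bounded_linear_map_def kform_iterated(1) [OF _ y assms]
        ell1_add_closed ell1_smult_closed ell1_simps(2,3))
qed

lemma kform_point_mass:
  assumes "\<And>p. p \<in> S \<times> S \<Longrightarrow> cmod (K p) \<le> C" "s \<in> S" "t \<in> S"
  shows "kform K (point_mass s) (point_mass t) = K (s, t)"
  by (simp add: kform_iterated(1) [OF point_mass_closed point_mass_closed assms(1)] assms(2,3) pairing_point_mass)

text \<open>Convolution sums over the fibres of \<open>op\<close>, so all three parts come from
  \<open>infsum_fibres\<close>. The third makes the product dual to pulling a function on
  \<open>S\<close> back along \<open>op\<close>; this is the form in which products are computed
  with later.\<close>

lemma ell1_mult:
  assumes x: "x \<in> carrier A" and y: "y \<in> carrier A"
  shows ell1_mult_closed: "x \<otimes>\<^bsub>A\<^esub> y \<in> carrier A"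
    and ell1_mult_norm: "vnorm A (x \<otimes>\<^bsub>A\<^esub> y) \<le> vnorm A x * vnorm A y"
    and pairing_mult: "(\<And>s. s \<in> S \<Longrightarrow> cmod (c s) \<le> C) \<Longrightarrow>
      pairing c (x \<otimes>\<^bsub>A\<^esub> y) = kform (\<lambda>p. c (op (fst p) (snd p))) x y"
proof -
  let ?g = "\<lambda>p. x (fst p) * y (snd p)" and ?q = "\<lambda>p. op (fst p) (snd p)"
  have g: "(\<lambda>p. cmod (?g p)) summable_on S \<times> S"
    using kform_summable [OF x y, of "\<lambda>p. 1" 1] by simp
  have q: "?q ` (S \<times> S) \<subseteq> S" using op_closed by auto
  have m: "x \<otimes>\<^bsub>A\<^esub> y = (\<lambda>s. infsum ?g {p \<in> S \<times> S. ?q p = s})" by (simp add: ell1_simps fun_eq_iff)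
  have z: "infsum ?g {p \<in> S \<times> S. ?q p = s} = 0" if "s \<notin> S" for s
  proof -
    have "{p \<in> S \<times> S. ?q p = s} = {}" using op_closed that by fastforce
    then show ?thesis by (simp only: infsum_empty)
  qed
  show "x \<otimes>\<^bsub>A\<^esub> y \<in> carrier A"
    using abs_summable_fibres [OF g q] z unfolding m by (simp add: ell1_simps(1))
  have "vnorm A (x \<otimes>\<^bsub>A\<^esub> y) \<le> infsum (\<lambda>p. cmod (?g p)) (S \<times> S)"
    using infsum_norm_fibres [OF g q] unfolding m by (simp add: ell1_simps)
  also have "\<dots> = infsum (\<lambda>(s, t). cmod (x s) * cmod (y t)) (S \<times> S)"
    by (simp add: norm_mult case_prod_unfold)
  also have "\<dots> = infsum (\<lambda>s. infsum (\<lambda>t. cmod (x s) * cmod (y t)) S) S"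
    by (rule infsum_Sigma'_banach [symmetric]) (use g in \<open>simp add: norm_mult case_prod_unfold\<close>)
  also have "\<dots> = vnorm A x * vnorm A y"
    by (simp add: infsum_cmult_left' infsum_cmult_right' ell1_simps)
  finally show "vnorm A (x \<otimes>\<^bsub>A\<^esub> y) \<le> vnorm A x * vnorm A y" .
  assume c: "\<And>s. s \<in> S \<Longrightarrow> cmod (c s) \<le> C"
  have gc: "(\<lambda>p. cmod (?g p * c (?q p))) summable_on S \<times> S"
    by (rule kform_summable [OF x y, where C = C]) (use c op_closed in auto)
  have "pairing c (x \<otimes>\<^bsub>A\<^esub> y) = (\<Sum>\<^sub>\<infinity>s\<in>S. \<Sum>\<^sub>\<infinity>p\<in>{p \<in> S \<times> S. ?q p = s}. ?g p * c (?q p))"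
    unfolding m pairing_def infsum_cmult_left' [symmetric] by (intro infsum_cong) auto
  also have "\<dots> = kform (\<lambda>p. c (?q p)) x y"
    unfolding kform_def by (rule infsum_infsum_fibres [OF gc q])
  finally show "pairing c (x \<otimes>\<^bsub>A\<^esub> y) = kform (\<lambda>p. c (?q p)) x y" .
qed

text \<open>Each coordinate of a product is a bilinear form with a bounded kernel, so the
  convolution inherits linearity in each factor from \<open>kform\<close>.\<close>

lemma mult_coord:
  assumes "x \<in> carrier A" "y \<in> carrier A" "s \<in> S"
  shows "(x \<otimes>\<^bsub>A\<^esub> y) s = kform (\<lambda>p. if op (fst p) (snd p) = s then 1 else 0) x y"
  using pairing_indicator [OF assms(3) ell1_mult_closed [OF assms(1,2)]]
    pairing_mult [OF assms(1,2), of "\<lambda>t. if t = s then 1 else 0" 1] by simp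

lemma ell1_eqI:
  assumes "x \<in> carrier A" "y \<in> carrier A" "\<And>s. s \<in> S \<Longrightarrow> x s = y s" shows "x = y"
proof
  show "x s = y s" for s using assms by (cases "s \<in> S") (auto simp: ell1_simps)
qed

lemma point_mass_mult:
  assumes "s \<in> S" "t \<in> S"
  shows "point_mass s \<otimes>\<^bsub>A\<^esub> point_mass t = point_mass (op s t)"
proof (rule ell1_eqI)
  show "(point_mass s \<otimes>\<^bsub>A\<^esub> point_mass t) r = point_mass (op s t) r" if "r \<in> S" for r
    unfolding mult_coord [OF point_mass_closed [OF assms(1)] point_mass_closed [OF assms(2)] that]
    by (subst kform_point_mass [where C = 1]) (use assms in \<open>auto simp: point_mass_def\<close>)
qed (use assms op_closed in \<open>auto intro!: ell1_mult_closed point_mass_closed\<close>)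

lemma ell1_bilinear_eqI:
  assumes "\<And>x. x \<in> carrier A \<Longrightarrow> bounded_linear_map A complex_space (f x)"
    and "\<And>x. x \<in> carrier A \<Longrightarrow> bounded_linear_map A complex_space (g x)"
    and "\<And>y. y \<in> carrier A \<Longrightarrow> bounded_linear_map A complex_space (\<lambda>x. f x y)"
    and "\<And>y. y \<in> carrier A \<Longrightarrow> bounded_linear_map A complex_space (\<lambda>x. g x y)"
    and "\<And>s t. s \<in> S \<Longrightarrow> t \<in> S \<Longrightarrow> f (point_mass s) (point_mass t) = g (point_mass s) (point_mass t)"
    and "x \<in> carrier A" "y \<in> carrier A"
  shows "f x y = g x y"
proof (rule functional_eqI [where T = "f x" and U = "g x"])
  fix t assume t: "t \<in> S"
  show "f x (point_mass t) = g x (point_mass t)"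
    by (rule functional_eqI [where T = "\<lambda>x. f x (point_mass t)" and U = "\<lambda>x. g x (point_mass t)"])
      (use assms t point_mass_closed in auto)
qed (use assms in auto)

end

section \<open>The projective tensor product of a semigroup algebra\<close>

text \<open>Interleaving lets one series represent the sum of two tensors. Real and imaginary parts
  are treated separately by \<open>sums_if\<close>.\<close>

lemma sums_complex_if:
  fixes f g :: "nat \<Rightarrow> complex"
  assumes "g sums x" "f sums y"
  shows "(\<lambda>n. if even n then f (n div 2) else g ((n - 1) div 2)) sums (x + y)"
  using sums_if [of "\<lambda>n. Re (g n)" "Re x" "\<lambda>n. Re (f n)" "Re y"]
    sums_if [of "\<lambda>n. Im (g n)" "Im x" "\<lambda>n. Im (f n)" "Im y"] assms
  by (simp add: sums_complex_iff if_distrib [of Re] if_distrib [of Im] cong: if_cong)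

lemma blm_compose:
  assumes T: "bounded_linear_map V W T" and U: "bounded_linear_map W complex_space U"
    and "\<And>x. x \<in> carrier W \<Longrightarrow> 0 \<le> vnorm W x"
  shows "bounded_linear_map V complex_space (\<lambda>x. U (T x))"
proof -
  obtain K where K: "K > 0" "\<And>x. x \<in> carrier W \<Longrightarrow> cmod (U x) \<le> K * vnorm W x"
    using blm_complex_bound [OF U assms(3)] by metis
  obtain L where L: "\<And>x. x \<in> carrier V \<Longrightarrow> vnorm W (T x) \<le> L * vnorm V x"
    using T unfolding bounded_linear_map_def by blast
  show ?thesis
  proof (rule blm_complexI [where K = "K * L"])
    show "cmod (U (T x)) \<le> K * L * vnorm V x" if "x \<in> carrier V" for x
      using order_trans [OF K(2) [OF blmD(1) [OF T that]] mult_left_mono [OF L [OF that], of K]] K(1)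
      by (simp add: mult.assoc)
  qed (simp_all add: blmD [OF T] blmD [OF U])
qed

context ell1_algebra
begin

lemma mult_blm:
  assumes "a \<in> carrier A"
  shows mult_blm_right: "bounded_linear_map A A (\<lambda>x. a \<otimes>\<^bsub>A\<^esub> x)"
    and mult_blm_left: "bounded_linear_map A A (\<lambda>x. x \<otimes>\<^bsub>A\<^esub> a)"
proof -
  let ?K = "\<lambda>s p. if op (fst p) (snd p) = s then 1 else (0::complex)"
  have K: "cmod (?K s p) \<le> 1" for s p by simp
  note b1 = kform_blm(1) [of "?K s" 1 for s, OF K] and b2 = kform_blm(2) [of "?K s" 1 for s, OF K]
  show "bounded_linear_map A A (\<lambda>x. a \<otimes>\<^bsub>A\<^esub> x)"
    unfolding bounded_linear_map_def
  proof (intro conjI ballI allI exI)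
    show "a \<otimes>\<^bsub>A\<^esub> (x \<oplus>\<^bsub>A\<^esub> y) = (a \<otimes>\<^bsub>A\<^esub> x) \<oplus>\<^bsub>A\<^esub> (a \<otimes>\<^bsub>A\<^esub> y)" if "x \<in> carrier A" "y \<in> carrier A" for x y
      using assms that blmD(2) [OF b1 that]
      by (intro ell1_eqI) (simp_all add: ell1_simps(2) ell1_add_closed ell1_mult_closed mult_coord)
    show "a \<otimes>\<^bsub>A\<^esub> (c \<odot>\<^bsub>A\<^esub> x) = c \<odot>\<^bsub>A\<^esub> (a \<otimes>\<^bsub>A\<^esub> x)" if "x \<in> carrier A" for c x
      using assms that blmD(3) [OF b1 that]
      by (intro ell1_eqI) (auto simp: ell1_simps(3) ell1_smult_closed ell1_mult_closed mult_coord)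
    show "vnorm A (a \<otimes>\<^bsub>A\<^esub> x) \<le> vnorm A a * vnorm A x" if "x \<in> carrier A" for x
      using assms that by (rule ell1_mult_norm)
  qed (use assms in \<open>auto intro: ell1_mult_closed\<close>)
  show "bounded_linear_map A A (\<lambda>x. x \<otimes>\<^bsub>A\<^esub> a)"
    unfolding bounded_linear_map_def
  proof (intro conjI ballI allI exI)
    show "(x \<oplus>\<^bsub>A\<^esub> y) \<otimes>\<^bsub>A\<^esub> a = (x \<otimes>\<^bsub>A\<^esub> a) \<oplus>\<^bsub>A\<^esub> (y \<otimes>\<^bsub>A\<^esub> a)" if "x \<in> carrier A" "y \<in> carrier A" for x y
      using assms that blmD(2) [OF b2 that]
      by (intro ell1_eqI) (auto simp: ell1_simps(2) ell1_add_closed ell1_mult_closed mult_coord)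
    show "(c \<odot>\<^bsub>A\<^esub> x) \<otimes>\<^bsub>A\<^esub> a = c \<odot>\<^bsub>A\<^esub> (x \<otimes>\<^bsub>A\<^esub> a)" if "x \<in> carrier A" for c x
      using assms that blmD(3) [OF b2 that]
      by (intro ell1_eqI) (auto simp: ell1_simps(3) ell1_smult_closed ell1_mult_closed mult_coord)
    show "vnorm A (x \<otimes>\<^bsub>A\<^esub> a) \<le> vnorm A a * vnorm A x" if "x \<in> carrier A" for x
      using ell1_mult_norm [OF that assms] by (simp add: mult.commute)
  qed (use assms in \<open>auto intro: ell1_mult_closed\<close>)
qed

abbreviation "BF \<equiv> bilinear_forms A"
abbreviation "P \<equiv> proj_tensor A"
abbreviation "tens \<equiv> elementary_tensor A"

lemma BF_blm:
  assumes "\<beta> \<in> BF" "x \<in> carrier A"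
  shows "bounded_linear_map A complex_space (\<lambda>y. \<beta> (x, y))"
    and "bounded_linear_map A complex_space (\<lambda>y. \<beta> (y, x))"
  using assms unfolding bilinear_forms_def by auto

lemma BF_bound:
  assumes "\<beta> \<in> BF"
  obtains K where "K > 0" "\<And>x y. x \<in> carrier A \<Longrightarrow> y \<in> carrier A \<Longrightarrow> cmod (\<beta> (x, y)) \<le> K * (vnorm A x * vnorm A y)"
proof -
  obtain K where K: "\<And>x y. x \<in> carrier A \<Longrightarrow> y \<in> carrier A \<Longrightarrow> cmod (\<beta> (x, y)) \<le> K * vnorm A x * vnorm A y"
    using assms unfolding bilinear_forms_def by blast
  have "cmod (\<beta> (x, y)) \<le> (\<bar>K\<bar> + 1) * (vnorm A x * vnorm A y)" if "x \<in> carrier A" "y \<in> carrier A" for x y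
    using order_trans [OF K [OF that, unfolded mult.assoc] mult_right_mono [of K "\<bar>K\<bar> + 1"]]
      mult_nonneg_nonneg [OF ell1_vnorm_nonneg [of x] ell1_vnorm_nonneg [of y]] by simp
  then show ?thesis by (rule that [rotated]) auto
qed

lemma BF_I:
  assumes "\<And>x. x \<in> carrier A \<Longrightarrow> bounded_linear_map A complex_space (\<lambda>y. f x y)"
    and "\<And>y. y \<in> carrier A \<Longrightarrow> bounded_linear_map A complex_space (\<lambda>x. f x y)"
    and "\<And>x y. x \<in> carrier A \<Longrightarrow> y \<in> carrier A \<Longrightarrow> cmod (f x y) \<le> K * (vnorm A x * vnorm A y)"
  shows "(\<lambda>(x, y)\<in>carrier A \<times> carrier A. f x y) \<in> BF"
proof -
  have "bounded_linear_map A complex_space (\<lambda>y. (\<lambda>(x, y)\<in>carrier A \<times> carrier A. f x y) (x, y))"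
    "bounded_linear_map A complex_space (\<lambda>y. (\<lambda>(x, y)\<in>carrier A \<times> carrier A. f x y) (y, x))"
    if "x \<in> carrier A" for x
    using assms(1) [OF that] assms(2) [OF that] that
    by (simp_all add: bounded_linear_map_def ell1_add_closed ell1_smult_closed ell1_simps(2,3))
  then show ?thesis
    unfolding bilinear_forms_def using assms(3) by (auto simp: mult.assoc intro!: exI [of _ K])
qed

lemma BF_eqI:
  assumes "\<beta> \<in> BF" "\<gamma> \<in> BF" "\<And>x y. x \<in> carrier A \<Longrightarrow> y \<in> carrier A \<Longrightarrow> \<beta> (x, y) = \<gamma> (x, y)"
  shows "\<beta> = \<gamma>"
  using assms unfolding bilinear_forms_def by (auto intro!: extensionalityI [of _ "carrier A \<times> carrier A"])

lemma BF_compose: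
  assumes "\<beta> \<in> BF" "a \<in> carrier A"
  shows BF_left: "(\<lambda>(x, y)\<in>carrier A \<times> carrier A. \<beta> (a \<otimes>\<^bsub>A\<^esub> x, y)) \<in> BF"
    and BF_right: "(\<lambda>(x, y)\<in>carrier A \<times> carrier A. \<beta> (x, y \<otimes>\<^bsub>A\<^esub> a)) \<in> BF"
proof -
  obtain K where K: "K > 0" "\<And>x y. x \<in> carrier A \<Longrightarrow> y \<in> carrier A \<Longrightarrow> cmod (\<beta> (x, y)) \<le> K * (vnorm A x * vnorm A y)"
    using BF_bound [OF assms(1)] by metis
  have 1: "cmod (\<beta> (a \<otimes>\<^bsub>A\<^esub> x, y)) \<le> (K * vnorm A a) * (vnorm A x * vnorm A y)"
    if "x \<in> carrier A" "y \<in> carrier A" for x y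
  proof -
    have "cmod (\<beta> (a \<otimes>\<^bsub>A\<^esub> x, y)) \<le> K * (vnorm A (a \<otimes>\<^bsub>A\<^esub> x) * vnorm A y)"
      using K(2) ell1_mult_closed assms(2) that by blast
    also have "\<dots> \<le> K * ((vnorm A a * vnorm A x) * vnorm A y)"
      using K(1) ell1_mult_norm [OF assms(2) that(1)] ell1_vnorm_nonneg
      by (intro mult_left_mono mult_right_mono) auto
    finally show ?thesis by (simp add: mult.assoc)
  qed
  have 2: "cmod (\<beta> (x, y \<otimes>\<^bsub>A\<^esub> a)) \<le> (K * vnorm A a) * (vnorm A x * vnorm A y)"
    if "x \<in> carrier A" "y \<in> carrier A" for x y
  proof -
    have "cmod (\<beta> (x, y \<otimes>\<^bsub>A\<^esub> a)) \<le> K * (vnorm A x * vnorm A (y \<otimes>\<^bsub>A\<^esub> a))"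
      using K(2) ell1_mult_closed assms(2) that by blast
    also have "\<dots> \<le> K * (vnorm A x * (vnorm A y * vnorm A a))"
      using K(1) ell1_mult_norm [OF that(2) assms(2)] ell1_vnorm_nonneg
      by (intro mult_left_mono) auto
    finally show ?thesis by (simp add: mult_ac)
  qed
  show "(\<lambda>(x, y)\<in>carrier A \<times> carrier A. \<beta> (a \<otimes>\<^bsub>A\<^esub> x, y)) \<in> BF"
    by (rule BF_I [OF _ _ 1])
      (auto intro: BF_blm [OF assms(1)] ell1_mult_closed assms(2) ell1_vnorm_nonneg
        blm_compose [OF mult_blm_right [OF assms(2)] BF_blm(2) [OF assms(1)]])
  show "(\<lambda>(x, y)\<in>carrier A \<times> carrier A. \<beta> (x, y \<otimes>\<^bsub>A\<^esub> a)) \<in> BF"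
    by (rule BF_I [OF _ _ 2])
      (auto intro: BF_blm [OF assms(1)] ell1_mult_closed assms(2) ell1_vnorm_nonneg
        blm_compose [OF mult_blm_left [OF assms(2)] BF_blm(1) [OF assms(1)]])
qed

definition kernel_form :: "('s \<times> 's \<Rightarrow> complex) \<Rightarrow> ('s \<Rightarrow> complex) \<times> ('s \<Rightarrow> complex) \<Rightarrow> complex" where
  "kernel_form K = (\<lambda>(x, y)\<in>carrier A \<times> carrier A. kform K x y)"

lemma kernel_form_BF:
  assumes "\<And>p. p \<in> S \<times> S \<Longrightarrow> cmod (K p) \<le> C" shows "kernel_form K \<in> BF"
proof -
  have "cmod (kform K x y) \<le> C * (vnorm A x * vnorm A y)" if "x \<in> carrier A" "y \<in> carrier A" for x y
    using cmod_kform_le [OF that assms] by (simp add: mult.assoc)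
  moreover have "bounded_linear_map A complex_space (kform K x)"
    "bounded_linear_map A complex_space (\<lambda>y. kform K y x)" if "x \<in> carrier A" for x
    by (rule kform_blm [OF assms that], assumption)+
  ultimately show ?thesis
    unfolding kernel_form_def by (intro BF_I) auto
qed

text \<open>A bounded form is determined by its values on pairs of point masses. Composing a form
  with multiplication by a point mass therefore amounts to a substitution in its kernel.\<close>

lemma kernel_form_eqI:
  assumes K: "\<And>p. p \<in> S \<times> S \<Longrightarrow> cmod (K p) \<le> C" and "\<beta> \<in> BF"
    and "\<And>s t. s \<in> S \<Longrightarrow> t \<in> S \<Longrightarrow> \<beta> (point_mass s, point_mass t) = K (s, t)"
  shows "\<beta> = kernel_form K"
proof (rule BF_eqI [OF assms(2) kernel_form_BF [OF K]])
  fix x y assume xy: "x \<in> carrier A" "y \<in> carrier A"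
  have "\<beta> (x, y) = kform K x y"
  proof (rule ell1_bilinear_eqI [where f = "\<lambda>x y. \<beta> (x, y)"])
    show "bounded_linear_map A complex_space (kform K x)"
      "bounded_linear_map A complex_space (\<lambda>y. kform K y x)" if "x \<in> carrier A" for x
      by (rule kform_blm [OF K that], assumption)+
    show "\<beta> (point_mass s, point_mass t) = kform K (point_mass s) (point_mass t)"
      if "s \<in> S" "t \<in> S" for s t
      using kform_point_mass [of K, OF K that] assms(3) [OF that] by simp
  qed (use xy BF_blm [OF assms(2)] in simp_all)
  then show "\<beta> (x, y) = kernel_form K (x, y)" using xy by (simp add: kernel_form_def)
qed

lemma proj_simps:
  "u \<in> carrier P \<longleftrightarrow> (\<exists>a b. tensor_series A a b u)"
  "\<zero>\<^bsub>P\<^esub> = (\<lambda>\<beta>\<in>BF. 0)" "u \<oplus>\<^bsub>P\<^esub> v = (\<lambda>\<beta>\<in>BF. u \<beta> + v \<beta>)" "c \<odot>\<^bsub>P\<^esub> u = (\<lambda>\<beta>\<in>BF. c * u \<beta>)"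
  "vnorm P u = Inf {(\<Sum>n. vnorm A (a n) * vnorm A (b n)) | a b. tensor_series A a b u}"
  "lact P a u = (\<lambda>\<beta>\<in>BF. u (\<lambda>(x, y)\<in>carrier A \<times> carrier A. \<beta> (a \<otimes>\<^bsub>A\<^esub> x, y)))"
  "ract P u a = (\<lambda>\<beta>\<in>BF. u (\<lambda>(x, y)\<in>carrier A \<times> carrier A. \<beta> (x, y \<otimes>\<^bsub>A\<^esub> a)))"
  by (simp_all add: proj_tensor_def)

lemma tens_simp: "\<beta> \<in> BF \<Longrightarrow> tens a b \<beta> = \<beta> (a, b)"
  by (simp add: elementary_tensor_def)

lemma tensor_seriesD:
  assumes "tensor_series A a b u"
  shows "a n \<in> carrier A" "b n \<in> carrier A" "summable (\<lambda>n. vnorm A (a n) * vnorm A (b n))"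
    "u \<in> extensional BF"
  using assms unfolding tensor_series_def by (auto simp: image_subset_iff)

lemma tensor_summable:
  assumes "tensor_series A a b u" "\<beta> \<in> BF"
  shows "summable (\<lambda>n. cmod (\<beta> (a n, b n)))"
proof -
  obtain K where K: "K > 0" "\<And>x y. x \<in> carrier A \<Longrightarrow> y \<in> carrier A \<Longrightarrow> cmod (\<beta> (x, y)) \<le> K * (vnorm A x * vnorm A y)"
    using BF_bound [OF assms(2)] by metis
  show ?thesis
    by (rule summable_comparison_test' [where N = 0, OF summable_mult [OF tensor_seriesD(3) [OF assms(1)], of K]])
      (use K(2) tensor_seriesD(1,2) [OF assms(1)] in auto)
qed

lemma tensor_sums:
  assumes "tensor_series A a b u" "\<beta> \<in> BF"
  shows "(\<lambda>n. \<beta> (a n, b n)) sums u \<beta>"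
  using summable_sums [OF summable_norm_cancel [OF tensor_summable [OF assms]]] assms
  unfolding tensor_series_def by (simp add: tens_simp)

lemma tensor_seriesI:
  assumes "\<And>n. a n \<in> carrier A" "\<And>n. b n \<in> carrier A" "summable (\<lambda>n. vnorm A (a n) * vnorm A (b n))"
    and "u \<in> extensional BF" "\<And>\<beta>. \<beta> \<in> BF \<Longrightarrow> (\<lambda>n. \<beta> (a n, b n)) sums u \<beta>"
  shows "tensor_series A a b u"
  unfolding tensor_series_def using assms(1-4) sums_unique [OF assms(5)]
  by (auto simp: tens_simp intro!: extensionalityI [of u BF])

lemma tensor_add:
  assumes "tensor_series A a b u" "tensor_series A c d v"
  shows "\<exists>a b. tensor_series A a b (u \<oplus>\<^bsub>P\<^esub> v)"
proof -
  \<comment> \<open>Even positions carry the series of \<open>v\<close>, odd positions that of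
    \<open>u\<close>, matching the order in \<open>sums_if\<close>.\<close>
  let ?a = "\<lambda>n. if even n then c (n div 2) else a ((n - 1) div 2)"
  let ?b = "\<lambda>n. if even n then d (n div 2) else b ((n - 1) div 2)"
  have "tensor_series A ?a ?b (u \<oplus>\<^bsub>P\<^esub> v)"
  proof (rule tensor_seriesI)
    show "summable (\<lambda>n. vnorm A (?a n) * vnorm A (?b n))"
      using sums_summable [OF sums_if [OF summable_sums [OF tensor_seriesD(3) [OF assms(1)]]
          summable_sums [OF tensor_seriesD(3) [OF assms(2)]]]]
      by (rule back_subst [of summable]) auto
    show "(\<lambda>n. \<beta> (?a n, ?b n)) sums (u \<oplus>\<^bsub>P\<^esub> v) \<beta>" if "\<beta> \<in> BF" for \<beta>
    proof -
      have "(\<lambda>n. \<beta> (?a n, ?b n)) = (\<lambda>n. if even n then \<beta> (c (n div 2), d (n div 2)) else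
          \<beta> (a ((n - 1) div 2), b ((n - 1) div 2)))" by auto
      then show ?thesis
        using sums_complex_if [OF tensor_sums [OF assms(1) that] tensor_sums [OF assms(2) that]] that
        by (simp add: proj_simps)
    qed
  qed (use tensor_seriesD [OF assms(1)] tensor_seriesD [OF assms(2)] in \<open>auto simp: proj_simps\<close>)
  then show ?thesis by blast
qed

lemma tensor_smult:
  assumes "tensor_series A a b u"
  shows "tensor_series A (\<lambda>n s. c * a n s) b (c \<odot>\<^bsub>P\<^esub> u)"
proof (rule tensor_seriesI)
  show "summable (\<lambda>n. vnorm A (\<lambda>s. c * a n s) * vnorm A (b n))"
    using summable_mult [OF tensor_seriesD(3) [OF assms], of "cmod c"] tensor_seriesD(1) [OF assms]
    by (simp add: ell1_smult_norm mult.assoc)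
  show "(\<lambda>n. \<beta> ((\<lambda>s. c * a n s), b n)) sums (c \<odot>\<^bsub>P\<^esub> u) \<beta>" if "\<beta> \<in> BF" for \<beta>
  proof -
    have "\<beta> ((\<lambda>s. c * a n s), b n) = c * \<beta> (a n, b n)" for n
      using blmD(3) [OF BF_blm(2) [OF that tensor_seriesD(2) [OF assms]] tensor_seriesD(1) [OF assms], of c]
      by (simp add: ell1_simps(3))
    then show ?thesis using sums_mult [OF tensor_sums [OF assms that], of c] that by (simp add: proj_simps)
  qed
qed (use tensor_seriesD [OF assms] in \<open>auto simp: proj_simps ell1_smult_closed\<close>)

lemma tensor_lact:
  assumes "tensor_series A a b u" "c \<in> carrier A"
  shows "tensor_series A (\<lambda>n. c \<otimes>\<^bsub>A\<^esub> a n) b (lact P c u)"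
proof (rule tensor_seriesI)
  show "summable (\<lambda>n. vnorm A (c \<otimes>\<^bsub>A\<^esub> a n) * vnorm A (b n))"
  proof (rule summable_comparison_test' [where N = 0])
    show "summable (\<lambda>n. vnorm A c * (vnorm A (a n) * vnorm A (b n)))"
      by (rule summable_mult [OF tensor_seriesD(3) [OF assms(1)]])
    show "norm (vnorm A (c \<otimes>\<^bsub>A\<^esub> a n) * vnorm A (b n)) \<le> vnorm A c * (vnorm A (a n) * vnorm A (b n))" for n
      using ell1_mult_norm [OF assms(2) tensor_seriesD(1) [OF assms(1)]] ell1_vnorm_nonneg
      by (simp add: abs_mult mult.assoc [symmetric] mult_right_mono)
  qed
  show "(\<lambda>n. \<beta> (c \<otimes>\<^bsub>A\<^esub> a n, b n)) sums (lact P c u) \<beta>" if "\<beta> \<in> BF" for \<beta>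
    using tensor_sums [OF assms(1) BF_left [OF that assms(2)]] that tensor_seriesD(1,2) [OF assms(1)]
    by (simp add: proj_simps)
qed (use tensor_seriesD [OF assms(1)] assms(2) in \<open>auto simp: proj_simps ell1_mult_closed\<close>)

lemma tensor_ract:
  assumes "tensor_series A a b u" "c \<in> carrier A"
  shows "tensor_series A a (\<lambda>n. b n \<otimes>\<^bsub>A\<^esub> c) (ract P u c)"
proof (rule tensor_seriesI)
  show "summable (\<lambda>n. vnorm A (a n) * vnorm A (b n \<otimes>\<^bsub>A\<^esub> c))"
  proof (rule summable_comparison_test' [where N = 0])
    show "summable (\<lambda>n. (vnorm A (a n) * vnorm A (b n)) * vnorm A c)"
      by (rule summable_mult2 [OF tensor_seriesD(3) [OF assms(1)]])
    show "norm (vnorm A (a n) * vnorm A (b n \<otimes>\<^bsub>A\<^esub> c)) \<le> (vnorm A (a n) * vnorm A (b n)) * vnorm A c" for n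
      using ell1_mult_norm [OF tensor_seriesD(2) [OF assms(1)] assms(2)] ell1_vnorm_nonneg
      by (simp add: abs_mult mult.assoc mult_left_mono)
  qed
  show "(\<lambda>n. \<beta> (a n, b n \<otimes>\<^bsub>A\<^esub> c)) sums (ract P u c) \<beta>" if "\<beta> \<in> BF" for \<beta>
    using tensor_sums [OF assms(1) BF_right [OF that assms(2)]] that tensor_seriesD(1,2) [OF assms(1)]
    by (simp add: proj_simps)
qed (use tensor_seriesD [OF assms(1)] assms(2) in \<open>auto simp: proj_simps ell1_mult_closed\<close>)

lemma BF_zero: "\<beta> \<in> BF \<Longrightarrow> x \<in> carrier A \<Longrightarrow> \<beta> (x, (\<lambda>s. 0)) = 0"
  using blmD(3) [OF BF_blm(1), of \<beta> x "\<lambda>s. 0" 0] by (simp add: ell1_simps(3) ell1_zero)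

text \<open>Representing series are always infinite. The first factor stays constant and the second
  is zero from index 1 on.\<close>

lemma tensor_tens:
  assumes "a \<in> carrier A" "b \<in> carrier A"
  shows "tensor_series A (\<lambda>n. a) (\<lambda>n. if n = 0 then b else (\<lambda>s. 0)) (tens a b)"
proof (rule tensor_seriesI)
  have "(\<lambda>n. vnorm A a * vnorm A (if n = (0::nat) then b else (\<lambda>s. 0)))
     = (\<lambda>n. if n = 0 then vnorm A a * vnorm A b else 0)" by (auto simp: ell1_zero)
  then show "summable (\<lambda>n. vnorm A a * vnorm A (if n = (0::nat) then b else (\<lambda>s. 0)))"
    using summable_single [of 0 "\<lambda>_. vnorm A a * vnorm A b"] by (simp only:)
  show "(\<lambda>n. \<beta> (a, if n = 0 then b else (\<lambda>s. 0))) sums tens a b \<beta>" if "\<beta> \<in> BF" for \<beta>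
  proof -
    have "(\<lambda>n. \<beta> (a, if n = (0::nat) then b else (\<lambda>s. 0))) = (\<lambda>n. if n = 0 then \<beta> (a, b) else 0)"
      using BF_zero [OF that assms(1)] by auto
    then show ?thesis using sums_single [of 0 "\<lambda>_. \<beta> (a, b)"] by (simp add: tens_simp [OF that])
  qed
qed (use assms ell1_zero in \<open>auto simp: elementary_tensor_def\<close>)

lemma proj_vnorm_le: "tensor_series A a b u \<Longrightarrow> vnorm P u \<le> (\<Sum>n. vnorm A (a n) * vnorm A (b n))"
  unfolding proj_simps
  by (rule cInf_lower) (auto intro!: bdd_belowI [where m = 0] suminf_nonneg tensor_seriesD(3) simp: ell1_vnorm_nonneg)

text \<open>The projective norm is an infimum, so an upper bound by a multiple of it is obtained
  from every representing series separately; \<open>K\<close> is positive so that it can be divided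
  out.\<close>

lemma proj_vnorm_ge:
  assumes "u \<in> carrier P" "K > 0"
    and "\<And>a b. tensor_series A a b u \<Longrightarrow> r \<le> K * (\<Sum>n. vnorm A (a n) * vnorm A (b n))"
  shows "r \<le> K * vnorm P u"
proof -
  have "r / K \<le> vnorm P u"
    unfolding proj_simps(5)
  proof (rule cInf_greatest)
    show "r / K \<le> z" if "z \<in> {(\<Sum>n. vnorm A (a n) * vnorm A (b n)) | a b. tensor_series A a b u}" for z
      using that assms(2,3) by (auto simp: field_simps)
  qed (use assms(1) in \<open>auto simp: proj_simps(1)\<close>)
  then show ?thesis using assms(2) by (simp add: field_simps)
qed

lemma proj_vnorm_nonneg: "u \<in> carrier P \<Longrightarrow> 0 \<le> vnorm P u"
  using proj_vnorm_ge [of u 1 0]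
  by (simp add: suminf_nonneg tensor_seriesD(3) ell1_vnorm_nonneg)

lemma tens_closed: "a \<in> carrier A \<Longrightarrow> b \<in> carrier A \<Longrightarrow> tens a b \<in> carrier P"
  using tensor_tens unfolding proj_simps(1) by blast

lemma tens_norm:
  assumes "a \<in> carrier A" "b \<in> carrier A"
  shows "vnorm P (tens a b) \<le> vnorm A a * vnorm A b"
proof -
  have "(\<lambda>n. vnorm A a * vnorm A (if n = (0::nat) then b else (\<lambda>s. 0)))
     = (\<lambda>n. if n = 0 then vnorm A a * vnorm A b else 0)" by (auto simp: ell1_zero)
  then show ?thesis
    using proj_vnorm_le [OF tensor_tens [OF assms]] sums_unique [OF sums_single [of 0 "\<lambda>_. vnorm A a * vnorm A b"]]
    by (simp only:)
qed

lemma proj_pre_space: "pre_space P"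
  unfolding pre_space_def
proof (intro conjI ballI allI)
  show "\<exists>x\<in>carrier P. vnorm P x \<le> 1"
    using tens_closed [OF ell1_zero(1) ell1_zero(1)] tens_norm [OF ell1_zero(1) ell1_zero(1)]
    by (auto simp: ell1_zero(2) intro!: bexI [of _ "tens (\<lambda>s. 0) (\<lambda>s. 0)"])
  show "c \<odot>\<^bsub>P\<^esub> u \<in> carrier P" if "u \<in> carrier P" for c u
    using that tensor_smult unfolding proj_simps(1) by blast
  show "vnorm P (c \<odot>\<^bsub>P\<^esub> u) \<le> cmod c * vnorm P u" if u: "u \<in> carrier P" for c u
  proof (rule field_le_epsilon)
    fix \<epsilon> :: real assume "\<epsilon> > 0"
    \<comment> \<open>\<open>proj_vnorm_ge\<close> asks for a positive factor, but \<open>c\<close>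
      may be 0; its modulus is enlarged by \<delta>, which costs at most \<epsilon>.\<close>
    define \<delta> where "\<delta> = \<epsilon> / (vnorm P u + 1)"
    have \<delta>: "\<delta> > 0" "\<delta> * vnorm P u \<le> \<epsilon>"
      using \<open>\<epsilon> > 0\<close> proj_vnorm_nonneg [OF u] by (auto simp: \<delta>_def field_simps)
    have "vnorm P (c \<odot>\<^bsub>P\<^esub> u) \<le> (cmod c + \<delta>) * vnorm P u"
    proof (rule proj_vnorm_ge [OF u])
      fix a b assume ab: "tensor_series A a b u"
      have "vnorm P (c \<odot>\<^bsub>P\<^esub> u) \<le> (\<Sum>n. cmod c * (vnorm A (a n) * vnorm A (b n)))"
        using proj_vnorm_le [OF tensor_smult [OF ab]] tensor_seriesD(1) [OF ab]
        by (simp add: ell1_smult_norm mult.assoc)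
      also have "\<dots> = cmod c * (\<Sum>n. vnorm A (a n) * vnorm A (b n))"
        by (rule suminf_mult [OF tensor_seriesD(3) [OF ab]])
      also have "\<dots> \<le> (cmod c + \<delta>) * (\<Sum>n. vnorm A (a n) * vnorm A (b n))"
        using \<delta>(1) tensor_seriesD(3) [OF ab]
        by (intro mult_right_mono suminf_nonneg) (auto simp: ell1_vnorm_nonneg)
      finally show "vnorm P (c \<odot>\<^bsub>P\<^esub> u) \<le> (cmod c + \<delta>) * (\<Sum>n. vnorm A (a n) * vnorm A (b n))" .
    qed (use \<delta>(1) in \<open>simp add: add_nonneg_pos\<close>)
    then show "vnorm P (c \<odot>\<^bsub>P\<^esub> u) \<le> cmod c * vnorm P u + \<epsilon>" using \<delta>(2) by (simp add: algebra_simps)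
  qed
qed (use tensor_add proj_vnorm_nonneg in \<open>auto simp: proj_simps(1)\<close>)

text \<open>Splitting off the first N elementary tensors does not change the value of
  \<open>T\<close>, and the remaining tensor has projective norm at most the tail of a convergent
  series.\<close>

lemma tensor_functional_zero:
  assumes add: "\<And>u v. u \<in> carrier P \<Longrightarrow> v \<in> carrier P \<Longrightarrow> T (u \<oplus>\<^bsub>P\<^esub> v) = T u + T v"
    and bound: "\<And>u. u \<in> carrier P \<Longrightarrow> cmod (T u) \<le> K * vnorm P u"
    and zero: "\<And>a b. a \<in> carrier A \<Longrightarrow> b \<in> carrier A \<Longrightarrow> T (tens a b) = 0"
    and u: "u \<in> carrier P"
  shows "T u = 0"
proof -
  obtain a b where ab: "tensor_series A a b u" using u by (auto simp: proj_simps(1))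
  note D = tensor_seriesD [OF ab]
  define v where "v N = (\<lambda>\<beta>\<in>BF. \<Sum>n. \<beta> (a (n + N), b (n + N)))" for N
  have v: "tensor_series A (\<lambda>n. a (n + N)) (\<lambda>n. b (n + N)) (v N)" for N
  proof (rule tensor_seriesI)
    show "summable (\<lambda>n. vnorm A (a (n + N)) * vnorm A (b (n + N)))"
      using D(3) by (rule summable_ignore_initial_segment)
    show "(\<lambda>n. \<beta> (a (n + N), b (n + N))) sums v N \<beta>" if "\<beta> \<in> BF" for \<beta>
      using summable_sums [OF summable_ignore_initial_segment [OF sums_summable [OF tensor_sums [OF ab that]], of N]] that
      by (simp add: v_def)
  qed (use D in \<open>auto simp: v_def\<close>)
  then have vP: "v N \<in> carrier P" for N by (auto simp: proj_simps(1))
  have eq: "v N = tens (a N) (b N) \<oplus>\<^bsub>P\<^esub> v (Suc N)" for N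
  proof (rule extensionalityI [of _ BF])
    fix \<beta> assume \<beta>: "\<beta> \<in> BF"
    have s: "summable (\<lambda>n. \<beta> (a (n + N), b (n + N)))"
      by (rule summable_ignore_initial_segment [OF sums_summable [OF tensor_sums [OF ab \<beta>]]])
    show "v N \<beta> = (tens (a N) (b N) \<oplus>\<^bsub>P\<^esub> v (Suc N)) \<beta>"
      using suminf_split_head [OF s] \<beta> by (simp add: v_def proj_simps tens_simp)
  qed (auto simp: v_def proj_simps)
  have u0: "u = v 0" using sums_unique [OF tensor_sums [OF ab]] D(4)
    by (intro extensionalityI [of _ BF]) (auto simp: v_def)
  have Tv: "T u = T (v N)" for N
  proof (induction N)
    case (Suc N)
    then show ?case
      using add [OF tens_closed [OF D(1,2), of N N] vP [of "Suc N"]] zero [OF D(1,2), of N N] eq [of N]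
      by simp
  qed (simp add: u0)
  have "cmod (T u) \<le> \<bar>K\<bar> * (\<Sum>n. vnorm A (a (n + N)) * vnorm A (b (n + N)))" for N
  proof -
    have "cmod (T u) \<le> K * vnorm P (v N)" using bound [OF vP, of N] Tv [of N] by simp
    also have "\<dots> \<le> \<bar>K\<bar> * vnorm P (v N)" using proj_vnorm_nonneg [OF vP] by (intro mult_right_mono) auto
    also have "\<dots> \<le> \<bar>K\<bar> * (\<Sum>n. vnorm A (a (n + N)) * vnorm A (b (n + N)))"
      by (intro mult_left_mono proj_vnorm_le [OF v]) auto
    finally show ?thesis .
  qed
  moreover have "(\<lambda>N. \<bar>K\<bar> * (\<Sum>n. vnorm A (a (n + N)) * vnorm A (b (n + N)))) \<longlonglongrightarrow> \<bar>K\<bar> * 0"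
    by (rule tendsto_mult_left [OF suminf_exist_split2 [OF D(3)]])
  ultimately have "cmod (T u) \<le> \<bar>K\<bar> * 0"
    by (intro LIMSEQ_le_const) auto
  then show ?thesis by simp
qed

lemma tensor_functional_eqI:
  assumes T: "bounded_linear_map P complex_space T" and U: "bounded_linear_map P complex_space U"
    and "\<And>a b. a \<in> carrier A \<Longrightarrow> b \<in> carrier A \<Longrightarrow> T (tens a b) = U (tens a b)"
    and u: "u \<in> carrier P"
  shows "T u = U u"
proof -
  obtain K where K: "\<And>u. u \<in> carrier P \<Longrightarrow> cmod (T u) \<le> K * vnorm P u"
    using blm_complex_bound [OF T] proj_vnorm_nonneg by metis
  obtain L where L: "\<And>u. u \<in> carrier P \<Longrightarrow> cmod (U u) \<le> L * vnorm P u"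
    using blm_complex_bound [OF U] proj_vnorm_nonneg by metis
  have "T u - U u = 0"
  proof (rule tensor_functional_zero [where T = "\<lambda>v. T v - U v" and K = "K + L"])
    show "cmod (T v - U v) \<le> (K + L) * vnorm P v" if "v \<in> carrier P" for v
      using norm_triangle_ineq4 [of "T v" "U v"] K [OF that] L [OF that] by (simp add: algebra_simps)
    show "T (v \<oplus>\<^bsub>P\<^esub> w) - U (v \<oplus>\<^bsub>P\<^esub> w) = T v - U v + (T w - U w)"
      if "v \<in> carrier P" "w \<in> carrier P" for v w
      using blmD(2) [OF T that] blmD(2) [OF U that] by simp
    show "T (tens a b) - U (tens a b) = 0" if "a \<in> carrier A" "b \<in> carrier A" for a b
      using assms(3) [OF that] by simp
  qed (rule u)
  then show ?thesis by simp
qed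

end

section \<open>The product map and the functionals given by kernels\<close>

lemma self_simps:
  "carrier (self_bimodule V) = carrier V" "x \<oplus>\<^bsub>self_bimodule V\<^esub> y = x \<oplus>\<^bsub>V\<^esub> y"
  "c \<odot>\<^bsub>self_bimodule V\<^esub> x = c \<odot>\<^bsub>V\<^esub> x" "vnorm (self_bimodule V) x = vnorm V x"
  "lact (self_bimodule V) a x = a \<otimes>\<^bsub>V\<^esub> x" "ract (self_bimodule V) x a = x \<otimes>\<^bsub>V\<^esub> a"
  by (simp_all add: self_bimodule_def)

lemma self_blm:
  "bounded_linear_map (self_bimodule V) W T = bounded_linear_map V W T"
  "bounded_linear_map U (self_bimodule V) T' = bounded_linear_map U V T'"
  by (simp_all add: bounded_linear_map_def self_simps)

lemma self_pre_space: "pre_space (self_bimodule V) = pre_space V"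
  by (simp add: pre_space_def self_simps)

context ell1_algebra
begin

abbreviation "mult_at \<equiv> \<lambda>s p. if op (fst p) (snd p) = s then 1 else (0 :: complex)"

text \<open>The form with kernel \<open>mult_at s\<close> reads off the coefficient at
  \<open>s\<close> of a product. Evaluating \<open>u\<close> at these forms gives the product map
  without choosing a representing series.\<close>

definition tensor_product_map :: "('s \<Rightarrow> complex) tensor \<Rightarrow> 's \<Rightarrow> complex" where
  "tensor_product_map = (\<lambda>u\<in>carrier P. \<lambda>s. if s \<in> S then u (kernel_form (mult_at s)) else 0)"

lemma mult_at_BF: "kernel_form (mult_at s) \<in> BF"
  by (rule kernel_form_BF [where C = 1]) auto

text \<open>Summability of the coordinates has to be proved together with the norm bound: finite
  partial sums are estimated uniformly, by exchanging a finite sum with the series and using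
  submultiplicativity term by term.\<close>

lemma tensor_product_map_bound:
  assumes u: "tensor_series A a b u"
  shows "tensor_product_map u \<in> carrier A"
    and "vnorm A (tensor_product_map u) \<le> (\<Sum>n. vnorm A (a n) * vnorm A (b n))"
proof -
  note D = tensor_seriesD [OF u]
  have uP: "u \<in> carrier P" using u by (auto simp: proj_simps(1))
  have co: "kernel_form (mult_at s) (a n, b n) = (a n \<otimes>\<^bsub>A\<^esub> b n) s" if "s \<in> S" for n s
    using D that by (simp add: mult_coord kernel_form_def)
  have fin: "(\<Sum>s\<in>F. cmod (tensor_product_map u s)) \<le> (\<Sum>n. vnorm A (a n) * vnorm A (b n))"
    if F: "finite F" "F \<subseteq> S" for F
  proof -
    have sm: "summable (\<lambda>n. cmod ((a n \<otimes>\<^bsub>A\<^esub> b n) s))" if "s \<in> F" for s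
      using tensor_summable [OF u mult_at_BF [of s]] co F that by (simp add: subset_iff)
    have "(\<Sum>s\<in>F. cmod (tensor_product_map u s)) \<le> (\<Sum>s\<in>F. \<Sum>n. cmod ((a n \<otimes>\<^bsub>A\<^esub> b n) s))"
    proof (rule sum_mono)
      fix s assume s: "s \<in> F"
      have "tensor_product_map u s = (\<Sum>n. (a n \<otimes>\<^bsub>A\<^esub> b n) s)"
        using sums_unique [OF tensor_sums [OF u mult_at_BF [of s]]] co F s uP
        by (auto simp: tensor_product_map_def)
      then show "cmod (tensor_product_map u s) \<le> (\<Sum>n. cmod ((a n \<otimes>\<^bsub>A\<^esub> b n) s))"
        using summable_norm [OF sm [OF s]] by simp
    qed
    also have "\<dots> = (\<Sum>n. \<Sum>s\<in>F. cmod ((a n \<otimes>\<^bsub>A\<^esub> b n) s))"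
      by (rule suminf_sum [symmetric]) (rule sm)
    also have "\<dots> \<le> (\<Sum>n. vnorm A (a n) * vnorm A (b n))"
    proof (rule suminf_le)
      fix n
      have "(\<Sum>s\<in>F. cmod ((a n \<otimes>\<^bsub>A\<^esub> b n) s)) \<le> vnorm A (a n \<otimes>\<^bsub>A\<^esub> b n)"
        unfolding ell1_simps(5) using ell1_mult_closed [OF D(1,2)] F
        by (intro finite_sum_le_infsum) (auto simp: ell1_simps(1))
      also have "\<dots> \<le> vnorm A (a n) * vnorm A (b n)" by (rule ell1_mult_norm [OF D(1,2)])
      finally show "(\<Sum>s\<in>F. cmod ((a n \<otimes>\<^bsub>A\<^esub> b n) s)) \<le> vnorm A (a n) * vnorm A (b n)" .
    qed (use sm D(3) in \<open>auto intro: summable_sum\<close>)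
    finally show ?thesis .
  qed
  have s: "(\<lambda>s. cmod (tensor_product_map u s)) summable_on S"
    by (rule nonneg_bdd_above_summable_on) (use fin in \<open>auto intro!: bdd_aboveI2\<close>)
  show "tensor_product_map u \<in> carrier A"
    using s uP by (auto simp: ell1_simps(1) tensor_product_map_def)
  show "vnorm A (tensor_product_map u) \<le> (\<Sum>n. vnorm A (a n) * vnorm A (b n))"
    unfolding ell1_simps(5) [of "tensor_product_map u"] by (rule infsum_le_finite_sums [OF s fin])
qed

lemma tensor_product_map_closed: "u \<in> carrier P \<Longrightarrow> tensor_product_map u \<in> carrier A"
  using tensor_product_map_bound(1) unfolding proj_simps(1) by blast

lemma tensor_product_map_blm: "bounded_linear_map P A tensor_product_map"
  unfolding bounded_linear_map_def
proof (intro conjI ballI allI exI funcsetI)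
  fix u assume u: "u \<in> carrier P"
  show "vnorm A (tensor_product_map u) \<le> 1 * vnorm P u"
    by (rule proj_vnorm_ge [OF u]) (simp_all add: tensor_product_map_bound(2))
  show "tensor_product_map u \<in> carrier A" by (rule tensor_product_map_closed [OF u])
qed (use pre_spaceD [OF proj_pre_space] in \<open>auto simp: tensor_product_map_def
    ell1_simps(2,3) proj_simps(3,4) mult_at_BF fun_eq_iff\<close>)

lemma tensor_product_map_tens:
  assumes "a \<in> carrier A" "b \<in> carrier A"
  shows "tensor_product_map (tens a b) = a \<otimes>\<^bsub>A\<^esub> b"
proof (rule ell1_eqI)
  show "tensor_product_map (tens a b) s = (a \<otimes>\<^bsub>A\<^esub> b) s" if "s \<in> S" for s
    using assms that
    by (simp add: tensor_product_map_def tens_closed tens_simp [OF mult_at_BF] mult_coord)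
      (simp add: kernel_form_def)
qed (use assms in \<open>auto intro: tensor_product_map_closed tens_closed ell1_mult_closed\<close>)

text \<open>The definite description is resolved by density: another candidate, composed with a
  coordinate functional, agrees with \<open>tensor_product_map\<close> on elementary tensors and
  hence everywhere.\<close>

lemma product_map_eq: "product_map A = tensor_product_map"
  unfolding product_map_def
proof (rule the_equality)
  fix T assume T: "T \<in> extensional (carrier P) \<and> bounded_linear_map P A T \<and>
    (\<forall>a\<in>carrier A. \<forall>b\<in>carrier A. T (tens a b) = a \<otimes>\<^bsub>A\<^esub> b)"
  show "T = tensor_product_map"
  proof (rule extensionalityI [of _ "carrier P"])
    fix u assume u: "u \<in> carrier P"
    show "T u = tensor_product_map u"
    proof (rule ell1_eqI)
      show Tu: "T u \<in> carrier A" using T u blmD(1) by metis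
      fix s assume s: "s \<in> S"
      let ?c = "\<lambda>t. if t = s then 1 else (0 :: complex)"
      have c: "bounded_linear_map A complex_space (pairing ?c)" by (rule pairing_blm [where C = 1]) auto
      have "pairing ?c (T u) = pairing ?c (tensor_product_map u)"
        by (rule tensor_functional_eqI [where T = "\<lambda>u. pairing ?c (T u)" and U = "\<lambda>u. pairing ?c (tensor_product_map u)"])
          (use T u in \<open>auto intro: blm_compose [OF _ c] tensor_product_map_blm ell1_vnorm_nonneg
            simp: tensor_product_map_tens\<close>)
      then show "T u s = tensor_product_map u s"
        using Tu s tensor_product_map_closed [OF u] by (simp add: pairing_indicator)
    qed (rule tensor_product_map_closed [OF u])
  qed (use T in \<open>auto simp: tensor_product_map_def\<close>)
next
  have "tensor_product_map \<in> extensional (carrier P)" by (simp add: tensor_product_map_def)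
  then show "tensor_product_map \<in> extensional (carrier P) \<and> bounded_linear_map P A tensor_product_map \<and>
    (\<forall>a\<in>carrier A. \<forall>b\<in>carrier A. tensor_product_map (tens a b) = a \<otimes>\<^bsub>A\<^esub> b)"
    by (simp add: tensor_product_map_blm tensor_product_map_tens)
qed

lemma tens_blm:
  assumes "a \<in> carrier A"
  shows "bounded_linear_map A P (\<lambda>x. tens a x)" and "bounded_linear_map A P (\<lambda>x. tens x a)"
  unfolding bounded_linear_map_def
proof (safe intro!: exI [of _ "vnorm A a"])
  note l = BF_blm [of _ a, OF _ assms]
  show "tens a (x \<oplus>\<^bsub>A\<^esub> y) = tens a x \<oplus>\<^bsub>P\<^esub> tens a y" "tens (x \<oplus>\<^bsub>A\<^esub> y) a = tens x a \<oplus>\<^bsub>P\<^esub> tens y a"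
    if "x \<in> carrier A" "y \<in> carrier A" for x y
    using blmD(2) [OF l(1) that] blmD(2) [OF l(2) that]
    by (auto simp: elementary_tensor_def proj_simps(3) restrict_def fun_eq_iff)
  show "tens a (c \<odot>\<^bsub>A\<^esub> x) = c \<odot>\<^bsub>P\<^esub> tens a x" "tens (c \<odot>\<^bsub>A\<^esub> x) a = c \<odot>\<^bsub>P\<^esub> tens x a"
    if "x \<in> carrier A" for c x
    using blmD(3) [OF l(1) that] blmD(3) [OF l(2) that]
    by (auto simp: elementary_tensor_def proj_simps(4) restrict_def fun_eq_iff)
  show "vnorm P (tens a x) \<le> vnorm A a * vnorm A x" "vnorm P (tens x a) \<le> vnorm A a * vnorm A x"
    if "x \<in> carrier A" for x
    using tens_norm [OF assms that] tens_norm [OF that assms] by (simp_all add: mult.commute)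
qed (use assms in \<open>auto intro: tens_closed\<close>)

lemma proj_act_blm:
  assumes "a \<in> carrier A"
  shows "bounded_linear_map P P (lact P a)" and "bounded_linear_map P P (\<lambda>u. ract P u a)"
proof -
  \<comment> \<open>The summand 1 keeps the factor positive for \<open>a = 0\<close>, as
    \<open>proj_vnorm_ge\<close> requires.\<close>
  let ?K = "vnorm A a + 1"
  have K: "?K > 0" using ell1_vnorm_nonneg [of a] by simp
  have cl: "lact P a u \<in> carrier P" "ract P u a \<in> carrier P" if "u \<in> carrier P" for u
    using that tensor_lact [OF _ assms] tensor_ract [OF _ assms] unfolding proj_simps(1) by blast+
  have n: "vnorm P (lact P a u) \<le> ?K * vnorm P u" "vnorm P (ract P u a) \<le> ?K * vnorm P u"
    if u: "u \<in> carrier P" for u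
  proof -
    have le: "(\<Sum>n. vnorm A (a \<otimes>\<^bsub>A\<^esub> c n) * vnorm A (d n)) \<le> ?K * (\<Sum>n. vnorm A (c n) * vnorm A (d n))"
      "(\<Sum>n. vnorm A (c n) * vnorm A (d n \<otimes>\<^bsub>A\<^esub> a)) \<le> ?K * (\<Sum>n. vnorm A (c n) * vnorm A (d n))"
      if "tensor_series A c d u" for c d
    proof -
      note D = tensor_seriesD [OF that]
      have 1: "vnorm A (a \<otimes>\<^bsub>A\<^esub> c n) * vnorm A (d n) \<le> ?K * (vnorm A (c n) * vnorm A (d n))" for n
      proof -
        have "vnorm A (a \<otimes>\<^bsub>A\<^esub> c n) * vnorm A (d n) \<le> (vnorm A a * vnorm A (c n)) * vnorm A (d n)"
          by (intro mult_right_mono ell1_mult_norm assms D ell1_vnorm_nonneg)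
        also have "\<dots> \<le> ?K * (vnorm A (c n) * vnorm A (d n))"
          by (simp add: mult.assoc mult_right_mono ell1_vnorm_nonneg)
        finally show ?thesis .
      qed
      have 2: "vnorm A (c n) * vnorm A (d n \<otimes>\<^bsub>A\<^esub> a) \<le> ?K * (vnorm A (c n) * vnorm A (d n))" for n
      proof -
        have "vnorm A (c n) * vnorm A (d n \<otimes>\<^bsub>A\<^esub> a) \<le> vnorm A (c n) * (vnorm A (d n) * vnorm A a)"
          by (intro mult_left_mono ell1_mult_norm assms D ell1_vnorm_nonneg)
        also have "\<dots> = vnorm A a * (vnorm A (c n) * vnorm A (d n))" by simp
        also have "\<dots> \<le> ?K * (vnorm A (c n) * vnorm A (d n))"
          by (intro mult_right_mono mult_nonneg_nonneg ell1_vnorm_nonneg) simp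
        finally show ?thesis .
      qed
      have s: "summable (\<lambda>n. ?K * (vnorm A (c n) * vnorm A (d n)))" by (rule summable_mult [OF D(3)])
      show "(\<Sum>n. vnorm A (a \<otimes>\<^bsub>A\<^esub> c n) * vnorm A (d n)) \<le> ?K * (\<Sum>n. vnorm A (c n) * vnorm A (d n))"
        unfolding suminf_mult [OF D(3), symmetric]
        by (rule suminf_le [OF 1 tensor_seriesD(3) [OF tensor_lact [OF that assms]] s])
      show "(\<Sum>n. vnorm A (c n) * vnorm A (d n \<otimes>\<^bsub>A\<^esub> a)) \<le> ?K * (\<Sum>n. vnorm A (c n) * vnorm A (d n))"
        unfolding suminf_mult [OF D(3), symmetric]
        by (rule suminf_le [OF 2 tensor_seriesD(3) [OF tensor_ract [OF that assms]] s])
    qed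
    show "vnorm P (lact P a u) \<le> ?K * vnorm P u"
      by (rule proj_vnorm_ge [OF u K]) (rule order_trans [OF proj_vnorm_le [OF tensor_lact [OF _ assms]] le(1)])
    show "vnorm P (ract P u a) \<le> ?K * vnorm P u"
      by (rule proj_vnorm_ge [OF u K]) (rule order_trans [OF proj_vnorm_le [OF tensor_ract [OF _ assms]] le(2)])
  qed
  show "bounded_linear_map P P (lact P a)" "bounded_linear_map P P (\<lambda>u. ract P u a)"
    unfolding bounded_linear_map_def
    using cl n BF_left [OF _ assms] BF_right [OF _ assms]
    by (auto simp: proj_simps(3,4,6,7) fun_eq_iff restrict_def [of _ BF] intro!: exI [of _ ?K])
qed

text \<open>The projective tensor square of the algebra is the algebra of summable functions on
  \<open>S \<times> S\<close>; this is the functional belonging to the bounded function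
  \<open>K\<close>. Elements of the bidual are tested on such functionals.\<close>

definition evaluation :: "('s \<times> 's \<Rightarrow> complex) \<Rightarrow> ('s \<Rightarrow> complex) tensor \<Rightarrow> complex" where
  "evaluation K = (\<lambda>u\<in>carrier P. u (kernel_form K))"

lemma evaluation_bound:
  assumes K: "\<And>p. p \<in> S \<times> S \<Longrightarrow> cmod (K p) \<le> C" and "C > 0"
  shows evaluation_closed: "evaluation K \<in> carrier (dual_bimodule P)"
    and evaluation_norm: "vnorm (dual_bimodule P) (evaluation K) \<le> C"
proof -
  have BF: "kernel_form K \<in> BF" by (rule kernel_form_BF [OF K])
  have bd: "cmod (u (kernel_form K)) \<le> C * vnorm P u" if u: "u \<in> carrier P" for u
  proof (rule proj_vnorm_ge [OF u \<open>C > 0\<close>])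
    fix a b assume ab: "tensor_series A a b u"
    note D = tensor_seriesD [OF ab]
    have "cmod (u (kernel_form K)) \<le> (\<Sum>n. cmod (kernel_form K (a n, b n)))"
      using summable_norm [OF tensor_summable [OF ab BF]] sums_unique [OF tensor_sums [OF ab BF]] by simp
    also have "\<dots> \<le> (\<Sum>n. C * (vnorm A (a n) * vnorm A (b n)))"
    proof (rule suminf_le [OF _ tensor_summable [OF ab BF] summable_mult [OF D(3)]])
      show "cmod (kernel_form K (a n, b n)) \<le> C * (vnorm A (a n) * vnorm A (b n))" for n
        using cmod_kform_le [OF D(1) [of n] D(2) [of n] K] D(1,2) by (simp add: kernel_form_def mult.assoc)
    qed
    also have "\<dots> = C * (\<Sum>n. vnorm A (a n) * vnorm A (b n))" by (rule suminf_mult [OF D(3)])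
    finally show "cmod (u (kernel_form K)) \<le> C * (\<Sum>n. vnorm A (a n) * vnorm A (b n))" .
  qed
  show "evaluation K \<in> carrier (dual_bimodule P)"
    unfolding evaluation_def
    by (rule dual_carrierI [OF _ _ bd])
      (use BF pre_spaceD [OF proj_pre_space] in \<open>auto simp: proj_simps(3,4)\<close>)
  show "vnorm (dual_bimodule P) (evaluation K) \<le> C"
  proof (rule dual_vnorm_le [OF proj_pre_space])
    fix u assume u: "u \<in> carrier P" "vnorm P u \<le> 1"
    then show "cmod (evaluation K u) \<le> C"
      using order_trans [OF bd [OF u(1)] mult_left_mono [OF u(2)]] \<open>C > 0\<close> by (simp add: evaluation_def)
  qed
qed

lemma evaluation_cong:
  assumes "\<And>p. p \<in> S \<times> S \<Longrightarrow> K p = L p" shows "evaluation K = evaluation L"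
proof -
  have "kform K = kform L"
    unfolding kform_def using assms by (auto simp: fun_eq_iff intro!: infsum_cong)
  then show ?thesis by (simp add: evaluation_def kernel_form_def)
qed

lemma kernel_form_point_mass:
  "(\<And>p. p \<in> S \<times> S \<Longrightarrow> cmod (K p) \<le> C) \<Longrightarrow> s \<in> S \<Longrightarrow> t \<in> S \<Longrightarrow>
    kernel_form K (point_mass s, point_mass t) = K (s, t)"
  using kform_point_mass [of K C s t] by (simp add: kernel_form_def point_mass_closed)

text \<open>Forms are determined by their kernels, and on point masses the product is
  \<open>op\<close>. The dual actions of a point mass hence multiply one argument of the kernel:
  \<open>ract\<close> the first argument from the left, \<open>lact\<close> the second from the
  right.\<close>

lemma evaluation_ract:
  assumes K: "\<And>p. p \<in> S \<times> S \<Longrightarrow> cmod (K p) \<le> C" and r: "r \<in> S"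
  shows "ract (dual_bimodule P) (evaluation K) (point_mass r) = evaluation (\<lambda>p. K (op r (fst p), snd p))"
    and "lact (dual_bimodule P) (point_mass r) (evaluation K) = evaluation (\<lambda>p. K (fst p, op (snd p) r))"
proof -
  have 1: "(\<lambda>(x, y)\<in>carrier A \<times> carrier A. kernel_form K (point_mass r \<otimes>\<^bsub>A\<^esub> x, y))
      = kernel_form (\<lambda>p. K (op r (fst p), snd p))"
    by (rule kernel_form_eqI [where C = C])
      (use r op_closed in \<open>auto simp: K point_mass_closed point_mass_mult kernel_form_point_mass [OF K]
        intro!: BF_left kernel_form_BF [OF K]\<close>)
  have 2: "(\<lambda>(x, y)\<in>carrier A \<times> carrier A. kernel_form K (x, y \<otimes>\<^bsub>A\<^esub> point_mass r))
      = kernel_form (\<lambda>p. K (fst p, op (snd p) r))"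
    by (rule kernel_form_eqI [where C = C])
      (use r op_closed in \<open>auto simp: K point_mass_closed point_mass_mult kernel_form_point_mass [OF K]
        intro!: BF_right kernel_form_BF [OF K]\<close>)
  show "ract (dual_bimodule P) (evaluation K) (point_mass r) = evaluation (\<lambda>p. K (op r (fst p), snd p))"
    "lact (dual_bimodule P) (point_mass r) (evaluation K) = evaluation (\<lambda>p. K (fst p, op (snd p) r))"
    using 1 2 blmD(1) [OF proj_act_blm(1) [OF point_mass_closed [OF r]]]
      blmD(1) [OF proj_act_blm(2) [OF point_mass_closed [OF r]]] kernel_form_BF [of K, OF K]
    unfolding dual_simps(6,7) evaluation_def
    by (auto intro!: restrict_ext simp: proj_simps(6,7))
qed

end

section \<open>Biduals and the reduction of strong pseudo-amenability to kernels\<close>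

context ell1_algebra
begin

abbreviation "DP \<equiv> dual_bimodule P"
abbreviation "DA \<equiv> dual_bimodule (self_bimodule A)"

lemmas DP_pre_space = dual_pre_space [OF proj_pre_space]

lemma self_A_pre_space: "pre_space (self_bimodule A)"
  by (rule iffD2 [OF self_pre_space ell1_pre_space])

lemmas DA_pre_space = dual_pre_space [OF self_A_pre_space]

lemma product_map_adjoint_blm:
  "bounded_linear_map DA DP (\<lambda>\<psi>. \<lambda>u\<in>carrier P. \<psi> (tensor_product_map u))"
  by (rule dual_adjoint_blm [OF proj_pre_space self_A_pre_space iffD2 [OF self_blm(2) tensor_product_map_blm]])

lemma product_map_bidual_eq:
  assumes "m \<in> carrier (dual_bimodule DP)"
  shows "product_map_bidual A m = (\<lambda>\<psi>\<in>carrier DA. m (\<lambda>u\<in>carrier P. \<psi> (tensor_product_map u)))"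
proof -
  have "product_map_bidual A m = (\<lambda>\<psi>\<in>carrier DA. m (adjoint_map P (self_bimodule A) tensor_product_map \<psi>))"
    unfolding product_map_bidual_def adjoint_map_def [of DA] product_map_eq
    by (rule restrict_apply') (rule assms)
  also have "\<dots> = (\<lambda>\<psi>\<in>carrier DA. m (\<lambda>u\<in>carrier P. \<psi> (tensor_product_map u)))"
    by (rule restrict_ext) (simp only: adjoint_map_def restrict_apply')
  finally show ?thesis .
qed

lemma product_map_bidual_closed:
  assumes "m \<in> carrier (dual_bimodule DP)"
  shows "product_map_bidual A m \<in> carrier (dual_bimodule DA)"
  unfolding product_map_bidual_eq [OF assms]
  by (rule blmD(1) [OF dual_adjoint_blm [OF DA_pre_space DP_pre_space product_map_adjoint_blm] assms])

lemma dual_act_eq: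
  "lact (dual_bimodule X) a = (\<lambda>f. \<lambda>x\<in>carrier X. f (ract X x a))"
  "(\<lambda>f. ract (dual_bimodule X) f a) = (\<lambda>f. \<lambda>x\<in>carrier X. f (lact X a x))"
  by (rule ext, rule dual_simps)+

lemma DP_act_blm:
  assumes "a \<in> carrier A"
  shows "bounded_linear_map DP DP (lact DP a)" and "bounded_linear_map DP DP (\<lambda>\<phi>. ract DP \<phi> a)"
  unfolding dual_act_eq by (intro dual_adjoint_blm proj_pre_space proj_act_blm assms)+

lemma DA_act_blm:
  assumes "a \<in> carrier A"
  shows "bounded_linear_map DA DA (lact DA a)" and "bounded_linear_map DA DA (\<lambda>\<phi>. ract DA \<phi> a)"
  unfolding dual_act_eq self_simps
  by (rule dual_adjoint_blm [OF self_A_pre_space self_A_pre_space, unfolded self_simps self_blm],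
      intro mult_blm assms)+

lemma DDP_act_closed:
  assumes "a \<in> carrier A" "m \<in> carrier (dual_bimodule DP)"
  shows "lact (dual_bimodule DP) a m \<in> carrier (dual_bimodule DP)"
    and "ract (dual_bimodule DP) m a \<in> carrier (dual_bimodule DP)"
  unfolding dual_simps(6,7) [of DP]
  by (rule blmD(1) [OF dual_adjoint_blm [OF DP_pre_space DP_pre_space] assms(2)], rule DP_act_blm [OF assms(1)])+

lemma DDA_act_closed:
  assumes "a \<in> carrier A" "m \<in> carrier (dual_bimodule DA)"
  shows "lact (dual_bimodule DA) a m \<in> carrier (dual_bimodule DA)"
    and "ract (dual_bimodule DA) m a \<in> carrier (dual_bimodule DA)"
  unfolding dual_simps(6,7) [of DA]
  by (rule blmD(1) [OF dual_adjoint_blm [OF DA_pre_space DA_pre_space] assms(2)], rule DA_act_blm [OF assms(1)])+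

definition pairing_functional :: "('s \<Rightarrow> complex) \<Rightarrow> ('s \<Rightarrow> complex) \<Rightarrow> complex" where
  "pairing_functional c = (\<lambda>x\<in>carrier A. pairing c x)"

lemma pairing_functional_bound:
  assumes "\<And>s. s \<in> S \<Longrightarrow> cmod (c s) \<le> C"
  shows pairing_functional_closed: "pairing_functional c \<in> carrier DA"
    and pairing_functional_norm: "vnorm DA (pairing_functional c) \<le> \<bar>C\<bar>"
proof -
  have bd: "cmod (pairing c x) \<le> C * vnorm A x" if "x \<in> carrier A" for x
    by (rule cmod_pairing_le [OF that assms])
  show "pairing_functional c \<in> carrier DA"
    unfolding pairing_functional_def
  proof (rule dual_carrierI [of "self_bimodule A" "pairing c" C, unfolded self_simps])
    show "x \<oplus>\<^bsub>A\<^esub> y \<in> carrier A \<and> pairing c (x \<oplus>\<^bsub>A\<^esub> y) = pairing c x + pairing c y"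
      if "x \<in> carrier A" "y \<in> carrier A" for x y
      using pairing_add [OF that assms] ell1_add_closed [OF that] by (simp add: ell1_simps(2))
    show "k \<odot>\<^bsub>A\<^esub> x \<in> carrier A \<and> pairing c (k \<odot>\<^bsub>A\<^esub> x) = k * pairing c x"
      if "x \<in> carrier A" for k x
      using ell1_smult_closed [OF that] by (simp add: ell1_simps(3) pairing_smult)
  qed (rule bd)
  show "vnorm DA (pairing_functional c) \<le> \<bar>C\<bar>"
  proof (rule dual_vnorm_le [OF self_A_pre_space], unfold self_simps)
    fix x assume x: "x \<in> carrier A" "vnorm A x \<le> 1"
    have "cmod (pairing c x) \<le> \<bar>C\<bar> * vnorm A x"
      using bd [OF x(1)] mult_right_mono [OF abs_ge_self ell1_vnorm_nonneg] by (rule order_trans)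
    also have "\<dots> \<le> \<bar>C\<bar> * 1" using x(2) by (intro mult_left_mono) auto
    finally show "cmod (pairing_functional c x) \<le> \<bar>C\<bar>" using x(1) by (simp add: pairing_functional_def)
  qed
qed

lemma evaluation_tens:
  assumes "\<And>p. p \<in> S \<times> S \<Longrightarrow> cmod (K p) \<le> C" "a \<in> carrier A" "b \<in> carrier A"
  shows "evaluation K (tens a b) = kform K a b"
proof -
  have "kernel_form K \<in> BF" by (rule kernel_form_BF [OF assms(1)])
  then show ?thesis using assms(2,3)
    by (simp add: evaluation_def tens_closed tens_simp) (simp add: kernel_form_def)
qed

text \<open>Under the adjoint of the product map a function on \<open>S\<close> becomes a kernel
  that depends only on the product of its arguments. The conditions on the image of an approximate
  diagonal thereby become conditions on such kernels.\<close>

lemma product_map_adjoint_pairing: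
  assumes c: "\<And>s. s \<in> S \<Longrightarrow> cmod (c s) \<le> C"
  shows "(\<lambda>u\<in>carrier P. pairing_functional c (tensor_product_map u))
    = evaluation (\<lambda>p. c (op (fst p) (snd p)))"
proof (rule extensionalityI [of _ "carrier P"])
  have K: "cmod (c (op (fst p) (snd p))) \<le> \<bar>C\<bar> + 1" if "p \<in> S \<times> S" for p
    using c [of "op (fst p) (snd p)"] that op_closed by fastforce
  have e: "evaluation (\<lambda>p. c (op (fst p) (snd p))) \<in> carrier DP"
    by (rule evaluation_closed [OF K]) auto
  then show "evaluation (\<lambda>p. c (op (fst p) (snd p))) \<in> extensional (carrier P)" by (rule dualD(1))
  fix u assume u: "u \<in> carrier P"
  have "pairing c (tensor_product_map u) = evaluation (\<lambda>p. c (op (fst p) (snd p))) u"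
  proof (rule tensor_functional_eqI [where T = "\<lambda>u. pairing c (tensor_product_map u)"])
    show "pairing c (tensor_product_map (tens a b)) = evaluation (\<lambda>p. c (op (fst p) (snd p))) (tens a b)"
      if "a \<in> carrier A" "b \<in> carrier A" for a b
      using that evaluation_tens [OF K that] pairing_mult [OF that c] by (simp add: tensor_product_map_tens)
    show "bounded_linear_map P complex_space (\<lambda>u. pairing c (tensor_product_map u))"
      by (rule blm_compose [OF tensor_product_map_blm pairing_blm [OF c] ell1_vnorm_nonneg], assumption)
  qed (rule dualD(2) [OF e], rule u)
  then show "(\<lambda>u\<in>carrier P. pairing_functional c (tensor_product_map u)) u
      = evaluation (\<lambda>p. c (op (fst p) (snd p))) u"
    using u by (simp add: pairing_functional_def tensor_product_map_closed)
qed auto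

lemma pairing_functional_act:
  assumes c: "\<And>s. s \<in> S \<Longrightarrow> cmod (c s) \<le> C" and r: "r \<in> S"
  shows "ract DA (pairing_functional c) (point_mass r) = pairing_functional (\<lambda>s. c (op r s))"
    and "lact DA (point_mass r) (pairing_functional c) = pairing_functional (\<lambda>s. c (op s r))"
proof -
  have "pairing c (point_mass r \<otimes>\<^bsub>A\<^esub> x) = pairing (\<lambda>s. c (op r s)) x"
    and "pairing c (x \<otimes>\<^bsub>A\<^esub> point_mass r) = pairing (\<lambda>s. c (op s r)) x" if "x \<in> carrier A" for x
  proof -
    have 1: "bounded_linear_map A complex_space (\<lambda>x. pairing c (point_mass r \<otimes>\<^bsub>A\<^esub> x))"
      "bounded_linear_map A complex_space (\<lambda>x. pairing c (x \<otimes>\<^bsub>A\<^esub> point_mass r))"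
      by (rule blm_compose [OF mult_blm_right [OF point_mass_closed [OF r]] pairing_blm [OF c] ell1_vnorm_nonneg],
          assumption)
        (rule blm_compose [OF mult_blm_left [OF point_mass_closed [OF r]] pairing_blm [OF c] ell1_vnorm_nonneg],
          assumption)
    have 2: "bounded_linear_map A complex_space (pairing (\<lambda>s. c (op r s)))"
      "bounded_linear_map A complex_space (pairing (\<lambda>s. c (op s r)))"
      by (rule pairing_blm [where C = C], rule c, intro op_closed r, assumption)+
    show "pairing c (point_mass r \<otimes>\<^bsub>A\<^esub> x) = pairing (\<lambda>s. c (op r s)) x"
      "pairing c (x \<otimes>\<^bsub>A\<^esub> point_mass r) = pairing (\<lambda>s. c (op s r)) x"
      by (rule functional_eqI [OF 1(1) 2(1) _ that], simp add: r op_closed pairing_point_mass point_mass_mult)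
        (rule functional_eqI [OF 1(2) 2(2) _ that], simp add: r op_closed pairing_point_mass point_mass_mult)
  qed
  then show "ract DA (pairing_functional c) (point_mass r) = pairing_functional (\<lambda>s. c (op r s))"
    "lact DA (point_mass r) (pairing_functional c) = pairing_functional (\<lambda>s. c (op s r))"
    unfolding dual_simps(6,7) self_simps pairing_functional_def
    by - (rule restrict_ext, simp add: ell1_mult_closed point_mass_closed r)+
qed

lemma kform_add_left:
  assumes "x \<in> carrier A" "y \<in> carrier A" "\<And>p. p \<in> S \<times> S \<Longrightarrow> cmod (K p) \<le> C" "\<And>p. p \<in> S \<times> S \<Longrightarrow> cmod (L p) \<le> D"
  shows "kform (\<lambda>p. K p + L p) x y = kform K x y + kform L x y"
  unfolding kform_def ring_distribs
  by (rule infsum_add [OF abs_summable_summable [OF kform_summable [OF assms(1-3)]]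
      abs_summable_summable [OF kform_summable [OF assms(1,2,4)]]])

lemma kform_smult_left: "kform (\<lambda>p. c * K p) x y = c * kform K x y"
  unfolding kform_def by (simp add: mult.left_commute infsum_cmult_right')

lemma evaluation_add:
  assumes "\<And>p. p \<in> S \<times> S \<Longrightarrow> cmod (K p) \<le> C" "\<And>p. p \<in> S \<times> S \<Longrightarrow> cmod (L p) \<le> D"
  shows "evaluation (\<lambda>p. K p + L p) = evaluation K \<oplus>\<^bsub>DP\<^esub> evaluation L"
  unfolding dual_simps evaluation_def
proof (rule restrict_ext)
  fix u assume u: "u \<in> carrier P"
  then obtain a b where ab: "tensor_series A a b u" by (auto simp: proj_simps(1))
  note D = tensor_seriesD [OF ab]
  have K: "kernel_form K \<in> BF" and L: "kernel_form L \<in> BF"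
    by (rule kernel_form_BF, rule assms, assumption)+
  have "cmod (K p + L p) \<le> C + D" if "p \<in> S \<times> S" for p
    using assms that norm_triangle_mono by blast
  then have KL: "kernel_form (\<lambda>p. K p + L p) \<in> BF" by (rule kernel_form_BF)
  have "kernel_form (\<lambda>p. K p + L p) (a n, b n) = kernel_form K (a n, b n) + kernel_form L (a n, b n)" for n
    using kform_add_left [OF D(1) [of n] D(2) [of n] assms] D(1,2) by (simp add: kernel_form_def)
  then show "u (kernel_form (\<lambda>p. K p + L p))
      = (\<lambda>u\<in>carrier P. u (kernel_form K)) u + (\<lambda>u\<in>carrier P. u (kernel_form L)) u"
    using sums_unique2 [OF tensor_sums [OF ab KL]] sums_add [OF tensor_sums [OF ab K] tensor_sums [OF ab L]] u
    by simp
qed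

lemma evaluation_smult:
  assumes "\<And>p. p \<in> S \<times> S \<Longrightarrow> cmod (K p) \<le> C"
  shows "evaluation (\<lambda>p. c * K p) = c \<odot>\<^bsub>DP\<^esub> evaluation K"
  unfolding dual_simps evaluation_def
proof (rule restrict_ext)
  fix u assume u: "u \<in> carrier P"
  then obtain a b where ab: "tensor_series A a b u" by (auto simp: proj_simps(1))
  have K: "kernel_form K \<in> BF" by (rule kernel_form_BF, rule assms)
  have "cmod (c * K p) \<le> cmod c * C" if "p \<in> S \<times> S" for p
    using assms [OF that] by (simp add: norm_mult mult_left_mono)
  then have cK: "kernel_form (\<lambda>p. c * K p) \<in> BF" by (rule kernel_form_BF)
  have "kernel_form (\<lambda>p. c * K p) (a n, b n) = c * kernel_form K (a n, b n)" for n
    using tensor_seriesD(1,2) [OF ab] by (simp add: kernel_form_def kform_smult_left)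
  then show "u (kernel_form (\<lambda>p. c * K p)) = c * (\<lambda>u\<in>carrier P. u (kernel_form K)) u"
    using sums_unique2 [OF tensor_sums [OF ab cK]] sums_mult [OF tensor_sums [OF ab K]] u
    by simp
qed

text \<open>The trace that an element of the bidual leaves on bounded functions on
  \<open>S \<times> S\<close>. Kernels are total functions on a type, so the first clause makes the
  values outside \<open>S \<times> S\<close> irrelevant.\<close>

definition kernel_functional :: "((('s \<times> 's) \<Rightarrow> complex) \<Rightarrow> complex) \<Rightarrow> bool" where
  "kernel_functional N \<longleftrightarrow>
     (\<forall>K L. (\<forall>p\<in>S \<times> S. K p = L p) \<longrightarrow> N K = N L) \<and>
     (\<forall>K L. bounded (K ` (S \<times> S)) \<longrightarrow> bounded (L ` (S \<times> S)) \<longrightarrow> N (\<lambda>p. K p + L p) = N K + N L) \<and>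
     (\<forall>c K. bounded (K ` (S \<times> S)) \<longrightarrow> N (\<lambda>p. c * K p) = c * N K) \<and>
     (\<exists>M. \<forall>K C. C > 0 \<longrightarrow> (\<forall>p\<in>S \<times> S. cmod (K p) \<le> C) \<longrightarrow> cmod (N K) \<le> M * C)"

lemma bounded_imageE:
  assumes "bounded (f ` X)" obtains C where "C > 0" "\<And>x. x \<in> X \<Longrightarrow> cmod (f x) \<le> C"
  using assms unfolding bounded_pos by (elim exE conjE) (rule that, auto)

lemma kernel_functional_bidual:
  assumes m: "m \<in> carrier (dual_bimodule DP)"
  shows "kernel_functional (\<lambda>K. m (evaluation K))"
  unfolding kernel_functional_def
proof (intro conjI allI impI)
  fix K L :: "'s \<times> 's \<Rightarrow> complex" and c
  show "m (evaluation K) = m (evaluation L)" if "\<forall>p\<in>S \<times> S. K p = L p"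
    using evaluation_cong [of K L] that by simp
  assume K: "bounded (K ` (S \<times> S))"
  obtain C where C: "C > 0" "\<And>p. p \<in> S \<times> S \<Longrightarrow> cmod (K p) \<le> C" using bounded_imageE [OF K] by metis
  note eK = evaluation_closed [OF C(2,1)]
  show "m (evaluation (\<lambda>p. c * K p)) = c * m (evaluation K)"
    using dualD(4) [OF m eK] evaluation_smult [OF C(2)] by simp
  assume L: "bounded (L ` (S \<times> S))"
  obtain D where D: "D > 0" "\<And>p. p \<in> S \<times> S \<Longrightarrow> cmod (L p) \<le> D" using bounded_imageE [OF L] by metis
  show "m (evaluation (\<lambda>p. K p + L p)) = m (evaluation K) + m (evaluation L)"
    using dualD(3) [OF m eK evaluation_closed [OF D(2,1)]] evaluation_add [OF C(2) D(2)] by simp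
next
  show "\<exists>M. \<forall>K C. C > 0 \<longrightarrow> (\<forall>p\<in>S \<times> S. cmod (K p) \<le> C) \<longrightarrow> cmod (m (evaluation K)) \<le> M * C"
  proof (intro exI allI impI)
    fix K :: "'s \<times> 's \<Rightarrow> complex" and C :: real
    assume C: "C > 0" and "\<forall>p\<in>S \<times> S. cmod (K p) \<le> C"
    then have K: "\<And>p. p \<in> S \<times> S \<Longrightarrow> cmod (K p) \<le> C" by blast
    show "cmod (m (evaluation K)) \<le> vnorm (dual_bimodule DP) m * C"
      by (rule order_trans [OF dual_bound [OF DP_pre_space m evaluation_closed [OF K C]]
          mult_left_mono [OF evaluation_norm [OF K C] dual_vnorm_nonneg [OF DP_pre_space m]]])
  qed
qed

end

context ell1_algebra
begin

text \<open>Convergence in the bidual norm turns into an estimate with one \<epsilon> for all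
  kernels in the unit ball; that uniformity is used later for positive parts. Point masses suffice
  as test elements of the algebra.\<close>

theorem strong_pseudo_amenable_kernel_functionals:
  assumes "strong_pseudo_amenable A"
  shows "\<exists>F. F \<noteq> bot \<and>
    (\<forall>\<^sub>F N in F. kernel_functional N \<and> (\<forall>r\<in>S. \<forall>c. bounded (c ` S) \<longrightarrow>
          N (\<lambda>p. c (op r (op (fst p) (snd p)))) = N (\<lambda>p. c (op (op (fst p) (snd p)) r)))) \<and>
    (\<forall>r\<in>S. \<forall>\<epsilon>>0. \<forall>\<^sub>F N in F. \<forall>K. (\<forall>p\<in>S \<times> S. cmod (K p) \<le> 1) \<longrightarrow>
          cmod (N (\<lambda>p. K (op r (fst p), snd p)) - N (\<lambda>p. K (fst p, op (snd p) r))) \<le> \<epsilon>) \<and>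
    (\<forall>r\<in>S. \<forall>\<epsilon>>0. \<forall>\<^sub>F N in F. \<forall>c. (\<forall>s\<in>S. cmod (c s) \<le> 1) \<longrightarrow>
          cmod (N (\<lambda>p. c (op (op (fst p) (snd p)) r)) - c r) \<le> \<epsilon>)"
proof -
  let ?T = "dual_bimodule DP" and ?B = "dual_bimodule DA" and ?\<pi> = "product_map_bidual A"
  obtain F where F: "F \<noteq> bot"
    and ev: "\<forall>\<^sub>F m in F. m \<in> carrier ?T \<and> (\<forall>a\<in>carrier A. lact ?B a (?\<pi> m) = ract ?B (?\<pi> m) a)"
    and lim1: "\<And>a. a \<in> carrier A \<Longrightarrow> ((\<lambda>m. vnorm ?T (lact ?T a m \<ominus>\<^bsub>?T\<^esub> ract ?T m a)) \<longlongrightarrow> 0) F"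
    and lim2: "\<And>a. a \<in> carrier A \<Longrightarrow>
      ((\<lambda>m. vnorm ?B (ract ?B (?\<pi> m) a \<ominus>\<^bsub>?B\<^esub> canonical_embedding (self_bimodule A) a)) \<longlongrightarrow> 0) F"
    using assms unfolding strong_pseudo_amenable_def Let_def by blast
  have \<pi>: "?\<pi> m (pairing_functional c) = m (evaluation (\<lambda>p. c (op (fst p) (snd p))))"
    if "m \<in> carrier ?T" "\<And>s. s \<in> S \<Longrightarrow> cmod (c s) \<le> C" for m c C
    using product_map_adjoint_pairing [OF that(2)] pairing_functional_closed [OF that(2)]
    by (simp add: product_map_bidual_eq [OF that(1)])
  let ?F = "filtermap (\<lambda>m K. m (evaluation K)) F"
  show ?thesis
  proof (intro exI [of _ ?F] conjI ballI allI impI)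
    show "?F \<noteq> bot" using F by (simp add: filtermap_bot_iff)
    show "\<forall>\<^sub>F N in ?F. kernel_functional N \<and> (\<forall>r\<in>S. \<forall>c. bounded (c ` S) \<longrightarrow>
          N (\<lambda>p. c (op r (op (fst p) (snd p)))) = N (\<lambda>p. c (op (op (fst p) (snd p)) r)))"
      unfolding eventually_filtermap
    proof (rule eventually_mono [OF ev], intro conjI ballI allI impI)
      fix m assume m: "m \<in> carrier ?T \<and> (\<forall>a\<in>carrier A. lact ?B a (?\<pi> m) = ract ?B (?\<pi> m) a)"
      then show "kernel_functional (\<lambda>K. m (evaluation K))" by (intro kernel_functional_bidual) simp
      fix r and c :: "'s \<Rightarrow> complex" assume r: "r \<in> S" and "bounded (c ` S)"
      then obtain C where c: "\<And>s. s \<in> S \<Longrightarrow> cmod (c s) \<le> C" using bounded_imageE by metis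
      have "lact ?B (point_mass r) (?\<pi> m) (pairing_functional c) = ract ?B (?\<pi> m) (point_mass r) (pairing_functional c)"
        using m point_mass_closed [OF r] by simp
      then have "?\<pi> m (pairing_functional (\<lambda>s. c (op r s))) = ?\<pi> m (pairing_functional (\<lambda>s. c (op s r)))"
        using pairing_functional_closed [of c, OF c] pairing_functional_act [of c, OF c r]
        by (simp add: dual_simps(6,7) [of DA])
      moreover have "cmod (c (op r s)) \<le> C" "cmod (c (op s r)) \<le> C" if "s \<in> S" for s
        using c op_closed r that by auto
      ultimately show "m (evaluation (\<lambda>p. c (op r (op (fst p) (snd p)))))
          = m (evaluation (\<lambda>p. c (op (op (fst p) (snd p)) r)))"
        using \<pi> [of m "\<lambda>s. c (op r s)" C] \<pi> [of m "\<lambda>s. c (op s r)" C] m by simp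
    qed
  next
    fix r :: 's and \<epsilon> :: real assume r: "r \<in> S" and \<epsilon>: "\<epsilon> > 0"
    note pm = point_mass_closed [OF r]
    have "\<forall>\<^sub>F m in F. vnorm ?T (lact ?T (point_mass r) m \<ominus>\<^bsub>?T\<^esub> ract ?T m (point_mass r)) < \<epsilon>"
      by (rule order_tendstoD(2) [OF lim1 [OF pm] \<epsilon>])
    then show "\<forall>\<^sub>F N in ?F. \<forall>K. (\<forall>p\<in>S \<times> S. cmod (K p) \<le> 1) \<longrightarrow>
          cmod (N (\<lambda>p. K (op r (fst p), snd p)) - N (\<lambda>p. K (fst p, op (snd p) r))) \<le> \<epsilon>"
      unfolding eventually_filtermap using ev
    proof eventually_elim
      case (elim m)
      then have m: "m \<in> carrier ?T" by simp
      show ?case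
      proof (intro allI impI)
        fix K :: "'s \<times> 's \<Rightarrow> complex" assume "\<forall>p\<in>S \<times> S. cmod (K p) \<le> 1"
        then have K: "\<And>p. p \<in> S \<times> S \<Longrightarrow> cmod (K p) \<le> 1" by blast
        note e = evaluation_closed [of K, OF K zero_less_one] evaluation_norm [of K, OF K zero_less_one]
        have "cmod ((lact ?T (point_mass r) m \<ominus>\<^bsub>?T\<^esub> ract ?T m (point_mass r)) (evaluation K))
            \<le> vnorm ?T (lact ?T (point_mass r) m \<ominus>\<^bsub>?T\<^esub> ract ?T m (point_mass r))"
          by (intro dual_vnorm_ge DP_pre_space dual_minus_closed DDP_act_closed pm m e)
        then show "cmod (m (evaluation (\<lambda>p. K (op r (fst p), snd p))) - m (evaluation (\<lambda>p. K (fst p, op (snd p) r)))) \<le> \<epsilon>"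
          using elim(1) e evaluation_ract [of K, OF K r] m pm
          by (simp add: dual_minus DP_pre_space DDP_act_closed) (simp add: dual_simps(6,7) [of DP])
      qed
    qed
  next
    fix r :: 's and \<epsilon> :: real assume r: "r \<in> S" and \<epsilon>: "\<epsilon> > 0"
    note pm = point_mass_closed [OF r]
    have "\<forall>\<^sub>F m in F. vnorm ?B (ract ?B (?\<pi> m) (point_mass r)
        \<ominus>\<^bsub>?B\<^esub> canonical_embedding (self_bimodule A) (point_mass r)) < \<epsilon>"
      by (rule order_tendstoD(2) [OF lim2 [OF pm] \<epsilon>])
    then show "\<forall>\<^sub>F N in ?F. \<forall>c. (\<forall>s\<in>S. cmod (c s) \<le> 1) \<longrightarrow>
          cmod (N (\<lambda>p. c (op (op (fst p) (snd p)) r)) - c r) \<le> \<epsilon>"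
      unfolding eventually_filtermap using ev
    proof eventually_elim
      case (elim m)
      then have m: "m \<in> carrier ?T" by simp
      have can: "canonical_embedding (self_bimodule A) (point_mass r) \<in> carrier ?B"
        by (rule canonical_embedding_closed) (simp_all add: self_A_pre_space self_simps pm)
      show ?case
      proof (intro allI impI)
        fix c :: "'s \<Rightarrow> complex" assume "\<forall>s\<in>S. cmod (c s) \<le> 1"
        then have c: "\<And>s. s \<in> S \<Longrightarrow> cmod (c s) \<le> 1" by blast
        note e = pairing_functional_closed [of c, OF c] pairing_functional_norm [of c, OF c, unfolded abs_one]
        have cr: "\<And>s. s \<in> S \<Longrightarrow> cmod (c (op s r)) \<le> 1" using c op_closed r by blast
        have "cmod ((ract ?B (?\<pi> m) (point_mass r)
            \<ominus>\<^bsub>?B\<^esub> canonical_embedding (self_bimodule A) (point_mass r)) (pairing_functional c))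
            \<le> vnorm ?B (ract ?B (?\<pi> m) (point_mass r)
            \<ominus>\<^bsub>?B\<^esub> canonical_embedding (self_bimodule A) (point_mass r))"
          by (intro dual_vnorm_ge DA_pre_space dual_minus_closed DDA_act_closed pm
              product_map_bidual_closed m e can)
        then show "cmod (m (evaluation (\<lambda>p. c (op (op (fst p) (snd p)) r))) - c r) \<le> \<epsilon>"
          using elim(1) e pairing_functional_act(2) [of c, OF c r] pm r
            \<pi> [OF m cr] dual_minus [OF DA_pre_space DDA_act_closed(2) [OF pm product_map_bidual_closed [OF m]] can]
          by (simp add: dual_simps(6,7) [of DA] canonical_embedding_def)
            (simp add: pairing_functional_def pairing_point_mass)
      qed
    qed
  qed
qed

end

section \<open>Virtual diagonals\<close>

lemma normed_space_pre_space:
  assumes "normed_space X" shows "pre_space X"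
proof -
  interpret Module.module complex_space X using assms unfolding normed_space_def by blast
  show ?thesis
    unfolding pre_space_def
  proof (intro conjI ballI allI bexI [of _ "\<zero>\<^bsub>X\<^esub>"])
    show "vnorm X \<zero>\<^bsub>X\<^esub> \<le> 1" using assms unfolding normed_space_def by (metis M.zero_closed zero_le_one)
  qed (use assms in \<open>auto simp: normed_space_def\<close>)
qed

text \<open>Johnson's virtual diagonal, written as a functional on bounded bilinear forms instead of
  an element of the bidual. In this form it applies to functionals on the tensor product and equally
  to the forms that a derivation produces. \<open>\<mu>_mult\<close> says that multiplying the
  diagonal out gives the unit \<open>e\<close>.\<close>

locale virtual_diagonal = ell1_algebra S op
  for S :: "'s set" and op +
  fixes e :: "'s \<Rightarrow> complex" and \<mu> :: "(('s \<Rightarrow> complex) \<times> ('s \<Rightarrow> complex) \<Rightarrow> complex) \<Rightarrow> complex" and C :: real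
  assumes e_closed: "e \<in> carrier A"
    and e_left: "x \<in> carrier A \<Longrightarrow> e \<otimes>\<^bsub>A\<^esub> x = x" and e_right: "x \<in> carrier A \<Longrightarrow> x \<otimes>\<^bsub>A\<^esub> e = x"
    and \<mu>_add: "\<beta> \<in> BF \<Longrightarrow> \<gamma> \<in> BF \<Longrightarrow> \<mu> (\<lambda>p\<in>carrier A \<times> carrier A. \<beta> p + \<gamma> p) = \<mu> \<beta> + \<mu> \<gamma>"
    and \<mu>_smult: "\<beta> \<in> BF \<Longrightarrow> \<mu> (\<lambda>p\<in>carrier A \<times> carrier A. c * \<beta> p) = c * \<mu> \<beta>"
    and \<mu>_bound: "\<beta> \<in> BF \<Longrightarrow> 0 \<le> B \<Longrightarrow>
      (\<And>x y. x \<in> carrier A \<Longrightarrow> y \<in> carrier A \<Longrightarrow> vnorm A x \<le> 1 \<Longrightarrow> vnorm A y \<le> 1 \<Longrightarrow> cmod (\<beta> (x, y)) \<le> B) \<Longrightarrow>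
      cmod (\<mu> \<beta>) \<le> C * B"
    and \<mu>_act: "\<beta> \<in> BF \<Longrightarrow> a \<in> carrier A \<Longrightarrow>
      \<mu> (\<lambda>(x, y)\<in>carrier A \<times> carrier A. \<beta> (a \<otimes>\<^bsub>A\<^esub> x, y)) = \<mu> (\<lambda>(x, y)\<in>carrier A \<times> carrier A. \<beta> (x, y \<otimes>\<^bsub>A\<^esub> a))"
    and \<mu>_mult: "bounded_linear_map A complex_space \<phi> \<Longrightarrow>
      \<mu> (\<lambda>(x, y)\<in>carrier A \<times> carrier A. \<phi> (x \<otimes>\<^bsub>A\<^esub> y)) = \<phi> e"
begin

definition tensor_form where
  "tensor_form \<phi> = (\<lambda>(x, y)\<in>carrier A \<times> carrier A. \<phi> (tens x y))"

lemma tensor_form_ball: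
  assumes "\<phi> \<in> carrier DP" "x \<in> carrier A" "y \<in> carrier A" "vnorm A x \<le> 1" "vnorm A y \<le> 1"
  shows "cmod (\<phi> (tens x y)) \<le> vnorm DP \<phi>"
proof (rule dual_vnorm_ge [OF proj_pre_space assms(1) tens_closed [OF assms(2,3)]])
  have "vnorm P (tens x y) \<le> vnorm A x * vnorm A y" by (rule tens_norm [OF assms(2,3)])
  also have "\<dots> \<le> 1" using assms(4,5) by (intro mult_le_one ell1_vnorm_nonneg)
  finally show "vnorm P (tens x y) \<le> 1" .
qed

lemma tensor_form_BF:
  assumes "\<phi> \<in> carrier DP" shows "tensor_form \<phi> \<in> BF"
  unfolding tensor_form_def
proof (rule BF_I)
  show "bounded_linear_map A complex_space (\<lambda>y. \<phi> (tens x y))"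
    and "bounded_linear_map A complex_space (\<lambda>y. \<phi> (tens y x))" if "x \<in> carrier A" for x
    by (rule blm_compose [OF tens_blm(1) [OF that] dualD(2) [OF assms] proj_vnorm_nonneg], assumption)
      (rule blm_compose [OF tens_blm(2) [OF that] dualD(2) [OF assms] proj_vnorm_nonneg], assumption)
  show "cmod (\<phi> (tens x y)) \<le> vnorm DP \<phi> * (vnorm A x * vnorm A y)"
    if "x \<in> carrier A" "y \<in> carrier A" for x y
    by (rule order_trans [OF dual_bound [OF proj_pre_space assms tens_closed [OF that]]
          mult_left_mono [OF tens_norm [OF that] dual_vnorm_nonneg [OF proj_pre_space assms]]])
qed

definition diagonal where "diagonal = (\<lambda>\<phi>\<in>carrier DP. \<mu> (tensor_form \<phi>))"

lemma diagonal_closed: "diagonal \<in> carrier (dual_bimodule DP)"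
  unfolding diagonal_def
proof (rule dual_carrierI)
  fix \<phi> \<psi> assume \<phi>: "\<phi> \<in> carrier DP" and \<psi>: "\<psi> \<in> carrier DP"
  have "tensor_form (\<phi> \<oplus>\<^bsub>DP\<^esub> \<psi>) = (\<lambda>p\<in>carrier A \<times> carrier A. tensor_form \<phi> p + tensor_form \<psi> p)"
    by (auto simp: tensor_form_def dual_simps(3) tens_closed intro!: restrict_ext)
  then show "\<phi> \<oplus>\<^bsub>DP\<^esub> \<psi> \<in> carrier DP \<and> \<mu> (tensor_form (\<phi> \<oplus>\<^bsub>DP\<^esub> \<psi>)) = \<mu> (tensor_form \<phi>) + \<mu> (tensor_form \<psi>)"
    using pre_spaceD(1) [OF DP_pre_space \<phi> \<psi>] \<mu>_add [OF tensor_form_BF [OF \<phi>] tensor_form_BF [OF \<psi>]] by simp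
next
  fix c \<phi> assume \<phi>: "\<phi> \<in> carrier DP"
  have "tensor_form (c \<odot>\<^bsub>DP\<^esub> \<phi>) = (\<lambda>p\<in>carrier A \<times> carrier A. c * tensor_form \<phi> p)"
    by (auto simp: tensor_form_def dual_simps(4) tens_closed intro!: restrict_ext)
  then show "c \<odot>\<^bsub>DP\<^esub> \<phi> \<in> carrier DP \<and> \<mu> (tensor_form (c \<odot>\<^bsub>DP\<^esub> \<phi>)) = c * \<mu> (tensor_form \<phi>)"
    using pre_spaceD(2) [OF DP_pre_space \<phi>] \<mu>_smult [OF tensor_form_BF [OF \<phi>]] by simp
next
  fix \<phi> assume \<phi>: "\<phi> \<in> carrier DP"
  show "cmod (\<mu> (tensor_form \<phi>)) \<le> C * vnorm DP \<phi>"
    by (rule \<mu>_bound [OF tensor_form_BF [OF \<phi>] dual_vnorm_nonneg [OF proj_pre_space \<phi>]])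
      (use tensor_form_ball [OF \<phi>] in \<open>simp add: tensor_form_def\<close>)
qed

lemma act_tens:
  assumes "a \<in> carrier A" "x \<in> carrier A" "y \<in> carrier A"
  shows "lact P a (tens x y) = tens (a \<otimes>\<^bsub>A\<^esub> x) y" and "ract P (tens x y) a = tens x (y \<otimes>\<^bsub>A\<^esub> a)"
  unfolding proj_simps(6,7) elementary_tensor_def
  by (rule restrict_ext, use assms BF_left BF_right in simp)+

lemma diagonal_act:
  assumes a: "a \<in> carrier A"
  shows "lact (dual_bimodule DP) a diagonal = ract (dual_bimodule DP) diagonal a"
  unfolding dual_simps(6,7) [of DP]
proof (rule restrict_ext)
  fix \<phi> assume \<phi>: "\<phi> \<in> carrier DP"
  have "tensor_form (ract DP \<phi> a) = (\<lambda>(x, y)\<in>carrier A \<times> carrier A. tensor_form \<phi> (a \<otimes>\<^bsub>A\<^esub> x, y))"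
    "tensor_form (lact DP a \<phi>) = (\<lambda>(x, y)\<in>carrier A \<times> carrier A. tensor_form \<phi> (x, y \<otimes>\<^bsub>A\<^esub> a))"
    using a by (auto simp: tensor_form_def dual_simps(6,7) tens_closed act_tens ell1_mult_closed intro!: restrict_ext)
  then show "diagonal (ract DP \<phi> a) = diagonal (lact DP a \<phi>)"
    using \<mu>_act [OF tensor_form_BF [OF \<phi>] a] blmD(1) [OF DP_act_blm(1) [OF a] \<phi>] blmD(1) [OF DP_act_blm(2) [OF a] \<phi>]
    by (simp add: diagonal_def)
qed

lemma product_map_bidual_diagonal:
  "product_map_bidual A diagonal = canonical_embedding (self_bimodule A) e"
  unfolding product_map_bidual_eq [OF diagonal_closed] canonical_embedding_def
proof (rule restrict_ext)
  fix \<psi> assume \<psi>: "\<psi> \<in> carrier DA"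
  have "tensor_form (\<lambda>u\<in>carrier P. \<psi> (tensor_product_map u)) = (\<lambda>(x, y)\<in>carrier A \<times> carrier A. \<psi> (x \<otimes>\<^bsub>A\<^esub> y))"
    by (auto simp: tensor_form_def tens_closed tensor_product_map_tens intro!: restrict_ext)
  then show "diagonal (\<lambda>u\<in>carrier P. \<psi> (tensor_product_map u)) = \<psi> e"
    using blmD(1) [OF product_map_adjoint_blm \<psi>] \<mu>_mult [OF dualD(2) [OF \<psi>, unfolded self_blm]]
    by (simp add: diagonal_def)
qed

theorem strong_pseudo_amenable: "strong_pseudo_amenable A"
proof -
  let ?T = "dual_bimodule DP" and ?B = "dual_bimodule DA" and ?\<pi> = "product_map_bidual A"
  have act: "lact ?B a (?\<pi> diagonal) = canonical_embedding (self_bimodule A) a"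
    "ract ?B (?\<pi> diagonal) a = canonical_embedding (self_bimodule A) a" if a: "a \<in> carrier A" for a
    unfolding dual_simps(6,7) [of DA] product_map_bidual_diagonal canonical_embedding_def
    by (rule restrict_ext, use a blmD(1) [OF DA_act_blm(1) [OF a]] blmD(1) [OF DA_act_blm(2) [OF a]] in
      \<open>simp add: dual_simps(6,7) self_simps e_closed e_left e_right\<close>)+
  have can: "canonical_embedding (self_bimodule A) a \<in> carrier ?B" if "a \<in> carrier A" for a
    by (rule canonical_embedding_closed) (simp_all add: self_A_pre_space self_simps that)
  have 1: "vnorm ?T (lact ?T a diagonal \<ominus>\<^bsub>?T\<^esub> ract ?T diagonal a) = 0" if a: "a \<in> carrier A" for a
    unfolding diagonal_act [OF a] dual_minus [OF DP_pre_space DDP_act_closed(2) [OF a diagonal_closed]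
        DDP_act_closed(2) [OF a diagonal_closed]] diff_self
    by (rule dual_vnorm_zero [OF DP_pre_space])
  have 2: "vnorm ?B (ract ?B (?\<pi> diagonal) a \<ominus>\<^bsub>?B\<^esub> canonical_embedding (self_bimodule A) a) = 0"
    if a: "a \<in> carrier A" for a
    unfolding act(2) [OF a] dual_minus [OF DA_pre_space can [OF a] can [OF a]] diff_self
    by (rule dual_vnorm_zero [OF DA_pre_space])
  show ?thesis
    unfolding strong_pseudo_amenable_def Let_def
  \<comment> \<open>A constant net: all the differences in question are exactly zero.\<close>
  proof (intro exI [of _ "principal {diagonal}"] conjI ballI)
    show "principal {diagonal} \<noteq> bot" by (simp add: principal_eq_bot_iff)
    show "\<forall>\<^sub>F m in principal {diagonal}. m \<in> carrier ?T \<and>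
        (\<forall>a\<in>carrier A. lact ?B a (?\<pi> m) = ract ?B (?\<pi> m) a)"
      by (simp add: eventually_principal diagonal_closed act)
    show "((\<lambda>m. vnorm ?T (lact ?T a m \<ominus>\<^bsub>?T\<^esub> ract ?T m a)) \<longlongrightarrow> 0) (principal {diagonal})"
      if "a \<in> carrier A" for a
      using tendsto_principal_singleton [of "\<lambda>m. vnorm ?T (lact ?T a m \<ominus>\<^bsub>?T\<^esub> ract ?T m a)" diagonal]
      unfolding 1 [OF that] .
    show "((\<lambda>m. vnorm ?B (ract ?B (?\<pi> m) a \<ominus>\<^bsub>?B\<^esub> canonical_embedding (self_bimodule A) a)) \<longlongrightarrow> 0) (principal {diagonal})"
      if "a \<in> carrier A" for a
      using tendsto_principal_singleton [of "\<lambda>m. vnorm ?B (ract ?B (?\<pi> m) a \<ominus>\<^bsub>?B\<^esub> canonical_embedding (self_bimodule A) a)" diagonal]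
      unfolding 2 [OF that] .
  qed
qed

text \<open>Johnson's averaging argument. If the diagonal is thought of as a sum of b \<otimes> c,
  then \<open>f1\<close> is the sum of b \<cdot> D(c). Moving \<open>a\<close> across the diagonal
  and applying the product rule to D(c a) gives f1(x a) - f1(a x) = D a (x e). This is D a x when
  \<open>e\<close> acts as the identity; in general D a x = D a (x e) + D e (a x), and
  \<open>f2\<close> accounts for the last term.\<close>

theorem derivation_inner:
  fixes X :: "('s \<Rightarrow> complex, 'x) bimodule"
  assumes X: "banach_bimodule A X" and D: "derivation A (dual_bimodule X) D"
  shows "\<exists>f\<in>carrier (dual_bimodule X). \<forall>a\<in>carrier A. \<forall>x\<in>carrier X. D a x = f (ract X x a) - f (lact X a x)"
proof -
  let ?Y = "dual_bimodule X"
  have pX: "pre_space X"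
    using X unfolding banach_bimodule_def banach_space_def by (intro normed_space_pre_space) simp
  have lX: "bounded_linear_map X X (lact X a)" and rX: "bounded_linear_map X X (\<lambda>x. ract X x a)"
    if "a \<in> carrier A" for a
    using X that unfolding banach_bimodule_def by blast+
  have rA: "bounded_linear_map A X (ract X x)" if "x \<in> carrier X" for x
    using X that unfolding banach_bimodule_def by blast
  have lmult: "lact X (a \<otimes>\<^bsub>A\<^esub> b) x = lact X a (lact X b x)"
    and rmult: "ract X x (a \<otimes>\<^bsub>A\<^esub> b) = ract X (ract X x a) b"
    and lr: "lact X a (ract X x b) = ract X (lact X a x) b"
    if "a \<in> carrier A" "b \<in> carrier A" "x \<in> carrier X" for a b x
    using X that unfolding banach_bimodule_def by blast+
  obtain K0 where K0: "vnorm X (ract X x a) \<le> K0 * vnorm A a * vnorm X x"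
    if "a \<in> carrier A" "x \<in> carrier X" for a x
    using X unfolding banach_bimodule_def by blast
  define K where "K = \<bar>K0\<bar>"
  have K: "vnorm X (ract X x a) \<le> K * (vnorm A a * vnorm X x)"
    if "a \<in> carrier A" "x \<in> carrier X" for a x
    using order_trans [OF K0 [OF that, unfolded mult.assoc] mult_right_mono [OF abs_ge_self]]
      mult_nonneg_nonneg [OF ell1_vnorm_nonneg [of a] pre_spaceD(4) [OF pX that(2)]]
    unfolding K_def by blast
  have Db: "bounded_linear_map A ?Y D" using D unfolding derivation_def by blast
  obtain L where L: "L > 0" "vnorm ?Y (D a) \<le> L * vnorm A a" if "a \<in> carrier A" for a
    using blm_bound [OF Db] ell1_vnorm_nonneg by metis
  note Dc = blmD(1) [OF Db]
  have Dmult: "D (a \<otimes>\<^bsub>A\<^esub> b) x = D b (ract X x a) + D a (lact X b x)"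
    if "a \<in> carrier A" "b \<in> carrier A" "x \<in> carrier X" for a b x
  proof -
    have "D (a \<otimes>\<^bsub>A\<^esub> b) = lact ?Y a (D b) \<oplus>\<^bsub>?Y\<^esub> ract ?Y (D a) b"
      using D that(1,2) unfolding derivation_def by blast
    then show ?thesis using that(3) by (simp add: dual_simps)
  qed
  have Dz: "bounded_linear_map A complex_space (\<lambda>a. D a z)" if z: "z \<in> carrier X" for z
  proof (rule blm_complexI)
    show "D (a \<oplus>\<^bsub>A\<^esub> b) z = D a z + D b z" if "a \<in> carrier A" "b \<in> carrier A" for a b
      unfolding blmD(2) [OF Db that] using z by (simp add: dual_simps)
    show "D (c \<odot>\<^bsub>A\<^esub> a) z = c * D a z" if "a \<in> carrier A" for c a
      unfolding blmD(3) [OF Db that] using z by (simp add: dual_simps)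
    show "cmod (D a z) \<le> (L * vnorm X z) * vnorm A a" if "a \<in> carrier A" for a
      using order_trans [OF dual_bound [OF pX Dc [OF that] z] mult_right_mono [OF L(2) [OF that] pre_spaceD(4) [OF pX z]]]
      by (simp add: mult_ac)
  qed
  \<comment> \<open>Applied to this form, \<mu> gives the value at \<open>x\<close> of the averaged
    functional: b \<cdot> D(c) takes the value D c (x b) there.\<close>
  define \<beta> where "\<beta> x = (\<lambda>(b, c)\<in>carrier A \<times> carrier A. D c (ract X x b))" for x
  have \<beta>_bound: "cmod (D c (ract X x b)) \<le> (L * K * vnorm X x) * (vnorm A b * vnorm A c)"
    if "x \<in> carrier X" "b \<in> carrier A" "c \<in> carrier A" for x b c
  proof -
    have "cmod (D c (ract X x b)) \<le> vnorm ?Y (D c) * vnorm X (ract X x b)"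
      by (rule dual_bound [OF pX Dc [OF that(3)] blmD(1) [OF rX [OF that(2)] that(1)]])
    also have "\<dots> \<le> (L * vnorm A c) * (K * (vnorm A b * vnorm X x))"
      using L(1) [OF that(3)] ell1_vnorm_nonneg [of c]
      by (intro mult_mono L(2) K that pre_spaceD(4) [OF pX] blmD(1) [OF rX]) auto
    finally show ?thesis by (simp add: mult_ac)
  qed
  have \<beta>_BF: "\<beta> x \<in> BF" if x: "x \<in> carrier X" for x
    unfolding \<beta>_def
  proof (rule BF_I)
    show "bounded_linear_map A complex_space (\<lambda>c. D c (ract X x b))" if "b \<in> carrier A" for b
      by (rule Dz [OF blmD(1) [OF rX [OF that] x]])
    show "bounded_linear_map A complex_space (\<lambda>b. D c (ract X x b))" if "c \<in> carrier A" for c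
      by (rule blm_compose [OF rA [OF x] dualD(2) [OF Dc [OF that]] pre_spaceD(4) [OF pX]])
  qed (rule \<beta>_bound [OF x])
  define f1 where "f1 = (\<lambda>x\<in>carrier X. \<mu> (\<beta> x))"
  \<comment> \<open>On a x this is D e (a x), because e a = a; on x a it vanishes, by fact
    \<open>3\<close> below. So subtracting it adds exactly the missing term.\<close>
  define f2 where "f2 = (\<lambda>x\<in>carrier X. D e (lact X e x))"
  have f1: "f1 \<in> carrier ?Y"
    unfolding f1_def
  proof (rule dual_carrierI)
    fix x y assume x: "x \<in> carrier X" and y: "y \<in> carrier X"
    have "\<beta> (x \<oplus>\<^bsub>X\<^esub> y) = (\<lambda>p\<in>carrier A \<times> carrier A. \<beta> x p + \<beta> y p)"
      unfolding \<beta>_def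
      by (rule restrict_ext) (use x y in \<open>auto simp: blmD [OF rX] dualD(3) [OF Dc]\<close>)
    then show "x \<oplus>\<^bsub>X\<^esub> y \<in> carrier X \<and> \<mu> (\<beta> (x \<oplus>\<^bsub>X\<^esub> y)) = \<mu> (\<beta> x) + \<mu> (\<beta> y)"
      using \<mu>_add [OF \<beta>_BF [OF x] \<beta>_BF [OF y]] pre_spaceD(1) [OF pX x y] by simp
  next
    fix c x assume x: "x \<in> carrier X"
    have "\<beta> (c \<odot>\<^bsub>X\<^esub> x) = (\<lambda>p\<in>carrier A \<times> carrier A. c * \<beta> x p)"
      unfolding \<beta>_def
      by (rule restrict_ext) (use x in \<open>auto simp: blmD [OF rX] dualD(4) [OF Dc]\<close>)
    then show "c \<odot>\<^bsub>X\<^esub> x \<in> carrier X \<and> \<mu> (\<beta> (c \<odot>\<^bsub>X\<^esub> x)) = c * \<mu> (\<beta> x)"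
      using \<mu>_smult [OF \<beta>_BF [OF x]] pre_spaceD(2) [OF pX x] by simp
  next
    fix x assume x: "x \<in> carrier X"
    have LK: "0 \<le> L * K * vnorm X x"
      using L(1) [OF e_closed] pre_spaceD(4) [OF pX x] by (simp add: K_def)
    have "cmod (\<mu> (\<beta> x)) \<le> C * (L * K * vnorm X x)"
    proof (rule \<mu>_bound [OF \<beta>_BF [OF x] LK])
      fix b c assume bc: "b \<in> carrier A" "c \<in> carrier A" "vnorm A b \<le> 1" "vnorm A c \<le> 1"
      have "vnorm A b * vnorm A c \<le> 1" using bc by (intro mult_le_one ell1_vnorm_nonneg)
      then have "L * K * vnorm X x * (vnorm A b * vnorm A c) \<le> L * K * vnorm X x * 1"
        by (rule mult_left_mono [OF _ LK])
      then show "cmod (\<beta> x (b, c)) \<le> L * K * vnorm X x"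
        using order_trans [OF \<beta>_bound [OF x bc(1,2)]] bc(1,2) by (simp add: \<beta>_def)
    qed
    then show "cmod (\<mu> (\<beta> x)) \<le> (C * L * K) * vnorm X x" by (simp add: mult_ac)
  qed
  have f2: "f2 \<in> carrier ?Y"
    unfolding f2_def
    by (rule blmD(1) [OF dual_adjoint_blm [OF pX pX lX [OF e_closed]] Dc [OF e_closed]])
  show ?thesis
  proof (intro bexI [of _ "f1 \<ominus>\<^bsub>?Y\<^esub> f2"] ballI)
    show "f1 \<ominus>\<^bsub>?Y\<^esub> f2 \<in> carrier ?Y" by (rule dual_minus_closed [OF pX f1 f2])
    fix a x assume a: "a \<in> carrier A" and x: "x \<in> carrier X"
    note xa = blmD(1) [OF rX [OF a] x] and ax = blmD(1) [OF lX [OF a] x]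
    let ?\<phi> = "\<lambda>y. D a (ract X x y)"
    have \<phi>: "bounded_linear_map A complex_space ?\<phi>"
      by (rule blm_compose [OF rA [OF x] dualD(2) [OF Dc [OF a]] pre_spaceD(4) [OF pX]])
    let ?\<gamma> = "\<lambda>(b, c)\<in>carrier A \<times> carrier A. \<beta> x (b, c \<otimes>\<^bsub>A\<^esub> a)"
    let ?\<delta> = "\<lambda>(b, c)\<in>carrier A \<times> carrier A. ?\<phi> (b \<otimes>\<^bsub>A\<^esub> c)"
    have "\<beta> (ract X x a) = (\<lambda>(b, c)\<in>carrier A \<times> carrier A. \<beta> x (a \<otimes>\<^bsub>A\<^esub> b, c))"
      unfolding \<beta>_def by (rule restrict_ext) (use a x in \<open>auto simp: rmult ell1_mult_closed\<close>)
    then have 1: "\<mu> (\<beta> (ract X x a)) = \<mu> ?\<gamma>" using \<mu>_act [OF \<beta>_BF [OF x] a] by simp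
    have "?\<gamma> = (\<lambda>p\<in>carrier A \<times> carrier A. \<beta> (lact X a x) p + ?\<delta> p)"
      unfolding \<beta>_def
      by (rule restrict_ext)
        (use a x in \<open>auto simp: Dmult rmult lr ell1_mult_closed blmD(1) [OF rX]\<close>)
    moreover have \<delta>: "?\<delta> \<in> BF"
    proof (rule BF_I)
      show "bounded_linear_map A complex_space (\<lambda>c. ?\<phi> (b \<otimes>\<^bsub>A\<^esub> c))" if "b \<in> carrier A" for b
        by (rule blm_compose [OF mult_blm_right [OF that] \<phi> ell1_vnorm_nonneg])
      show "bounded_linear_map A complex_space (\<lambda>c. ?\<phi> (c \<otimes>\<^bsub>A\<^esub> b))" if "b \<in> carrier A" for b
        by (rule blm_compose [OF mult_blm_left [OF that] \<phi> ell1_vnorm_nonneg])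
      show "cmod (?\<phi> (b \<otimes>\<^bsub>A\<^esub> c)) \<le> (L * K * vnorm X x * vnorm A a) * (vnorm A b * vnorm A c)"
        if bc: "b \<in> carrier A" "c \<in> carrier A" for b c
      proof -
        have "0 \<le> L * K * vnorm X x"
          using L(1) [OF e_closed] pre_spaceD(4) [OF pX x] by (simp add: K_def)
        then have "(L * K * vnorm X x) * (vnorm A (b \<otimes>\<^bsub>A\<^esub> c) * vnorm A a)
            \<le> (L * K * vnorm X x) * ((vnorm A b * vnorm A c) * vnorm A a)"
          using ell1_mult_norm [OF bc] by (intro mult_left_mono mult_right_mono ell1_vnorm_nonneg)
        then show ?thesis
          using order_trans [OF \<beta>_bound [OF x ell1_mult_closed [OF bc] a]] by (simp add: mult_ac)
      qed
    qed
    ultimately have 2: "\<mu> ?\<gamma> = \<mu> (\<beta> (lact X a x)) + D a (ract X x e)"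
      using \<mu>_add [OF \<beta>_BF [OF ax] \<delta>] \<mu>_mult [OF \<phi>] by simp
    \<comment> \<open>On an element z fixed by \<open>e\<close> from both sides, the product rule
      for e e = e reads D e z = D e z + D e z.\<close>
    have 3: "D e (lact X e (ract X x a)) = 0"
    proof -
      let ?y = "ract X x a" and ?z = "lact X e (ract X x a)"
      have z: "?z \<in> carrier X" by (rule blmD(1) [OF lX [OF e_closed] xa])
      have "ract X ?y e = ?y" using rmult [OF a e_closed x] e_right [OF a] by simp
      then have "ract X ?z e = ?z" using lr [OF e_closed e_closed xa] by simp
      moreover have "lact X e ?z = ?z" using lmult [OF e_closed e_closed xa] e_left [OF e_closed] by simp
      ultimately show ?thesis using Dmult [OF e_closed e_closed z] e_left [OF e_closed] by simp
    qed
    have 4: "lact X e (lact X a x) = lact X a x" using lmult [OF e_closed a x] e_left [OF a] by simp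
    have 5: "D a x = D a (ract X x e) + D e (lact X a x)" using Dmult [OF e_closed a x] e_left [OF a] by simp
    show "D a x = (f1 \<ominus>\<^bsub>?Y\<^esub> f2) (ract X x a) - (f1 \<ominus>\<^bsub>?Y\<^esub> f2) (lact X a x)"
      unfolding dual_minus [OF pX f1 f2] using xa ax 1 2 3 4 5 by (simp add: f1_def f2_def)
  qed
qed

theorem approximately_amenable: "approximately_amenable TYPE('x) A"
  unfolding approximately_amenable_def Let_def
proof (intro allI impI)
  fix X :: "('s \<Rightarrow> complex, 'x) bimodule" and D
  assume XD: "banach_bimodule A X \<and> derivation A (dual_bimodule X) D"
  let ?Y = "dual_bimodule X"
  have pX: "pre_space X"
    using XD unfolding banach_bimodule_def banach_space_def by (intro normed_space_pre_space) simp
  have act: "bounded_linear_map X X (lact X a)" "bounded_linear_map X X (\<lambda>x. ract X x a)"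
    if "a \<in> carrier A" for a
    using XD that unfolding banach_bimodule_def by blast+
  obtain f where f: "f \<in> carrier ?Y"
    and Df: "\<And>a x. a \<in> carrier A \<Longrightarrow> x \<in> carrier X \<Longrightarrow> D a x = f (ract X x a) - f (lact X a x)"
    using derivation_inner XD by blast
  have 0: "vnorm ?Y (D a \<ominus>\<^bsub>?Y\<^esub> (lact ?Y a f \<ominus>\<^bsub>?Y\<^esub> ract ?Y f a)) = 0" if a: "a \<in> carrier A" for a
  proof -
    have lf: "lact ?Y a f \<in> carrier ?Y" "ract ?Y f a \<in> carrier ?Y"
      unfolding dual_simps(6,7) by (rule blmD(1) [OF dual_adjoint_blm [OF pX pX] f], rule act [OF a])+
    have Da: "D a \<in> carrier ?Y"
      using XD a unfolding derivation_def bounded_linear_map_def by blast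
    have "D a \<ominus>\<^bsub>?Y\<^esub> (lact ?Y a f \<ominus>\<^bsub>?Y\<^esub> ract ?Y f a) = (\<lambda>x\<in>carrier X. 0)"
      unfolding dual_minus [OF pX Da dual_minus_closed [OF pX lf]] unfolding dual_minus [OF pX lf]
      by (rule restrict_ext) (simp add: dual_simps Df [OF a])
    then show ?thesis by (simp add: dual_vnorm_zero [OF pX])
  qed
  show "\<exists>F. F \<noteq> bot \<and> (\<forall>\<^sub>F f in F. f \<in> carrier ?Y) \<and>
      (\<forall>a\<in>carrier A. ((\<lambda>f. vnorm ?Y (D a \<ominus>\<^bsub>?Y\<^esub> (lact ?Y a f \<ominus>\<^bsub>?Y\<^esub> ract ?Y f a))) \<longlongrightarrow> 0) F)"
  proof (intro exI [of _ "principal {f}"] conjI ballI)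
    show "((\<lambda>f. vnorm ?Y (D a \<ominus>\<^bsub>?Y\<^esub> (lact ?Y a f \<ominus>\<^bsub>?Y\<^esub> ract ?Y f a))) \<longlongrightarrow> 0) (principal {f})"
      if "a \<in> carrier A" for a
      using tendsto_principal_singleton [of "\<lambda>f. vnorm ?Y (D a \<ominus>\<^bsub>?Y\<^esub> (lact ?Y a f \<ominus>\<^bsub>?Y\<^esub> ract ?Y f a))" f]
      unfolding 0 [OF that] .
  qed (simp_all add: f principal_eq_bot_iff eventually_principal)
qed

end

section \<open>Invariant means\<close>

text \<open>Tychonoff: the functions \<open>\<Phi> n\<close> eventually lie in a product of compact
  intervals. Passing to a finer filter turns a cluster point into a limit in every
  coordinate.\<close>

lemma bounded_filter_cluster:
  fixes \<Phi> :: "'n \<Rightarrow> 'f \<Rightarrow> real"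
  assumes "F \<noteq> bot" and ev: "\<forall>\<^sub>F n in F. \<forall>f. \<bar>\<Phi> n f\<bar> \<le> b f"
  shows "\<exists>F' Q. F' \<le> F \<and> F' \<noteq> bot \<and> (\<forall>f. ((\<lambda>n. \<Phi> n f) \<longlongrightarrow> Q f) F')"
proof -
  have "compactin (product_topology (\<lambda>f::'f. euclidean) UNIV) (PiE UNIV (\<lambda>f. {- b f..b f}))"
    by (simp add: compactin_PiE)
  then have K: "compact (PiE UNIV (\<lambda>f. {- b f..b f}))"
    by (simp add: euclidean_product_topology)
  have "filtermap \<Phi> F \<noteq> bot" using assms(1) by (simp add: filtermap_bot_iff)
  moreover have "\<forall>\<^sub>F q in filtermap \<Phi> F. q \<in> PiE UNIV (\<lambda>f. {- b f..b f})"
    unfolding eventually_filtermap by (rule eventually_mono [OF ev]) (auto simp: abs_le_iff minus_le_iff)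
  ultimately obtain Q where Q: "inf (nhds Q) (filtermap \<Phi> F) \<noteq> bot"
    using K [unfolded compact_filter, rule_format, of "filtermap \<Phi> F"] by auto
  \<comment> \<open>The finer filter adds the preimages of the neighbourhoods of \<open>Q\<close>;
    it is proper exactly because \<open>Q\<close> is a cluster point.\<close>
  define F' where "F' = inf F (filtercomap \<Phi> (nhds Q))"
  show ?thesis
  proof (intro exI [of _ F'] exI [of _ Q] conjI allI)
    show "F' \<le> F" by (simp add: F'_def)
    show "F' \<noteq> bot"
    proof
      assume "F' = bot"
      then have "eventually (\<lambda>x. False) F'" by simp
      then obtain A B where A: "eventually A F" and B: "eventually B (filtercomap \<Phi> (nhds Q))"
        and AB: "\<forall>x. A x \<and> B x \<longrightarrow> False" unfolding F'_def eventually_inf by auto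
      obtain R where R: "eventually R (nhds Q)" "\<forall>x. R (\<Phi> x) \<longrightarrow> B x"
        using B unfolding eventually_filtercomap by blast
      have "eventually (\<lambda>q. \<not> R q) (filtermap \<Phi> F)"
        unfolding eventually_filtermap using A by (rule eventually_mono) (use R AB in blast)
      then have "eventually (\<lambda>q. False) (inf (nhds Q) (filtermap \<Phi> F))"
        unfolding eventually_inf using R(1) by blast
      then show False using Q by (simp add: eventually_False)
    qed
    have "filterlim \<Phi> (nhds Q) F'"
      unfolding filterlim_def F'_def by (simp add: filtermap_le_iff_le_filtercomap)
    then have t: "(\<Phi> \<longlongrightarrow> Q) F'" by simp
    show "((\<lambda>n. \<Phi> n f) \<longlongrightarrow> Q f) F'" for f
      using continuous_on_tendsto_compose [OF continuous_on_product_coordinates [of f] t] by simp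
  qed
qed

section \<open>Positive parts of bounded functionals\<close>

definition bounded_functional :: "'g set \<Rightarrow> (('g \<Rightarrow> complex) \<Rightarrow> complex) \<Rightarrow> bool" where
  "bounded_functional X n \<longleftrightarrow>
     (\<forall>f h. bounded (f ` X) \<longrightarrow> bounded (h ` X) \<longrightarrow> n (\<lambda>x. f x + h x) = n f + n h) \<and>
     (\<forall>c f. bounded (f ` X) \<longrightarrow> n (\<lambda>x. c * f x) = c * n f) \<and>
     (\<exists>M. \<forall>f C. C > 0 \<longrightarrow> (\<forall>x\<in>X. cmod (f x) \<le> C) \<longrightarrow> cmod (n f) \<le> M * C)"

text \<open>The Riesz-Kantorovich formula for the positive part of the real part of
  \<open>n\<close>, evaluated at nonnegative \<open>f\<close>.\<close>

definition positive_part :: "'g set \<Rightarrow> (('g \<Rightarrow> complex) \<Rightarrow> complex) \<Rightarrow> ('g \<Rightarrow> real) \<Rightarrow> real" where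
  "positive_part X n f = (SUP h\<in>{h. \<forall>x\<in>X. 0 \<le> h x \<and> h x \<le> f x}. Re (n (\<lambda>x. of_real (h x))))"

definition nonneg_bounded :: "'g set \<Rightarrow> ('g \<Rightarrow> real) \<Rightarrow> bool" where
  "nonneg_bounded X f \<longleftrightarrow> (\<forall>x\<in>X. 0 \<le> f x) \<and> (\<exists>B. \<forall>x\<in>X. f x \<le> B)"

lemma nonneg_bounded_add:
  assumes "nonneg_bounded X f" "nonneg_bounded X g" shows "nonneg_bounded X (\<lambda>x. f x + g x)"
proof -
  obtain B D where "\<forall>x\<in>X. f x \<le> B" "\<forall>x\<in>X. g x \<le> D" using assms unfolding nonneg_bounded_def by blast
  then have "\<forall>x\<in>X. f x + g x \<le> B + D" by (auto intro: add_mono)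
  then show ?thesis using assms unfolding nonneg_bounded_def by auto
qed

lemma nonneg_bounded_smult:
  assumes "nonneg_bounded X f" "0 \<le> c" shows "nonneg_bounded X (\<lambda>x. c * f x)"
proof -
  obtain B where "\<forall>x\<in>X. f x \<le> B" using assms unfolding nonneg_bounded_def by blast
  then have "\<forall>x\<in>X. c * f x \<le> c * B" using assms(2) by (auto intro: mult_left_mono)
  then show ?thesis using assms unfolding nonneg_bounded_def by auto
qed

context
  fixes X :: "'g set" and n :: "('g \<Rightarrow> complex) \<Rightarrow> complex"
  assumes n: "bounded_functional X n"
begin

lemma bounded_functional_add:
  "bounded (f ` X) \<Longrightarrow> bounded (h ` X) \<Longrightarrow> n (\<lambda>x. f x + h x) = n f + n h"
  using n [unfolded bounded_functional_def, THEN conjunct1] by simp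

lemma bounded_functional_smult: "bounded (f ` X) \<Longrightarrow> n (\<lambda>x. c * f x) = c * n f"
  using n [unfolded bounded_functional_def, THEN conjunct2, THEN conjunct1] by simp

lemma bounded_functional_bound:
  obtains M where "M > 0" "\<And>f C. C > 0 \<Longrightarrow> (\<And>x. x \<in> X \<Longrightarrow> cmod (f x) \<le> C) \<Longrightarrow> cmod (n f) \<le> M * C"
proof -
  obtain M where M: "\<forall>f C. C > 0 \<longrightarrow> (\<forall>x\<in>X. cmod (f x) \<le> C) \<longrightarrow> cmod (n f) \<le> M * C"
    using n [unfolded bounded_functional_def, THEN conjunct2, THEN conjunct2] by (elim exE)
  show thesis
  proof (rule that [of "\<bar>M\<bar> + 1"])
    fix f :: "'g \<Rightarrow> complex" and C :: real assume C: "C > 0" "\<And>x. x \<in> X \<Longrightarrow> cmod (f x) \<le> C"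
    have "cmod (n f) \<le> M * C" using M C by simp
    also have "\<dots> \<le> (\<bar>M\<bar> + 1) * C" using C(1) by (intro mult_right_mono) auto
    finally show "cmod (n f) \<le> (\<bar>M\<bar> + 1) * C" .
  qed simp
qed

text \<open>The difference of \<open>f\<close> and \<open>h\<close> is bounded on \<open>X\<close>
  by every positive constant, so its value is arbitrarily small; values off \<open>X\<close> cannot
  matter.\<close>

lemma bounded_functional_cong:
  assumes "\<And>x. x \<in> X \<Longrightarrow> f x = h x" "bounded (f ` X)" shows "n f = n h"
proof -
  obtain M where M: "M > 0" "\<And>f C. C > 0 \<Longrightarrow> (\<And>x. x \<in> X \<Longrightarrow> cmod (f x) \<le> C) \<Longrightarrow> cmod (n f) \<le> M * C"
    using bounded_functional_bound by metis
  let ?d = "\<lambda>x. h x - f x"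
  have d0: "cmod (?d x) \<le> c" if "x \<in> X" "c \<ge> 0" for x c using assms(1) [OF that(1)] that(2) by simp
  have "cmod (n ?d) \<le> M * (\<epsilon> / M)" if "\<epsilon> > 0" for \<epsilon>
    by (intro M(2) d0) (use M(1) that in simp_all)
  then have "cmod (n ?d) \<le> 0 + \<epsilon>" if "\<epsilon> > 0" for \<epsilon> using M(1) that by simp
  then have "cmod (n ?d) \<le> 0" by (rule field_le_epsilon)
  moreover have "bounded (?d ` X)" by (rule boundedI [of _ 0]) (use d0 [of _ 0] in blast)
  then have "n h = n f + n ?d" using bounded_functional_add [OF assms(2), of ?d] by simp
  ultimately show ?thesis by simp
qed

lemma nonneg_bounded_between:
  assumes "nonneg_bounded X f" "\<And>x. x \<in> X \<Longrightarrow> 0 \<le> h x \<and> h x \<le> f x"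
  shows "bounded ((\<lambda>x. complex_of_real (h x)) ` X)"
proof -
  obtain B where "\<forall>x\<in>X. f x \<le> B" using assms(1) unfolding nonneg_bounded_def by blast
  then have "cmod (complex_of_real (h x)) \<le> B" if "x \<in> X" for x
    using assms(2) [OF that] that by (metis abs_of_nonneg norm_of_real order_trans)
  then show ?thesis by (intro boundedI [of _ B]) auto
qed

lemma positive_part_bdd:
  assumes "nonneg_bounded X f"
  shows "bdd_above ((\<lambda>h. Re (n (\<lambda>x. of_real (h x)))) ` {h. \<forall>x\<in>X. 0 \<le> h x \<and> h x \<le> f x})"
proof -
  obtain B where B: "\<forall>x\<in>X. f x \<le> B" using assms unfolding nonneg_bounded_def by blast
  obtain M where M: "M > 0" "\<And>f C. C > 0 \<Longrightarrow> (\<And>x. x \<in> X \<Longrightarrow> cmod (f x) \<le> C) \<Longrightarrow> cmod (n f) \<le> M * C"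
    using bounded_functional_bound by metis
  show ?thesis
  proof (rule bdd_aboveI2)
    fix h assume h: "h \<in> {h. \<forall>x\<in>X. 0 \<le> h x \<and> h x \<le> f x}"
    have "cmod (complex_of_real (h x)) \<le> \<bar>B\<bar> + 1" if "x \<in> X" for x
    proof -
      have "0 \<le> h x" "h x \<le> f x" "f x \<le> B" using h B that by auto
      then show ?thesis by simp
    qed
    then have "cmod (n (\<lambda>x. of_real (h x))) \<le> M * (\<bar>B\<bar> + 1)" by (intro M(2)) simp_all
    then show "Re (n (\<lambda>x. of_real (h x))) \<le> M * (\<bar>B\<bar> + 1)" by (rule order_trans [OF complex_Re_le_cmod])
  qed
qed

lemma positive_part_upper:
  assumes "nonneg_bounded X f" "\<And>x. x \<in> X \<Longrightarrow> 0 \<le> h x \<and> h x \<le> f x"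
  shows "Re (n (\<lambda>x. of_real (h x))) \<le> positive_part X n f"
  unfolding positive_part_def
  by (rule cSUP_upper [OF _ positive_part_bdd [OF assms(1)]]) (simp add: assms(2))

lemma positive_part_least:
  assumes "nonneg_bounded X f"
    and "\<And>h. (\<And>x. x \<in> X \<Longrightarrow> 0 \<le> h x \<and> h x \<le> f x) \<Longrightarrow> Re (n (\<lambda>x. of_real (h x))) \<le> r"
  shows "positive_part X n f \<le> r"
  unfolding positive_part_def
proof (rule cSUP_least)
  show "{h. \<forall>x\<in>X. 0 \<le> h x \<and> h x \<le> f x} \<noteq> {}" using assms(1) unfolding nonneg_bounded_def by blast
  show "Re (n (\<lambda>x. of_real (h x))) \<le> r" if "h \<in> {h. \<forall>x\<in>X. 0 \<le> h x \<and> h x \<le> f x}" for h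
    by (rule assms(2)) (use that in simp)
qed

lemma positive_part_nonneg:
  assumes "nonneg_bounded X f" shows "0 \<le> positive_part X n f"
proof -
  have "n (\<lambda>x. 0) = 0" using bounded_functional_smult [of "\<lambda>x. 0" 0] by (simp add: image_constant_conv)
  then show ?thesis using positive_part_upper [OF assms, of "\<lambda>x. 0"] assms by (simp add: nonneg_bounded_def)
qed

lemma positive_part_mono:
  assumes "nonneg_bounded X f" "nonneg_bounded X g" "\<And>x. x \<in> X \<Longrightarrow> f x \<le> g x"
  shows "positive_part X n f \<le> positive_part X n g"
proof (rule positive_part_least [OF assms(1)], rule positive_part_upper [OF assms(2)])
  show "0 \<le> h x \<and> h x \<le> g x" if "\<And>x. x \<in> X \<Longrightarrow> 0 \<le> h x \<and> h x \<le> f x" "x \<in> X" for h x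
    using that(1) [OF that(2)] assms(3) [OF that(2)] by simp
qed

lemma positive_part_add:
  assumes f: "nonneg_bounded X f" and g: "nonneg_bounded X g"
  shows "positive_part X n (\<lambda>x. f x + g x) = positive_part X n f + positive_part X n g"
proof (rule antisym)
  note fg = nonneg_bounded_add [OF f g]
  have split: "Re (n (\<lambda>x. of_real (h1 x + h2 x))) = Re (n (\<lambda>x. of_real (h1 x))) + Re (n (\<lambda>x. of_real (h2 x)))"
    if "\<And>x. x \<in> X \<Longrightarrow> 0 \<le> h1 x \<and> h1 x \<le> f x" "\<And>x. x \<in> X \<Longrightarrow> 0 \<le> h2 x \<and> h2 x \<le> g x" for h1 h2
    using bounded_functional_add [OF nonneg_bounded_between [OF f that(1)] nonneg_bounded_between [OF g that(2)]]
    by simp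
  show "positive_part X n (\<lambda>x. f x + g x) \<le> positive_part X n f + positive_part X n g"
  proof (rule positive_part_least [OF fg])
    fix h assume h: "\<And>x. x \<in> X \<Longrightarrow> 0 \<le> h x \<and> h x \<le> f x + g x"
    \<comment> \<open>Riesz decomposition: a function between 0 and f + g splits into one below
      \<open>f\<close> and one below \<open>g\<close>.\<close>
    let ?h1 = "\<lambda>x. min (h x) (f x)" and ?h2 = "\<lambda>x. h x - min (h x) (f x)"
    have 1: "0 \<le> ?h1 x \<and> ?h1 x \<le> f x" and 2: "0 \<le> ?h2 x \<and> ?h2 x \<le> g x" if "x \<in> X" for x
      using h [OF that] f g that unfolding nonneg_bounded_def min_def by auto
    have "(\<lambda>x. h x) = (\<lambda>x. ?h1 x + ?h2 x)" by auto
    then have "Re (n (\<lambda>x. of_real (h x))) = Re (n (\<lambda>x. of_real (?h1 x))) + Re (n (\<lambda>x. of_real (?h2 x)))"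
      using split [OF 1 2] by simp
    also have "\<dots> \<le> positive_part X n f + positive_part X n g"
      by (intro add_mono positive_part_upper f g 1 2)
    finally show "Re (n (\<lambda>x. of_real (h x))) \<le> positive_part X n f + positive_part X n g" .
  qed
  \<comment> \<open>For the converse the two suprema are taken one after the other, with
    \<open>h1\<close> fixed while \<open>h2\<close> varies.\<close>
  have "positive_part X n f \<le> positive_part X n (\<lambda>x. f x + g x) - positive_part X n g"
  proof (rule positive_part_least [OF f])
    fix h1 assume h1: "\<And>x. x \<in> X \<Longrightarrow> 0 \<le> h1 x \<and> h1 x \<le> f x"
    have "positive_part X n g \<le> positive_part X n (\<lambda>x. f x + g x) - Re (n (\<lambda>x. of_real (h1 x)))"
    proof (rule positive_part_least [OF g])
      fix h2 assume h2: "\<And>x. x \<in> X \<Longrightarrow> 0 \<le> h2 x \<and> h2 x \<le> g x"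
      have "0 \<le> h1 x + h2 x \<and> h1 x + h2 x \<le> f x + g x" if "x \<in> X" for x
        using h1 [OF that] h2 [OF that] by auto
      then show "Re (n (\<lambda>x. of_real (h2 x))) \<le> positive_part X n (\<lambda>x. f x + g x) - Re (n (\<lambda>x. of_real (h1 x)))"
        using positive_part_upper [OF fg, of "\<lambda>x. h1 x + h2 x"] split [OF h1 h2] by simp
    qed
    then show "Re (n (\<lambda>x. of_real (h1 x))) \<le> positive_part X n (\<lambda>x. f x + g x) - positive_part X n g" by simp
  qed
  then show "positive_part X n f + positive_part X n g \<le> positive_part X n (\<lambda>x. f x + g x)" by simp
qed

lemma positive_part_smult:
  assumes f: "nonneg_bounded X f" and c: "0 < c"
  shows "positive_part X n (\<lambda>x. c * f x) = c * positive_part X n f"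
proof (rule antisym)
  note cf = nonneg_bounded_smult [OF f less_imp_le [OF c]]
  have sc: "Re (n (\<lambda>x. of_real (c * h x))) = c * Re (n (\<lambda>x. of_real (h x)))"
    if "\<And>x. x \<in> X \<Longrightarrow> 0 \<le> h x \<and> h x \<le> f x" for h
    using bounded_functional_smult [OF nonneg_bounded_between [OF f that], of "of_real c"] by simp
  show "positive_part X n (\<lambda>x. c * f x) \<le> c * positive_part X n f"
  proof (rule positive_part_least [OF cf])
    fix h assume h: "\<And>x. x \<in> X \<Longrightarrow> 0 \<le> h x \<and> h x \<le> c * f x"
    have h': "0 \<le> h x / c \<and> h x / c \<le> f x" if "x \<in> X" for x
      using h [OF that] c by (simp add: field_simps)
    show "Re (n (\<lambda>x. of_real (h x))) \<le> c * positive_part X n f"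
      using sc [OF h'] positive_part_upper [OF f h'] c by simp
  qed
  have "positive_part X n f \<le> positive_part X n (\<lambda>x. c * f x) / c"
  proof (rule positive_part_least [OF f])
    fix h assume h: "\<And>x. x \<in> X \<Longrightarrow> 0 \<le> h x \<and> h x \<le> f x"
    have "0 \<le> c * h x \<and> c * h x \<le> c * f x" if "x \<in> X" for x using h [OF that] c by simp
    then show "Re (n (\<lambda>x. of_real (h x))) \<le> positive_part X n (\<lambda>x. c * f x) / c"
      using positive_part_upper [OF cf, of "\<lambda>x. c * h x"] sc [OF h] c by (simp add: field_simps)
  qed
  then show "c * positive_part X n f \<le> positive_part X n (\<lambda>x. c * f x)" using c by (simp add: field_simps)
qed

end

text \<open>A null set contains no point of the space, so "locally almost everywhere" means
  everywhere. This applies to counting measure and to every Haar measure of a discrete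
  group.\<close>

lemma loc_ess_bound_points:
  assumes "\<And>x. x \<in> space \<mu> \<Longrightarrow> {x} \<in> sets \<mu> \<and> 0 < emeasure \<mu> {x} \<and> emeasure \<mu> {x} < \<infinity>"
  shows "loc_ess_bound \<mu> f C \<longleftrightarrow> (\<forall>x\<in>space \<mu>. cmod (f x) \<le> C)"
proof
  assume l: "loc_ess_bound \<mu> f C"
  show "\<forall>x\<in>space \<mu>. cmod (f x) \<le> C"
  proof
    fix x assume x: "x \<in> space \<mu>"
    note a = assms [OF x]
    have "{x} \<in> fmeasurable \<mu>" using a by (intro fmeasurableI) (auto simp: less_top)
    then have "AE y in \<mu>. y \<in> {x} \<longrightarrow> cmod (f y) \<le> C" using l unfolding loc_ess_bound_def by blast
    then obtain N where N: "{y \<in> space \<mu>. \<not> (y \<in> {x} \<longrightarrow> cmod (f y) \<le> C)} \<subseteq> N" "emeasure \<mu> N = 0" "N \<in> sets \<mu>"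
      by (rule AE_E)
    show "cmod (f x) \<le> C"
    proof (rule ccontr)
      assume "\<not> cmod (f x) \<le> C"
      then have "{x} \<subseteq> N" using N(1) x by auto
      then have "emeasure \<mu> {x} \<le> emeasure \<mu> N" using N(3) by (rule emeasure_mono)
      then show False using N(2) a by simp
    qed
  qed
next
  assume "\<forall>x\<in>space \<mu>. cmod (f x) \<le> C"
  then show "loc_ess_bound \<mu> f C" unfolding loc_ess_bound_def by (auto intro: AE_I2)
qed

lemma L_infinity_points:
  assumes "\<And>x. x \<in> space \<mu> \<Longrightarrow> {x} \<in> sets \<mu> \<and> 0 < emeasure \<mu> {x} \<and> emeasure \<mu> {x} < \<infinity>"
    and "sets \<mu> = Pow (space \<mu>)"
  shows "L_infinity \<mu> = {f. bounded (f ` space \<mu>)}"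
proof -
  have "f \<in> borel_measurable (restrict_space \<mu> E)" for f :: "'a \<Rightarrow> complex" and E
    unfolding measurable_def sets_restrict_space assms(2) by (auto simp: space_restrict_space)
  moreover have "(\<exists>C. loc_ess_bound \<mu> f C) \<longleftrightarrow> bounded (f ` space \<mu>)" for f
    unfolding bounded_iff by (intro ex_cong1) (simp add: loc_ess_bound_points [OF assms(1)])
  ultimately show ?thesis unfolding L_infinity_def by simp
qed

lemma count_space_points:
  "L_infinity (count_space X) = {f. bounded (f ` X)}"
  "loc_ess_bound (count_space X) f C \<longleftrightarrow> (\<forall>x\<in>X. cmod (f x) \<le> C)"
  using L_infinity_points [of "count_space X"] loc_ess_bound_points [of "count_space X" f C]
  by simp_all

lemma left_invariant_mean_count:
  "left_invariant_mean G (count_space (carrier G)) m \<longleftrightarrow>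
     (\<forall>f h. bounded (f ` carrier G) \<longrightarrow> bounded (h ` carrier G) \<longrightarrow> m (\<lambda>x. f x + h x) = m f + m h) \<and>
     (\<forall>c f. bounded (f ` carrier G) \<longrightarrow> m (\<lambda>x. c * f x) = c * m f) \<and>
     (\<forall>f C. (\<forall>x\<in>carrier G. cmod (f x) \<le> C) \<longrightarrow> 0 \<le> C \<longrightarrow> cmod (m f) \<le> C) \<and>
     m (\<lambda>x. 1) = 1 \<and>
     (\<forall>g\<in>carrier G. \<forall>f. bounded (f ` carrier G) \<longrightarrow> m (\<lambda>x. f (inv\<^bsub>G\<^esub> g \<otimes>\<^bsub>G\<^esub> x)) = m f)"
proof -
  have b: "bounded (f ` carrier G)" if "\<forall>x\<in>carrier G. cmod (f x) \<le> C" for f :: "'a \<Rightarrow> complex" and C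
    unfolding bounded_iff using that by (intro exI [of _ C]) simp
  have "(\<forall>f\<in>{f. bounded (f ` carrier G)}. \<forall>C. (\<forall>x\<in>carrier G. cmod (f x) \<le> C) \<longrightarrow> 0 \<le> C \<longrightarrow> cmod (m f) \<le> C)
    \<longleftrightarrow> (\<forall>f C. (\<forall>x\<in>carrier G. cmod (f x) \<le> C) \<longrightarrow> 0 \<le> C \<longrightarrow> cmod (m f) \<le> C)"
  proof (intro iffI allI impI ballI)
    fix f C assume *: "\<forall>f\<in>{f. bounded (f ` carrier G)}. \<forall>C. (\<forall>x\<in>carrier G. cmod (f x) \<le> C) \<longrightarrow> 0 \<le> C \<longrightarrow> cmod (m f) \<le> C"
      and f: "\<forall>x\<in>carrier G. cmod (f x) \<le> C" and "0 \<le> C"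
    show "cmod (m f) \<le> C" using bspec [OF *, of f] b [OF f] f \<open>0 \<le> C\<close> by simp
  qed simp
  then show ?thesis
    unfolding left_invariant_mean_def count_space_points by (simp add: imp_conjL)
qed

text \<open>The norms in the net may be unbounded, so the functionals are replaced by their positive
  parts divided by their mass. Closeness of n(1) to 1 keeps the mass at least 1/2. The quotients
  respect upper bounds of functions and hence cluster, and dividing by the mass at most doubles the
  error in the invariance. The limit is defined on nonnegative functions and extended to real and
  then to complex ones.\<close>

theorem invariant_mean_from_net:
  fixes G :: "('g, 'm) monoid_scheme" and F :: "(('g \<Rightarrow> complex) \<Rightarrow> complex) filter"
  assumes G: "Group.group G" and F: "F \<noteq> bot"
    and fn: "\<forall>\<^sub>F n in F. bounded_functional (carrier G) n"
    and one: "\<And>\<epsilon>. \<epsilon> > 0 \<Longrightarrow> \<forall>\<^sub>F n in F. cmod (n (\<lambda>x. 1) - 1) \<le> \<epsilon>"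
    and inv: "\<And>k \<epsilon>. k \<in> carrier G \<Longrightarrow> \<epsilon> > 0 \<Longrightarrow> \<forall>\<^sub>F n in F. \<forall>f. (\<forall>x\<in>carrier G. cmod (f x) \<le> 1) \<longrightarrow>
            cmod (n (\<lambda>x. f (k \<otimes>\<^bsub>G\<^esub> x)) - n f) \<le> \<epsilon>"
  shows "\<exists>m. left_invariant_mean G (count_space (carrier G)) m"
proof -
  interpret G: Group.group G by (rule G)
  let ?X = "carrier G"
  let ?pp = "positive_part ?X"
  let ?nb = "nonneg_bounded ?X"
  define \<Phi> where "\<Phi> n f = (if ?nb f then ?pp n f / ?pp n (\<lambda>x. 1) else 0)" for n f
  \<comment> \<open>A bound for each \<open>f\<close> that does not depend on \<open>n\<close>, as
    \<open>bounded_filter_cluster\<close> requires.\<close>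
  define b where "b f = (SOME B. B \<ge> 0 \<and> (?nb f \<longrightarrow> (\<forall>x\<in>?X. f x \<le> B)))" for f
  have "\<exists>B\<ge>0. ?nb f \<longrightarrow> (\<forall>x\<in>?X. f x \<le> B)" for f
  proof (cases "?nb f")
    case True
    then obtain B where "\<forall>x\<in>?X. f x \<le> B" unfolding nonneg_bounded_def by blast
    then show ?thesis by (intro exI [of _ "\<bar>B\<bar>"]) (auto intro: order_trans)
  qed auto
  then have "b f \<ge> 0 \<and> (?nb f \<longrightarrow> (\<forall>x\<in>?X. f x \<le> b f))" for f
    unfolding b_def by (rule someI_ex)
  then have b: "b f \<ge> 0" "?nb f \<Longrightarrow> x \<in> ?X \<Longrightarrow> f x \<le> b f" for f x by blast+
  have nb1: "?nb (\<lambda>x. c)" if "c \<ge> 0" for c using that unfolding nonneg_bounded_def by auto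
  define good where "good n \<longleftrightarrow> bounded_functional ?X n \<and> ?pp n (\<lambda>x. 1) \<ge> 1 / 2" for n
  have "\<forall>\<^sub>F n in F. cmod (n (\<lambda>x. 1) - 1) \<le> 1 / 2" by (rule one) simp
  with fn have evg: "\<forall>\<^sub>F n in F. good n"
  proof eventually_elim
    case (elim n)
    have "Re (n (\<lambda>x. 1)) \<ge> 1 / 2"
      using elim(2) abs_Re_le_cmod [of "n (\<lambda>x. 1) - 1"] by simp
    then show ?case
      using positive_part_upper [OF elim(1) nb1, of 1 "\<lambda>x. 1"] elim(1) unfolding good_def by simp
  qed
  have le: "?pp n f \<le> B * ?pp n (\<lambda>x. 1)" if "good n" "?nb f" "B \<ge> 0" "\<And>x. x \<in> ?X \<Longrightarrow> f x \<le> B" for n f B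
  proof -
    have n: "bounded_functional ?X n" using that(1) unfolding good_def by simp
    \<comment> \<open>\<open>positive_part_smult\<close> needs a positive factor and
      \<open>B\<close> may be 0, hence the extra 1/N. Below, \<open>N\<close> is the mass divided by
      \<epsilon>, which makes the error exactly \<epsilon>.\<close>
    have "?pp n f \<le> ?pp n (\<lambda>x. B + 1 / N)" if N: "N > 0" for N :: real
    proof (rule positive_part_mono [OF n \<open>?nb f\<close> nb1])
      show "0 \<le> B + 1 / N" using N \<open>B \<ge> 0\<close> by simp
      show "f x \<le> B + 1 / N" if "x \<in> ?X" for x
        using \<open>\<And>x. x \<in> ?X \<Longrightarrow> f x \<le> B\<close> [OF that] N by (simp add: add_increasing2)
    qed
    moreover have "?pp n (\<lambda>x. B + 1 / N) = (B + 1 / N) * ?pp n (\<lambda>x. 1)" if "N > 0" for N :: real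
      using positive_part_smult [OF n nb1 [of 1], of "B + 1 / N"] that \<open>B \<ge> 0\<close> by (simp add: add_nonneg_pos)
    ultimately have *: "?pp n f \<le> (B + 1 / N) * ?pp n (\<lambda>x. 1)" if "N > 0" for N :: real using that by metis
    show ?thesis
    proof (rule field_le_epsilon)
      fix \<epsilon> :: real assume "\<epsilon> > 0"
      have pos: "?pp n (\<lambda>x. 1) > 0" using \<open>good n\<close> unfolding good_def by auto
      then have "(B + 1 / (?pp n (\<lambda>x. 1) / \<epsilon>)) * ?pp n (\<lambda>x. 1) = B * ?pp n (\<lambda>x. 1) + \<epsilon>"
        by (simp add: distrib_right)
      then show "?pp n f \<le> B * ?pp n (\<lambda>x. 1) + \<epsilon>"
        using * [of "?pp n (\<lambda>x. 1) / \<epsilon>"] pos \<open>\<epsilon> > 0\<close> by simp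
    qed
  qed
  have "\<forall>\<^sub>F n in F. \<forall>f. \<bar>\<Phi> n f\<bar> \<le> b f"
    using evg
  proof eventually_elim
    case (elim n)
    show ?case
    proof
      fix f
      have n: "bounded_functional ?X n" and pos: "?pp n (\<lambda>x. 1) > 0" using elim unfolding good_def by auto
      show "\<bar>\<Phi> n f\<bar> \<le> b f"
      proof (cases "?nb f")
        case True
        then have "0 \<le> ?pp n f" "?pp n f \<le> b f * ?pp n (\<lambda>x. 1)"
          using positive_part_nonneg [OF n True] le [OF elim True b(1) b(2)] by auto
        then show ?thesis using pos True by (simp add: \<Phi>_def field_simps)
      qed (simp add: \<Phi>_def b)
    qed
  qed
  from bounded_filter_cluster [OF F this] obtain F' Q where F': "F' \<le> F" "F' \<noteq> bot"
    and Q: "\<And>f. ((\<lambda>n. \<Phi> n f) \<longlongrightarrow> Q f) F'" by blast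
  have evg': "\<forall>\<^sub>F n in F'. good n" using evg F'(1) by (rule filter_leD [rotated])
  \<comment> \<open>One form of passage to the limit serves twice: \<open>c = 1\<close> gives
    additivity, and \<open>g = 0\<close> gives homogeneity.\<close>
  have Qeq: "Q f = Q g + c * Q h" if "\<And>n. good n \<Longrightarrow> \<Phi> n f = \<Phi> n g + c * \<Phi> n h" for f g h c
  proof -
    have "((\<lambda>n. \<Phi> n g + c * \<Phi> n h) \<longlongrightarrow> Q g + c * Q h) F'" by (intro tendsto_intros Q)
    then have "((\<lambda>n. \<Phi> n f) \<longlongrightarrow> Q g + c * Q h) F'"
      by (rule Lim_transform_eventually) (use evg' in \<open>eventually_elim, simp add: that\<close>)
    then show ?thesis by (rule tendsto_unique [OF F'(2) Q])
  qed
  have Qadd: "Q (\<lambda>x. f x + g x) = Q f + Q g" if "?nb f" "?nb g" for f g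
    using Qeq [of "\<lambda>x. f x + g x" f 1 g] that nonneg_bounded_add [OF that]
    by (simp add: \<Phi>_def good_def positive_part_add add_divide_distrib)
  have Q0: "Q (\<lambda>x. 0) = 0" using Qadd [OF nb1 [of 0] nb1 [of 0]] by simp
  have Qsm: "Q (\<lambda>x. c * f x) = c * Q f" if "?nb f" "0 \<le> c" for c f
  proof (cases "c = 0")
    case False
    have "\<Phi> n (\<lambda>x. c * f x) = \<Phi> n (\<lambda>x. 0) + c * \<Phi> n f" if "good n" for n
    proof -
      have n: "bounded_functional ?X n" using that unfolding good_def by simp
      have "?pp n (\<lambda>x. 0) = 0"
        using positive_part_add [OF n nb1 [of 0] nb1 [of 0]] by simp
      then show ?thesis
        using positive_part_smult [OF n \<open>?nb f\<close>, of c] False \<open>0 \<le> c\<close> nonneg_bounded_smult [OF \<open>?nb f\<close> \<open>0 \<le> c\<close>] \<open>?nb f\<close> nb1 [of 0]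
        by (simp add: \<Phi>_def)
    qed
    then show ?thesis using Qeq [of "\<lambda>x. c * f x" "\<lambda>x. 0" c f] Q0 by simp
  qed (simp add: Q0)
  have Qge: "0 \<le> Q f" if "?nb f" for f
  proof (rule tendsto_lowerbound [OF Q _ F'(2)])
    show "\<forall>\<^sub>F n in F'. 0 \<le> \<Phi> n f"
      using evg' by eventually_elim (simp add: \<Phi>_def that good_def positive_part_nonneg)
  qed
  have Qle: "Q f \<le> B" if "?nb f" "0 \<le> B" "\<And>x. x \<in> ?X \<Longrightarrow> f x \<le> B" for f B
  proof (rule tendsto_upperbound [OF Q _ F'(2)])
    show "\<forall>\<^sub>F n in F'. \<Phi> n f \<le> B"
      using evg'
    proof eventually_elim
      case (elim n)
      have "?pp n f \<le> B * ?pp n (\<lambda>x. 1)" by (rule le [OF elim that])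
      then show ?case using elim \<open>?nb f\<close> by (simp add: \<Phi>_def good_def field_simps)
    qed
  qed
  have Q1: "Q (\<lambda>x. 1) = 1"
  proof -
    have "((\<lambda>n. 1 :: real) \<longlongrightarrow> Q (\<lambda>x. 1)) F'"
    proof (rule Lim_transform_eventually [OF Q [of "\<lambda>x. 1"]])
      show "\<forall>\<^sub>F n in F'. \<Phi> n (\<lambda>x. 1) = 1"
        using evg' by eventually_elim (use nb1 [of 1] in \<open>simp add: \<Phi>_def good_def\<close>)
    qed
    then show ?thesis by (simp add: tendsto_const_iff [OF F'(2)])
  qed
  have Qcong: "Q f = Q g" if "\<And>x. x \<in> ?X \<Longrightarrow> f x = g x" for f g
  proof -
    have "?nb f = ?nb g" using that unfolding nonneg_bounded_def by simp
    moreover have "?pp n f = ?pp n g" for n unfolding positive_part_def using that by simp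
    ultimately have "\<Phi> n f = \<Phi> n g" for n by (simp add: \<Phi>_def)
    then have "(\<lambda>n. \<Phi> n f) = (\<lambda>n. \<Phi> n g)" by simp
    with Q [of g] have "((\<lambda>n. \<Phi> n f) \<longlongrightarrow> Q g) F'" by (simp only:)
    then show ?thesis by (rule tendsto_unique [OF F'(2) Q])
  qed
  have nbt: "?nb (\<lambda>x. f (k \<otimes>\<^bsub>G\<^esub> x))" if "?nb f" "k \<in> ?X" for f k
    using that unfolding nonneg_bounded_def by (auto intro: G.m_closed)
  \<comment> \<open>One inequality for all \<open>k\<close> is enough: applied to the translate and
    the inverse element it yields the other.\<close>
  have Qtr: "Q (\<lambda>x. f (k \<otimes>\<^bsub>G\<^esub> x)) \<le> Q f" if f: "?nb f" and k: "k \<in> ?X" for f k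
  proof (rule field_le_epsilon)
    fix \<epsilon> :: real assume \<epsilon>: "\<epsilon> > 0"
    define B where "B = b f + 1"
    have B: "B > 0" "\<And>x. x \<in> ?X \<Longrightarrow> f x \<le> B" using b(1) [of f] b(2) [OF f] unfolding B_def by (auto intro: add_increasing2 add_nonneg_pos)
    \<comment> \<open>Scaling to the unit ball costs a factor \<open>B\<close>, so the total error
      is B \<delta> = \<epsilon>/2, which is at most \<epsilon> times the mass since the mass is at
      least 1/2.\<close>
    define \<delta> where "\<delta> = \<epsilon> / (2 * B)"
    have \<delta>: "\<delta> > 0" using \<epsilon> B by (simp add: \<delta>_def)
    have "\<forall>\<^sub>F n in F'. \<forall>f. (\<forall>x\<in>?X. cmod (f x) \<le> 1) \<longrightarrow> cmod (n (\<lambda>x. f (k \<otimes>\<^bsub>G\<^esub> x)) - n f) \<le> \<delta>"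
      using inv [OF k \<delta>] F'(1) by (rule filter_leD [rotated])
    then have "\<forall>\<^sub>F n in F'. \<Phi> n (\<lambda>x. f (k \<otimes>\<^bsub>G\<^esub> x)) \<le> \<Phi> n f + \<epsilon>"
      using evg'
    proof eventually_elim
      case (elim n)
      have n: "bounded_functional ?X n" and pos: "?pp n (\<lambda>x. 1) \<ge> 1 / 2" using elim(2) unfolding good_def by auto
      have "?pp n (\<lambda>x. f (k \<otimes>\<^bsub>G\<^esub> x)) \<le> ?pp n f + B * \<delta>"
      proof (rule positive_part_least [OF n nbt [OF f k]])
        fix h assume h: "\<And>x. x \<in> ?X \<Longrightarrow> 0 \<le> h x \<and> h x \<le> f (k \<otimes>\<^bsub>G\<^esub> x)"
        \<comment> \<open>Translating a competitor \<open>h\<close> for the shifted function back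
          gives a competitor for \<open>f\<close>; almost-invariance compares the values of
          \<open>n\<close> at the two.\<close>
        define h' where "h' y = h (inv\<^bsub>G\<^esub> k \<otimes>\<^bsub>G\<^esub> y)" for y
        have h': "0 \<le> h' y \<and> h' y \<le> f y" if "y \<in> ?X" for y
          using h [of "inv\<^bsub>G\<^esub> k \<otimes>\<^bsub>G\<^esub> y"] that k by (simp add: h'_def G.m_assoc [symmetric])
        have hh: "h' (k \<otimes>\<^bsub>G\<^esub> x) = h x" if "x \<in> ?X" for x
          using that k by (simp add: h'_def G.m_assoc [symmetric])
        let ?u = "\<lambda>x. complex_of_real (h' x / B)"
        have h'1: "\<bar>h' x / B\<bar> \<le> 1" if "x \<in> ?X" for x
          using h' [OF that] B(1) B(2) [OF that] by (simp add: field_simps)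
        then have bu: "bounded (?u ` ?X)" "bounded ((\<lambda>x. ?u (k \<otimes>\<^bsub>G\<^esub> x)) ` ?X)"
          using k by (auto simp: bounded_iff intro!: exI [of _ 1] simp del: of_real_divide)
        have e1: "n (\<lambda>x. of_real (h' x)) = B * n ?u"
          using bounded_functional_smult [OF n bu(1), of B] B(1) by simp
        have e2: "n (\<lambda>x. of_real (h x)) = B * n (\<lambda>x. ?u (k \<otimes>\<^bsub>G\<^esub> x))"
        proof -
          have "n (\<lambda>x. of_real (h x)) = n (\<lambda>x. B * ?u (k \<otimes>\<^bsub>G\<^esub> x))"
            by (rule bounded_functional_cong [OF n _ nonneg_bounded_between [OF n nbt [OF f k] h]])
              (use B(1) hh in simp_all)
          then show ?thesis using bounded_functional_smult [OF n bu(2), of B] by simp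
        qed
        have "Re (n (\<lambda>x. of_real (h x))) - Re (n (\<lambda>x. of_real (h' x)))
            = B * Re (n (\<lambda>x. ?u (k \<otimes>\<^bsub>G\<^esub> x)) - n ?u)"
          unfolding e1 e2 by (simp add: algebra_simps)
        also have "\<dots> \<le> B * \<delta>"
        proof (rule mult_left_mono)
          have "cmod (n (\<lambda>x. ?u (k \<otimes>\<^bsub>G\<^esub> x)) - n ?u) \<le> \<delta>"
            using elim(1) [rule_format, of ?u] h'1 by (simp del: of_real_divide)
          then show "Re (n (\<lambda>x. ?u (k \<otimes>\<^bsub>G\<^esub> x)) - n ?u) \<le> \<delta>"
            using complex_Re_le_cmod order_trans by blast
        qed (use B in simp)
        finally show "Re (n (\<lambda>x. of_real (h x))) \<le> ?pp n f + B * \<delta>"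
          using positive_part_upper [OF n f h'] by simp
      qed
      also have "B * \<delta> \<le> \<epsilon> * ?pp n (\<lambda>x. 1)"
        using pos \<epsilon> B(1) mult_left_mono [OF pos, of \<epsilon>] by (simp add: \<delta>_def)
      finally show ?case using pos f nbt [OF f k] by (simp add: \<Phi>_def field_simps)
    qed
    then show "Q (\<lambda>x. f (k \<otimes>\<^bsub>G\<^esub> x)) \<le> Q f + \<epsilon>"
      by (rule tendsto_le [OF F'(2) tendsto_add [OF Q tendsto_const] Q])
  qed
  have Qinv: "Q (\<lambda>x. f (k \<otimes>\<^bsub>G\<^esub> x)) = Q f" if f: "?nb f" and k: "k \<in> ?X" for f k
  proof (rule antisym [OF Qtr [OF f k]])
    have "Q f = Q (\<lambda>x. f (k \<otimes>\<^bsub>G\<^esub> (inv\<^bsub>G\<^esub> k \<otimes>\<^bsub>G\<^esub> x)))"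
      by (rule Qcong) (use k in \<open>simp add: G.m_assoc [symmetric]\<close>)
    also have "\<dots> \<le> Q (\<lambda>x. f (k \<otimes>\<^bsub>G\<^esub> x))"
      using Qtr [OF nbt [OF f k], of "inv\<^bsub>G\<^esub> k"] k by simp
    finally show "Q f \<le> Q (\<lambda>x. f (k \<otimes>\<^bsub>G\<^esub> x))" .
  qed
  define R where "R f = Q (\<lambda>x. max (f x) 0) - Q (\<lambda>x. max (- f x) 0)" for f
  define bd where "bd f \<longleftrightarrow> (\<exists>B. \<forall>x\<in>?X. \<bar>f x\<bar> \<le> B)" for f :: "'g \<Rightarrow> real"
  have nbm: "?nb (\<lambda>x. max (f x) 0)" "?nb (\<lambda>x. max (- f x) 0)" if f: "bd f" for f
  proof -
    obtain B where B: "\<forall>x\<in>?X. \<bar>f x\<bar> \<le> B" using f unfolding bd_def by blast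
    then have "\<forall>x\<in>?X. max (f x) 0 \<le> \<bar>B\<bar>" "\<forall>x\<in>?X. max (- f x) 0 \<le> \<bar>B\<bar>" by auto
    then show "?nb (\<lambda>x. max (f x) 0)" "?nb (\<lambda>x. max (- f x) 0)" unfolding nonneg_bounded_def by auto
  qed
  have bda: "bd (\<lambda>x. f x + g x)" if f: "bd f" and g: "bd g" for f g
  proof -
    obtain B D where "\<forall>x\<in>?X. \<bar>f x\<bar> \<le> B" "\<forall>x\<in>?X. \<bar>g x\<bar> \<le> D" using f g unfolding bd_def by blast
    then have "\<forall>x\<in>?X. \<bar>f x + g x\<bar> \<le> B + D" by (auto intro!: order_trans [OF abs_triangle_ineq] add_mono)
    then show ?thesis unfolding bd_def by blast
  qed
  have bds: "bd (\<lambda>x. c * f x)" if f: "bd f" for c f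
  proof -
    obtain B where "\<forall>x\<in>?X. \<bar>f x\<bar> \<le> B" using f unfolding bd_def by blast
    then have "\<forall>x\<in>?X. \<bar>c * f x\<bar> \<le> \<bar>c\<bar> * B" by (auto simp: abs_mult intro: mult_left_mono)
    then show ?thesis unfolding bd_def by blast
  qed
  have Radd: "R (\<lambda>x. f x + g x) = R f + R g" if f: "bd f" and g: "bd g" for f g
  proof -
    let ?p = "\<lambda>f x. max (f x) (0::real)" and ?q = "\<lambda>f x. max (- f x) (0::real)" and ?s = "\<lambda>x. f x + g x"
    note s = bda [OF f g]
    \<comment> \<open>The equation s = f + g between positive and negative parts, rearranged so that
      only sums of nonnegative functions occur.\<close>
    have "(\<lambda>x. (?p ?s x + ?q f x) + ?q g x) = (\<lambda>x. (?q ?s x + ?p f x) + ?p g x)"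
      by (auto simp: fun_eq_iff max_def)
    then have "Q (\<lambda>x. (?p ?s x + ?q f x) + ?q g x) = Q (\<lambda>x. (?q ?s x + ?p f x) + ?p g x)" by simp
    moreover have "Q (\<lambda>x. (?p ?s x + ?q f x) + ?q g x) = Q (?p ?s) + Q (?q f) + Q (?q g)"
      using Qadd [OF nonneg_bounded_add [OF nbm(1) [OF s] nbm(2) [OF f]] nbm(2) [OF g]]
        Qadd [OF nbm(1) [OF s] nbm(2) [OF f]] by simp
    moreover have "Q (\<lambda>x. (?q ?s x + ?p f x) + ?p g x) = Q (?q ?s) + Q (?p f) + Q (?p g)"
      using Qadd [OF nonneg_bounded_add [OF nbm(2) [OF s] nbm(1) [OF f]] nbm(1) [OF g]]
        Qadd [OF nbm(2) [OF s] nbm(1) [OF f]] by simp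
    ultimately show ?thesis unfolding R_def by simp
  qed
  have Rneg: "R (\<lambda>x. - f x) = - R f" for f unfolding R_def by simp
  have Rpos: "R (\<lambda>x. c * f x) = c * R f" if "bd f" "c \<ge> 0" for c f
  proof -
    have "max (c * f x) 0 = c * max (f x) 0" "max (- (c * f x)) 0 = c * max (- f x) 0" for x
      using max_mult_distrib_left [of c "f x" 0] max_mult_distrib_left [of c "- f x" 0] \<open>c \<ge> 0\<close> by auto
    then show ?thesis
      unfolding R_def using Qsm [OF nbm(1) [OF that(1)] that(2)] Qsm [OF nbm(2) [OF that(1)] that(2)]
      by (simp add: algebra_simps)
  qed
  have Rsm: "R (\<lambda>x. c * f x) = c * R f" if f: "bd f" for c f
  proof (cases "c \<ge> 0")
    case False
    then show ?thesis using Rpos [OF f, of "- c"] Rneg [of "\<lambda>x. c * f x"] by simp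
  qed (rule Rpos [OF f])
  have Rle: "R f \<le> B" if f: "bd f" and "0 \<le> B" "\<And>x. x \<in> ?X \<Longrightarrow> f x \<le> B" for f B
    using Qle [OF nbm(1) [OF f], of B] Qge [OF nbm(2) [OF f]] that unfolding R_def by force
  have Rinv: "R (\<lambda>x. f (k \<otimes>\<^bsub>G\<^esub> x)) = R f" if f: "bd f" and k: "k \<in> ?X" for f k
    unfolding R_def using Qinv [OF nbm(1) [OF f] k] Qinv [OF nbm(2) [OF f] k] by simp
  have R1: "R (\<lambda>x. 1) = 1" and R0: "R (\<lambda>x. 0) = 0" unfolding R_def using Q1 Q0 by simp_all
  define m where "m f = Complex (R (\<lambda>x. Re (f x))) (R (\<lambda>x. Im (f x)))" for f
  have bRI: "bd (\<lambda>x. Re (f x))" "bd (\<lambda>x. Im (f x))" if f: "bounded (f ` ?X)" for f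
  proof -
    obtain B where "\<forall>x\<in>?X. cmod (f x) \<le> B" using f by (auto simp: bounded_iff)
    then show "bd (\<lambda>x. Re (f x))" "bd (\<lambda>x. Im (f x))"
      unfolding bd_def using abs_Re_le_cmod abs_Im_le_cmod by (meson order_trans)+
  qed
  have msm: "m (\<lambda>x. c * f x) = c * m f" if f: "bounded (f ` ?X)" for c f
  proof -
    have "R (\<lambda>x. Re (c * f x)) = Re c * R (\<lambda>x. Re (f x)) - Im c * R (\<lambda>x. Im (f x))"
      using Radd [OF bds [OF bRI(1) [OF f], of "Re c"] bds [OF bRI(2) [OF f], of "- Im c"]]
        Rsm [OF bRI(1) [OF f], of "Re c"] Rsm [OF bRI(2) [OF f], of "- Im c"] by simp
    moreover have "R (\<lambda>x. Im (c * f x)) = Re c * R (\<lambda>x. Im (f x)) + Im c * R (\<lambda>x. Re (f x))"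
      using Radd [OF bds [OF bRI(2) [OF f], of "Re c"] bds [OF bRI(1) [OF f], of "Im c"]]
        Rsm [OF bRI(1) [OF f], of "Im c"] Rsm [OF bRI(2) [OF f], of "Re c"] by simp
    ultimately show ?thesis unfolding m_def by (simp add: complex_eq_iff)
  qed
  have mbound: "cmod (m f) \<le> C" if fC: "\<forall>x\<in>?X. cmod (f x) \<le> C" and "0 \<le> C" for f C
  proof -
    have f: "bounded (f ` ?X)" using fC by (auto simp: bounded_iff)
    \<comment> \<open>Multiplication by \<open>c\<close> rotates m f to the nonnegative real axis,
      so the complex bound reduces to the upper bound for real functions.\<close>
    define c where "c = cnj (sgn (m f))"
    have c1: "cmod c \<le> 1" by (simp add: c_def norm_sgn)
    have "c * m f = of_real (cmod (m f))"
      by (cases "m f = 0") (simp_all add: c_def sgn_eq complex_norm_square [symmetric] power2_eq_square mult.commute)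
    then have "cmod (m f) = Re (m (\<lambda>x. c * f x))" using msm [OF f, of c] by simp
    also have "\<dots> = R (\<lambda>x. Re (c * f x))" by (simp add: m_def)
    also have "\<dots> \<le> C"
    proof (rule Rle)
      have cf: "cmod (c * f x) \<le> C" if "x \<in> ?X" for x
        using mult_mono [OF c1 bspec [OF fC that]] \<open>0 \<le> C\<close> by (simp add: norm_mult)
      then show "Re (c * f x) \<le> C" if "x \<in> ?X" for x
        using that complex_Re_le_cmod order_trans by blast
      have "bounded ((\<lambda>x. c * f x) ` ?X)" using cf by (auto simp: bounded_iff)
      then show "bd (\<lambda>x. Re (c * f x))" by (rule bRI(1))
    qed (rule \<open>0 \<le> C\<close>)
    finally show ?thesis .
  qed
  have "left_invariant_mean G (count_space ?X) m"
    unfolding left_invariant_mean_count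
  proof (intro conjI allI impI ballI)
    show "m (\<lambda>x. f x + h x) = m f + m h" if "bounded (f ` ?X)" "bounded (h ` ?X)" for f h
      unfolding m_def using Radd [OF bRI(1) [OF that(1)] bRI(1) [OF that(2)]]
        Radd [OF bRI(2) [OF that(1)] bRI(2) [OF that(2)]] by (simp add: complex_eq_iff)
    show "m (\<lambda>x. c * f x) = c * m f" if "bounded (f ` ?X)" for c f by (rule msm [OF that])
    show "cmod (m f) \<le> C" if "\<forall>x\<in>?X. cmod (f x) \<le> C" "0 \<le> C" for f C by (rule mbound [OF that])
    show "m (\<lambda>x. 1) = 1" by (simp add: m_def R1 R0 complex_eq_iff)
    show "m (\<lambda>x. f (inv\<^bsub>G\<^esub> g \<otimes>\<^bsub>G\<^esub> x)) = m f" if "g \<in> ?X" "bounded (f ` ?X)" for g f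
      unfolding m_def using Rinv [OF bRI(1) [OF that(2)], of "inv\<^bsub>G\<^esub> g"] Rinv [OF bRI(2) [OF that(2)], of "inv\<^bsub>G\<^esub> g"] that(1)
      by simp
  qed
  then show ?thesis by blast
qed

section \<open>Discrete and non-discrete amenability\<close>

text \<open>Compact sets of a discrete space are the finite ones. The delicate condition is inner
  regularity of an infinite set: its finite subsets of every cardinality make the supremum
  infinite.\<close>

lemma count_space_left_haar:
  assumes "Group.group G"
  shows "left_haar_measure G (discrete_topology (carrier G)) (count_space (carrier G))"
proof -
  interpret Group.group G by (rule assms)
  let ?X = "carrier G" and ?e = "emeasure (count_space (carrier G))"
  have outer: "?e B = (INF U\<in>{U. openin (discrete_topology ?X) U \<and> B \<subseteq> U}. ?e U)" if "B \<in> sets (count_space ?X)" for B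
  proof (rule antisym)
    show "?e B \<le> (INF U\<in>{U. openin (discrete_topology ?X) U \<and> B \<subseteq> U}. ?e U)"
      by (rule INF_greatest) (auto intro: emeasure_mono)
    show "(INF U\<in>{U. openin (discrete_topology ?X) U \<and> B \<subseteq> U}. ?e U) \<le> ?e B"
      by (rule INF_lower) (use that in auto)
  qed
  have inner: "?e U = (SUP K\<in>{K. compactin (discrete_topology ?X) K \<and> K \<subseteq> U}. ?e K)"
    if "openin (discrete_topology ?X) U" for U
  proof (rule antisym)
    have U: "U \<subseteq> ?X" using that by simp
    let ?S = "SUP K\<in>{K. compactin (discrete_topology ?X) K \<and> K \<subseteq> U}. ?e K"
    have fin: "?e K \<le> ?S" if "finite K" "K \<subseteq> U" for K
      by (rule SUP_upper) (use that U in \<open>auto simp: compactin_discrete_topology\<close>)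
    show "?e U \<le> ?S"
    proof (cases "finite U")
      case False
      have S: "?S = \<infinity>"
      proof (rule ccontr)
        assume "?S \<noteq> \<infinity>"
        then have "?S < top_class.top" by (simp only: infinity_ennreal_def top.not_eq_extremum)
        from ennreal_Ex_less_of_nat [OF this] obtain n where n: "?S < of_nat n" by blast
        obtain K where K: "finite K" "K \<subseteq> U" "card K = n"
          using infinite_arbitrarily_large [OF False, of n] by auto
        then have "?e K = of_nat n" using U by simp
        then show False using fin [OF K(1,2)] n by simp
      qed
      show ?thesis unfolding S by simp
    qed (use fin in simp)
    show "?S \<le> ?e U" by (rule SUP_least) (use U in \<open>auto intro: emeasure_mono\<close>)
  qed
  have tr: "?e ((\<lambda>x. g \<otimes>\<^bsub>G\<^esub> x) ` B) = ?e B" if g: "g \<in> ?X" and "B \<in> sets (count_space ?X)" for g B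
  proof -
    have B: "B \<subseteq> ?X" using that by simp
    then have inj: "inj_on (\<lambda>x. g \<otimes>\<^bsub>G\<^esub> x) B" using g by (auto intro!: inj_onI simp: subset_iff)
    have im: "(\<lambda>x. g \<otimes>\<^bsub>G\<^esub> x) ` B \<subseteq> ?X" using B g by auto
    show ?thesis
      using B im card_image [OF inj] finite_image_iff [OF inj] by (simp add: emeasure_count_space)
  qed
  have sg: "sigma_sets ?X {U. openin (discrete_topology ?X) U} = Pow ?X"
    using sigma_algebra.sigma_sets_eq [OF sigma_algebra_Pow, of ?X] by (simp add: Pow_def)
  show ?thesis
    unfolding left_haar_measure_def sg
  proof (intro conjI ballI allI impI)
    have "?e {\<one>\<^bsub>G\<^esub>} \<le> ?e ?X" by (rule emeasure_mono) auto
    then show "?e ?X \<noteq> 0" by auto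
    show "?e K < \<infinity>" if "compactin (discrete_topology ?X) K" for K
      using that by (simp add: compactin_discrete_topology less_top [symmetric])
  qed ((rule outer inner tr; assumption) | simp)+
qed

lemma left_haar_measureD:
  assumes "left_haar_measure G \<tau> \<mu>"
  shows "space \<mu> = carrier G" and "sets \<mu> = sigma_sets (carrier G) {U. openin \<tau> U}"
    and "emeasure \<mu> (carrier G) \<noteq> 0"
    and "\<forall>K. compactin \<tau> K \<longrightarrow> emeasure \<mu> K < \<infinity>"
    and "\<forall>U. openin \<tau> U \<longrightarrow> emeasure \<mu> U = (SUP K\<in>{K. compactin \<tau> K \<and> K \<subseteq> U}. emeasure \<mu> K)"
    and "\<forall>g\<in>carrier G. \<forall>B\<in>sets \<mu>. emeasure \<mu> ((\<lambda>x. g \<otimes>\<^bsub>G\<^esub> x) ` B) = emeasure \<mu> B"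
  using assms unfolding left_haar_measure_def by - (elim conjE, assumption)+

text \<open>Translation gives all points the same measure. Were it 0, all finite sets, which are the
  compact ones, would be null, and inner regularity would make the whole group null.\<close>

lemma discrete_haar_points:
  assumes "Group.group G" and \<mu>: "left_haar_measure G (discrete_topology (carrier G)) \<mu>"
  shows "space \<mu> = carrier G" "sets \<mu> = Pow (carrier G)"
    and "x \<in> carrier G \<Longrightarrow> 0 < emeasure \<mu> {x} \<and> emeasure \<mu> {x} < \<infinity>"
proof -
  interpret Group.group G by (rule assms)
  let ?X = "carrier G"
  note D = left_haar_measureD [OF \<mu>]
  have "sigma_sets ?X {U. openin (discrete_topology ?X) U} = Pow ?X"
    using sigma_algebra.sigma_sets_eq [OF sigma_algebra_Pow, of ?X] by (simp add: Pow_def)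
  then show sp: "space \<mu> = ?X" and st: "sets \<mu> = Pow ?X" using D(1,2) by simp_all
  have fin: "emeasure \<mu> {x} < \<infinity>" if "x \<in> ?X" for x
    by (rule D(4) [rule_format]) (use that in \<open>simp add: compactin_discrete_topology\<close>)
  have tr: "emeasure \<mu> {g \<otimes>\<^bsub>G\<^esub> x} = emeasure \<mu> {x}" if "g \<in> ?X" "x \<in> ?X" for g x
  proof -
    have "emeasure \<mu> ((\<lambda>x. g \<otimes>\<^bsub>G\<^esub> x) ` {x}) = emeasure \<mu> {x}"
      by (rule D(6) [rule_format]) (use that st in auto)
    then show ?thesis by simp
  qed
  have pos: "emeasure \<mu> {x} \<noteq> 0" if x: "x \<in> ?X" for x
  proof
    assume z: "emeasure \<mu> {x} = 0"
    have z': "emeasure \<mu> {y} = 0" if "y \<in> ?X" for y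
      using tr [of "y \<otimes>\<^bsub>G\<^esub> inv\<^bsub>G\<^esub> x" x] x that z by (simp add: m_assoc)
    have "emeasure \<mu> K = 0" if "finite K" "K \<subseteq> ?X" for K
    proof -
      have "emeasure \<mu> K = (\<Sum>y\<in>K. emeasure \<mu> {y})"
        by (rule emeasure_eq_sum_singleton) (use that st in auto)
      also have "\<dots> = 0" by (rule sum.neutral) (use that z' in blast)
      finally show ?thesis .
    qed
    then have "(SUP K\<in>{K. compactin (discrete_topology ?X) K \<and> K \<subseteq> ?X}. emeasure \<mu> K) \<le> 0"
      by (intro SUP_least) (simp add: compactin_discrete_topology)
    moreover have "emeasure \<mu> ?X = (SUP K\<in>{K. compactin (discrete_topology ?X) K \<and> K \<subseteq> ?X}. emeasure \<mu> K)"
      by (rule D(5) [rule_format]) simp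
    ultimately show False using D(3) by (simp only: le_zero_eq)
  qed
  show "0 < emeasure \<mu> {x} \<and> emeasure \<mu> {x} < \<infinity>" if "x \<in> ?X"
    using fin [OF that] pos [OF that] by (simp add: zero_less_iff_neq_zero)
qed

lemma discrete_locally_compact_group:
  assumes "Group.group G" shows "locally_compact_group G (discrete_topology (carrier G))"
proof -
  interpret Group.group G by (rule assms)
  show ?thesis
    unfolding locally_compact_group_def prod_topology_discrete_topology [symmetric]
    by (auto simp: assms locally_compact_space_discrete_topology)
qed

theorem amenable_discrete_iff:
  assumes G: "Group.group G"
  shows "amenable_group G (discrete_topology (carrier G)) \<longleftrightarrow>
    (\<exists>m. left_invariant_mean G (count_space (carrier G)) m)"
proof
  assume "amenable_group G (discrete_topology (carrier G))"
  then show "\<exists>m. left_invariant_mean G (count_space (carrier G)) m"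
    using count_space_left_haar [OF G] unfolding amenable_group_def by blast
next
  assume "\<exists>m. left_invariant_mean G (count_space (carrier G)) m"
  then obtain m where m: "left_invariant_mean G (count_space (carrier G)) m" by blast
  have "left_invariant_mean G \<mu> m" if \<mu>: "left_haar_measure G (discrete_topology (carrier G)) \<mu>" for \<mu>
  proof -
    note d = discrete_haar_points [OF G \<mu>]
    have p: "{x} \<in> sets \<mu> \<and> 0 < emeasure \<mu> {x} \<and> emeasure \<mu> {x} < \<infinity>" if "x \<in> space \<mu>" for x
      using d that by simp
    have "L_infinity \<mu> = L_infinity (count_space (carrier G))"
      using L_infinity_points [OF p] d by (simp add: count_space_points)
    moreover have "loc_ess_bound \<mu> f C \<longleftrightarrow> (\<forall>x\<in>space \<mu>. cmod (f x) \<le> C)" for f C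
      by (rule loc_ess_bound_points, rule p)
    then have "loc_ess_bound \<mu> = loc_ess_bound (count_space (carrier G))"
      by (intro ext) (simp add: d(1) count_space_points)
    ultimately show ?thesis using m unfolding left_invariant_mean_def by simp
  qed
  then show "amenable_group G (discrete_topology (carrier G))"
    unfolding amenable_group_def using discrete_locally_compact_group [OF G] by blast
qed

text \<open>A mean for the discrete group is applied to the averages of a function over the translates of a
  fixed set of positive finite measure.\<close>

theorem amenable_discrete_imp_amenable:
  assumes \<tau>: "locally_compact_group G \<tau>" and am: "amenable_group G (discrete_topology (carrier G))"
  shows "amenable_group G \<tau>"
proof -
  have G: "Group.group G" using \<tau> unfolding locally_compact_group_def by blast
  interpret G: Group.group G by (rule G)
  let ?X = "carrier G"
  obtain m0 where m0: "left_invariant_mean G (count_space ?X) m0"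
    using am amenable_discrete_iff [OF G] by blast
  note m = m0 [unfolded left_invariant_mean_count]
  note madd = m [THEN conjunct1, rule_format] and msmult = m [THEN conjunct2, THEN conjunct1, rule_format]
    and mbound = m [THEN conjunct2, THEN conjunct2, THEN conjunct1, rule_format]
    and mone = m [THEN conjunct2, THEN conjunct2, THEN conjunct2, THEN conjunct1]
    and minv = m [THEN conjunct2, THEN conjunct2, THEN conjunct2, THEN conjunct2, rule_format]
  have "\<exists>m. left_invariant_mean G \<mu> m" if \<mu>: "left_haar_measure G \<tau> \<mu>" for \<mu>
  proof -
    note D = left_haar_measureD [OF \<mu>]
    note sp = D(1) and st = D(2) and nz = D(3) and cpt = D(4) [rule_format] and inner = D(5) [rule_format]
      and inv = D(6) [rule_format]
    have top: "topspace \<tau> = ?X" and hd: "Hausdorff_space \<tau>"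
      and cm: "continuous_map (prod_topology \<tau> \<tau>) \<tau> (\<lambda>(x, y). x \<otimes>\<^bsub>G\<^esub> y)"
      using \<tau> unfolding locally_compact_group_def by blast+
    \<comment> \<open>The group is not null, so inner regularity yields a compact set of positive
      measure; compactness makes the measure finite.\<close>
    have "\<exists>K. compactin \<tau> K \<and> emeasure \<mu> K \<noteq> 0"
    proof (rule ccontr)
      assume "\<not> ?thesis"
      then have "(SUP K\<in>{K. compactin \<tau> K \<and> K \<subseteq> ?X}. emeasure \<mu> K) \<le> 0"
        by (intro SUP_least) auto
      moreover have "openin \<tau> ?X" using openin_topspace [of \<tau>] top by simp
      note inner [OF this]
      ultimately show False using nz by (simp only: le_zero_eq)
    qed
    then obtain K where K: "compactin \<tau> K" "emeasure \<mu> K \<noteq> 0" by blast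
    have KX: "K \<subseteq> ?X" using compactin_subset_topspace [OF K(1)] top by simp
    have "closedin \<tau> K" by (rule compactin_imp_closedin [OF hd K(1)])
    then have "openin \<tau> (?X - K)" using top by (simp add: closedin_def)
    then have "?X - (?X - K) \<in> sets \<mu>" unfolding st by (intro sigma_sets.Compl sigma_sets.Basic) simp
    then have Ks: "K \<in> sets \<mu>" using KX by (simp add: double_diff)
    have Kf: "emeasure \<mu> K < \<infinity>" by (rule cpt [OF K(1)])
    define w where "w = measure \<mu> K"
    have w: "w > 0" using K(2) Kf unfolding w_def
      by (metis emeasure_eq_ennreal_measure ennreal_0 infinity_ennreal_def less_irrefl measure_nonneg order_le_less top.not_eq_extremum)
    have trm: "(\<lambda>x. g \<otimes>\<^bsub>G\<^esub> x) \<in> measurable \<mu> \<mu>" if g: "g \<in> ?X" for g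
    proof (rule measurable_sigma_sets [OF st])
      have cg: "continuous_map \<tau> \<tau> (\<lambda>x. g \<otimes>\<^bsub>G\<^esub> x)"
      proof -
        have "continuous_map \<tau> (prod_topology \<tau> \<tau>) (\<lambda>x. (g, x))"
          using g top by (intro continuous_map_pairedI) auto
        from continuous_map_compose [OF this cm] show ?thesis by (simp add: o_def)
      qed
      show "{U. openin \<tau> U} \<subseteq> Pow ?X" using openin_subset top by blast
      show "(\<lambda>x. g \<otimes>\<^bsub>G\<^esub> x) \<in> space \<mu> \<rightarrow> ?X" using g sp by simp
      fix U assume "U \<in> {U. openin \<tau> U}"
      then have "openin \<tau> {x \<in> ?X. g \<otimes>\<^bsub>G\<^esub> x \<in> U}"
        using openin_continuous_map_preimage [OF cg, of U] top by simp
      moreover have "(\<lambda>x. g \<otimes>\<^bsub>G\<^esub> x) -` U \<inter> space \<mu> = {x \<in> ?X. g \<otimes>\<^bsub>G\<^esub> x \<in> U}" using sp by auto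
      ultimately show "(\<lambda>x. g \<otimes>\<^bsub>G\<^esub> x) -` U \<inter> space \<mu> \<in> sets \<mu>" unfolding st by (auto intro: sigma_sets.Basic)
    qed
    have im: "(\<lambda>x. g \<otimes>\<^bsub>G\<^esub> x) ` B = (\<lambda>x. inv\<^bsub>G\<^esub> g \<otimes>\<^bsub>G\<^esub> x) -` B \<inter> space \<mu>" if "g \<in> ?X" "B \<subseteq> ?X" for g B
    proof (intro equalityI subsetI)
      fix y assume "y \<in> (\<lambda>x. inv\<^bsub>G\<^esub> g \<otimes>\<^bsub>G\<^esub> x) -` B \<inter> space \<mu>"
      then have "y = g \<otimes>\<^bsub>G\<^esub> (inv\<^bsub>G\<^esub> g \<otimes>\<^bsub>G\<^esub> y)" "inv\<^bsub>G\<^esub> g \<otimes>\<^bsub>G\<^esub> y \<in> B"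
        using that sp by (auto simp: G.m_assoc [symmetric])
      then show "y \<in> (\<lambda>x. g \<otimes>\<^bsub>G\<^esub> x) ` B" by blast
    qed (use that sp in \<open>auto simp: G.m_assoc [symmetric] subset_iff\<close>)
    have tr: "(\<lambda>x. g \<otimes>\<^bsub>G\<^esub> x) ` B \<in> sets \<mu>" if g: "g \<in> ?X" and B: "B \<in> sets \<mu>" for g B
      using measurable_sets [OF trm [of "inv\<^bsub>G\<^esub> g"] B] im [OF g, of B] sets.sets_into_space [OF B] g sp by simp
    have fm: "(\<lambda>x. g \<otimes>\<^bsub>G\<^esub> x) ` K \<in> fmeasurable \<mu>" if g: "g \<in> ?X" for g
      using tr [OF g Ks] inv [OF g Ks] Kf by (intro fmeasurableI) auto
    \<comment> \<open>The average over the translate g K is computed as an integral over the fixed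
      set \<open>K\<close> of x \<mapsto> f(g x), so that translating \<open>f\<close> becomes
      translation of the variable \<open>g\<close>.\<close>
    define u where "u f g x = indicator K x *\<^sub>R f (g \<otimes>\<^bsub>G\<^esub> x)" for f :: "'a \<Rightarrow> complex" and g x
    \<comment> \<open>Only the restrictions of \<open>f\<close> to sets of finite measure are known
      to be measurable. The set g K is one, and the restriction to it is pulled back to
      \<open>K\<close>.\<close>
    have um: "u f g \<in> borel_measurable \<mu>" if f: "f \<in> L_infinity \<mu>" and g: "g \<in> ?X" for f g
    proof -
      let ?gK = "(\<lambda>x. g \<otimes>\<^bsub>G\<^esub> x) ` K"
      have "f \<in> borel_measurable (restrict_space \<mu> ?gK)" using f fm [OF g] unfolding L_infinity_def by blast
      moreover have "(\<lambda>x. g \<otimes>\<^bsub>G\<^esub> x) \<in> measurable (restrict_space \<mu> K) (restrict_space \<mu> ?gK)"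
        using trm [OF g] by (intro measurable_restrict_space2 measurable_restrict_space1) (auto simp: space_restrict_space)
      ultimately have "(\<lambda>x. f (g \<otimes>\<^bsub>G\<^esub> x)) \<in> borel_measurable (restrict_space \<mu> K)"
        by (rule measurable_compose [rotated])
      then show ?thesis
        unfolding u_def using borel_measurable_restrict_space_iff [of K \<mu> "\<lambda>x. f (g \<otimes>\<^bsub>G\<^esub> x)"] Ks KX sp
        by (simp add: Int_absorb2)
    qed
    have ub: "AE x in \<mu>. norm (u f g x) \<le> C * indicator K x" if f: "loc_ess_bound \<mu> f C" and g: "g \<in> ?X" for f g C
    proof -
      let ?gK = "(\<lambda>x. g \<otimes>\<^bsub>G\<^esub> x) ` K"
      have "AE y in \<mu>. y \<in> ?gK \<longrightarrow> cmod (f y) \<le> C" using f fm [OF g] unfolding loc_ess_bound_def by blast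
      then obtain N where N: "{y \<in> space \<mu>. \<not> (y \<in> ?gK \<longrightarrow> cmod (f y) \<le> C)} \<subseteq> N" "emeasure \<mu> N = 0" "N \<in> sets \<mu>"
        by (rule AE_E)
      let ?N = "(\<lambda>x. inv\<^bsub>G\<^esub> g \<otimes>\<^bsub>G\<^esub> x) ` N"
      have NX: "N \<subseteq> ?X" using sets.sets_into_space [OF N(3)] sp by simp
      have N': "?N \<in> null_sets \<mu>"
        using tr [of "inv\<^bsub>G\<^esub> g" N] inv [of "inv\<^bsub>G\<^esub> g" N] N g by (intro null_setsI) auto
      show ?thesis
      proof (rule AE_I' [OF N'], safe)
        fix x assume x: "x \<in> space \<mu>" and n: "\<not> norm (u f g x) \<le> C * indicator K x"
        have xK: "x \<in> K" using n by (cases "x \<in> K") (auto simp: u_def)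
        then have "\<not> cmod (f (g \<otimes>\<^bsub>G\<^esub> x)) \<le> C" using n by (simp add: u_def)
        then have "g \<otimes>\<^bsub>G\<^esub> x \<in> N" using N(1) xK x g sp by auto
        moreover have "x = inv\<^bsub>G\<^esub> g \<otimes>\<^bsub>G\<^esub> (g \<otimes>\<^bsub>G\<^esub> x)" using g x sp by (simp add: G.m_assoc [symmetric])
        ultimately show "x \<in> ?N" by blast
      qed
    qed
    have Ki: "integrable \<mu> (\<lambda>x. C * indicator K x)" for C :: real
      using Ks Kf by (intro integrable_mult_right integrable_real_indicator) auto
    have ui: "integrable \<mu> (u f g)" if f: "f \<in> L_infinity \<mu>" and g: "g \<in> ?X" for f g
    proof -
      obtain C where "loc_ess_bound \<mu> f C" using f unfolding L_infinity_def by blast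
      from ub [OF this g] have "AE x in \<mu>. norm (u f g x) \<le> norm (C * indicator K x)"
        by (rule eventually_mono) simp
      then show ?thesis by (rule Bochner_Integration.integrable_bound [OF Ki um [OF f g]])
    qed
    define \<Psi> where "\<Psi> f g = (if g \<in> ?X then (\<integral>x. u f g x \<partial>\<mu>) / w else 0)" for f g
    have \<Psi>b: "cmod (\<Psi> f g) \<le> C" if f: "f \<in> L_infinity \<mu>" "loc_ess_bound \<mu> f C" "0 \<le> C" and g: "g \<in> ?X" for f C g
    proof -
      have "cmod (\<integral>x. u f g x \<partial>\<mu>) \<le> (\<integral>x. cmod (u f g x) \<partial>\<mu>)"
        by (rule Bochner_Integration.integral_norm_bound)
      also have "\<dots> \<le> (\<integral>x. C * indicator K x \<partial>\<mu>)"
        by (rule integral_mono_AE [OF integrable_norm [OF ui [OF f(1) g]] Ki ub [OF f(2) g]])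
      also have "\<dots> = C * w" using Ks Kf by (simp add: w_def)
      finally show ?thesis using w g by (simp add: \<Psi>_def norm_divide field_simps)
    qed
    have \<Psi>bd: "bounded (\<Psi> f ` ?X)" if f: "f \<in> L_infinity \<mu>" for f
    proof -
      obtain C where C: "loc_ess_bound \<mu> f C" using f unfolding L_infinity_def by blast
      then have "loc_ess_bound \<mu> f \<bar>C\<bar>" unfolding loc_ess_bound_def
        by (auto elim!: eventually_mono)
      from \<Psi>b [OF f this] show ?thesis by (intro boundedI [of _ "\<bar>C\<bar>"]) auto
    qed
    have mcong: "m0 p = m0 q" if "\<And>x. x \<in> ?X \<Longrightarrow> p x = q x" "bounded (q ` ?X)" for p q
    proof -
      have d: "cmod (p x - q x) \<le> 0" if "x \<in> ?X" for x using \<open>\<And>x. x \<in> ?X \<Longrightarrow> p x = q x\<close> [OF that] by simp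
      then have "cmod (m0 (\<lambda>x. p x - q x)) \<le> 0" by (intro mbound) simp_all
      moreover have "bounded ((\<lambda>x. p x - q x) ` ?X)" by (rule boundedI [of _ 0]) (use d in blast)
      then have "m0 (\<lambda>x. (p x - q x) + q x) = m0 (\<lambda>x. p x - q x) + m0 q" using that(2) by (rule madd)
      ultimately show ?thesis by simp
    qed
    have "left_invariant_mean G \<mu> (\<lambda>f. m0 (\<Psi> f))"
      unfolding left_invariant_mean_def
    proof (intro conjI ballI allI impI)
      fix f assume f: "f \<in> L_infinity \<mu>"
      show "m0 (\<Psi> (\<lambda>x. c * f x)) = c * m0 (\<Psi> f)" for c
      proof -
        have "u (\<lambda>x. c * f x) g = (\<lambda>x. c * u f g x)" for g by (simp add: u_def fun_eq_iff)
        then have "\<Psi> (\<lambda>x. c * f x) = (\<lambda>g. c * \<Psi> f g)" by (simp add: \<Psi>_def fun_eq_iff)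
        then show ?thesis using msmult [OF \<Psi>bd [OF f]] by simp
      qed
      show "m0 (\<Psi> (\<lambda>x. f x + h x)) = m0 (\<Psi> f) + m0 (\<Psi> h)" if h: "h \<in> L_infinity \<mu>" for h
      proof -
        have "u (\<lambda>x. f x + h x) g = (\<lambda>x. u f g x + u h g x)" for g
          by (simp add: u_def fun_eq_iff scaleR_add_right)
        then have "\<Psi> (\<lambda>x. f x + h x) g = \<Psi> f g + \<Psi> h g" for g
          using ui [OF f, of g] ui [OF h, of g] by (simp add: \<Psi>_def add_divide_distrib)
        then have "\<Psi> (\<lambda>x. f x + h x) = (\<lambda>g. \<Psi> f g + \<Psi> h g)" by (rule ext)
        then show ?thesis using madd [OF \<Psi>bd [OF f] \<Psi>bd [OF h]] by simp
      qed
      show "cmod (m0 (\<Psi> f)) \<le> C" if "loc_ess_bound \<mu> f C" "0 \<le> C" for C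
        by (rule mbound [OF \<Psi>b [OF f that] that(2)])
      fix g assume g: "g \<in> ?X"
      \<comment> \<open>Translating \<open>f\<close> translates its averages as a function on the
        group, so the invariance of \<open>m0\<close> applies.\<close>
      have "m0 (\<Psi> (\<lambda>x. f (inv\<^bsub>G\<^esub> g \<otimes>\<^bsub>G\<^esub> x))) = m0 (\<lambda>h. \<Psi> f (inv\<^bsub>G\<^esub> g \<otimes>\<^bsub>G\<^esub> h))"
      proof (rule mcong)
        fix h assume h: "h \<in> ?X"
        have "u (\<lambda>x. f (inv\<^bsub>G\<^esub> g \<otimes>\<^bsub>G\<^esub> x)) h x = u f (inv\<^bsub>G\<^esub> g \<otimes>\<^bsub>G\<^esub> h) x" for x
          using KX g h by (cases "x \<in> K") (auto simp: u_def G.m_assoc)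
        then have "u (\<lambda>x. f (inv\<^bsub>G\<^esub> g \<otimes>\<^bsub>G\<^esub> x)) h = u f (inv\<^bsub>G\<^esub> g \<otimes>\<^bsub>G\<^esub> h)" by (rule ext)
        then show "\<Psi> (\<lambda>x. f (inv\<^bsub>G\<^esub> g \<otimes>\<^bsub>G\<^esub> x)) h = \<Psi> f (inv\<^bsub>G\<^esub> g \<otimes>\<^bsub>G\<^esub> h)"
          using g h by (simp add: \<Psi>_def)
      next
        show "bounded ((\<lambda>h. \<Psi> f (inv\<^bsub>G\<^esub> g \<otimes>\<^bsub>G\<^esub> h)) ` ?X)"
          by (rule bounded_subset [OF \<Psi>bd [OF f]]) (use g in auto)
      qed
      also have "\<dots> = m0 (\<Psi> f)" by (rule minv [OF g \<Psi>bd [OF f]])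
      finally show "m0 (\<Psi> (\<lambda>x. f (inv\<^bsub>G\<^esub> g \<otimes>\<^bsub>G\<^esub> x))) = m0 (\<Psi> f)" .
    next
      have "m0 (\<Psi> (\<lambda>x. 1)) = m0 (\<lambda>x. 1)"
      proof (rule mcong)
        have "integrable \<mu> (indicat_real K)" using Ki [of 1] by simp
        then have "(\<integral>x. indicator K x *\<^sub>R (1 :: complex) \<partial>\<mu>) = (\<integral>x. indicator K x \<partial>\<mu>) *\<^sub>R 1"
          by (intro integral_scaleR_left) simp
        moreover have "(\<integral>x. indicator K x \<partial>\<mu>) = w"
          unfolding w_def Bochner_Integration.integral_indicator using KX sp by (simp add: Int_absorb2)
        moreover have "u (\<lambda>x. 1) g = (\<lambda>x. indicator K x *\<^sub>R (1 :: complex))" for g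
          by (rule ext) (simp only: u_def)
        ultimately have "(\<integral>x. u (\<lambda>x. 1) g x \<partial>\<mu>) = of_real w" for g
          by (simp only: scaleR_conv_of_real mult_1_right)
        then show "\<Psi> (\<lambda>x. 1) g = 1" if "g \<in> ?X" for g using w that by (simp add: \<Psi>_def)
        show "bounded ((\<lambda>x. 1 :: complex) ` ?X)" by (rule boundedI [of _ 1]) auto
      qed
      then show "m0 (\<Psi> (\<lambda>x. 1)) = 1" using mone by simp
    qed
    then show ?thesis by blast
  qed
  then show ?thesis using \<tau> unfolding amenable_group_def by blast
qed

section \<open>Bimodules of bounded functions\<close>

text \<open>A scheme for bimodules of bounded functions on a set that vanish on \<open>N\<close>. A
  point mass at s acts by x \<mapsto> x(l s \<omega>) on one side and by x \<mapsto> x(r s \<omega>)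
  - x(r' s \<omega>) on the other; the subtracted term can restore the vanishing on
  \<open>N\<close>. The derivation sends it to evaluation at d s minus evaluation at d' s. The
  assumptions are the bimodule laws and the product rule on point masses, required for functions
  that vanish on \<open>N\<close>. The map \<open>enc\<close> moves the carrier into the type over
  which approximate amenability quantifies.\<close>

locale point_module = ell1_algebra S op
  for S :: "'s set" and op +
  fixes l r r' :: "'s \<Rightarrow> 'w \<Rightarrow> 'w" and N :: "'w set" and d d' :: "'s \<Rightarrow> 'w"
    and enc :: "('w \<Rightarrow> complex) \<Rightarrow> 'y"
  assumes inj_enc: "inj enc"
    and l_zero: "\<lbrakk>\<forall>\<omega>\<in>N. x \<omega> = (0::complex); s \<in> S; \<omega> \<in> N\<rbrakk> \<Longrightarrow> x (l s \<omega>) = 0"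
    and r_zero: "\<lbrakk>\<forall>\<omega>\<in>N. x \<omega> = (0::complex); s \<in> S; \<omega> \<in> N\<rbrakk> \<Longrightarrow> x (r s \<omega>) = x (r' s \<omega>)"
    and l_mult: "\<lbrakk>\<forall>\<omega>\<in>N. x \<omega> = (0::complex); s \<in> S; t \<in> S\<rbrakk> \<Longrightarrow> x (l (op s t) \<omega>) = x (l t (l s \<omega>))"
    and r_mult: "\<lbrakk>\<forall>\<omega>\<in>N. x \<omega> = (0::complex); s \<in> S; t \<in> S\<rbrakk> \<Longrightarrow>
      x (r (op s t) \<omega>) - x (r' (op s t) \<omega>)
        = (x (r s (r t \<omega>)) - x (r' s (r t \<omega>))) - (x (r s (r' t \<omega>)) - x (r' s (r' t \<omega>)))"
    and l_r: "\<lbrakk>\<forall>\<omega>\<in>N. x \<omega> = (0::complex); s \<in> S; t \<in> S\<rbrakk> \<Longrightarrow>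
      x (r t (l s \<omega>)) - x (r' t (l s \<omega>)) = x (l s (r t \<omega>)) - x (l s (r' t \<omega>))"
    and d_mult: "\<lbrakk>\<forall>\<omega>\<in>N. x \<omega> = (0::complex); s \<in> S; t \<in> S\<rbrakk> \<Longrightarrow>
      x (d (op s t)) - x (d' (op s t))
        = ((x (r s (d t)) - x (r' s (d t))) - (x (r s (d' t)) - x (r' s (d' t)))) + (x (l t (d s)) - x (l t (d' s)))"
begin

definition test_functions :: "('w \<Rightarrow> complex) set" where
  "test_functions = {x. bounded (range x) \<and> (\<forall>\<omega>\<in>N. x \<omega> = 0)}"

definition left_action where "left_action a x \<omega> = pairing (\<lambda>s. x (l s \<omega>)) a"

definition right_action where "right_action a x \<omega> = pairing (\<lambda>s. x (r s \<omega>) - x (r' s \<omega>)) a"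

definition dec :: "'y \<Rightarrow> 'w \<Rightarrow> complex" where "dec = inv_into UNIV enc"

definition sup_norm :: "('w \<Rightarrow> complex) \<Rightarrow> real" where "sup_norm x = (SUP \<omega>. cmod (x \<omega>))"

definition point_bimodule :: "('s \<Rightarrow> complex, 'y) bimodule" where
  "point_bimodule = \<lparr>carrier = enc ` test_functions, mult = undefined, one = undefined,
     zero = enc (\<lambda>\<omega>. 0), add = (\<lambda>x y. enc (\<lambda>\<omega>. dec x \<omega> + dec y \<omega>)),
     smult = (\<lambda>c x. enc (\<lambda>\<omega>. c * dec x \<omega>)), vnorm = (\<lambda>x. sup_norm (dec x)),
     lact = (\<lambda>a x. enc (left_action a (dec x))), ract = (\<lambda>x a. enc (right_action a (dec x)))\<rparr>"

definition point_derivation where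
  "point_derivation a = (\<lambda>y\<in>carrier point_bimodule. pairing (\<lambda>s. dec y (d s) - dec y (d' s)) a)"

lemma dec_enc [simp]: "dec (enc x) = x"
  by (simp add: dec_def inj_enc)

lemma pb_simps [simp]:
  "carrier point_bimodule = enc ` test_functions"
  "\<zero>\<^bsub>point_bimodule\<^esub> = enc (\<lambda>\<omega>. 0)"
  "enc x \<oplus>\<^bsub>point_bimodule\<^esub> enc y = enc (\<lambda>\<omega>. x \<omega> + y \<omega>)"
  "c \<odot>\<^bsub>point_bimodule\<^esub> enc x = enc (\<lambda>\<omega>. c * x \<omega>)"
  "vnorm point_bimodule (enc x) = sup_norm x"
  "lact point_bimodule a (enc x) = enc (left_action a x)"
  "ract point_bimodule (enc x) a = enc (right_action a x)"
  by (simp_all add: point_bimodule_def)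

lemma test_functionD:
  assumes "x \<in> test_functions"
  shows "\<forall>\<omega>\<in>N. x \<omega> = 0" and "bdd_above (range (\<lambda>\<omega>. cmod (x \<omega>)))"
  using assms unfolding test_functions_def
  by (simp_all add: bounded_norm_comp bounded_imp_bdd_above)

lemma test_functionI:
  assumes "\<And>\<omega>. cmod (x \<omega>) \<le> C" "\<And>\<omega>. \<omega> \<in> N \<Longrightarrow> x \<omega> = 0" shows "x \<in> test_functions"
  unfolding test_functions_def using assms by (auto intro: boundedI [of _ C])

lemma sup_norm_ge: "x \<in> test_functions \<Longrightarrow> cmod (x \<omega>) \<le> sup_norm x"
  unfolding sup_norm_def by (rule cSUP_upper) (auto dest: test_functionD(2))

lemma sup_norm_le: "(\<And>\<omega>. cmod (x \<omega>) \<le> C) \<Longrightarrow> sup_norm x \<le> C"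
  unfolding sup_norm_def by (rule cSUP_least) auto

lemma sup_norm_nonneg: "x \<in> test_functions \<Longrightarrow> 0 \<le> sup_norm x"
  using sup_norm_ge [of x] norm_ge_zero order_trans by blast

lemma test_add:
  assumes "x \<in> test_functions" "y \<in> test_functions"
  shows "(\<lambda>\<omega>. x \<omega> + y \<omega>) \<in> test_functions" and "sup_norm (\<lambda>\<omega>. x \<omega> + y \<omega>) \<le> sup_norm x + sup_norm y"
proof -
  have *: "cmod (x \<omega> + y \<omega>) \<le> sup_norm x + sup_norm y" for \<omega>
    using sup_norm_ge [OF assms(1)] sup_norm_ge [OF assms(2)] by (rule norm_triangle_mono)
  show "(\<lambda>\<omega>. x \<omega> + y \<omega>) \<in> test_functions"
    by (rule test_functionI [OF *]) (use test_functionD(1) [OF assms(1)] test_functionD(1) [OF assms(2)] in simp)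
  show "sup_norm (\<lambda>\<omega>. x \<omega> + y \<omega>) \<le> sup_norm x + sup_norm y" by (rule sup_norm_le [OF *])
qed

lemma test_smult:
  assumes "x \<in> test_functions"
  shows "(\<lambda>\<omega>. c * x \<omega>) \<in> test_functions" and "sup_norm (\<lambda>\<omega>. c * x \<omega>) = cmod c * sup_norm x"
proof -
  have *: "cmod (c * x \<omega>) \<le> cmod c * sup_norm x" for \<omega>
    using sup_norm_ge [OF assms] by (simp add: norm_mult mult_left_mono)
  show c: "(\<lambda>\<omega>. c * x \<omega>) \<in> test_functions"
    by (rule test_functionI [OF *]) (use test_functionD(1) [OF assms] in simp)
  show "sup_norm (\<lambda>\<omega>. c * x \<omega>) = cmod c * sup_norm x"
  proof (rule antisym)
    show "sup_norm (\<lambda>\<omega>. c * x \<omega>) \<le> cmod c * sup_norm x" by (rule sup_norm_le [OF *])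
    show "cmod c * sup_norm x \<le> sup_norm (\<lambda>\<omega>. c * x \<omega>)"
    proof (cases "c = 0")
      case True
      then show ?thesis using sup_norm_nonneg [OF c] by simp
    next
      case False
      have "sup_norm x \<le> sup_norm (\<lambda>\<omega>. c * x \<omega>) / cmod c"
        by (rule sup_norm_le) (use False sup_norm_ge [OF c] in \<open>simp add: field_simps norm_mult\<close>)
      then show ?thesis using False by (simp add: field_simps)
    qed
  qed
qed

lemma test_zero: "(\<lambda>\<omega>. 0) \<in> test_functions"
  by (rule test_functionI [of _ 0]) auto

lemma pb_abelian_group: "abelian_group point_bimodule"
proof (rule abelian_groupI)
  fix y assume "y \<in> carrier point_bimodule"
  then obtain x where x: "y = enc x" "x \<in> test_functions" by auto
  have "enc (\<lambda>\<omega>. - x \<omega>) \<in> carrier point_bimodule" using test_smult(1) [OF x(2), of "-1"] by simp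
  then show "\<exists>z\<in>carrier point_bimodule. z \<oplus>\<^bsub>point_bimodule\<^esub> y = \<zero>\<^bsub>point_bimodule\<^esub>"
    by (rule bexI [rotated]) (simp add: x)
qed (auto simp: test_add test_zero add_ac)

lemma pb_minus:
  assumes "x \<in> test_functions" "y \<in> test_functions"
  shows "enc x \<ominus>\<^bsub>point_bimodule\<^esub> enc y = enc (\<lambda>\<omega>. x \<omega> - y \<omega>)"
proof -
  interpret abelian_group point_bimodule by (rule pb_abelian_group)
  have "enc (\<lambda>\<omega>. - y \<omega>) \<in> carrier point_bimodule" using test_smult(1) [OF assms(2), of "-1"] by simp
  then have "\<ominus>\<^bsub>point_bimodule\<^esub> enc y = enc (\<lambda>\<omega>. - y \<omega>)"
    using assms(2) by (intro minus_equality) auto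
  then show ?thesis by (simp add: a_minus_def)
qed

lemma test_diff:
  assumes "x \<in> test_functions" "y \<in> test_functions" shows "(\<lambda>\<omega>. x \<omega> - y \<omega>) \<in> test_functions"
  using test_add(1) [OF assms(1) test_smult(1) [OF assms(2), of "-1"]] by simp

lemma sup_norm_zero_iff: "x \<in> test_functions \<Longrightarrow> sup_norm x = 0 \<longleftrightarrow> x = (\<lambda>\<omega>. 0)"
proof
  assume "x \<in> test_functions" "sup_norm x = 0"
  then show "x = (\<lambda>\<omega>. 0)" using sup_norm_ge [of x] by (intro ext) simp
next
  assume "x \<in> test_functions" "x = (\<lambda>\<omega>. 0)"
  then show "sup_norm x = 0" using sup_norm_le [of x 0] sup_norm_nonneg [of x] by simp
qed

lemma pb_normed: "normed_space point_bimodule"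
  unfolding normed_space_def
proof (intro conjI allI ballI)
  show "Module.module complex_space point_bimodule"
    by (rule moduleI [OF complex_space_cring pb_abelian_group]) (auto simp: test_smult algebra_simps)
qed (use sup_norm_zero_iff inj_enc in \<open>auto simp: sup_norm_nonneg test_add test_smult dest: injD\<close>)

lemma pb_banach: "banach_space point_bimodule"
  unfolding banach_space_def
proof (intro conjI pb_normed allI impI)
  fix \<sigma> :: "nat \<Rightarrow> 'y"
  assume *: "range \<sigma> \<subseteq> carrier point_bimodule \<and>
    (\<forall>e>0. \<exists>N. \<forall>n\<ge>N. \<forall>k\<ge>N. vnorm point_bimodule (\<sigma> n \<ominus>\<^bsub>point_bimodule\<^esub> \<sigma> k) < e)"
  define x where "x n = dec (\<sigma> n)" for n
  have "range \<sigma> \<subseteq> enc ` test_functions" using * by simp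
  then have \<sigma>0: "\<sigma> n \<in> enc ` test_functions" for n by blast
  have \<sigma>: "\<sigma> n = enc (x n)" and xt: "x n \<in> test_functions" for n
    using \<sigma>0 [of n] unfolding x_def by fastforce+
  have cau: "\<exists>M. \<forall>n\<ge>M. \<forall>k\<ge>M. \<forall>\<omega>. cmod (x n \<omega> - x k \<omega>) < e" if e: "e > 0" for e
  proof -
    obtain M where M: "\<forall>n\<ge>M. \<forall>k\<ge>M. vnorm point_bimodule (\<sigma> n \<ominus>\<^bsub>point_bimodule\<^esub> \<sigma> k) < e"
      using conjunct2 [OF *] e by blast
    have "cmod (x n \<omega> - x k \<omega>) < e" if "n \<ge> M" "k \<ge> M" for n k \<omega>
    proof -
      have "cmod (x n \<omega> - x k \<omega>) \<le> sup_norm (\<lambda>\<omega>. x n \<omega> - x k \<omega>)"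
        by (rule sup_norm_ge [OF test_diff [OF xt xt]])
      also have "\<dots> = vnorm point_bimodule (\<sigma> n \<ominus>\<^bsub>point_bimodule\<^esub> \<sigma> k)"
        unfolding \<sigma> pb_minus [OF xt xt] pb_simps ..
      also have "\<dots> < e" using M that by simp
      finally show ?thesis .
    qed
    then show ?thesis by blast
  qed
  define z where "z \<omega> = lim (\<lambda>n. x n \<omega>)" for \<omega>
  have "Cauchy (\<lambda>n. x n \<omega>)" for \<omega>
  proof (rule metric_CauchyI)
    fix e :: real assume "e > 0"
    then obtain M where "\<forall>n\<ge>M. \<forall>k\<ge>M. \<forall>\<omega>. cmod (x n \<omega> - x k \<omega>) < e" using cau by blast
    then show "\<exists>M. \<forall>m\<ge>M. \<forall>n\<ge>M. dist (x m \<omega>) (x n \<omega>) < e" by (auto simp: dist_norm)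
  qed
  then have z: "(\<lambda>n. x n \<omega>) \<longlonglongrightarrow> z \<omega>" for \<omega>
    unfolding z_def using Cauchy_convergent convergent_LIMSEQ_iff by blast
  have unif: "\<exists>M. \<forall>n\<ge>M. \<forall>\<omega>. cmod (x n \<omega> - z \<omega>) \<le> e" if e: "e > 0" for e
  proof -
    obtain M where M: "\<forall>n\<ge>M. \<forall>k\<ge>M. \<forall>\<omega>. cmod (x n \<omega> - x k \<omega>) < e" using cau [OF e] by blast
    have "cmod (x n \<omega> - z \<omega>) \<le> e" if n: "n \<ge> M" for n \<omega>
    proof (rule tendsto_upperbound)
      show "(\<lambda>k. cmod (x n \<omega> - x k \<omega>)) \<longlonglongrightarrow> cmod (x n \<omega> - z \<omega>)" by (intro tendsto_intros z)
      show "\<forall>\<^sub>F k in sequentially. cmod (x n \<omega> - x k \<omega>) \<le> e"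
        unfolding eventually_sequentially using M n less_imp_le by blast
    qed simp
    then show ?thesis by blast
  qed
  have zt: "z \<in> test_functions"
  proof -
    obtain M where M: "\<forall>n\<ge>M. \<forall>\<omega>. cmod (x n \<omega> - z \<omega>) \<le> 1" using unif [of 1] by auto
    show ?thesis
    proof (rule test_functionI)
      fix \<omega>
      have "cmod (z \<omega>) \<le> cmod (x M \<omega>) + cmod (x M \<omega> - z \<omega>)"
        using norm_triangle_ineq4 [of "x M \<omega>" "x M \<omega> - z \<omega>"] by simp
      also have "\<dots> \<le> sup_norm (x M) + 1" using M sup_norm_ge [OF xt] by (intro add_mono) auto
      finally show "cmod (z \<omega>) \<le> sup_norm (x M) + 1" .
    next
      fix \<omega> assume "\<omega> \<in> N"
      then have "(\<lambda>n. x n \<omega>) = (\<lambda>n. 0)" using test_functionD(1) [OF xt] by auto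
      then show "z \<omega> = 0" using z [of \<omega>] by (simp add: LIMSEQ_const_iff)
    qed
  qed
  show "\<exists>y\<in>carrier point_bimodule. (\<lambda>n. vnorm point_bimodule (\<sigma> n \<ominus>\<^bsub>point_bimodule\<^esub> y)) \<longlonglongrightarrow> 0"
  proof (rule bexI [of _ "enc z"])
    show "(\<lambda>n. vnorm point_bimodule (\<sigma> n \<ominus>\<^bsub>point_bimodule\<^esub> enc z)) \<longlonglongrightarrow> 0"
      unfolding \<sigma> pb_minus [OF xt zt] pb_simps
    proof (rule LIMSEQ_I)
      fix e :: real assume e: "e > 0"
      then obtain M where M: "\<forall>n\<ge>M. \<forall>\<omega>. cmod (x n \<omega> - z \<omega>) \<le> e / 2" using unif [of "e / 2"] by auto
      have "norm (sup_norm (\<lambda>\<omega>. x n \<omega> - z \<omega>) - 0) < e" if "n \<ge> M" for n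
        using sup_norm_le [of "\<lambda>\<omega>. x n \<omega> - z \<omega>" "e / 2"] M that sup_norm_nonneg [OF test_diff [OF xt [of n] zt]] e
        by simp
      then show "\<exists>M. \<forall>n\<ge>M. norm (sup_norm (\<lambda>\<omega>. x n \<omega> - z \<omega>) - 0) < e" by blast
    qed
    show "enc z \<in> carrier point_bimodule" using zt by simp
  qed
qed

lemma kernel_bounds:
  assumes "x \<in> test_functions"
  shows "cmod (x \<omega>) \<le> sup_norm x" "cmod (x \<omega> - x \<omega>') \<le> 2 * sup_norm x"
  using sup_norm_ge [OF assms, of \<omega>] sup_norm_ge [OF assms, of \<omega>'] norm_triangle_ineq4 [of "x \<omega>" "x \<omega>'"] by auto

lemma kernel_bound_diff:
  assumes "x \<in> test_functions"
  shows "cmod ((x \<omega>1 - x \<omega>2) - (x \<omega>3 - x \<omega>4)) \<le> 4 * sup_norm x"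
proof -
  have "cmod ((x \<omega>1 - x \<omega>2) - (x \<omega>3 - x \<omega>4)) \<le> cmod (x \<omega>1 - x \<omega>2) + cmod (x \<omega>3 - x \<omega>4)"
    by (rule norm_triangle_ineq4)
  also have "\<dots> \<le> 2 * sup_norm x + 2 * sup_norm x" by (intro add_mono kernel_bounds(2) assms)
  finally show ?thesis by simp
qed

lemma left_action_test:
  assumes "a \<in> carrier A" "x \<in> test_functions"
  shows "left_action a x \<in> test_functions" and "sup_norm (left_action a x) \<le> 2 * vnorm A a * sup_norm x"
proof -
  have "cmod (left_action a x \<omega>) \<le> sup_norm x * vnorm A a" for \<omega>
    unfolding left_action_def by (rule cmod_pairing_le [OF assms(1) kernel_bounds(1) [OF assms(2)]])
  also have "\<dots> \<le> 2 * vnorm A a * sup_norm x"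
    using mult_nonneg_nonneg [OF ell1_vnorm_nonneg [of a] sup_norm_nonneg [OF assms(2)]] by (simp add: mult.commute)
  finally have *: "cmod (left_action a x \<omega>) \<le> 2 * vnorm A a * sup_norm x" for \<omega> .
  show "left_action a x \<in> test_functions"
  proof (rule test_functionI [OF *])
    fix \<omega> assume "\<omega> \<in> N"
    then have "pairing (\<lambda>s. x (l s \<omega>)) a = pairing (\<lambda>s. 0) a"
      by (intro pairing_cong l_zero [OF test_functionD(1) [OF assms(2)]])
    then show "left_action a x \<omega> = 0" by (simp add: left_action_def pairing_def)
  qed
  show "sup_norm (left_action a x) \<le> 2 * vnorm A a * sup_norm x" by (rule sup_norm_le [OF *])
qed

lemma right_action_test:
  assumes "a \<in> carrier A" "x \<in> test_functions"
  shows "right_action a x \<in> test_functions" and "sup_norm (right_action a x) \<le> 2 * vnorm A a * sup_norm x"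
proof -
  have *: "cmod (right_action a x \<omega>) \<le> 2 * vnorm A a * sup_norm x" for \<omega>
    unfolding right_action_def using cmod_pairing_le [OF assms(1) kernel_bounds(2) [OF assms(2)]] by (simp add: mult_ac)
  show "right_action a x \<in> test_functions"
  proof (rule test_functionI [OF *])
    fix \<omega> assume "\<omega> \<in> N"
    then have "pairing (\<lambda>s. x (r s \<omega>) - x (r' s \<omega>)) a = pairing (\<lambda>s. 0) a"
      by (intro pairing_cong) (simp add: r_zero [OF test_functionD(1) [OF assms(2)]])
    then show "right_action a x \<omega> = 0" by (simp add: right_action_def pairing_def)
  qed
  show "sup_norm (right_action a x) \<le> 2 * vnorm A a * sup_norm x" by (rule sup_norm_le [OF *])
qed

lemma pairing_diff_left:
  assumes "a \<in> carrier A" "\<And>s. s \<in> S \<Longrightarrow> cmod (c s) \<le> C" "\<And>s. s \<in> S \<Longrightarrow> cmod (e s) \<le> E"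
  shows "pairing (\<lambda>s. c s - e s) a = pairing c a - pairing e a"
  using pairing_add_left [OF assms(1,2), where d = "\<lambda>s. - e s" and D = E] assms(3) pairing_smult_left [of "-1" e a] by simp

text \<open>Pairing with a product is a double sum over pairs, and each law is the corresponding law
  for point masses after a choice of the order of summation.\<close>

lemma action_mult:
  assumes a: "a \<in> carrier A" and b: "b \<in> carrier A" and x: "x \<in> test_functions"
  shows "left_action (a \<otimes>\<^bsub>A\<^esub> b) x = left_action a (left_action b x)"
    and "right_action (a \<otimes>\<^bsub>A\<^esub> b) x = right_action b (right_action a x)"
    and "left_action a (right_action b x) = right_action b (left_action a x)"
proof -
  note x0 = test_functionD(1) [OF x] and k1 = kernel_bounds(1) [OF x] and k2 = kernel_bounds(2) [OF x]
  show "left_action (a \<otimes>\<^bsub>A\<^esub> b) x = left_action a (left_action b x)"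
  proof
    fix \<omega>
    have "left_action (a \<otimes>\<^bsub>A\<^esub> b) x \<omega> = kform (\<lambda>p. x (l (op (fst p) (snd p)) \<omega>)) a b"
      unfolding left_action_def by (rule pairing_mult [OF a b k1])
    also have "\<dots> = pairing (\<lambda>s. pairing (\<lambda>t. x (l (op s t) \<omega>)) b) a"
      by (simp add: kform_iterated(1) [OF a b k1])
    also have "\<dots> = left_action a (left_action b x) \<omega>"
      unfolding left_action_def by (intro pairing_cong) (simp add: l_mult [OF x0])
    finally show "left_action (a \<otimes>\<^bsub>A\<^esub> b) x \<omega> = left_action a (left_action b x) \<omega>" .
  qed
  show "right_action (a \<otimes>\<^bsub>A\<^esub> b) x = right_action b (right_action a x)"
  proof
    fix \<omega>
    have "right_action (a \<otimes>\<^bsub>A\<^esub> b) x \<omega>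
        = kform (\<lambda>p. x (r (op (fst p) (snd p)) \<omega>) - x (r' (op (fst p) (snd p)) \<omega>)) a b"
      unfolding right_action_def by (rule pairing_mult [OF a b k2])
    also have "\<dots> = pairing (\<lambda>t. pairing (\<lambda>s. x (r (op s t) \<omega>) - x (r' (op s t) \<omega>)) a) b"
      by (simp add: kform_iterated(2) [OF a b k2])
    also have "\<dots> = right_action b (right_action a x) \<omega>"
      unfolding right_action_def
    proof (rule pairing_cong)
      fix t assume t: "t \<in> S"
      have "pairing (\<lambda>s. x (r (op s t) \<omega>) - x (r' (op s t) \<omega>)) a
        = pairing (\<lambda>s. (x (r s (r t \<omega>)) - x (r' s (r t \<omega>))) - (x (r s (r' t \<omega>)) - x (r' s (r' t \<omega>)))) a"
        by (rule pairing_cong) (rule r_mult [OF x0 _ t])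
      also have "\<dots> = pairing (\<lambda>s. x (r s (r t \<omega>)) - x (r' s (r t \<omega>))) a - pairing (\<lambda>s. x (r s (r' t \<omega>)) - x (r' s (r' t \<omega>))) a"
        by (rule pairing_diff_left [OF a k2 k2])
      finally show "pairing (\<lambda>s. x (r (op s t) \<omega>) - x (r' (op s t) \<omega>)) a = \<dots>" .
    qed
    finally show "right_action (a \<otimes>\<^bsub>A\<^esub> b) x \<omega> = right_action b (right_action a x) \<omega>" .
  qed
  show "left_action a (right_action b x) = right_action b (left_action a x)"
  proof
    fix \<omega>
    let ?K = "\<lambda>p. x (r (snd p) (l (fst p) \<omega>)) - x (r' (snd p) (l (fst p) \<omega>))"
    have "left_action a (right_action b x) \<omega> = kform ?K a b"
      unfolding left_action_def right_action_def by (simp add: kform_iterated(1) [OF a b k2])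
    also have "\<dots> = pairing (\<lambda>t. pairing (\<lambda>s. x (r t (l s \<omega>)) - x (r' t (l s \<omega>))) a) b"
      by (simp add: kform_iterated(2) [OF a b k2])
    also have "\<dots> = right_action b (left_action a x) \<omega>"
      unfolding left_action_def right_action_def
    proof (rule pairing_cong)
      fix t assume t: "t \<in> S"
      have "pairing (\<lambda>s. x (r t (l s \<omega>)) - x (r' t (l s \<omega>))) a = pairing (\<lambda>s. x (l s (r t \<omega>)) - x (l s (r' t \<omega>))) a"
        by (rule pairing_cong) (rule l_r [OF x0 _ t])
      also have "\<dots> = pairing (\<lambda>s. x (l s (r t \<omega>))) a - pairing (\<lambda>s. x (l s (r' t \<omega>))) a"
        by (rule pairing_diff_left [OF a k1 k1])
      finally show "pairing (\<lambda>s. x (r t (l s \<omega>)) - x (r' t (l s \<omega>))) a = \<dots>" .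
    qed
    finally show "left_action a (right_action b x) \<omega> = right_action b (left_action a x) \<omega>" .
  qed
qed

lemma action_linear:
  assumes a: "a \<in> carrier A" and b: "b \<in> carrier A" and x: "x \<in> test_functions" and y: "y \<in> test_functions"
  shows "left_action a (\<lambda>\<omega>. x \<omega> + y \<omega>) = (\<lambda>\<omega>. left_action a x \<omega> + left_action a y \<omega>)"
    and "right_action a (\<lambda>\<omega>. x \<omega> + y \<omega>) = (\<lambda>\<omega>. right_action a x \<omega> + right_action a y \<omega>)"
    and "left_action a (\<lambda>\<omega>. c * x \<omega>) = (\<lambda>\<omega>. c * left_action a x \<omega>)"
    and "right_action a (\<lambda>\<omega>. c * x \<omega>) = (\<lambda>\<omega>. c * right_action a x \<omega>)"
    and "left_action (\<lambda>s. a s + b s) x = (\<lambda>\<omega>. left_action a x \<omega> + left_action b x \<omega>)"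
    and "right_action (\<lambda>s. a s + b s) x = (\<lambda>\<omega>. right_action a x \<omega> + right_action b x \<omega>)"
    and "left_action (\<lambda>s. c * a s) x = (\<lambda>\<omega>. c * left_action a x \<omega>)"
    and "right_action (\<lambda>s. c * a s) x = (\<lambda>\<omega>. c * right_action a x \<omega>)"
proof -
  note kx = kernel_bounds [OF x] and ky = kernel_bounds [OF y]
  show "left_action a (\<lambda>\<omega>. x \<omega> + y \<omega>) = (\<lambda>\<omega>. left_action a x \<omega> + left_action a y \<omega>)"
    unfolding left_action_def by (rule ext) (rule pairing_add_left [OF a kx(1) ky(1)])
  show "right_action a (\<lambda>\<omega>. x \<omega> + y \<omega>) = (\<lambda>\<omega>. right_action a x \<omega> + right_action a y \<omega>)"
    unfolding right_action_def
    by (rule ext) (simp add: pairing_add_left [OF a kx(2) ky(2), symmetric] algebra_simps)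
  show "left_action a (\<lambda>\<omega>. c * x \<omega>) = (\<lambda>\<omega>. c * left_action a x \<omega>)"
    unfolding left_action_def by (rule ext) (rule pairing_smult_left)
  show "right_action a (\<lambda>\<omega>. c * x \<omega>) = (\<lambda>\<omega>. c * right_action a x \<omega>)"
    unfolding right_action_def by (rule ext) (simp add: pairing_smult_left [symmetric] right_diff_distrib)
  show "left_action (\<lambda>s. a s + b s) x = (\<lambda>\<omega>. left_action a x \<omega> + left_action b x \<omega>)"
    unfolding left_action_def by (rule ext) (rule pairing_add [OF a b kx(1)])
  show "right_action (\<lambda>s. a s + b s) x = (\<lambda>\<omega>. right_action a x \<omega> + right_action b x \<omega>)"
    unfolding right_action_def by (rule ext) (rule pairing_add [OF a b kx(2)])
  show "left_action (\<lambda>s. c * a s) x = (\<lambda>\<omega>. c * left_action a x \<omega>)"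
    unfolding left_action_def by (rule ext) (rule pairing_smult)
  show "right_action (\<lambda>s. c * a s) x = (\<lambda>\<omega>. c * right_action a x \<omega>)"
    unfolding right_action_def by (rule ext) (rule pairing_smult)
qed

lemma pb_bimodule: "banach_bimodule A point_bimodule"
proof -
  have n: "sup_norm (left_action a x) \<le> (2 * sup_norm x) * vnorm A a"
    "sup_norm (right_action a x) \<le> (2 * sup_norm x) * vnorm A a"
    if "a \<in> carrier A" "x \<in> test_functions" for a x
    using left_action_test(2) [OF that] right_action_test(2) [OF that] by (simp_all add: mult_ac)
  have 1: "bounded_linear_map point_bimodule point_bimodule (lact point_bimodule a)"
    "bounded_linear_map point_bimodule point_bimodule (\<lambda>x. ract point_bimodule x a)" if a: "a \<in> carrier A" for a
    unfolding bounded_linear_map_def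
    by (use a in \<open>auto simp: left_action_test right_action_test action_linear [OF a a] intro!: exI [of _ "2 * vnorm A a"]\<close>)
  have 2: "bounded_linear_map A point_bimodule (\<lambda>a. lact point_bimodule a x)"
    "bounded_linear_map A point_bimodule (ract point_bimodule x)" if x: "x \<in> carrier point_bimodule" for x
  proof -
    obtain z where z: "x = enc z" "z \<in> test_functions" using x by auto
    show "bounded_linear_map A point_bimodule (\<lambda>a. lact point_bimodule a x)"
      "bounded_linear_map A point_bimodule (ract point_bimodule x)"
      unfolding bounded_linear_map_def z(1)
      by (use z(2) n in \<open>auto simp: left_action_test right_action_test ell1_simps(2,3) action_linear [OF _ _ z(2) z(2)]
        intro!: exI [of _ "2 * sup_norm z"]\<close>)
  qed
  show ?thesis
    unfolding banach_bimodule_def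
  proof (intro conjI pb_banach ballI 1 2)
    show "\<exists>K. \<forall>a\<in>carrier A. \<forall>x\<in>carrier point_bimodule.
       vnorm point_bimodule (lact point_bimodule a x) \<le> K * vnorm A a * vnorm point_bimodule x \<and>
       vnorm point_bimodule (ract point_bimodule x a) \<le> K * vnorm A a * vnorm point_bimodule x"
      using left_action_test(2) right_action_test(2) by (intro exI [of _ 2]) auto
  qed (auto simp: action_mult left_action_test right_action_test)
qed

lemma pb_pre_space: "pre_space point_bimodule"
  unfolding pre_space_def
proof (intro conjI ballI allI)
  show "\<exists>x\<in>carrier point_bimodule. vnorm point_bimodule x \<le> 1"
    using sup_norm_zero_iff [OF test_zero] by (intro bexI [of _ "enc (\<lambda>\<omega>. 0)"]) (simp_all add: test_zero)
qed (auto simp: test_add test_smult sup_norm_nonneg)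

lemma pb_derivation: "derivation A (dual_bimodule point_bimodule) point_derivation"
proof -
  let ?Y = "dual_bimodule point_bimodule"
  define p where "p a x = pairing (\<lambda>s. x (d s) - x (d' s)) a" for a and x :: "'w \<Rightarrow> complex"
  have D: "point_derivation a (enc x) = p a x" if "x \<in> test_functions" for a x
    using that by (simp add: point_derivation_def p_def)
  have pb: "cmod (p a x) \<le> 2 * vnorm A a * sup_norm x" if "a \<in> carrier A" "x \<in> test_functions" for a x
    unfolding p_def using cmod_pairing_le [OF that(1) kernel_bounds(2) [OF that(2)]] by (simp add: mult_ac)
  have padd: "p a (\<lambda>\<omega>. x \<omega> + y \<omega>) = p a x + p a y" if "a \<in> carrier A" "x \<in> test_functions" "y \<in> test_functions" for a x y
    unfolding p_def
    by (simp add: pairing_add_left [OF that(1) kernel_bounds(2) [OF that(2)] kernel_bounds(2) [OF that(3)], symmetric] algebra_simps)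
  have psm: "p a (\<lambda>\<omega>. c * x \<omega>) = c * p a x" for a c x
    unfolding p_def by (simp add: pairing_smult_left [symmetric] right_diff_distrib)
  have Dc: "point_derivation a \<in> carrier ?Y" if a: "a \<in> carrier A" for a
  proof -
    have "(\<lambda>y\<in>carrier point_bimodule. p a (dec y)) \<in> carrier ?Y"
      by (rule dual_carrierI [where K = "2 * vnorm A a"]) (auto simp: test_add test_smult padd [OF a] psm pb [OF a])
    then show ?thesis by (simp add: point_derivation_def p_def)
  qed
  have eqI: "f = g" if "f \<in> carrier ?Y" "g \<in> carrier ?Y" "\<And>x. x \<in> test_functions \<Longrightarrow> f (enc x) = g (enc x)" for f g
    using that(3) by (intro extensionalityI [OF dualD(1) [OF that(1)] dualD(1) [OF that(2)]]) auto
  note pY = pre_spaceD [OF dual_pre_space [OF pb_pre_space]]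
  have blm: "bounded_linear_map A ?Y point_derivation"
    unfolding bounded_linear_map_def
  proof (intro conjI ballI allI exI [of _ 2] funcsetI Dc)
    show "point_derivation (a \<oplus>\<^bsub>A\<^esub> b) = point_derivation a \<oplus>\<^bsub>?Y\<^esub> point_derivation b"
      if a: "a \<in> carrier A" and b: "b \<in> carrier A" for a b
    proof (rule eqI)
      show "point_derivation (a \<oplus>\<^bsub>A\<^esub> b) \<in> carrier ?Y"
        by (rule Dc) (simp add: ell1_simps(2) ell1_add_closed a b)
      show "point_derivation a \<oplus>\<^bsub>?Y\<^esub> point_derivation b \<in> carrier ?Y" by (intro pY(1) Dc a b)
      show "point_derivation (a \<oplus>\<^bsub>A\<^esub> b) (enc x) = (point_derivation a \<oplus>\<^bsub>?Y\<^esub> point_derivation b) (enc x)"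
        if x: "x \<in> test_functions" for x
        using x pairing_add [OF a b kernel_bounds(2) [OF x]] by (simp add: dual_simps(3) D p_def ell1_simps(2))
    qed
    show "point_derivation (c \<odot>\<^bsub>A\<^esub> a) = c \<odot>\<^bsub>?Y\<^esub> point_derivation a" if a: "a \<in> carrier A" for c a
    proof (rule eqI)
      show "point_derivation (c \<odot>\<^bsub>A\<^esub> a) \<in> carrier ?Y"
        by (rule Dc) (simp add: ell1_simps(3) ell1_smult_closed a)
      show "c \<odot>\<^bsub>?Y\<^esub> point_derivation a \<in> carrier ?Y" by (intro pY(2) Dc a)
      show "point_derivation (c \<odot>\<^bsub>A\<^esub> a) (enc x) = (c \<odot>\<^bsub>?Y\<^esub> point_derivation a) (enc x)"
        if x: "x \<in> test_functions" for x
        using x by (simp add: dual_simps(4) D p_def ell1_simps(3) pairing_smult)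
    qed
    show "vnorm ?Y (point_derivation a) \<le> 2 * vnorm A a" if a: "a \<in> carrier A" for a
    proof (rule dual_vnorm_le [OF pb_pre_space])
      fix y assume "y \<in> carrier point_bimodule" "vnorm point_bimodule y \<le> 1"
      then obtain x where x: "y = enc x" "x \<in> test_functions" "sup_norm x \<le> 1" by auto
      have "cmod (p a x) \<le> 2 * vnorm A a * sup_norm x" by (rule pb [OF a x(2)])
      also have "\<dots> \<le> 2 * vnorm A a * 1" using x(3) ell1_vnorm_nonneg [of a] by (intro mult_left_mono) auto
      finally show "cmod (point_derivation a y) \<le> 2 * vnorm A a" using x by (simp add: D)
    qed
  qed
  have act: "lact ?Y a (point_derivation b) \<in> carrier ?Y" "ract ?Y (point_derivation b) a \<in> carrier ?Y"
    if "a \<in> carrier A" "b \<in> carrier A" for a b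
    using pb_bimodule that(1) unfolding dual_simps(6,7) banach_bimodule_def
    by - (rule blmD(1) [OF dual_adjoint_blm [OF pb_pre_space pb_pre_space] Dc [OF that(2)]], blast)+
  have "point_derivation (a \<otimes>\<^bsub>A\<^esub> b) = lact ?Y a (point_derivation b) \<oplus>\<^bsub>?Y\<^esub> ract ?Y (point_derivation a) b"
    if a: "a \<in> carrier A" and b: "b \<in> carrier A" for a b
  proof (rule eqI)
    show "point_derivation (a \<otimes>\<^bsub>A\<^esub> b) \<in> carrier ?Y" by (rule Dc [OF ell1_mult_closed [OF a b]])
    show "lact ?Y a (point_derivation b) \<oplus>\<^bsub>?Y\<^esub> ract ?Y (point_derivation a) b \<in> carrier ?Y"
      by (intro pY(1) act a b)
    fix x assume x: "x \<in> test_functions"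
    note x0 = test_functionD(1) [OF x] and k1 = kernel_bounds(1) [OF x] and k2 = kernel_bounds(2) [OF x]
    \<comment> \<open>The product rule on point masses splits the kernel into two. The first, summed
      over \<open>a\<close> inside, is D b at x a; the second, summed over \<open>b\<close> inside,
      is D a at b x.\<close>
    let ?K1 = "\<lambda>p. (x (r (fst p) (d (snd p))) - x (r' (fst p) (d (snd p)))) - (x (r (fst p) (d' (snd p))) - x (r' (fst p) (d' (snd p))))"
    let ?K2 = "\<lambda>p. x (l (snd p) (d (fst p))) - x (l (snd p) (d' (fst p)))"
    have b1: "cmod (?K1 q) \<le> 4 * sup_norm x" for q by (rule kernel_bound_diff [OF x])
    have b2: "cmod (?K2 q) \<le> 2 * sup_norm x" for q by (rule k2)
    have "p (a \<otimes>\<^bsub>A\<^esub> b) x = kform (\<lambda>q. x (d (op (fst q) (snd q))) - x (d' (op (fst q) (snd q)))) a b"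
      unfolding p_def by (rule pairing_mult [OF a b k2])
    also have "\<dots> = kform (\<lambda>q. ?K1 q + ?K2 q) a b"
      unfolding kform_def by (intro infsum_cong) (auto simp: d_mult [OF x0])
    also have "\<dots> = kform ?K1 a b + kform ?K2 a b"
    proof -
      have s: "(\<lambda>q. a (fst q) * b (snd q) * ?K1 q) summable_on S \<times> S" "(\<lambda>q. a (fst q) * b (snd q) * ?K2 q) summable_on S \<times> S"
        by (rule abs_summable_summable [OF kform_summable [OF a b b1]], rule abs_summable_summable [OF kform_summable [OF a b b2]])
      show ?thesis unfolding kform_def distrib_left [of "a _ * b _"] by (rule infsum_add [OF s])
    qed
    also have "kform ?K1 a b = p b (right_action a x)"
      unfolding p_def right_action_def kform_iterated(2) [OF a b b1] 
      by (intro pairing_cong) (simp add: pairing_diff_left [OF a k2 k2])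
    also have "kform ?K2 a b = p a (left_action b x)"
      unfolding p_def left_action_def kform_iterated(1) [OF a b b2]
      by (intro pairing_cong) (simp add: pairing_diff_left [OF b k1 k1])
    finally show "point_derivation (a \<otimes>\<^bsub>A\<^esub> b) (enc x)
        = (lact ?Y a (point_derivation b) \<oplus>\<^bsub>?Y\<^esub> ract ?Y (point_derivation a) b) (enc x)"
      using x a b by (simp add: dual_simps D left_action_test right_action_test)
  qed
  then show ?thesis unfolding derivation_def using blm by blast
qed

text \<open>Convergence in the dual norm gives an estimate uniform over the unit ball of test
  functions. Here \<open>a\<close> ranges over the whole algebra, since infinite weighted sums of
  idempotents have to be tested later.\<close>

theorem approximately_amenable_functionals:
  assumes AA: "approximately_amenable TYPE('y) A"
  shows "\<exists>F. F \<noteq> bot \<and>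
    (\<forall>\<^sub>F f in F. (\<forall>x\<in>test_functions. \<forall>y\<in>test_functions. f (\<lambda>\<omega>. x \<omega> + y \<omega>) = f x + f y) \<and>
          (\<forall>c. \<forall>x\<in>test_functions. f (\<lambda>\<omega>. c * x \<omega>) = c * f x) \<and>
          (\<exists>M. \<forall>x\<in>test_functions. \<forall>C. (\<forall>\<omega>. cmod (x \<omega>) \<le> C) \<longrightarrow> cmod (f x) \<le> M * C)) \<and>
    (\<forall>a\<in>carrier A. \<forall>\<epsilon>>0. \<forall>\<^sub>F f in F. \<forall>x\<in>test_functions. (\<forall>\<omega>. cmod (x \<omega>) \<le> 1) \<longrightarrow>
          cmod (pairing (\<lambda>s. x (d s) - x (d' s)) a - (f (right_action a x) - f (left_action a x))) \<le> \<epsilon>)"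
proof -
  let ?Y = "dual_bimodule point_bimodule"
  have "\<exists>F. F \<noteq> bot \<and> (\<forall>\<^sub>F f in F. f \<in> carrier ?Y) \<and>
      (\<forall>a\<in>carrier A. ((\<lambda>f. vnorm ?Y (point_derivation a \<ominus>\<^bsub>?Y\<^esub> (lact ?Y a f \<ominus>\<^bsub>?Y\<^esub> ract ?Y f a))) \<longlongrightarrow> 0) F)"
    using AA [unfolded approximately_amenable_def Let_def, rule_format, OF conjI [OF pb_bimodule pb_derivation]] .
  then obtain F where F: "F \<noteq> bot" and ev: "\<forall>\<^sub>F f in F. f \<in> carrier ?Y"
    and lim: "\<And>a. a \<in> carrier A \<Longrightarrow> ((\<lambda>f. vnorm ?Y (point_derivation a \<ominus>\<^bsub>?Y\<^esub> (lact ?Y a f \<ominus>\<^bsub>?Y\<^esub> ract ?Y f a))) \<longlongrightarrow> 0) F"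
    by blast
  let ?F = "filtermap (\<lambda>f x. f (enc x)) F"
  show ?thesis
  proof (rule exI [of _ ?F], intro conjI)
    show "?F \<noteq> bot" using F by (simp add: filtermap_bot_iff)
    show "\<forall>\<^sub>F f in ?F. (\<forall>x\<in>test_functions. \<forall>y\<in>test_functions. f (\<lambda>\<omega>. x \<omega> + y \<omega>) = f x + f y) \<and>
          (\<forall>c. \<forall>x\<in>test_functions. f (\<lambda>\<omega>. c * x \<omega>) = c * f x) \<and>
          (\<exists>M. \<forall>x\<in>test_functions. \<forall>C. (\<forall>\<omega>. cmod (x \<omega>) \<le> C) \<longrightarrow> cmod (f x) \<le> M * C)"
      unfolding eventually_filtermap
    proof (rule eventually_mono [OF ev], intro conjI ballI allI)
      fix f assume f: "f \<in> carrier ?Y"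
      show "f (enc (\<lambda>\<omega>. x \<omega> + y \<omega>)) = f (enc x) + f (enc y)" if "x \<in> test_functions" "y \<in> test_functions" for x y
        using dualD(3) [OF f, of "enc x" "enc y"] that by simp
      show "f (enc (\<lambda>\<omega>. c * x \<omega>)) = c * f (enc x)" if "x \<in> test_functions" for c x
        using dualD(4) [OF f, of "enc x" c] that by simp
      show "\<exists>M. \<forall>x\<in>test_functions. \<forall>C. (\<forall>\<omega>. cmod (x \<omega>) \<le> C) \<longrightarrow> cmod (f (enc x)) \<le> M * C"
      proof (intro exI ballI allI impI)
        fix x C assume x: "x \<in> test_functions" "\<forall>\<omega>. cmod (x \<omega>) \<le> C"
        have "cmod (f (enc x)) \<le> vnorm ?Y f * sup_norm x"
          using dual_bound [OF pb_pre_space f, of "enc x"] x by simp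
        also have "\<dots> \<le> vnorm ?Y f * C"
          using x(2) by (intro mult_left_mono sup_norm_le dual_vnorm_nonneg [OF pb_pre_space f]) auto
        finally show "cmod (f (enc x)) \<le> vnorm ?Y f * C" .
      qed
    qed
    show "\<forall>a\<in>carrier A. \<forall>\<epsilon>>0. \<forall>\<^sub>F f in ?F. \<forall>x\<in>test_functions. (\<forall>\<omega>. cmod (x \<omega>) \<le> 1) \<longrightarrow>
          cmod (pairing (\<lambda>s. x (d s) - x (d' s)) a - (f (right_action a x) - f (left_action a x))) \<le> \<epsilon>"
    proof (intro ballI allI impI)
    fix a and \<epsilon> :: real assume a: "a \<in> carrier A" and \<epsilon>: "\<epsilon> > 0"
    have "\<forall>\<^sub>F f in F. vnorm ?Y (point_derivation a \<ominus>\<^bsub>?Y\<^esub> (lact ?Y a f \<ominus>\<^bsub>?Y\<^esub> ract ?Y f a)) < \<epsilon>"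
      by (rule order_tendstoD(2) [OF lim [OF a] \<epsilon>])
    then show "\<forall>\<^sub>F f in ?F. \<forall>x\<in>test_functions. (\<forall>\<omega>. cmod (x \<omega>) \<le> 1) \<longrightarrow>
          cmod (pairing (\<lambda>s. x (d s) - x (d' s)) a - (f (right_action a x) - f (left_action a x))) \<le> \<epsilon>"
      unfolding eventually_filtermap using ev
    proof eventually_elim
      case (elim f)
      have act: "lact ?Y a f \<in> carrier ?Y" "ract ?Y f a \<in> carrier ?Y"
        using pb_bimodule a unfolding dual_simps(6,7) banach_bimodule_def
        by - (rule blmD(1) [OF dual_adjoint_blm [OF pb_pre_space pb_pre_space] elim(2)], blast)+
      have Da: "point_derivation a \<in> carrier ?Y"
        using pb_derivation a unfolding derivation_def bounded_linear_map_def by blast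
      show ?case
      proof (intro ballI impI)
        fix x assume x: "x \<in> test_functions" "\<forall>\<omega>. cmod (x \<omega>) \<le> 1"
        let ?E = "point_derivation a \<ominus>\<^bsub>?Y\<^esub> (lact ?Y a f \<ominus>\<^bsub>?Y\<^esub> ract ?Y f a)"
        have "cmod (?E (enc x)) \<le> vnorm ?Y ?E"
          using x by (intro dual_vnorm_ge [OF pb_pre_space] dual_minus_closed [OF pb_pre_space] act Da)
            (auto intro: sup_norm_le)
        moreover have "?E (enc x) = pairing (\<lambda>s. x (d s) - x (d' s)) a - (f (enc (right_action a x)) - f (enc (left_action a x)))"
          unfolding dual_minus [OF pb_pre_space Da dual_minus_closed [OF pb_pre_space act]]
          unfolding dual_minus [OF pb_pre_space act]
          using x(1) by (simp add: dual_simps point_derivation_def)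
        ultimately show "cmod (pairing (\<lambda>s. x (d s) - x (d' s)) a - (f (enc (right_action a x)) - f (enc (left_action a x)))) \<le> \<epsilon>"
          using elim(1) by simp
      qed
    qed
    qed
  qed
qed

end

section \<open>Brandt semigroups\<close>

locale brandt_semigroup =
  fixes G :: "('g, 'm) monoid_scheme" (structure) and I :: "'i set"
  assumes group: "Group.group G"
begin

abbreviation "BS \<equiv> brandt_set G I"
abbreviation "bm \<equiv> brandt_mult G"

lemma BElt_mem [simp]: "BElt g i j \<in> BS \<longleftrightarrow> g \<in> carrier G \<and> i \<in> I \<and> j \<in> I"
  by (auto simp: brandt_set_def)

lemma BZero_mem [simp]: "BZero \<in> BS"
  by (simp add: brandt_set_def)

lemma brandt_mult_zero [simp]: "bm s BZero = BZero" "bm BZero s = BZero"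
  by (cases s; simp)+

lemma group_facts [simp]:
  "g \<in> carrier G \<Longrightarrow> h \<in> carrier G \<Longrightarrow> g \<otimes> h \<in> carrier G" "\<one> \<in> carrier G"
  "g \<in> carrier G \<Longrightarrow> inv g \<in> carrier G" "g \<in> carrier G \<Longrightarrow> g \<otimes> \<one> = g" "g \<in> carrier G \<Longrightarrow> \<one> \<otimes> g = g"
  "g \<in> carrier G \<Longrightarrow> inv g \<otimes> g = \<one>" "g \<in> carrier G \<Longrightarrow> g \<otimes> inv g = \<one>"
  "g \<in> carrier G \<Longrightarrow> inv (inv g) = g"
proof -
  interpret Group.group G by (rule group)
  show "g \<in> carrier G \<Longrightarrow> h \<in> carrier G \<Longrightarrow> g \<otimes> h \<in> carrier G" "\<one> \<in> carrier G"
    "g \<in> carrier G \<Longrightarrow> inv g \<in> carrier G" "g \<in> carrier G \<Longrightarrow> g \<otimes> \<one> = g" "g \<in> carrier G \<Longrightarrow> \<one> \<otimes> g = g"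
    "g \<in> carrier G \<Longrightarrow> inv g \<otimes> g = \<one>" "g \<in> carrier G \<Longrightarrow> g \<otimes> inv g = \<one>"
    "g \<in> carrier G \<Longrightarrow> inv (inv g) = g"
    by simp_all
qed

lemma group_assoc: "g \<in> carrier G \<Longrightarrow> h \<in> carrier G \<Longrightarrow> k \<in> carrier G \<Longrightarrow> g \<otimes> h \<otimes> k = g \<otimes> (h \<otimes> k)"
  using group by (simp add: group_def monoid.m_assoc)

lemma bm_closed: "s \<in> BS \<Longrightarrow> t \<in> BS \<Longrightarrow> bm s t \<in> BS"
  by (cases s; cases t) auto

sublocale ell1_algebra BS bm
  by unfold_locales (rule bm_closed)

lemma bm_unit_right:
  assumes "s \<in> BS" shows "bm s (BElt \<one> i i') = BElt \<one> i i' \<longleftrightarrow> s = BElt \<one> i i"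
  using assms by (cases s) auto

lemma bm_unit_left:
  assumes "s \<in> BS" shows "bm (BElt \<one> i i') s = BElt \<one> i i' \<longleftrightarrow> s = BElt \<one> i' i'"
  using assms by (cases s) auto

lemma kernel_functional_sum:
  assumes N: "kernel_functional N" and "finite J" "\<And>i. i \<in> J \<Longrightarrow> bounded (K i ` (BS \<times> BS))"
  shows "N (\<lambda>p. \<Sum>i\<in>J. K i p) = (\<Sum>i\<in>J. N (K i))"
proof -
  note add = N [unfolded kernel_functional_def, THEN conjunct2, THEN conjunct1, rule_format]
    and smult = N [unfolded kernel_functional_def, THEN conjunct2, THEN conjunct2, THEN conjunct1, rule_format]
  have "bounded ((\<lambda>p. \<Sum>i\<in>J. K i p) ` (BS \<times> BS)) \<and> N (\<lambda>p. \<Sum>i\<in>J. K i p) = (\<Sum>i\<in>J. N (K i))"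
    using assms(2,3)
  proof (induction J)
    case empty
    have b: "bounded ((\<lambda>p. 0 :: complex) ` (BS \<times> BS))" by (rule boundedI [of _ 0]) auto
    then show ?case using smult [OF b, of 0] by simp
  next
    case (insert i J)
    have "bounded ((\<lambda>p. K i p + (\<Sum>i\<in>J. K i p)) ` (BS \<times> BS))"
      using insert by (intro bounded_plus_comp) simp_all
    then show ?case using insert add [of "K i" "\<lambda>p. \<Sum>i\<in>J. K i p"] by simp
  qed
  then show ?thesis by blast
qed

text \<open>With \<open>r = (1)\<^sub>i\<^sub>j\<close>, both \<open>x r = r\<close> and \<open>r x = r\<close> determine \<open>x\<close>: it is \<open>(1)\<^sub>i\<^sub>i\<close> or \<open>(1)\<^sub>j\<^sub>j\<close>. So centrality
  makes the value on the pairs with product \<open>(1)\<^sub>i\<^sub>i\<close> independent of \<open>i\<close>.\<close>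

theorem strong_pseudo_amenable_finite:
  assumes "strong_pseudo_amenable A" shows "finite I"
proof (rule ccontr)
  assume inf: "infinite I"
  then obtain i0 where i0: "i0 \<in> I" using infinite_imp_nonempty by blast
  obtain F :: "((('g, 'i) brandt \<times> ('g, 'i) brandt \<Rightarrow> complex) \<Rightarrow> complex) filter" where F: "F \<noteq> bot"
    and F1: "\<forall>\<^sub>F N in F. kernel_functional N \<and> (\<forall>r\<in>BS. \<forall>c. bounded (c ` BS) \<longrightarrow>
          N (\<lambda>p. c (bm r (bm (fst p) (snd p)))) = N (\<lambda>p. c (bm (bm (fst p) (snd p)) r)))"
    and F3: "\<forall>r\<in>BS. \<forall>\<epsilon>>0. \<forall>\<^sub>F N in F. \<forall>c. (\<forall>s\<in>BS. cmod (c s) \<le> 1) \<longrightarrow>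
          cmod (N (\<lambda>p. c (bm (bm (fst p) (snd p)) r)) - c r) \<le> \<epsilon>"
    using strong_pseudo_amenable_kernel_functionals [OF assms] by blast
  have r0: "BElt \<one> i0 i0 \<in> BS" using i0 by simp
  have "\<forall>\<^sub>F N in F. \<forall>c. (\<forall>s\<in>BS. cmod (c s) \<le> 1) \<longrightarrow>
      cmod (N (\<lambda>p. c (bm (bm (fst p) (snd p)) (BElt \<one> i0 i0))) - c (BElt \<one> i0 i0)) \<le> 1 / 2"
    by (rule F3 [rule_format, OF r0]) simp
  with F1 have "\<forall>\<^sub>F N in F. False"
  proof (eventually_elim, goal_cases)
    case (1 N)
    then have N: "kernel_functional N"
      and cen: "\<And>r c. r \<in> BS \<Longrightarrow> bounded (c ` BS) \<Longrightarrow>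
          N (\<lambda>p. c (bm r (bm (fst p) (snd p)))) = N (\<lambda>p. c (bm (bm (fst p) (snd p)) r))" by auto
    note cong = N [unfolded kernel_functional_def, THEN conjunct1, rule_format]
    obtain M where M: "\<And>K C. C > 0 \<Longrightarrow> (\<forall>p\<in>BS \<times> BS. cmod (K p) \<le> C) \<Longrightarrow> cmod (N K) \<le> M * C"
      using N unfolding kernel_functional_def by blast
    \<comment> \<open>\<open>K i\<close> singles out the pairs with product
      \<open>(1)\<^sub>i\<^sub>i\<close>, while \<open>c i j\<close> singles out the element
      \<open>(1)\<^sub>i\<^sub>j\<close> with which centrality is tested.\<close>
    define K where "K i p = (if bm (fst p) (snd p) = BElt \<one> i i then 1 else 0 :: complex)" for i :: 'i and p
    define c where "c i j s = (if s = BElt \<one> i j then 1 else 0 :: complex)" for i j :: 'i and s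
    have bc: "bounded (c i j ` BS)" for i j by (rule boundedI [of _ 1]) (auto simp: c_def)
    have bK: "bounded (K i ` (BS \<times> BS))" for i by (rule boundedI [of _ 1]) (auto simp: K_def)
    have eqr: "N (\<lambda>p. c i j (bm (bm (fst p) (snd p)) (BElt \<one> i j))) = N (K i)" if "i \<in> I" "j \<in> I" for i j
      by (rule cong) (auto simp: c_def K_def bm_unit_right bm_closed)
    have eql: "N (\<lambda>p. c i j (bm (BElt \<one> i j) (bm (fst p) (snd p)))) = N (K j)" if "i \<in> I" "j \<in> I" for i j
      by (rule cong) (auto simp: c_def K_def bm_unit_left bm_closed)
    have eq: "N (K j) = N (K i0)" if "j \<in> I" for j
      using cen [of "BElt \<one> i0 j" "c i0 j", OF _ bc] eqr [OF i0 that] eql [OF i0 that] i0 that by simp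
    \<comment> \<open>A pair has only one product, so at most one of the kernels \<open>K i\<close>
      is nonzero at it. Their sum stays in the unit ball however large \<open>J\<close> is, whereas
      its value is card J times a fixed number.\<close>
    have MJ: "real (card J) * cmod (N (K i0)) \<le> M" if J: "finite J" "J \<subseteq> I" for J
    proof -
      have "cmod (\<Sum>i\<in>J. K i p) \<le> 1" for p
      proof (cases "\<exists>i\<in>J. bm (fst p) (snd p) = BElt \<one> i i")
        case True
        then obtain i where i: "i \<in> J" "bm (fst p) (snd p) = BElt \<one> i i" by blast
        have "(\<Sum>i\<in>J. K i p) = (\<Sum>j\<in>J. if i = j then 1 else 0)" by (rule sum.cong) (auto simp: K_def i)
        then show ?thesis using i J by simp
      next
        case False
        then have "(\<Sum>i\<in>J. K i p) = 0" by (intro sum.neutral) (auto simp: K_def)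
        then show ?thesis by simp
      qed
      then have "cmod (N (\<lambda>p. \<Sum>i\<in>J. K i p)) \<le> M * 1" by (intro M) simp_all
      moreover have "N (\<lambda>p. \<Sum>i\<in>J. K i p) = of_nat (card J) * N (K i0)"
        using kernel_functional_sum [OF N J(1), of K] bK eq J(2) by (simp add: subset_iff)
      ultimately show ?thesis by (simp add: norm_mult)
    qed
    have "cmod (N (K i0) - 1) \<le> 1 / 2"
    proof -
      have "cmod (N (\<lambda>p. c i0 i0 (bm (bm (fst p) (snd p)) (BElt \<one> i0 i0))) - c i0 i0 (BElt \<one> i0 i0)) \<le> 1 / 2"
        using 1(2) by (rule allE [of _ "c i0 i0"]) (auto simp: c_def)
      then show ?thesis using eqr [OF i0 i0] by (simp add: c_def)
    qed
    then have half: "cmod (N (K i0)) \<ge> 1 / 2"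
      using norm_triangle_ineq2 [of 1 "N (K i0)"] by (simp add: norm_minus_commute)
    \<comment> \<open>The common value has modulus at least 1/2, so more than 2 M indices contradict
      \<open>MJ\<close>.\<close>
    obtain n :: nat where n: "real n > 2 * M" using reals_Archimedean2 by blast
    obtain J where J: "finite J" "card J = n" "J \<subseteq> I" using infinite_arbitrarily_large [OF inf] by blast
    have "real n * (1 / 2) \<le> real n * cmod (N (K i0))" using half by (rule mult_left_mono) simp
    moreover have "real n * cmod (N (K i0)) \<le> M" using MJ [OF J(1,3)] J(2) by simp
    ultimately show False using n by linarith
  qed
  then show False using F by (simp add: eventually_False)
qed

text \<open>The kernel \<open>\<kappa> f\<close> lives on the pairs
  \<open>(g)\<^sub>i\<^sub>j\<close>, \<open>(h)\<^sub>j\<^sub>i\<close> with i = \<open>i0\<close>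
  and takes the value f g there. Multiplying the first entry by \<open>(k)\<^sub>i\<^sub>i\<close>
  from the left translates \<open>f\<close>; multiplying the second from the right changes nothing.
  The approximate commutation of the diagonal is thus approximate invariance.\<close>

theorem strong_pseudo_amenable_mean:
  assumes "strong_pseudo_amenable A" and "I \<noteq> {}"
  shows "\<exists>m. left_invariant_mean G (count_space (carrier G)) m"
proof -
  obtain i0 where i0: "i0 \<in> I" using assms(2) by blast
  obtain F :: "((('g, 'i) brandt \<times> ('g, 'i) brandt \<Rightarrow> complex) \<Rightarrow> complex) filter" where F: "F \<noteq> bot"
    and F1: "\<forall>\<^sub>F N in F. kernel_functional N \<and> (\<forall>r\<in>BS. \<forall>c. bounded (c ` BS) \<longrightarrow>
          N (\<lambda>p. c (bm r (bm (fst p) (snd p)))) = N (\<lambda>p. c (bm (bm (fst p) (snd p)) r)))"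
    and F2: "\<forall>r\<in>BS. \<forall>\<epsilon>>0. \<forall>\<^sub>F N in F. \<forall>K. (\<forall>p\<in>BS \<times> BS. cmod (K p) \<le> 1) \<longrightarrow>
          cmod (N (\<lambda>p. K (bm r (fst p), snd p)) - N (\<lambda>p. K (fst p, bm (snd p) r))) \<le> \<epsilon>"
    and F3: "\<forall>r\<in>BS. \<forall>\<epsilon>>0. \<forall>\<^sub>F N in F. \<forall>c. (\<forall>s\<in>BS. cmod (c s) \<le> 1) \<longrightarrow>
          cmod (N (\<lambda>p. c (bm (bm (fst p) (snd p)) r)) - c r) \<le> \<epsilon>"
    using strong_pseudo_amenable_kernel_functionals [OF assms(1)] by blast
  define \<kappa> where "\<kappa> f p = (case p of (BElt g i j, BElt h k l) \<Rightarrow> if i = i0 \<and> j = k \<and> l = i0 then f g else 0 | _ \<Rightarrow> 0)"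
    for f :: "'g \<Rightarrow> complex" and p :: "('g, 'i) brandt \<times> ('g, 'i) brandt"
  have \<kappa>b: "cmod (\<kappa> f p) \<le> C" if "C \<ge> 0" "\<And>g. g \<in> carrier G \<Longrightarrow> cmod (f g) \<le> C" "p \<in> BS \<times> BS" for f p C
    using that by (auto simp: \<kappa>_def split: brandt.splits)
  have bd: "bounded (\<kappa> f ` (BS \<times> BS))" if bf: "bounded (f ` carrier G)" for f
  proof -
    obtain C where C: "C > 0" "\<And>g. g \<in> carrier G \<Longrightarrow> cmod (f g) \<le> C" using bounded_imageE [OF bf] by metis
    have "cmod (\<kappa> f p) \<le> C" if "p \<in> BS \<times> BS" for p by (rule \<kappa>b) (use C that in auto)
    then show ?thesis by (intro boundedI [of _ C]) auto
  qed
  have k1: "\<kappa> f (bm (BElt k i0 i0) s, t) = \<kappa> (\<lambda>x. f (k \<otimes> x)) (s, t)" for f k s t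
    by (cases s; cases t) (auto simp: \<kappa>_def)
  have k2: "\<kappa> f (s, bm t (BElt k i0 i0)) = \<kappa> f (s, t)" for f k s t
    by (cases s; cases t) (auto simp: \<kappa>_def)
  let ?F = "filtermap (\<lambda>N f. N (\<kappa> f)) F"
  show ?thesis
  proof (rule invariant_mean_from_net [OF group, of ?F])
    show "?F \<noteq> bot" using F by (simp add: filtermap_bot_iff)
    show "\<forall>\<^sub>F n in ?F. bounded_functional (carrier G) n"
      unfolding eventually_filtermap
    proof (rule eventually_mono [OF F1])
      fix N assume "kernel_functional N \<and> (\<forall>r\<in>BS. \<forall>c. bounded (c ` BS) \<longrightarrow>
          N (\<lambda>p. c (bm r (bm (fst p) (snd p)))) = N (\<lambda>p. c (bm (bm (fst p) (snd p)) r)))"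
      then have N: "kernel_functional N" by blast
      note add = N [unfolded kernel_functional_def, THEN conjunct2, THEN conjunct1, rule_format]
        and smult = N [unfolded kernel_functional_def, THEN conjunct2, THEN conjunct2, THEN conjunct1, rule_format]
      obtain M where M: "\<And>K C. C > 0 \<Longrightarrow> (\<forall>p\<in>BS \<times> BS. cmod (K p) \<le> C) \<Longrightarrow> cmod (N K) \<le> M * C"
        using N unfolding kernel_functional_def by blast
      show "bounded_functional (carrier G) (\<lambda>f. N (\<kappa> f))"
        unfolding bounded_functional_def
      proof (intro conjI allI impI exI)
        show "N (\<kappa> (\<lambda>x. f x + h x)) = N (\<kappa> f) + N (\<kappa> h)" if "bounded (f ` carrier G)" "bounded (h ` carrier G)" for f h
        proof -
          have "\<kappa> (\<lambda>x. f x + h x) = (\<lambda>p. \<kappa> f p + \<kappa> h p)" by (auto simp: \<kappa>_def fun_eq_iff split: brandt.splits)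
          then show ?thesis using add [OF bd [OF that(1)] bd [OF that(2)]] by simp
        qed
        show "N (\<kappa> (\<lambda>x. c * f x)) = c * N (\<kappa> f)" if "bounded (f ` carrier G)" for c f
        proof -
          have "\<kappa> (\<lambda>x. c * f x) = (\<lambda>p. c * \<kappa> f p)" by (auto simp: \<kappa>_def fun_eq_iff split: brandt.splits)
          then show ?thesis using smult [OF bd [OF that]] by simp
        qed
        show "cmod (N (\<kappa> f)) \<le> M * C" if "C > 0" "\<forall>x\<in>carrier G. cmod (f x) \<le> C" for f C
          using that by (intro M ballI \<kappa>b) auto
      qed
    qed
    fix \<epsilon> :: real assume \<epsilon>: "\<epsilon> > 0"
    have r0: "BElt \<one> i0 i0 \<in> BS" using i0 by simp
    \<comment> \<open>Evaluated on the product of a pair times the idempotent at \<open>i0\<close>,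
      this indicator is \<open>\<kappa> 1\<close>; so the approximate identity condition gives value
      near 1 at the constant 1.\<close>
    define c :: "('g, 'i) brandt \<Rightarrow> complex" where "c s = (case s of BElt g i j \<Rightarrow> if i = i0 \<and> j = i0 then 1 else 0 | _ \<Rightarrow> 0)" for s
    have c: "c (bm (bm (fst p) (snd p)) (BElt \<one> i0 i0)) = \<kappa> (\<lambda>x. 1) p" for p
      by (cases p, cases "fst p"; cases "snd p") (auto simp: c_def \<kappa>_def)
    show "\<forall>\<^sub>F n in ?F. cmod (n (\<lambda>x. 1) - 1) \<le> \<epsilon>"
      unfolding eventually_filtermap
    proof (rule eventually_mono [OF F3 [rule_format, OF r0 \<epsilon>]])
      fix N assume "\<forall>c. (\<forall>s\<in>BS. cmod (c s) \<le> 1) \<longrightarrow>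
          cmod (N (\<lambda>p. c (bm (bm (fst p) (snd p)) (BElt \<one> i0 i0))) - c (BElt \<one> i0 i0)) \<le> \<epsilon>"
      from this [rule_format, of c] show "cmod (N (\<kappa> (\<lambda>x. 1)) - 1) \<le> \<epsilon>"
        unfolding c by (simp add: c_def split: brandt.splits)
    qed
    fix k assume k: "k \<in> carrier G"
    have rk: "BElt k i0 i0 \<in> BS" using i0 k by simp
    show "\<forall>\<^sub>F n in ?F. \<forall>f. (\<forall>x\<in>carrier G. cmod (f x) \<le> 1) \<longrightarrow> cmod (n (\<lambda>x. f (k \<otimes> x)) - n f) \<le> \<epsilon>"
      unfolding eventually_filtermap
    proof (rule eventually_mono [OF F2 [rule_format, OF rk \<epsilon>]], intro allI impI)
      fix N f assume N: "\<forall>K. (\<forall>p\<in>BS \<times> BS. cmod (K p) \<le> 1) \<longrightarrow>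
          cmod (N (\<lambda>p. K (bm (BElt k i0 i0) (fst p), snd p)) - N (\<lambda>p. K (fst p, bm (snd p) (BElt k i0 i0)))) \<le> \<epsilon>"
        and f: "\<forall>x\<in>carrier G. cmod (f x) \<le> 1"
      have "\<forall>p\<in>BS \<times> BS. cmod (\<kappa> f p) \<le> 1" using f by (intro ballI \<kappa>b) auto
      from N [rule_format, of "\<kappa> f", OF this [rule_format]]
      show "cmod (N (\<kappa> (\<lambda>x. f (k \<otimes> x))) - N (\<kappa> f)) \<le> \<epsilon>"
        unfolding k1 k2 prod.collapse .
    qed
  qed
qed

end

section \<open>The virtual diagonal for finite index set and amenable group\<close>

lemma left_invariant_meanD:
  assumes "left_invariant_mean G (count_space (carrier G)) m"
  shows "bounded (f ` carrier G) \<Longrightarrow> bounded (h ` carrier G) \<Longrightarrow> m (\<lambda>x. f x + h x) = m f + m h"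
    and "bounded (f ` carrier G) \<Longrightarrow> m (\<lambda>x. c * f x) = c * m f"
    and "(\<And>x. x \<in> carrier G \<Longrightarrow> cmod (f x) \<le> C) \<Longrightarrow> 0 \<le> C \<Longrightarrow> cmod (m f) \<le> C"
    and "m (\<lambda>x. c) = c"
    and "g \<in> carrier G \<Longrightarrow> bounded (f ` carrier G) \<Longrightarrow> m (\<lambda>x. f (inv\<^bsub>G\<^esub> g \<otimes>\<^bsub>G\<^esub> x)) = m f"
proof -
  note m = assms [unfolded left_invariant_mean_count]
  note smult = m [THEN conjunct2, THEN conjunct1, rule_format]
    and one = m [THEN conjunct2, THEN conjunct2, THEN conjunct2, THEN conjunct1]
  show "bounded (f ` carrier G) \<Longrightarrow> bounded (h ` carrier G) \<Longrightarrow> m (\<lambda>x. f x + h x) = m f + m h"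
    by (rule m [THEN conjunct1, rule_format])
  show "bounded (f ` carrier G) \<Longrightarrow> m (\<lambda>x. c * f x) = c * m f" by (rule smult)
  show "(\<And>x. x \<in> carrier G \<Longrightarrow> cmod (f x) \<le> C) \<Longrightarrow> 0 \<le> C \<Longrightarrow> cmod (m f) \<le> C"
    by (rule m [THEN conjunct2, THEN conjunct2, THEN conjunct1, rule_format])
  have "bounded ((\<lambda>x. 1 :: complex) ` carrier G)" by (rule boundedI [of _ 1]) auto
  from smult [OF this, of c] show "m (\<lambda>x. c) = c" using one by simp
  show "g \<in> carrier G \<Longrightarrow> bounded (f ` carrier G) \<Longrightarrow> m (\<lambda>x. f (inv\<^bsub>G\<^esub> g \<otimes>\<^bsub>G\<^esub> x)) = m f"
    by (rule m [THEN conjunct2, THEN conjunct2, THEN conjunct2, THEN conjunct2, rule_format])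
qed

lemma left_invariant_mean_cong:
  assumes m: "left_invariant_mean G (count_space (carrier G)) m"
    and eq: "\<And>x. x \<in> carrier G \<Longrightarrow> p x = q x" and "bounded (q ` carrier G)"
  shows "m p = m q"
proof -
  note D = left_invariant_meanD [OF m]
  have d: "cmod (p x - q x) \<le> 0" if "x \<in> carrier G" for x using eq [OF that] by simp
  have "cmod (m (\<lambda>x. p x - q x)) \<le> 0" by (rule D(3) [OF d]) simp_all
  moreover have "bounded ((\<lambda>x. p x - q x) ` carrier G)" by (rule boundedI [of _ 0]) (use d in blast)
  then have "m (\<lambda>x. (p x - q x) + q x) = m (\<lambda>x. p x - q x) + m q" using assms(3) by (rule D(1))
  ultimately show ?thesis by simp
qed

context brandt_semigroup
begin

text \<open>Subtracting the zero of the semigroup splits off a copy of \<open>\<complex>\<close>: the algebra is the direct product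
  of \<open>\<complex>\<close> and the matrices over \<open>\<ell>\<^sup>1(G)\<close>, which is where the unit and the diagonal come from.\<close>

definition brandt_unit :: "'i set \<Rightarrow> ('g, 'i) brandt \<Rightarrow> complex" where
  "brandt_unit J = (\<lambda>s. point_mass BZero s + (\<Sum>i\<in>J. point_mass (BElt \<one> i i) s - point_mass BZero s))"

lemma brandt_unit_functional:
  assumes \<phi>: "bounded_linear_map A complex_space \<phi>" and "finite J" "J \<subseteq> I"
  shows "brandt_unit J \<in> carrier A \<and>
    \<phi> (brandt_unit J) = \<phi> (point_mass BZero) + (\<Sum>i\<in>J. \<phi> (point_mass (BElt \<one> i i)) - \<phi> (point_mass BZero))"
  using assms(2,3)
proof (induction J)
  case empty
  then show ?case by (simp add: brandt_unit_def point_mass_closed)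
next
  case (insert i J)
  have add: "\<phi> (\<lambda>s. x s + y s) = \<phi> x + \<phi> y" if "x \<in> carrier A" "y \<in> carrier A" for x y
    using blmD(2) [OF \<phi> that] by (simp add: ell1_simps(2))
  have smult: "\<phi> (\<lambda>s. c * x s) = c * \<phi> x" if "x \<in> carrier A" for c x
    using blmD(3) [OF \<phi> that] by (simp add: ell1_simps(3))
  have pm: "point_mass (BElt \<one> i i) \<in> carrier A" "point_mass BZero \<in> carrier A"
    using insert by (auto intro: point_mass_closed)
  let ?u = "\<lambda>s. point_mass (BElt \<one> i i) s + (-1) * point_mass BZero s"
  have u: "?u \<in> carrier A" "\<phi> ?u = \<phi> (point_mass (BElt \<one> i i)) - \<phi> (point_mass BZero)"
    using add [OF pm(1) ell1_smult_closed [OF pm(2), of "-1"]] smult [OF pm(2), of "-1"]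
      ell1_add_closed [OF pm(1) ell1_smult_closed [OF pm(2), of "-1"]] by simp_all
  have "brandt_unit (insert i J) = (\<lambda>s. brandt_unit J s + ?u s)"
    using insert by (simp add: brandt_unit_def fun_eq_iff algebra_simps)
  then show ?case
    using insert u add [of "brandt_unit J" ?u] ell1_add_closed [of "brandt_unit J" ?u] by simp
qed

lemma coord_blm: "bounded_linear_map A complex_space (\<lambda>y. y s)"
proof (cases "s \<in> BS")
  case True
  have "bounded_linear_map A complex_space (pairing (\<lambda>t. if t = s then 1 else 0))"
    by (rule pairing_blm [where C = 1]) simp
  then show ?thesis
    unfolding bounded_linear_map_def by (simp add: pairing_indicator True ell1_add_closed ell1_smult_closed ell1_simps(2,3))
qed (auto intro!: blm_complexI [where K = 0] simp: ell1_simps(1-3))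

lemma mult_coord_blm:
  assumes "x \<in> carrier A"
  shows "bounded_linear_map A complex_space (\<lambda>y. (x \<otimes>\<^bsub>A\<^esub> y) s)" and "bounded_linear_map A complex_space (\<lambda>y. (y \<otimes>\<^bsub>A\<^esub> x) s)"
  by (rule blm_compose [OF mult_blm_right [OF assms] coord_blm ell1_vnorm_nonneg],
      rule blm_compose [OF mult_blm_left [OF assms] coord_blm ell1_vnorm_nonneg])

lemma brandt_unit_closed:
  assumes "finite I" shows "brandt_unit I \<in> carrier A"
  using brandt_unit_functional [OF coord_blm assms order_refl] by blast

lemma brandt_unit_mult:
  assumes fin: "finite I" and x: "x \<in> carrier A"
  shows "brandt_unit I \<otimes>\<^bsub>A\<^esub> x = x" and "x \<otimes>\<^bsub>A\<^esub> brandt_unit I = x"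
proof -
  note e = brandt_unit_closed [OF fin]
  have pm: "(brandt_unit I \<otimes>\<^bsub>A\<^esub> point_mass t) s = point_mass t s \<and> (point_mass t \<otimes>\<^bsub>A\<^esub> brandt_unit I) s = point_mass t s"
    if t: "t \<in> BS" for s t
  proof -
    have m: "(point_mass BZero \<otimes>\<^bsub>A\<^esub> point_mass t) = point_mass BZero" "(point_mass t \<otimes>\<^bsub>A\<^esub> point_mass BZero) = point_mass BZero"
      "i \<in> I \<Longrightarrow> (point_mass (BElt \<one> i i) \<otimes>\<^bsub>A\<^esub> point_mass t) = point_mass (bm (BElt \<one> i i) t)"
      "i \<in> I \<Longrightarrow> (point_mass t \<otimes>\<^bsub>A\<^esub> point_mass (BElt \<one> i i)) = point_mass (bm t (BElt \<one> i i))" for i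
      using t by (simp_all add: point_mass_mult)
    have 1: "(brandt_unit I \<otimes>\<^bsub>A\<^esub> point_mass t) s = point_mass BZero s + (\<Sum>i\<in>I. point_mass (bm (BElt \<one> i i) t) s - point_mass BZero s)"
      using brandt_unit_functional [OF mult_coord_blm(2) [OF point_mass_closed [OF t]] fin order_refl, THEN conjunct2, of s]
      by (simp add: m)
    have 2: "(point_mass t \<otimes>\<^bsub>A\<^esub> brandt_unit I) s = point_mass BZero s + (\<Sum>i\<in>I. point_mass (bm t (BElt \<one> i i)) s - point_mass BZero s)"
      using brandt_unit_functional [OF mult_coord_blm(1) [OF point_mass_closed [OF t]] fin order_refl, THEN conjunct2, of s]
      by (simp add: m)
    show ?thesis
    proof (cases t)
      case (BElt g p q)
      \<comment> \<open>The idempotent at \<open>i\<close> fixes \<open>t\<close> if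
        \<open>i\<close> is the row (or, on the other side, the column) of \<open>t\<close>, and
        sends it to the zero of the semigroup otherwise, where the summand cancels.\<close>
      have "(\<Sum>i\<in>I. point_mass (bm (BElt \<one> i i) t) s - point_mass BZero s) = (\<Sum>i\<in>I. if i = p then point_mass t s - point_mass BZero s else 0)"
        "(\<Sum>i\<in>I. point_mass (bm t (BElt \<one> i i)) s - point_mass BZero s) = (\<Sum>i\<in>I. if i = q then point_mass t s - point_mass BZero s else 0)"
        using t BElt by (auto intro!: sum.cong)
      then show ?thesis unfolding 1 2 using t BElt fin by simp
    qed (use 1 2 in simp)
  qed
  show "brandt_unit I \<otimes>\<^bsub>A\<^esub> x = x"
  proof (rule ell1_eqI [OF ell1_mult_closed [OF e x] x])
    fix s assume "s \<in> BS"
    then show "(brandt_unit I \<otimes>\<^bsub>A\<^esub> x) s = x s"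
      by (intro functional_eqI [OF mult_coord_blm(1) [OF e] coord_blm _ x]) (simp_all add: pm)
  qed
  show "x \<otimes>\<^bsub>A\<^esub> brandt_unit I = x"
  proof (rule ell1_eqI [OF ell1_mult_closed [OF x e] x])
    fix s assume "s \<in> BS"
    then show "(x \<otimes>\<^bsub>A\<^esub> brandt_unit I) s = x s"
      by (intro functional_eqI [OF mult_coord_blm(2) [OF e] coord_blm _ x]) (simp_all add: pm)
  qed
qed

text \<open>This is \<beta> at the pair of differences of the point masses at \<open>s\<close> and
  \<open>t\<close> with the point mass at the zero, that is, \<beta> on the matrix part of the
  algebra.\<close>

definition reduced where
  "reduced \<beta> s t = \<beta> (point_mass s, point_mass t) - \<beta> (point_mass s, point_mass BZero)
     - \<beta> (point_mass BZero, point_mass t) + \<beta> (point_mass BZero, point_mass BZero)"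

text \<open>The form \<beta> applied to the diagonal for a single \<open>g\<close>: the zero
  tensored with itself for the factor \<complex>, plus the usual diagonal of a full matrix algebra
  with entries twisted by g \<otimes> g\<inverse>. Dividing by the number of indices normalizes the
  sum over the inner index.\<close>

definition local_diagonal where
  "local_diagonal \<beta> g = \<beta> (point_mass BZero, point_mass BZero) +
     (\<Sum>i\<in>I. \<Sum>j\<in>I. reduced \<beta> (BElt g i j) (BElt (inv g) j i)) / of_nat (card I)"

text \<open>There are (card I)^2 reduced values, each at most 4 B, and division by card I leaves 4
  card I; the remaining B belongs to the zero.\<close>

lemma local_diagonal_bound:
  assumes "0 \<le> B" "\<And>s t. s \<in> BS \<Longrightarrow> t \<in> BS \<Longrightarrow> cmod (\<beta> (point_mass s, point_mass t)) \<le> B" "g \<in> carrier G"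
    and "finite I" "I \<noteq> {}"
  shows "cmod (local_diagonal \<beta> g) \<le> (1 + 4 * real (card I)) * B"
proof -
  have n: "card I > 0" using assms(4,5) by (simp add: card_gt_0_iff)
  have red: "cmod (reduced \<beta> s t) \<le> 4 * B" if "s \<in> BS" "t \<in> BS" for s t
  proof -
    have "cmod (reduced \<beta> s t) \<le> cmod (\<beta> (point_mass s, point_mass t)) + cmod (\<beta> (point_mass s, point_mass BZero))
        + cmod (\<beta> (point_mass BZero, point_mass t)) + cmod (\<beta> (point_mass BZero, point_mass BZero))"
      unfolding reduced_def by (intro norm_triangle_mono norm_triangle_le_diff add_mono order_refl)
        
    also have "\<dots> \<le> B + B + B + B" by (intro add_mono assms(2) that BZero_mem)
    finally show ?thesis by simp
  qed
  have "cmod (\<Sum>i\<in>I. \<Sum>j\<in>I. reduced \<beta> (BElt g i j) (BElt (inv g) j i)) \<le> (\<Sum>i\<in>I. \<Sum>j\<in>I. 4 * B)"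
    by (intro sum_norm_le red) (use assms(3) in auto)
  also have "\<dots> = real (card I) * (real (card I) * (4 * B))" by simp
  finally have "cmod ((\<Sum>i\<in>I. \<Sum>j\<in>I. reduced \<beta> (BElt g i j) (BElt (inv g) j i)) / of_nat (card I)) \<le> real (card I) * (4 * B)"
    using n by (simp add: norm_divide field_simps)
  then have "cmod (local_diagonal \<beta> g) \<le> B + real (card I) * (4 * B)"
    unfolding local_diagonal_def by (rule norm_triangle_mono [OF assms(2) [OF BZero_mem BZero_mem]])
  then show ?thesis by (simp add: algebra_simps)
qed

text \<open>For one \<open>g\<close> the diagonal does not commute with the algebra. Acting with
  \<open>(k)\<^sub>p\<^sub>q\<close> on the two sides produces the same function of
  \<open>g\<close>, once evaluated at k g and once at \<open>g\<close>, and the mean removes the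
  difference.\<close>

theorem brandt_virtual_diagonal:
  assumes fin: "finite I" and ne: "I \<noteq> {}" and m: "left_invariant_mean G (count_space (carrier G)) m"
  shows "virtual_diagonal BS bm (brandt_unit I) (\<lambda>\<beta>. m (local_diagonal \<beta>)) (1 + 4 * real (card I))"
proof -
  note D = left_invariant_meanD [OF m]
  let ?C = "1 + 4 * real (card I)"
  have n: "card I > 0" using fin ne by (simp add: card_gt_0_iff)
  note pmc = point_mass_closed
  have bd0: "bounded (local_diagonal \<beta> ` carrier G)" if \<beta>: "\<beta> \<in> BF" for \<beta>
  proof -
    obtain K where K: "K > 0" "\<And>x y. x \<in> carrier A \<Longrightarrow> y \<in> carrier A \<Longrightarrow> cmod (\<beta> (x, y)) \<le> K * (vnorm A x * vnorm A y)"
      using BF_bound [OF \<beta>] by metis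
    have "cmod (\<beta> (point_mass s, point_mass t)) \<le> K" if "s \<in> BS" "t \<in> BS" for s t
      using K(2) [OF pmc [OF that(1)] pmc [OF that(2)]] that by (simp add: point_mass_norm)
    then have "cmod (local_diagonal \<beta> g) \<le> ?C * K" if "g \<in> carrier G" for g
      using K(1) that by (intro local_diagonal_bound fin ne) auto
    then show ?thesis by (intro boundedI [of _ "?C * K"]) auto
  qed
  have bound: "cmod (m (local_diagonal \<beta>)) \<le> ?C * B"
    if B: "0 \<le> B" and bB: "\<And>x y. x \<in> carrier A \<Longrightarrow> y \<in> carrier A \<Longrightarrow> vnorm A x \<le> 1 \<Longrightarrow> vnorm A y \<le> 1 \<Longrightarrow> cmod (\<beta> (x, y)) \<le> B"
    for \<beta> B
  proof (rule D(3))
    show "cmod (local_diagonal \<beta> g) \<le> ?C * B" if "g \<in> carrier G" for g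
      by (rule local_diagonal_bound [OF B _ that fin ne]) (rule bB, simp_all add: pmc point_mass_norm)
  qed (use B in simp)
  have add: "m (local_diagonal (\<lambda>p\<in>carrier A \<times> carrier A. \<beta> p + \<gamma> p)) = m (local_diagonal \<beta>) + m (local_diagonal \<gamma>)"
    if \<beta>: "\<beta> \<in> BF" and \<gamma>: "\<gamma> \<in> BF" for \<beta> \<gamma>
  proof -
    have "reduced (\<lambda>p\<in>carrier A \<times> carrier A. \<beta> p + \<gamma> p) s t = reduced \<beta> s t + reduced \<gamma> s t" if "s \<in> BS" "t \<in> BS" for s t
      using that by (simp add: reduced_def pmc)
    then have "local_diagonal (\<lambda>p\<in>carrier A \<times> carrier A. \<beta> p + \<gamma> p) g = local_diagonal \<beta> g + local_diagonal \<gamma> g"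
      if "g \<in> carrier G" for g
      using that by (simp add: local_diagonal_def pmc sum.distrib add_divide_distrib)
    then have "m (local_diagonal (\<lambda>p\<in>carrier A \<times> carrier A. \<beta> p + \<gamma> p)) = m (\<lambda>g. local_diagonal \<beta> g + local_diagonal \<gamma> g)"
      by (rule left_invariant_mean_cong [OF m]) (assumption, intro bounded_plus_comp bd0 \<beta> \<gamma>)
    then show ?thesis using D(1) [OF bd0 [OF \<beta>] bd0 [OF \<gamma>]] by simp
  qed
  have smult: "m (local_diagonal (\<lambda>p\<in>carrier A \<times> carrier A. c * \<beta> p)) = c * m (local_diagonal \<beta>)" if \<beta>: "\<beta> \<in> BF" for c \<beta>
  proof -
    have r: "reduced (\<lambda>p\<in>carrier A \<times> carrier A. c * \<beta> p) s t = c * reduced \<beta> s t" if "s \<in> BS" "t \<in> BS" for s t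
      using that by (simp add: reduced_def pmc algebra_simps)
    have eq: "local_diagonal (\<lambda>p\<in>carrier A \<times> carrier A. c * \<beta> p) g = c * local_diagonal \<beta> g" if "g \<in> carrier G" for g
      using that by (simp add: local_diagonal_def r pmc sum_distrib_left [symmetric] distrib_left)
    obtain B where B: "\<And>g. g \<in> carrier G \<Longrightarrow> cmod (local_diagonal \<beta> g) \<le> B"
      using bounded_imageE [OF bd0 [OF \<beta>]] by metis
    have "bounded ((\<lambda>g. c * local_diagonal \<beta> g) ` carrier G)"
      by (rule boundedI [of _ "cmod c * B"]) (use B in \<open>auto simp: norm_mult intro!: mult_left_mono\<close>)
    then have "m (local_diagonal (\<lambda>p\<in>carrier A \<times> carrier A. c * \<beta> p)) = m (\<lambda>g. c * local_diagonal \<beta> g)"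
      by (intro left_invariant_mean_cong [OF m] eq)
    then show ?thesis using D(2) [OF bd0 [OF \<beta>]] by simp
  qed
  \<comment> \<open>Both sides of the commutation law depend on \<open>a\<close> through a bounded
    functional, so that it has to be checked only on point masses.\<close>
  have lin: "bounded_linear_map A complex_space (\<lambda>a. m (local_diagonal (\<Gamma> a)))"
    if \<Gamma>: "\<And>a. a \<in> carrier A \<Longrightarrow> \<Gamma> a \<in> BF"
      and \<Gamma>add: "\<And>a b. a \<in> carrier A \<Longrightarrow> b \<in> carrier A \<Longrightarrow> \<Gamma> (a \<oplus>\<^bsub>A\<^esub> b) = (\<lambda>p\<in>carrier A \<times> carrier A. \<Gamma> a p + \<Gamma> b p)"
      and \<Gamma>smult: "\<And>c a. a \<in> carrier A \<Longrightarrow> \<Gamma> (c \<odot>\<^bsub>A\<^esub> a) = (\<lambda>p\<in>carrier A \<times> carrier A. c * \<Gamma> a p)"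
      and K: "0 \<le> K" "\<And>a x y. a \<in> carrier A \<Longrightarrow> x \<in> carrier A \<Longrightarrow> y \<in> carrier A \<Longrightarrow> vnorm A x \<le> 1 \<Longrightarrow> vnorm A y \<le> 1 \<Longrightarrow>
        cmod (\<Gamma> a (x, y)) \<le> K * vnorm A a" for \<Gamma> K
  proof (rule blm_complexI)
    show "m (local_diagonal (\<Gamma> (a \<oplus>\<^bsub>A\<^esub> b))) = m (local_diagonal (\<Gamma> a)) + m (local_diagonal (\<Gamma> b))"
      if "a \<in> carrier A" "b \<in> carrier A" for a b
      unfolding \<Gamma>add [OF that] by (rule add [OF \<Gamma> [OF that(1)] \<Gamma> [OF that(2)]])
    show "m (local_diagonal (\<Gamma> (c \<odot>\<^bsub>A\<^esub> a))) = c * m (local_diagonal (\<Gamma> a))" if "a \<in> carrier A" for c a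
      unfolding \<Gamma>smult [OF that] by (rule smult [OF \<Gamma> [OF that]])
    show "cmod (m (local_diagonal (\<Gamma> a))) \<le> (?C * K) * vnorm A a" if "a \<in> carrier A" for a
      unfolding mult.assoc by (rule bound) (rule mult_nonneg_nonneg [OF K(1) ell1_vnorm_nonneg], rule K(2) [OF that])
  qed
  have act: "m (local_diagonal (\<lambda>(x, y)\<in>carrier A \<times> carrier A. \<beta> (a \<otimes>\<^bsub>A\<^esub> x, y)))
      = m (local_diagonal (\<lambda>(x, y)\<in>carrier A \<times> carrier A. \<beta> (x, y \<otimes>\<^bsub>A\<^esub> a)))"
    if \<beta>: "\<beta> \<in> BF" and a: "a \<in> carrier A" for \<beta> a
  proof -
    let ?L = "\<lambda>a. \<lambda>(x, y)\<in>carrier A \<times> carrier A. \<beta> (a \<otimes>\<^bsub>A\<^esub> x, y)"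
    let ?R = "\<lambda>a. \<lambda>(x, y)\<in>carrier A \<times> carrier A. \<beta> (x, y \<otimes>\<^bsub>A\<^esub> a)"
    obtain K where K: "K > 0" "\<And>x y. x \<in> carrier A \<Longrightarrow> y \<in> carrier A \<Longrightarrow> cmod (\<beta> (x, y)) \<le> K * (vnorm A x * vnorm A y)"
      using BF_bound [OF \<beta>] by metis
    have Kb: "cmod (\<beta> (u, v)) \<le> K * vnorm A a"
      if "u \<in> carrier A" "v \<in> carrier A" "vnorm A u * vnorm A v \<le> vnorm A a" for u v a
      using order_trans [OF K(2) [OF that(1,2)] mult_left_mono [OF that(3)]] K(1) by simp
    have prod1: "vnorm A (a \<otimes>\<^bsub>A\<^esub> x) * vnorm A y \<le> vnorm A a" "vnorm A y * vnorm A (x \<otimes>\<^bsub>A\<^esub> a) \<le> vnorm A a"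
      if "a \<in> carrier A" "x \<in> carrier A" "y \<in> carrier A" "vnorm A x \<le> 1" "vnorm A y \<le> 1" for a x y
    proof -
      have le: "vnorm A a * vnorm A x \<le> vnorm A a" "vnorm A x * vnorm A a \<le> vnorm A a"
        using mult_left_mono [OF that(4) ell1_vnorm_nonneg [of a]] by (simp_all add: mult.commute)
      have "vnorm A (a \<otimes>\<^bsub>A\<^esub> x) * vnorm A y \<le> vnorm A (a \<otimes>\<^bsub>A\<^esub> x) * 1"
        by (intro mult_left_mono that ell1_vnorm_nonneg)
      then show "vnorm A (a \<otimes>\<^bsub>A\<^esub> x) * vnorm A y \<le> vnorm A a"
        using ell1_mult_norm [OF that(1,2)] le(1) by simp
      have "vnorm A y * vnorm A (x \<otimes>\<^bsub>A\<^esub> a) \<le> 1 * vnorm A (x \<otimes>\<^bsub>A\<^esub> a)"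
        by (intro mult_right_mono that ell1_vnorm_nonneg)
      then show "vnorm A y * vnorm A (x \<otimes>\<^bsub>A\<^esub> a) \<le> vnorm A a"
        using ell1_mult_norm [OF that(2,1)] le(2) by simp
    qed
    have L: "bounded_linear_map A complex_space (\<lambda>a. m (local_diagonal (?L a)))"
    proof (rule lin [OF BF_left [OF \<beta>] _ _ less_imp_le [OF K(1)]])
      show "?L (a \<oplus>\<^bsub>A\<^esub> b) = (\<lambda>p\<in>carrier A \<times> carrier A. ?L a p + ?L b p)" if "a \<in> carrier A" "b \<in> carrier A" for a b
        by (rule restrict_ext)
          (use that in \<open>auto simp: blmD(2) [OF mult_blm_left] blmD(2) [OF BF_blm(2) [OF \<beta>]] ell1_mult_closed\<close>)
      show "?L (c \<odot>\<^bsub>A\<^esub> a) = (\<lambda>p\<in>carrier A \<times> carrier A. c * ?L a p)" if "a \<in> carrier A" for c a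
        by (rule restrict_ext)
          (use that in \<open>auto simp: blmD(3) [OF mult_blm_left] blmD(3) [OF BF_blm(2) [OF \<beta>]] ell1_mult_closed\<close>)
      show "cmod (?L a (x, y)) \<le> K * vnorm A a"
        if "a \<in> carrier A" "x \<in> carrier A" "y \<in> carrier A" "vnorm A x \<le> 1" "vnorm A y \<le> 1" for a x y
        using Kb [OF ell1_mult_closed [OF that(1,2)] that(3) prod1(1) [OF that]] that by simp
    qed
    have R: "bounded_linear_map A complex_space (\<lambda>a. m (local_diagonal (?R a)))"
    proof (rule lin [OF BF_right [OF \<beta>] _ _ less_imp_le [OF K(1)]])
      show "?R (a \<oplus>\<^bsub>A\<^esub> b) = (\<lambda>p\<in>carrier A \<times> carrier A. ?R a p + ?R b p)" if "a \<in> carrier A" "b \<in> carrier A" for a b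
        by (rule restrict_ext)
          (use that in \<open>auto simp: blmD(2) [OF mult_blm_right] blmD(2) [OF BF_blm(1) [OF \<beta>]] ell1_mult_closed\<close>)
      show "?R (c \<odot>\<^bsub>A\<^esub> a) = (\<lambda>p\<in>carrier A \<times> carrier A. c * ?R a p)" if "a \<in> carrier A" for c a
        by (rule restrict_ext)
          (use that in \<open>auto simp: blmD(3) [OF mult_blm_right] blmD(3) [OF BF_blm(1) [OF \<beta>]] ell1_mult_closed\<close>)
      show "cmod (?R a (x, y)) \<le> K * vnorm A a"
        if "a \<in> carrier A" "x \<in> carrier A" "y \<in> carrier A" "vnorm A x \<le> 1" "vnorm A y \<le> 1" for a x y
        using Kb [OF that(2) ell1_mult_closed [OF that(3,1)] prod1(2) [OF that(1,3,2,5,4)]] that by simp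
    qed
    have "m (local_diagonal (?L (point_mass s))) = m (local_diagonal (?R (point_mass s)))" if s: "s \<in> BS" for s
    proof (cases s)
      case BZero
      \<comment> \<open>The zero of the semigroup annihilates differences with the zero, so only the
        term for the factor \<complex> survives on either side.\<close>
      have "reduced (?L (point_mass s)) t u = 0" "reduced (?R (point_mass s)) t u = 0" if "t \<in> BS" "u \<in> BS" for t u
        using that BZero by (simp_all add: reduced_def pmc point_mass_mult)
      then have "local_diagonal (?L (point_mass s)) g = local_diagonal (?R (point_mass s)) g" if "g \<in> carrier G" for g
        using that BZero by (simp add: local_diagonal_def pmc point_mass_mult)
      then show ?thesis
        by (rule left_invariant_mean_cong [OF m]) (assumption, intro bd0 BF_right \<beta> pmc s)
    next
      case (BElt k p q)
      then have k: "k \<in> carrier G" "p \<in> I" "q \<in> I" using s by simp_all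
      \<comment> \<open>The common function: the left action yields it at k g, since the inverse of
        k g times k is the inverse of \<open>g\<close>; the right action yields it at
        \<open>g\<close>.\<close>
      define f where "f g = \<beta> (point_mass BZero, point_mass BZero) +
        (\<Sum>j\<in>I. reduced \<beta> (BElt g p j) (BElt (inv g \<otimes> k) j q)) / of_nat (card I)" for g
      have rL: "reduced (?L (point_mass s)) (BElt g i j) u = (if i = q then reduced \<beta> (BElt (k \<otimes> g) p j) u else 0)"
        if "g \<in> carrier G" "i \<in> I" "j \<in> I" "u \<in> BS" for g i j u
        using that k BElt by (simp add: reduced_def pmc point_mass_mult)
      have rR: "reduced (?R (point_mass s)) u (BElt h j i) = (if i = p then reduced \<beta> u (BElt (h \<otimes> k) j q) else 0)"
        if "h \<in> carrier G" "i \<in> I" "j \<in> I" "u \<in> BS" for h i j u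
        using that k BElt by (simp add: reduced_def pmc point_mass_mult)
      have zL: "?L (point_mass s) (point_mass BZero, point_mass BZero) = \<beta> (point_mass BZero, point_mass BZero)"
        and zR: "?R (point_mass s) (point_mass BZero, point_mass BZero) = \<beta> (point_mass BZero, point_mass BZero)"
        using s by (simp_all add: pmc point_mass_mult)
      have fL: "local_diagonal (?L (point_mass s)) g = f (k \<otimes> g)" if g: "g \<in> carrier G" for g
      proof -
        interpret Group.group G by (rule group)
        have "inv (k \<otimes> g) \<otimes> k = inv g" using g k by (simp add: inv_mult_group m_assoc)
        moreover have "(\<Sum>i\<in>I. \<Sum>j\<in>I. reduced (?L (point_mass s)) (BElt g i j) (BElt (inv g) j i))
          = (\<Sum>i\<in>I. if i = q then (\<Sum>j\<in>I. reduced \<beta> (BElt (k \<otimes> g) p j) (BElt (inv g) j i)) else 0)"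
          by (intro sum.cong refl) (use rL g in simp)
        ultimately show ?thesis unfolding local_diagonal_def zL f_def using fin k by simp
      qed
      have fR: "local_diagonal (?R (point_mass s)) g = f g" if g: "g \<in> carrier G" for g
      proof -
        have "(\<Sum>i\<in>I. \<Sum>j\<in>I. reduced (?R (point_mass s)) (BElt g i j) (BElt (inv g) j i))
          = (\<Sum>i\<in>I. if i = p then (\<Sum>j\<in>I. reduced \<beta> (BElt g i j) (BElt (inv g \<otimes> k) j q)) else 0)"
          by (intro sum.cong refl) (use rR g in simp)
        then show ?thesis unfolding local_diagonal_def zR f_def using fin k by simp
      qed
      have "local_diagonal (?R (point_mass s)) ` carrier G = f ` carrier G" by (rule image_cong [OF refl fR])
      then have fb: "bounded (f ` carrier G)" using bd0 [OF BF_right [OF \<beta> pmc [OF s]]] by simp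
      have "m (local_diagonal (?L (point_mass s))) = m (\<lambda>g. f (k \<otimes> g))"
        by (rule left_invariant_mean_cong [OF m fL], assumption, rule bounded_subset [OF fb]) (use k in auto)
      also have "\<dots> = m f" using D(5) [of "inv k" f] k fb by simp
      also have "\<dots> = m (local_diagonal (?R (point_mass s)))"
        by (rule left_invariant_mean_cong [OF m, symmetric]) (rule fR, assumption, rule fb)
      finally show ?thesis .
    qed
    then show ?thesis by (rule functional_eqI [OF L R _ a])
  qed
  have mult: "m (local_diagonal (\<lambda>(x, y)\<in>carrier A \<times> carrier A. \<phi> (x \<otimes>\<^bsub>A\<^esub> y))) = \<phi> (brandt_unit I)"
    if \<phi>: "bounded_linear_map A complex_space \<phi>" for \<phi>
  proof -
    let ?\<beta> = "\<lambda>(x, y)\<in>carrier A \<times> carrier A. \<phi> (x \<otimes>\<^bsub>A\<^esub> y)"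
    have "local_diagonal ?\<beta> g = \<phi> (brandt_unit I)" if g: "g \<in> carrier G" for g
    proof -
      \<comment> \<open>The product of \<open>(g)\<^sub>i\<^sub>j\<close> with its partner is
        \<open>(1)\<^sub>i\<^sub>i\<close> for every \<open>j\<close> and \<open>g\<close>; the
        equal terms over \<open>j\<close> cancel the division by card I, and no averaging takes
        place.\<close>
      have "reduced ?\<beta> (BElt g i j) (BElt (inv g) j i) = \<phi> (point_mass (BElt \<one> i i)) - \<phi> (point_mass BZero)"
        if "i \<in> I" "j \<in> I" for i j
        using that g by (simp add: reduced_def pmc point_mass_mult)
      then have "(\<Sum>i\<in>I. \<Sum>j\<in>I. reduced ?\<beta> (BElt g i j) (BElt (inv g) j i))
          = of_nat (card I) * (\<Sum>i\<in>I. \<phi> (point_mass (BElt \<one> i i)) - \<phi> (point_mass BZero))"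
        by (simp add: sum_distrib_left)
      then show ?thesis
        using n brandt_unit_functional [OF \<phi> fin order_refl]
        by (simp add: local_diagonal_def pmc point_mass_mult)
    qed
    then have "m (local_diagonal ?\<beta>) = m (\<lambda>g. \<phi> (brandt_unit I))"
      by (rule left_invariant_mean_cong [OF m]) (assumption, rule boundedI [of _ "cmod (\<phi> (brandt_unit I))"], auto)
    then show ?thesis using D(4) by simp
  qed
  show ?thesis
  proof (unfold_locales)
    show "brandt_unit I \<in> carrier A" by (rule brandt_unit_closed [OF fin])
    show "brandt_unit I \<otimes>\<^bsub>A\<^esub> x = x" "x \<otimes>\<^bsub>A\<^esub> brandt_unit I = x" if "x \<in> carrier A" for x
      by (rule brandt_unit_mult [OF fin that])+
    show "cmod (m (local_diagonal \<beta>)) \<le> ?C * B"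
      if "\<beta> \<in> BF" "0 \<le> B" "\<And>x y. x \<in> carrier A \<Longrightarrow> y \<in> carrier A \<Longrightarrow> vnorm A x \<le> 1 \<Longrightarrow> vnorm A y \<le> 1 \<Longrightarrow> cmod (\<beta> (x, y)) \<le> B"
      for \<beta> B
      by (rule bound [OF that(2)]) (rule that(3))
  qed (fact add smult act mult)+
qed

end

section \<open>From approximate amenability to an invariant mean\<close>

context point_module
begin

definition linear_test :: "(('w \<Rightarrow> complex) \<Rightarrow> complex) \<Rightarrow> bool" where
  "linear_test E \<longleftrightarrow>
     (\<forall>x\<in>test_functions. \<forall>y\<in>test_functions. E (\<lambda>\<omega>. x \<omega> + y \<omega>) = E x + E y) \<and>
     (\<forall>c. \<forall>x\<in>test_functions. E (\<lambda>\<omega>. c * x \<omega>) = c * E x)"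

lemma linear_test_sum:
  assumes E: "linear_test E" and "finite W" "\<And>z. z \<in> W \<Longrightarrow> x z \<in> test_functions"
  shows "(\<lambda>\<omega>. \<Sum>z\<in>W. w z * x z \<omega>) \<in> test_functions \<and> E (\<lambda>\<omega>. \<Sum>z\<in>W. w z * x z \<omega>) = (\<Sum>z\<in>W. w z * E (x z))"
  using assms(2,3)
proof (induction W)
  case empty
  have "E (\<lambda>\<omega>. 0 * (0 :: complex)) = 0 * E (\<lambda>\<omega>. 0)" 
    using E [unfolded linear_test_def, THEN conjunct2, rule_format, OF test_zero, of 0] by simp
  then show ?case by (simp add: test_zero)
next
  case (insert z W)
  have x: "x z \<in> test_functions" using insert by simp
  have IH: "(\<lambda>\<omega>. \<Sum>z\<in>W. w z * x z \<omega>) \<in> test_functions" "E (\<lambda>\<omega>. \<Sum>z\<in>W. w z * x z \<omega>) = (\<Sum>z\<in>W. w z * E (x z))"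
    using insert by simp_all
  have "E (\<lambda>\<omega>. w z * x z \<omega> + (\<Sum>z\<in>W. w z * x z \<omega>)) = E (\<lambda>\<omega>. w z * x z \<omega>) + E (\<lambda>\<omega>. \<Sum>z\<in>W. w z * x z \<omega>)"
    using E [unfolded linear_test_def, THEN conjunct1] test_smult(1) [OF x] IH(1) by simp
  moreover have "E (\<lambda>\<omega>. w z * x z \<omega>) = w z * E (x z)"
    using E [unfolded linear_test_def, THEN conjunct2] x by simp
  ultimately show ?case using insert(1,2) IH test_add(1) [OF test_smult(1) [OF x] IH(1)] by simp
qed

text \<open>The error made at \<open>a\<close>, tested on \<open>x\<close>, when the derivation is
  replaced by the inner one implemented by \<open>f\<close>.\<close>

definition defect where
  "defect f a x = pairing (\<lambda>s. x (d s) - x (d' s)) a - (f (right_action a x) - f (left_action a x))"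

lemma defect_linear:
  assumes f: "linear_test f" and a: "a \<in> carrier A" shows "linear_test (defect f a)"
  unfolding linear_test_def
proof (intro conjI ballI allI)
  note fadd = f [unfolded linear_test_def, THEN conjunct1, rule_format]
    and fsmult = f [unfolded linear_test_def, THEN conjunct2, rule_format]
  fix x assume x: "x \<in> test_functions"
  show "defect f a (\<lambda>\<omega>. x \<omega> + y \<omega>) = defect f a x + defect f a y" if y: "y \<in> test_functions" for y
  proof -
    have "pairing (\<lambda>s. (x (d s) - x (d' s)) + (y (d s) - y (d' s))) a
      = pairing (\<lambda>s. x (d s) - x (d' s)) a + pairing (\<lambda>s. y (d s) - y (d' s)) a"
      by (rule pairing_add_left [OF a kernel_bounds(2) [OF x] kernel_bounds(2) [OF y]])
    then show ?thesis
      unfolding defect_def action_linear(1,2) [OF a a x y]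
        fadd [OF left_action_test(1) [OF a x] left_action_test(1) [OF a y]]
        fadd [OF right_action_test(1) [OF a x] right_action_test(1) [OF a y]]
      by (simp add: algebra_simps)
  qed
  show "defect f a (\<lambda>\<omega>. c * x \<omega>) = c * defect f a x" for c
    unfolding defect_def action_linear(3,4) [OF a a x x] fsmult [OF left_action_test(1) [OF a x]]
      fsmult [OF right_action_test(1) [OF a x]] right_diff_distrib pairing_smult_left [symmetric] ..
qed

end

context brandt_semigroup
begin

lemma bm_assoc: "s \<in> BS \<Longrightarrow> t \<in> BS \<Longrightarrow> u \<in> BS \<Longrightarrow> bm (bm s t) u = bm s (bm t u)"
  by (cases s; cases t; cases u) (auto simp: group_assoc)

text \<open>An idempotent endomorphism of the semigroup that forgets the group entry.\<close>

definition skel where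
  "skel s = (case s of BZero \<Rightarrow> BZero | BElt g i j \<Rightarrow> BElt \<one> i j)"

lemma skel_simps [simp]: "skel BZero = BZero" "skel (BElt g i j) = BElt \<one> i j"
  by (simp_all add: skel_def)

lemma skel_skel [simp]: "skel (skel s) = skel s"
  by (cases s) simp_all

lemma skel_closed [simp]: "s \<in> BS \<Longrightarrow> skel s \<in> BS"
  by (cases s) simp_all

lemma skel_bm: "s \<in> BS \<Longrightarrow> t \<in> BS \<Longrightarrow> skel (bm s t) = bm (skel s) (skel t)"
  by (cases s; cases t) auto

text \<open>The left action uses only indices, so it preserves vanishing on the range of
  \<open>skel\<close>. In the right action, translation by \<open>t\<close> would destroy this, and
  the term with \<open>gr'\<close> is subtracted to restore it. Arguments outside the semigroup go
  to the zero, where test functions vanish.\<close>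

abbreviation "gl \<equiv> \<lambda>t \<omega>. if \<omega> \<in> BS then bm \<omega> (skel t) else BZero"
abbreviation "gr \<equiv> \<lambda>t \<omega>. if \<omega> \<in> BS then bm t \<omega> else BZero"
abbreviation "gr' \<equiv> \<lambda>t \<omega>. if \<omega> \<in> BS then bm t (skel \<omega>) else BZero"

text \<open>The dual of the following module consists of the functionals on bounded functions on the semigroup modulo
  those that factor through \<open>skel\<close>; on a block it is the dual of \<open>\<ell>\<^sup>\<infinity>(G)\<close> modulo constants.\<close>

lemma group_point_module:
  assumes "inj enc"
  shows "point_module BS bm gl gr gr' {\<omega>. skel \<omega> = \<omega>} id (\<lambda>_. BZero) enc"
proof (unfold_locales)
  fix x :: "('g, 'i) brandt \<Rightarrow> complex" assume x: "\<forall>\<omega>\<in>{\<omega>. skel \<omega> = \<omega>}. x \<omega> = 0"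
  then have x0: "x BZero = 0" by simp
  fix s assume s: "s \<in> BS"
  show "x (gl s \<omega>) = 0" if "\<omega> \<in> {\<omega>. skel \<omega> = \<omega>}" for \<omega>
    using x that s by (auto simp: skel_bm)
  show "x (gr s \<omega>) = x (gr' s \<omega>)" if "\<omega> \<in> {\<omega>. skel \<omega> = \<omega>}" for \<omega>
    using that by simp
  fix t assume t: "t \<in> BS"
  show "x (gl (bm s t) \<omega>) = x (gl t (gl s \<omega>))" for \<omega>
    using s t by (auto simp: skel_bm bm_assoc bm_closed)
  show "x (gr (bm s t) \<omega>) - x (gr' (bm s t) \<omega>)
      = (x (gr s (gr t \<omega>)) - x (gr' s (gr t \<omega>))) - (x (gr s (gr' t \<omega>)) - x (gr' s (gr' t \<omega>)))" for \<omega>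
    using s t x0 by (auto simp: skel_bm bm_assoc bm_closed)
  show "x (gr t (gl s \<omega>)) - x (gr' t (gl s \<omega>)) = x (gl s (gr t \<omega>)) - x (gl s (gr' t \<omega>))" for \<omega>
    using s t x0 by (auto simp: skel_bm bm_assoc bm_closed)
  show "x (id (bm s t)) - x BZero = ((x (gr s (id t)) - x (gr' s (id t))) - (x (gr s BZero) - x (gr' s BZero)))
      + (x (gl t (id s)) - x (gl t BZero))"
    using s t x0 by auto
qed (rule assms)

text \<open>The classical device for groups: the derivation k \<mapsto> evaluation at k minus
  evaluation at 1 lives on functions modulo constants, here normalized to vanish at 1. If \<phi>
  almost implements it, then f \<mapsto> f(1) - \<phi>(f - f(1)) is almost invariant, and its value
  at the constant 1 is exactly 1.\<close>

theorem approximately_amenable_mean: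
  fixes enc :: "(('g, 'i) brandt \<Rightarrow> complex) \<Rightarrow> 'y"
  assumes AA: "approximately_amenable TYPE('y) A" and enc: "inj enc" and "I \<noteq> {}"
  shows "\<exists>m. left_invariant_mean G (count_space (carrier G)) m"
proof -
  obtain i0 where i0: "i0 \<in> I" using assms(3) by blast
  interpret M: point_module BS bm gl gr gr' "{\<omega>. skel \<omega> = \<omega>}" id "\<lambda>_. BZero" enc
    by (rule group_point_module [OF enc])
  obtain F where F: "F \<noteq> bot"
    and F1: "\<forall>\<^sub>F f in F. (\<forall>x\<in>M.test_functions. \<forall>y\<in>M.test_functions. f (\<lambda>\<omega>. x \<omega> + y \<omega>) = f x + f y) \<and>
          (\<forall>c. \<forall>x\<in>M.test_functions. f (\<lambda>\<omega>. c * x \<omega>) = c * f x) \<and>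
          (\<exists>M. \<forall>x\<in>M.test_functions. \<forall>C. (\<forall>\<omega>. cmod (x \<omega>) \<le> C) \<longrightarrow> cmod (f x) \<le> M * C)"
    and F2: "\<forall>a\<in>carrier A. \<forall>\<epsilon>>0. \<forall>\<^sub>F f in F. \<forall>x\<in>M.test_functions. (\<forall>\<omega>. cmod (x \<omega>) \<le> 1) \<longrightarrow>
          cmod (pairing (\<lambda>s. x (id s) - x BZero) a - (f (M.right_action a x) - f (M.left_action a x))) \<le> \<epsilon>"
    using M.approximately_amenable_functionals [OF AA] by blast
  define \<kappa> where "\<kappa> f \<omega> = (case \<omega> of BElt g i j \<Rightarrow> if g \<in> carrier G \<and> i = i0 \<and> j = i0 then f g - f \<one> else 0 | BZero \<Rightarrow> 0)"
    for f :: "'g \<Rightarrow> complex" and \<omega>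
  have \<kappa>b: "cmod (\<kappa> f \<omega>) \<le> 2 * C" if f: "\<And>g. g \<in> carrier G \<Longrightarrow> cmod (f g) \<le> C" for f C \<omega>
  proof -
    have "cmod (f g - f \<one>) \<le> 2 * C" if "g \<in> carrier G" for g
      using norm_triangle_ineq4 [of "f g" "f \<one>"] f [OF that] f [of \<one>] by simp
    moreover have "0 \<le> C" using order_trans [OF norm_ge_zero f [of \<one>]] by simp
    ultimately show ?thesis unfolding \<kappa>_def by (auto split: brandt.splits)
  qed
  have \<kappa>t: "\<kappa> f \<in> M.test_functions" if bf: "bounded (f ` carrier G)" for f
  proof -
    obtain C where C: "\<And>g. g \<in> carrier G \<Longrightarrow> cmod (f g) \<le> C" using bounded_imageE [OF bf] by metis
    show ?thesis
    proof (rule M.test_functionI [OF \<kappa>b [OF C]])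
      show "\<kappa> f \<omega> = 0" if "\<omega> \<in> {\<omega>. skel \<omega> = \<omega>}" for \<omega>
        using that by (cases \<omega>) (auto simp: \<kappa>_def)
    qed
  qed
  let ?F = "filtermap (\<lambda>\<phi> f. f \<one> - \<phi> (\<kappa> f)) F"
  have bfn: "bounded_functional (carrier G) (\<lambda>f. f \<one> - \<phi> (\<kappa> f))"
    if \<phi>: "(\<forall>x\<in>M.test_functions. \<forall>y\<in>M.test_functions. \<phi> (\<lambda>\<omega>. x \<omega> + y \<omega>) = \<phi> x + \<phi> y) \<and>
          (\<forall>c. \<forall>x\<in>M.test_functions. \<phi> (\<lambda>\<omega>. c * x \<omega>) = c * \<phi> x) \<and>
          (\<exists>M. \<forall>x\<in>M.test_functions. \<forall>C. (\<forall>\<omega>. cmod (x \<omega>) \<le> C) \<longrightarrow> cmod (\<phi> x) \<le> M * C)" for \<phi>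
  proof -
    note add = \<phi> [THEN conjunct1, rule_format] and smult = \<phi> [THEN conjunct2, THEN conjunct1, rule_format]
    obtain M0 where M0: "\<forall>x\<in>M.test_functions. \<forall>C. (\<forall>\<omega>. cmod (x \<omega>) \<le> C) \<longrightarrow> cmod (\<phi> x) \<le> M0 * C"
      using \<phi> [THEN conjunct2, THEN conjunct2] by blast
    show ?thesis
      unfolding bounded_functional_def
    proof (intro conjI allI impI exI [of _ "1 + 2 * M0"])
      show "f \<one> + h \<one> - \<phi> (\<kappa> (\<lambda>x. f x + h x)) = f \<one> - \<phi> (\<kappa> f) + (h \<one> - \<phi> (\<kappa> h))"
        if "bounded (f ` carrier G)" "bounded (h ` carrier G)" for f h
      proof -
        have "\<kappa> (\<lambda>x. f x + h x) = (\<lambda>p. \<kappa> f p + \<kappa> h p)" by (auto simp: \<kappa>_def fun_eq_iff split: brandt.splits)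
        then show ?thesis using add [OF \<kappa>t [OF that(1)] \<kappa>t [OF that(2)]] by simp
      qed
      show "c * f \<one> - \<phi> (\<kappa> (\<lambda>x. c * f x)) = c * (f \<one> - \<phi> (\<kappa> f))" if "bounded (f ` carrier G)" for c f
      proof -
        have "\<kappa> (\<lambda>x. c * f x) = (\<lambda>p. c * \<kappa> f p)"
          by (auto simp: \<kappa>_def fun_eq_iff right_diff_distrib split: brandt.splits)
        then show ?thesis using smult [OF \<kappa>t [OF that]] by (simp add: right_diff_distrib)
      qed
      show "cmod (f \<one> - \<phi> (\<kappa> f)) \<le> (1 + 2 * M0) * C" if "C > 0" and fC: "\<forall>x\<in>carrier G. cmod (f x) \<le> C" for f C
      proof -
        have "bounded (f ` carrier G)" by (rule boundedI [of _ C]) (use fC in auto)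
        then have "cmod (\<phi> (\<kappa> f)) \<le> M0 * (2 * C)"
          using M0 [rule_format, OF \<kappa>t] \<kappa>b [of f C] fC by blast
        moreover have "cmod (f \<one>) \<le> C" using fC by simp
        ultimately show ?thesis using norm_triangle_ineq4 [of "f \<one>" "\<phi> (\<kappa> f)"] by (simp add: algebra_simps)
      qed
    qed
  qed
  show ?thesis
  proof (rule invariant_mean_from_net [OF group, of ?F])
    show "?F \<noteq> bot" using F by (simp add: filtermap_bot_iff)
    show "\<forall>\<^sub>F n in ?F. bounded_functional (carrier G) n"
      unfolding eventually_filtermap by (rule eventually_mono [OF F1 bfn])
    fix \<epsilon> :: real assume \<epsilon>: "\<epsilon> > 0"
    have \<kappa>1: "\<kappa> (\<lambda>x. 1) = (\<lambda>\<omega>. 0 * 0)" by (auto simp: \<kappa>_def fun_eq_iff split: brandt.splits)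
    show "\<forall>\<^sub>F n in ?F. cmod (n (\<lambda>x. 1) - 1) \<le> \<epsilon>"
      unfolding eventually_filtermap
    proof (rule eventually_mono [OF F1])
      fix \<phi> :: "(('g, 'i) brandt \<Rightarrow> complex) \<Rightarrow> complex"
      assume \<phi>: "(\<forall>x\<in>M.test_functions. \<forall>y\<in>M.test_functions. \<phi> (\<lambda>\<omega>. x \<omega> + y \<omega>) = \<phi> x + \<phi> y) \<and>
          (\<forall>c. \<forall>x\<in>M.test_functions. \<phi> (\<lambda>\<omega>. c * x \<omega>) = c * \<phi> x) \<and>
          (\<exists>M. \<forall>x\<in>M.test_functions. \<forall>C. (\<forall>\<omega>. cmod (x \<omega>) \<le> C) \<longrightarrow> cmod (\<phi> x) \<le> M * C)"
      have "\<phi> (\<kappa> (\<lambda>x. 1)) = 0"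
        unfolding \<kappa>1 using \<phi> [THEN conjunct2, THEN conjunct1, rule_format, OF M.test_zero, of 0] by simp
      then show "cmod (1 - \<phi> (\<kappa> (\<lambda>x. 1)) - 1) \<le> \<epsilon>" using \<epsilon> by simp
    qed
    fix k assume k: "k \<in> carrier G"
    let ?r = "BElt k i0 i0"
    have r: "?r \<in> BS" using i0 k by simp
    have ra: "M.right_action (point_mass ?r) (\<kappa> f) = \<kappa> (\<lambda>x. f (k \<otimes> x))" for f
    proof
      fix \<omega>
      have "M.right_action (point_mass ?r) (\<kappa> f) \<omega> = \<kappa> f (gr ?r \<omega>) - \<kappa> f (gr' ?r \<omega>)"
        unfolding M.right_action_def by (rule pairing_point_mass [OF r])
      also have "\<dots> = \<kappa> (\<lambda>x. f (k \<otimes> x)) \<omega>" using i0 k by (cases \<omega>) (auto simp: \<kappa>_def)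
      finally show "M.right_action (point_mass ?r) (\<kappa> f) \<omega> = \<kappa> (\<lambda>x. f (k \<otimes> x)) \<omega>" .
    qed
    have la: "M.left_action (point_mass ?r) (\<kappa> f) = \<kappa> f" for f
    proof
      fix \<omega>
      have "M.left_action (point_mass ?r) (\<kappa> f) \<omega> = \<kappa> f (gl ?r \<omega>)"
        unfolding M.left_action_def by (rule pairing_point_mass [OF r])
      also have "\<dots> = \<kappa> f \<omega>" using i0 k by (cases \<omega>) (auto simp: \<kappa>_def)
      finally show "M.left_action (point_mass ?r) (\<kappa> f) \<omega> = \<kappa> f \<omega>" .
    qed
    have pr: "pairing (\<lambda>s. \<kappa> f (id s) - \<kappa> f BZero) (point_mass ?r) = f k - f \<one>" for f
      unfolding pairing_point_mass [OF r] using k by (simp add: \<kappa>_def)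
    have "\<forall>\<^sub>F f in F. \<forall>x\<in>M.test_functions. (\<forall>\<omega>. cmod (x \<omega>) \<le> 1) \<longrightarrow>
          cmod (pairing (\<lambda>s. x (id s) - x BZero) (point_mass ?r)
            - (f (M.right_action (point_mass ?r) x) - f (M.left_action (point_mass ?r) x))) \<le> \<epsilon> / 2"
      by (rule F2 [rule_format]) (use \<epsilon> point_mass_closed [OF r] in simp_all)
    then show "\<forall>\<^sub>F n in ?F. \<forall>f. (\<forall>x\<in>carrier G. cmod (f x) \<le> 1) \<longrightarrow> cmod (n (\<lambda>x. f (k \<otimes> x)) - n f) \<le> \<epsilon>"
      unfolding eventually_filtermap using F1
    proof (eventually_elim, intro allI impI)
      fix \<phi> :: "(('g, 'i) brandt \<Rightarrow> complex) \<Rightarrow> complex" and f :: "'g \<Rightarrow> complex"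
      assume 1: "\<forall>x\<in>M.test_functions. (\<forall>\<omega>. cmod (x \<omega>) \<le> 1) \<longrightarrow>
          cmod (pairing (\<lambda>s. x (id s) - x BZero) (point_mass ?r)
            - (\<phi> (M.right_action (point_mass ?r) x) - \<phi> (M.left_action (point_mass ?r) x))) \<le> \<epsilon> / 2"
        and \<phi>: "(\<forall>x\<in>M.test_functions. \<forall>y\<in>M.test_functions. \<phi> (\<lambda>\<omega>. x \<omega> + y \<omega>) = \<phi> x + \<phi> y) \<and>
          (\<forall>c. \<forall>x\<in>M.test_functions. \<phi> (\<lambda>\<omega>. c * x \<omega>) = c * \<phi> x) \<and>
          (\<exists>M. \<forall>x\<in>M.test_functions. \<forall>C. (\<forall>\<omega>. cmod (x \<omega>) \<le> C) \<longrightarrow> cmod (\<phi> x) \<le> M * C)"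
        and f: "\<forall>x\<in>carrier G. cmod (f x) \<le> 1"
      \<comment> \<open>Subtracting f(1) can double the norm; \<open>f\<close> is halved to put the
        test function into the unit ball, which is why the estimate was taken with
        \<epsilon>/2.\<close>
      let ?n = "\<lambda>f. f \<one> - \<phi> (\<kappa> f)" and ?h = "\<lambda>x. (1 / 2) * f x"
      have h: "cmod (?h x) \<le> 1 / 2" if "x \<in> carrier G" for x using f that by (simp add: norm_mult)
      have bh: "bounded (f ` carrier G)" "bounded ((\<lambda>x. f (k \<otimes> x)) ` carrier G)" "bounded (?h ` carrier G)"
        using f h k by (auto intro!: boundedI [of _ 1] order_trans [OF h] simp del: norm_mult times_divide_eq_left)
      have \<kappa>h: "\<forall>\<omega>. cmod (\<kappa> ?h \<omega>) \<le> 1" using \<kappa>b [of ?h "1 / 2", OF h] by simp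
      have "cmod (?h k - ?h \<one> - (\<phi> (\<kappa> (\<lambda>x. ?h (k \<otimes> x))) - \<phi> (\<kappa> ?h))) \<le> \<epsilon> / 2"
        using 1 [rule_format, OF \<kappa>t [OF bh(3)]] \<kappa>h unfolding ra la pr by blast
      moreover have "?h k - ?h \<one> - (\<phi> (\<kappa> (\<lambda>x. ?h (k \<otimes> x))) - \<phi> (\<kappa> ?h)) = ?n (\<lambda>x. ?h (k \<otimes> x)) - ?n ?h"
        using k by (simp add: algebra_simps)
      moreover have "?n (\<lambda>x. ?h (k \<otimes> x)) = (1 / 2) * ?n (\<lambda>x. f (k \<otimes> x))" "?n ?h = (1 / 2) * ?n f"
        using bounded_functional_smult [OF bfn [OF \<phi>] bh(2), of "1 / 2"] bounded_functional_smult [OF bfn [OF \<phi>] bh(1), of "1 / 2"]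
        by simp_all
      ultimately have "cmod ((1 / 2) * (?n (\<lambda>x. f (k \<otimes> x)) - ?n f)) \<le> \<epsilon> / 2" by (simp only: right_diff_distrib)
      then show "cmod (?n (\<lambda>x. f (k \<otimes> x)) - ?n f) \<le> \<epsilon>" by (simp add: norm_mult del: right_diff_distrib)
    qed
  qed
qed

end

section \<open>The index bimodule and finiteness of the index set\<close>

definition index_left :: "('g, 'i) brandt \<Rightarrow> 'i option \<times> 'i option \<Rightarrow> 'i option \<times> 'i option" where
  "index_left s \<omega> = (case s of BZero \<Rightarrow> (None, None) | BElt g i j \<Rightarrow>
     if \<omega> \<noteq> (None, None) \<and> (snd \<omega> = Some i \<or> snd \<omega> = None) then (fst \<omega>, Some j) else (None, None))"

text \<open>In both actions \<open>None\<close> matches every index, as the formal sum of all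
  indices would: a matrix with entry in position (i, j) moves it to j in the left action and to i in
  the right action. Mismatches and (\<open>None\<close>, \<open>None\<close>) go to
  (\<open>None\<close>, \<open>None\<close>).\<close>

definition index_right :: "('g, 'i) brandt \<Rightarrow> 'i option \<times> 'i option \<Rightarrow> 'i option \<times> 'i option" where
  "index_right s \<omega> = (case s of BZero \<Rightarrow> (None, None) | BElt g i j \<Rightarrow>
     if \<omega> \<noteq> (None, None) \<and> (fst \<omega> = Some j \<or> fst \<omega> = None) then (Some i, snd \<omega>) else (None, None))"

text \<open>With \<open>index_col\<close> this gives the two halves of a formal commutator with
  evaluation at (\<open>None\<close>, \<open>None\<close>). That point was given the value 0, so the
  functional that would implement the derivation is absent.\<close>

definition index_row :: "('g, 'i) brandt \<Rightarrow> 'i option \<times> 'i option" where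
  "index_row s = (case s of BZero \<Rightarrow> (None, None) | BElt g i j \<Rightarrow> (Some i, None))"

definition index_col :: "('g, 'i) brandt \<Rightarrow> 'i option \<times> 'i option" where
  "index_col s = (case s of BZero \<Rightarrow> (None, None) | BElt g i j \<Rightarrow> (None, Some j))"

text \<open>Indicators of single points serve as test functions. At the excluded point the function
  is 0, which spares a case distinction in the formulas for the actions.\<close>

definition tau :: "'i option \<times> 'i option \<Rightarrow> 'i option \<times> 'i option \<Rightarrow> complex" where
  "tau \<kappa> \<omega> = (if \<omega> = \<kappa> \<and> \<omega> \<noteq> (None, None) then 1 else 0)"

lemma tau_none: "tau (None, None) = (\<lambda>\<omega>. 0 * 0)"
  by (auto simp: tau_def fun_eq_iff)

text \<open>Distinct indices have distinct keys, so at any point at most one summand is nonzero and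
  the bound does not grow with the number of terms.\<close>

lemma tau_sum_bound:
  assumes "finite W" "inj_on key W" "\<And>z. z \<in> W \<Longrightarrow> cmod (w z) \<le> C" "0 \<le> C"
  shows "cmod (\<Sum>z\<in>W. w z * tau (key z) \<omega>) \<le> C"
proof (cases "\<exists>z\<in>W. key z = \<omega>")
  case True
  then obtain z where z: "z \<in> W" "key z = \<omega>" by blast
  have "w y * tau (key y) \<omega> = (if z = y then w y * tau (key y) \<omega> else 0)" if "y \<in> W" for y
    using inj_onD [OF assms(2) _ z(1) that] z(2) by (auto simp: tau_def)
  then have "(\<Sum>y\<in>W. w y * tau (key y) \<omega>) = (\<Sum>y\<in>W. if z = y then w y * tau (key y) \<omega> else 0)"
    by (rule sum.cong [OF refl])
  also have "\<dots> = w z * tau (key z) \<omega>" using assms(1) z(1) by (simp add: sum.delta')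
  finally have "(\<Sum>y\<in>W. w y * tau (key y) \<omega>) = w z * tau (key z) \<omega>" .
  then show ?thesis using assms(3) [OF z(1)] assms(4) by (simp add: tau_def)
next
  case False
  then have "(\<Sum>y\<in>W. w y * tau (key y) \<omega>) = 0" by (intro sum.neutral) (auto simp: tau_def)
  then show ?thesis using assms(4) by simp
qed

text \<open>Level \<open>j\<close> has \<open>4\<^sup>j\<close> points of weight \<open>8\<^sup>-\<^sup>j\<close>: the sum converges, while the double averages over
  adjacent levels remain bounded when divided by the weights.\<close>

definition block_weight :: "(nat \<Rightarrow> bool) \<Rightarrow> nat \<times> nat \<Rightarrow> complex" where
  "block_weight P z = (if P (fst z) \<and> snd z < 4 ^ fst z then (1 / 8) ^ fst z else 0)"

lemma block_weight_summable: "(\<lambda>z. cmod (block_weight P z)) summable_on UNIV"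
proof -
  have "(\<lambda>(j, k). (1 / 8 :: real) ^ j) summable_on (SIGMA j:UNIV. {..<4 ^ j :: nat})"
  proof (rule summable_on_SigmaI)
    show "((\<lambda>k. case (j, k) of (j, k) \<Rightarrow> (1 / 8 :: real) ^ j) has_sum (1 / 2) ^ j) {..<4 ^ j :: nat}" for j :: nat
    proof -
      have "4 ^ j * (1 / 8 :: real) ^ j = (1 / 2) ^ j" by (simp add: power_mult_distrib [symmetric])
      then show ?thesis by (intro has_sum_finiteI) simp_all
    qed
    have "summable (\<lambda>j. norm ((1 / 2 :: real) ^ j))" by simp
    then show "(\<lambda>j. (1 / 2 :: real) ^ j) summable_on UNIV" by (rule norm_summable_imp_summable_on)
  qed auto
  then have "(\<lambda>z. cmod (block_weight P z)) summable_on (SIGMA j:UNIV. {..<4 ^ j :: nat})"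
    by (rule summable_on_comparison_test) (auto simp: block_weight_def norm_power norm_divide)
  then show ?thesis
    by (rule summable_on_cong_neutral [THEN iffD1, rotated -1]) (auto simp: block_weight_def)
qed

lemma avg_difference:
  fixes F G :: "'z \<Rightarrow> complex"
  assumes "finite P" "finite Q" "card P \<noteq> 0" "card Q \<noteq> 0"
  shows "(\<Sum>(p, q)\<in>P \<times> Q. (F p - G q) / (of_nat (card P) * of_nat (card Q)))
    = (\<Sum>p\<in>P. F p) / of_nat (card P) - (\<Sum>q\<in>Q. G q) / of_nat (card Q)"
proof -
  have "(\<Sum>(p, q)\<in>P \<times> Q. (F p - G q) / (of_nat (card P) * of_nat (card Q)))
    = (\<Sum>p\<in>P. \<Sum>q\<in>Q. F p / (of_nat (card P) * of_nat (card Q)) - G q / (of_nat (card P) * of_nat (card Q)))"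
    by (simp add: sum.cartesian_product diff_divide_distrib)
  also have "\<dots> = (\<Sum>p\<in>P. F p / of_nat (card P) - (\<Sum>q\<in>Q. G q) / (of_nat (card P) * of_nat (card Q)))"
    using assms(4) by (simp add: sum_subtractf sum_divide_distrib [symmetric])
  also have "\<dots> = (\<Sum>p\<in>P. F p) / of_nat (card P) - (\<Sum>q\<in>Q. G q) / of_nat (card Q)"
    using assms(3) by (simp add: sum_subtractf sum_divide_distrib [symmetric])
  finally show ?thesis .
qed

definition block :: "nat \<Rightarrow> (nat \<times> nat) set" where "block j = {j} \<times> {..<4 ^ j}"

text \<open>The first component always lies on the even level. Hence row values are averaged over
  even levels only and column values over odd levels only.\<close>

definition block_pairs :: "nat \<Rightarrow> ((nat \<times> nat) \<times> (nat \<times> nat)) set" where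
  "block_pairs j = (if even j then block j \<times> block (Suc j) else block (Suc j) \<times> block j)"

lemma block_simps [simp]: "finite (block j)" "card (block j) = 4 ^ j" "finite (block_pairs j)"
  by (simp_all add: block_def block_pairs_def)

lemma block_pairsD:
  assumes "(p, q) \<in> block_pairs j"
  shows "even (fst p)" "snd p < 4 ^ fst p" "odd (fst q)" "snd q < 4 ^ fst q"
    "fst p \<le> Suc j" "fst q \<le> Suc j" "j = min (fst p) (fst q)"
  using assms by (auto simp: block_pairs_def block_def split: if_splits)

text \<open>\<open>H\<close> averages \<open>F\<close> on even levels and \<open>G\<close> on odd
  ones. Averaging F p - G q over pairs of adjacent levels gives a difference of consecutive values
  of \<open>H\<close>, and the sign (-1)^j gives it the same direction for both parities.\<close>

lemma block_telescope:
  fixes F G :: "nat \<times> nat \<Rightarrow> complex"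
  defines "H \<equiv> \<lambda>j. (\<Sum>z\<in>block j. if even j then F z else G z) / 4 ^ j"
  shows "(\<Sum>z\<in>(SIGMA j:{..<L}. block_pairs j). (-1) ^ fst z / (4 ^ fst z * 4 ^ Suc (fst z)) * (F (fst (snd z)) - G (snd (snd z))))
    = H 0 - H L"
proof -
  have "(\<Sum>pq\<in>block_pairs j. (-1) ^ j / (4 ^ j * 4 ^ Suc j) * (F (fst pq) - G (snd pq))) = H j - H (Suc j)" for j
  proof (cases "even j")
    case True
    have "(\<Sum>pq\<in>block_pairs j. (-1) ^ j / (4 ^ j * 4 ^ Suc j) * (F (fst pq) - G (snd pq)))
      = (\<Sum>(p, q)\<in>block j \<times> block (Suc j). (F p - G q) / (of_nat (card (block j)) * of_nat (card (block (Suc j)))))"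
      by (rule sum.cong) (use True in \<open>auto simp: block_pairs_def simp del: power_Suc\<close>)
    also have "\<dots> = (\<Sum>p\<in>block j. F p) / of_nat (card (block j)) - (\<Sum>q\<in>block (Suc j). G q) / of_nat (card (block (Suc j)))"
      by (rule avg_difference) simp_all
    also have "\<dots> = H j - H (Suc j)" using True by (simp add: H_def del: power_Suc)
    finally show ?thesis .
  next
    case False
    have "(\<Sum>pq\<in>block_pairs j. (-1) ^ j / (4 ^ j * 4 ^ Suc j) * (F (fst pq) - G (snd pq)))
      = (\<Sum>pq\<in>block (Suc j) \<times> block j. - (case pq of (p, q) \<Rightarrow> (F p - G q) / (of_nat (card (block (Suc j))) * of_nat (card (block j)))))"
      by (rule sum.cong) (use False in \<open>auto simp: block_pairs_def mult.commute simp del: power_Suc\<close>)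
    also have "\<dots> = - ((\<Sum>p\<in>block (Suc j). F p) / of_nat (card (block (Suc j))) - (\<Sum>q\<in>block j. G q) / of_nat (card (block j)))"
      unfolding sum_negf by (subst avg_difference) simp_all
    also have "\<dots> = H j - H (Suc j)" using False by (simp add: H_def del: power_Suc)
    finally show ?thesis .
  qed
  then have "(\<Sum>j<L. \<Sum>pq\<in>block_pairs j. (-1) ^ j / (4 ^ j * 4 ^ Suc j) * (F (fst pq) - G (snd pq)))
    = (\<Sum>j<L. H j - H (Suc j))" by simp
  also have "\<dots> = H 0 - H L" by (rule sum_lessThan_telescope')
  finally show ?thesis by (simp add: sum.Sigma case_prod_unfold del: power_Suc)
qed

text \<open>The price of dividing an averaging coefficient by a weight. In the worst case
  \<open>n = Suc j\<close> it is 2 (8/16)^j: the base 8 of the weights stays below 4 \<cdot> 4, the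
  growth of the number of pairs.\<close>

lemma block_coefficient:
  assumes "n \<le> Suc j" shows "cmod ((-1) ^ j / (4 ^ j * 4 ^ Suc j) / (1 / 8) ^ n) \<le> 2"
proof -
  have "cmod ((-1) ^ j / (4 ^ j * 4 ^ Suc j) / (1 / 8) ^ n) = 8 ^ n / (4 ^ j * 4 ^ Suc j)"
    by (simp add: norm_divide norm_mult norm_power power_divide)
  also have "\<dots> \<le> 8 ^ Suc j / (4 ^ j * 4 ^ Suc j)"
    using assms by (intro divide_right_mono power_increasing) simp_all
  also have "\<dots> = 2 * (8 / 16) ^ j"
    unfolding power_divide by (simp add: power_mult_distrib [symmetric] field_simps)
  also have "\<dots> \<le> 2 * 1" by (intro mult_left_mono power_le_one) simp_all
  finally show ?thesis by simp
qed

context brandt_semigroup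
begin

text \<open>\<open>None\<close> stands for the adjoined point \<open>*\<close>, and functions vanish at \<open>(None, None)\<close>, where all undefined
  values go. The derivation sends \<open>(g)\<^sub>i\<^sub>j\<close> to the evaluation at \<open>(i, *)\<close> minus that at \<open>(*, j)\<close>.\<close>

lemma index_point_module:
  assumes "inj enc"
  shows "point_module BS bm index_left index_right (\<lambda>_ _. (None, None)) {(None, None)} index_row index_col enc"
proof (unfold_locales)
  fix x :: "'i option \<times> 'i option \<Rightarrow> complex" assume x: "\<forall>\<omega>\<in>{(None, None)}. x \<omega> = 0"
  then have x0: "x (None, None) = 0" by simp
  fix s assume s: "s \<in> BS"
  show "x (index_left s \<omega>) = 0" if "\<omega> \<in> {(None, None)}" for \<omega>
    using x0 that by (auto simp: index_left_def split: brandt.splits)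
  show "x (index_right s \<omega>) = x (None, None)" if "\<omega> \<in> {(None, None)}" for \<omega>
    using that by (auto simp: index_right_def split: brandt.splits)
  fix t assume t: "t \<in> BS"
  show "x (index_left (bm s t) \<omega>) = x (index_left t (index_left s \<omega>))" for \<omega>
    by (cases s; cases t; cases \<omega>) (auto simp: index_left_def)
  show "x (index_right (bm s t) \<omega>) - x (None, None)
      = (x (index_right s (index_right t \<omega>)) - x (None, None)) - (x (index_right s (None, None)) - x (None, None))" for \<omega>
    by (cases s; cases t; cases \<omega>) (auto simp: index_right_def)
  show "x (index_right t (index_left s \<omega>)) - x (None, None) = x (index_left s (index_right t \<omega>)) - x (index_left s (None, None))" for \<omega>
    using x0 by (cases s; cases t; cases \<omega>) (auto simp: index_left_def index_right_def)
  show "x (index_row (bm s t)) - x (index_col (bm s t))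
    = ((x (index_right s (index_row t)) - x (None, None)) - (x (index_right s (index_col t)) - x (None, None)))
      + (x (index_left t (index_row s)) - x (index_left t (index_col s)))"
    using x0 by (cases s; cases t) (auto simp: index_left_def index_right_def index_row_def index_col_def)
qed (rule assms)

text \<open>The weighted sum of the idempotents at the indices \<nu> z with coefficients c z,
  written out pointwise through the inverse of z \<mapsto> idempotent.\<close>

definition diagonal_element :: "('z \<Rightarrow> 'i) \<Rightarrow> ('z \<Rightarrow> complex) \<Rightarrow> ('g, 'i) brandt \<Rightarrow> complex" where
  "diagonal_element \<nu> c s =
     (if s \<in> range (\<lambda>z. BElt \<one> (\<nu> z) (\<nu> z)) then c (inv_into UNIV (\<lambda>z. BElt \<one> (\<nu> z) (\<nu> z)) s) else 0)"

context
  fixes \<nu> :: "'z \<Rightarrow> 'i" and c :: "'z \<Rightarrow> complex"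
  assumes \<nu>: "inj \<nu>" "range \<nu> \<subseteq> I" and c: "(\<lambda>z. cmod (c z)) summable_on UNIV"
begin

lemma inj_diagonal: "inj (\<lambda>z. BElt \<one> (\<nu> z) (\<nu> z))"
  by (rule injI) (use \<nu>(1) in \<open>simp add: inj_eq\<close>)

lemma diagonal_element_eq: "diagonal_element \<nu> c (BElt \<one> (\<nu> z) (\<nu> z)) = c z"
  using inv_into_f_f [OF inj_diagonal, of z] by (simp add: diagonal_element_def)

lemma diagonal_element_closed: "diagonal_element \<nu> c \<in> carrier A"
  unfolding ell1_simps(1)
proof (intro conjI allI impI)
  let ?V = "\<lambda>z. BElt \<one> (\<nu> z) (\<nu> z) :: ('g, 'i) brandt"
  have sub: "range ?V \<subseteq> BS" using \<nu>(2) by auto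
  show "diagonal_element \<nu> c s = 0" if "s \<notin> BS" for s
    using sub that unfolding diagonal_element_def by auto
  have "(\<lambda>s. cmod (diagonal_element \<nu> c s)) summable_on range ?V"
    unfolding summable_on_reindex [OF inj_diagonal] o_def diagonal_element_eq by (rule c)
  then show "(\<lambda>s. cmod (diagonal_element \<nu> c s)) summable_on BS"
    by (rule summable_on_cong_neutral [THEN iffD1, rotated -1]) (use sub in \<open>auto simp: diagonal_element_def\<close>)
qed

lemma pairing_diagonal_element:
  assumes "\<And>y. y \<noteq> z \<Longrightarrow> k (BElt \<one> (\<nu> y) (\<nu> y)) = 0"
  shows "pairing k (diagonal_element \<nu> c) = c z * k (BElt \<one> (\<nu> z) (\<nu> z))"
proof -
  let ?V = "\<lambda>z. BElt \<one> (\<nu> z) (\<nu> z) :: ('g, 'i) brandt"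
  have "diagonal_element \<nu> c s * k s = 0" if s: "s \<noteq> ?V z" for s
  proof (cases "s \<in> range ?V")
    case True
    then obtain y where y: "s = ?V y" by blast
    then show ?thesis using assms [of y] s by auto
  qed (simp add: diagonal_element_def)
  moreover have "?V z \<in> BS" using \<nu>(2) by auto
  ultimately have "pairing k (diagonal_element \<nu> c) = (\<Sum>\<^sub>\<infinity>s\<in>{?V z}. diagonal_element \<nu> c s * k s)"
    unfolding pairing_def by (intro infsum_cong_neutral) auto
  then show ?thesis by (simp add: diagonal_element_eq)
qed

text \<open>The column of \<nu> z is reached from itself and from \<open>None\<close>, which matches
  every index, and in both cases through the idempotent at \<nu> z alone. No element moves anything
  to \<open>None\<close>.\<close>

lemma index_left_diagonal:
  "pairing (\<lambda>s. tau (\<alpha>, Some (\<nu> z)) (index_left s \<omega>)) (diagonal_element \<nu> c)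
    = c z * tau (\<alpha>, Some (\<nu> z)) \<omega> + c z * tau (\<alpha>, None) \<omega>"
  "pairing (\<lambda>s. tau (\<alpha>, None) (index_left s \<omega>)) (diagonal_element \<nu> c) = 0"
proof -
  show "pairing (\<lambda>s. tau (\<alpha>, Some (\<nu> z)) (index_left s \<omega>)) (diagonal_element \<nu> c)
    = c z * tau (\<alpha>, Some (\<nu> z)) \<omega> + c z * tau (\<alpha>, None) \<omega>"
    by (subst pairing_diagonal_element [of z])
      (use \<nu>(1) in \<open>cases \<omega>; auto simp: tau_def index_left_def inj_eq\<close>)+
  show "pairing (\<lambda>s. tau (\<alpha>, None) (index_left s \<omega>)) (diagonal_element \<nu> c) = 0"
    by (subst pairing_diagonal_element [of undefined]) (auto simp: tau_def index_left_def)
qed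

lemma index_right_diagonal:
  "pairing (\<lambda>s. tau (Some (\<nu> z), \<beta>) (index_right s \<omega>) - tau (Some (\<nu> z), \<beta>) (None, None)) (diagonal_element \<nu> c)
    = c z * tau (Some (\<nu> z), \<beta>) \<omega> + c z * tau (None, \<beta>) \<omega>"
  "pairing (\<lambda>s. tau (None, \<beta>) (index_right s \<omega>) - tau (None, \<beta>) (None, None)) (diagonal_element \<nu> c) = 0"
proof -
  show "pairing (\<lambda>s. tau (Some (\<nu> z), \<beta>) (index_right s \<omega>) - tau (Some (\<nu> z), \<beta>) (None, None)) (diagonal_element \<nu> c)
    = c z * tau (Some (\<nu> z), \<beta>) \<omega> + c z * tau (None, \<beta>) \<omega>"
    by (subst pairing_diagonal_element [of z])
      (use \<nu>(1) in \<open>cases \<omega>; auto simp: tau_def index_right_def inj_eq\<close>)+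
  show "pairing (\<lambda>s. tau (None, \<beta>) (index_right s \<omega>) - tau (None, \<beta>) (None, None)) (diagonal_element \<nu> c) = 0"
    by (subst pairing_diagonal_element [of undefined]) (auto simp: tau_def index_right_def)
qed

lemma index_row_col_diagonal:
  "pairing (\<lambda>s. tau (Some (\<nu> z), None) (index_row s) - tau (Some (\<nu> z), None) (index_col s)) (diagonal_element \<nu> c) = c z"
  "pairing (\<lambda>s. tau (Some i, Some j) (index_row s) - tau (Some i, Some j) (index_col s)) (diagonal_element \<nu> c) = 0"
proof -
  show "pairing (\<lambda>s. tau (Some (\<nu> z), None) (index_row s) - tau (Some (\<nu> z), None) (index_col s)) (diagonal_element \<nu> c) = c z"
    by (subst pairing_diagonal_element [of z]) (use \<nu>(1) in \<open>auto simp: tau_def index_row_def index_col_def inj_eq\<close>)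
  show "pairing (\<lambda>s. tau (Some i, Some j) (index_row s) - tau (Some i, Some j) (index_col s)) (diagonal_element \<nu> c) = 0"
    by (subst pairing_diagonal_element [of undefined]) (auto simp: tau_def index_row_def index_col_def)
qed

end

theorem approximately_amenable_finite:
  fixes enc :: "('i option \<times> 'i option \<Rightarrow> complex) \<Rightarrow> 'y"
  assumes AA: "approximately_amenable TYPE('y) A" and enc: "inj enc"
  shows "finite I"
proof (rule ccontr)
  assume "infinite I"
  then obtain \<mu> :: "nat \<Rightarrow> 'i" where \<mu>: "inj \<mu>" "range \<mu> \<subseteq> I" using infinite_countable_subset by blast
  define \<nu> where "\<nu> z = \<mu> (prod_encode z)" for z
  have \<nu>: "inj \<nu>" "range \<nu> \<subseteq> I"
    using \<mu> unfolding \<nu>_def by (auto intro!: injI dest: injD)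
  interpret M: point_module BS bm index_left index_right "\<lambda>_ _. (None, None)" "{(None, None)}" index_row index_col enc
    by (rule index_point_module [OF enc])
  let ?a = "\<lambda>P. diagonal_element \<nu> (block_weight P)"
  note s = block_weight_summable
  note closed = diagonal_element_closed [OF \<nu> s]
  obtain F where F: "F \<noteq> bot"
    and F1: "\<forall>\<^sub>F f in F. (\<forall>x\<in>M.test_functions. \<forall>y\<in>M.test_functions. f (\<lambda>\<omega>. x \<omega> + y \<omega>) = f x + f y) \<and>
          (\<forall>c. \<forall>x\<in>M.test_functions. f (\<lambda>\<omega>. c * x \<omega>) = c * f x) \<and>
          (\<exists>M. \<forall>x\<in>M.test_functions. \<forall>C. (\<forall>\<omega>. cmod (x \<omega>) \<le> C) \<longrightarrow> cmod (f x) \<le> M * C)"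
    and F2: "\<forall>a\<in>carrier A. \<forall>\<epsilon>>0. \<forall>\<^sub>F f in F. \<forall>x\<in>M.test_functions. (\<forall>\<omega>. cmod (x \<omega>) \<le> 1) \<longrightarrow>
          cmod (pairing (\<lambda>s. x (index_row s) - x (index_col s)) a - (f (M.right_action a x) - f (M.left_action a x))) \<le> \<epsilon>"
    using M.approximately_amenable_functionals [OF AA] by blast
  have ev: "\<forall>\<^sub>F f in F. \<forall>x\<in>M.test_functions. (\<forall>\<omega>. cmod (x \<omega>) \<le> 1) \<longrightarrow> cmod (M.defect f (?a P) x) \<le> 1 / 10" for P
    unfolding M.defect_def by (rule F2 [rule_format, OF closed]) simp
  obtain f where f: "(\<forall>x\<in>M.test_functions. \<forall>y\<in>M.test_functions. f (\<lambda>\<omega>. x \<omega> + y \<omega>) = f x + f y) \<and>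
          (\<forall>c. \<forall>x\<in>M.test_functions. f (\<lambda>\<omega>. c * x \<omega>) = c * f x) \<and>
          (\<exists>M. \<forall>x\<in>M.test_functions. \<forall>C. (\<forall>\<omega>. cmod (x \<omega>) \<le> C) \<longrightarrow> cmod (f x) \<le> M * C)"
    and Da: "\<forall>x\<in>M.test_functions. (\<forall>\<omega>. cmod (x \<omega>) \<le> 1) \<longrightarrow> cmod (M.defect f (?a even) x) \<le> 1 / 10"
    and Db: "\<forall>x\<in>M.test_functions. (\<forall>\<omega>. cmod (x \<omega>) \<le> 1) \<longrightarrow> cmod (M.defect f (?a odd) x) \<le> 1 / 10"
    using eventually_happens' [OF F eventually_conj [OF F1 eventually_conj [OF ev [of even] ev [of odd]]]] by blast
  note fadd = f [THEN conjunct1, rule_format] and fsmult = f [THEN conjunct2, THEN conjunct1, rule_format]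
  have lin: "M.linear_test f" unfolding M.linear_test_def using f by blast
  obtain K where K: "\<forall>x\<in>M.test_functions. \<forall>C. (\<forall>\<omega>. cmod (x \<omega>) \<le> C) \<longrightarrow> cmod (f x) \<le> K * C"
    using f [THEN conjunct2, THEN conjunct2] by blast
  have tt: "tau \<kappa> \<in> M.test_functions" for \<kappa>
    by (rule M.test_functionI [of _ 1]) (auto simp: tau_def)
  have f0: "f (\<lambda>\<omega>. 0) = 0" using fsmult [OF M.test_zero, of 0] by simp
  have f0': "f (tau (None, None)) = 0" using f0 by (simp add: tau_none)
  have fcomb: "f (\<lambda>\<omega>. k * tau \<kappa> \<omega> + k * tau \<kappa>' \<omega>) = k * f (tau \<kappa>) + k * f (tau \<kappa>')" for k \<kappa> \<kappa>'
    unfolding fadd [OF M.test_smult(1) [OF tt] M.test_smult(1) [OF tt]] fsmult [OF tt] ..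
  define R where "R z = f (tau (Some (\<nu> z), None))" for z
  define Q where "Q z = f (tau (None, Some (\<nu> z)))" for z
  have la: "M.left_action (?a P) (tau (\<alpha>, Some (\<nu> z)))
      = (\<lambda>\<omega>. block_weight P z * tau (\<alpha>, Some (\<nu> z)) \<omega> + block_weight P z * tau (\<alpha>, None) \<omega>)" for P \<alpha> z
    by (rule ext) (unfold M.left_action_def, rule index_left_diagonal(1) [OF \<nu> s])
  have la0: "M.left_action (?a P) (tau (\<alpha>, None)) = (\<lambda>\<omega>. 0)" for P \<alpha>
    by (rule ext) (unfold M.left_action_def, rule index_left_diagonal(2) [OF \<nu> s])
  have ra: "M.right_action (?a P) (tau (Some (\<nu> z), \<beta>))
      = (\<lambda>\<omega>. block_weight P z * tau (Some (\<nu> z), \<beta>) \<omega> + block_weight P z * tau (None, \<beta>) \<omega>)" for P \<beta> z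
    by (rule ext) (unfold M.right_action_def, rule index_right_diagonal(1) [OF \<nu> s])
  have dpq: "M.defect f (?a P) (tau (Some (\<nu> p), Some (\<nu> q)))
    = block_weight P q * (f (tau (Some (\<nu> p), Some (\<nu> q))) + R p)
      - block_weight P p * (f (tau (Some (\<nu> p), Some (\<nu> q))) + Q q)" for P p q
    unfolding M.defect_def la ra fcomb index_row_col_diagonal(2) [OF \<nu> s] R_def Q_def by (simp add: algebra_simps)
  have dR: "M.defect f (?a P) (tau (Some (\<nu> p), None)) = block_weight P p - block_weight P p * R p" for P p
    unfolding M.defect_def la0 ra fcomb index_row_col_diagonal(1) [OF \<nu> s] R_def by (simp add: f0 f0')
  have "4 * K < 4 ^ L \<Longrightarrow> False" for L
  proof -
    \<comment> \<open>The bound \<open>K\<close> of \<open>f\<close> is known only now, after the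
      two elements and \<open>f\<close> are fixed; \<open>L\<close> is adapted to it.\<close>
    assume L: "4 * K < 4 ^ L"
    define W where "W = (SIGMA j:{..<L}. block_pairs j)"
    define key where "key z = (Some (\<nu> (fst (snd z))), Some (\<nu> (snd (snd z))))" for z :: "nat \<times> (nat \<times> nat) \<times> nat \<times> nat"
    define c where "c z = (-1) ^ fst z / (4 ^ fst z * 4 ^ Suc (fst z) :: complex)" for z :: "nat \<times> (nat \<times> nat) \<times> nat \<times> nat"
    \<comment> \<open>Coefficients of the telescope divided by the weight of the even point
      (\<open>wa\<close>) or of the odd point (\<open>wb\<close>). With them the unknown values at
      pairs cancel between the two elements.\<close>
    define wa where "wa z = c z / (1 / 8) ^ fst (fst (snd z))" for z
    define wb where "wb z = c z / (1 / 8) ^ fst (snd (snd z))" for z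
    define H where "H j = (\<Sum>z\<in>block j. if even j then R z else Q z) / 4 ^ j" for j
    have finW: "finite W" unfolding W_def by (intro finite_SigmaI) simp_all
    have mem: "snd z \<in> block_pairs (fst z)" if "z \<in> W" for z using that by (auto simp: W_def)
    have mem': "(fst (snd z), snd (snd z)) \<in> block_pairs (fst z)" if "z \<in> W" for z using mem [OF that] by simp
    have inj_key: "inj_on key W"
    proof (rule inj_onI)
      fix y z assume y: "y \<in> W" and z: "z \<in> W" and e: "key y = key z"
      have 1: "fst (snd y) = fst (snd z)" "snd (snd y) = snd (snd z)"
        using e \<nu>(1) by (simp_all add: key_def inj_eq)
      have "fst y = fst z" using block_pairsD(7) [OF mem' [OF y]] block_pairsD(7) [OF mem' [OF z]] 1 by simp
      then show "y = z" using 1 by (simp add: prod_eq_iff)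
    qed
    \<comment> \<open>The combined test function is bounded by 2 and is halved to fit the unit ball;
      hence twice 1/10.\<close>
    have half: "cmod (M.defect f (?a P) (\<lambda>\<omega>. \<Sum>z\<in>W. w z * tau (key z) \<omega>)) \<le> 1 / 5"
      if w: "\<And>z. z \<in> W \<Longrightarrow> cmod (w z) \<le> 2"
        and D: "\<forall>x\<in>M.test_functions. (\<forall>\<omega>. cmod (x \<omega>) \<le> 1) \<longrightarrow> cmod (M.defect f (?a P) x) \<le> 1 / 10" for w P
    proof -
      let ?X = "\<lambda>\<omega>. \<Sum>z\<in>W. w z * tau (key z) \<omega>"
      note dl = M.defect_linear [OF lin closed, of P]
      have X: "?X \<in> M.test_functions" using M.linear_test_sum [OF lin finW, of "\<lambda>z. tau (key z)" w] tt by blast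
      have "cmod (?X \<omega>) \<le> 2" for \<omega> by (rule tau_sum_bound [OF finW inj_key w]) simp_all
      then have X1: "cmod (1 / 2 * ?X \<omega>) \<le> 1" for \<omega> by (simp add: norm_mult norm_divide)
      have "cmod (M.defect f (?a P) (\<lambda>\<omega>. 1 / 2 * ?X \<omega>)) \<le> 1 / 10"
        by (rule D [rule_format, OF M.test_smult(1) [OF X] X1])
      moreover have "M.defect f (?a P) (\<lambda>\<omega>. 1 / 2 * ?X \<omega>) = 1 / 2 * M.defect f (?a P) ?X"
        by (rule dl [unfolded M.linear_test_def, THEN conjunct2, rule_format, OF X])
      ultimately have "cmod (1 / 2 * M.defect f (?a P) ?X) \<le> 1 / 10" by (simp only:)
      then show ?thesis unfolding norm_mult by (simp add: norm_divide)
    qed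
    have dsum: "M.defect f (?a P) (\<lambda>\<omega>. \<Sum>z\<in>W. w z * tau (key z) \<omega>) = (\<Sum>z\<in>W. w z * M.defect f (?a P) (tau (key z)))" for w P
      using M.linear_test_sum [OF M.defect_linear [OF lin closed] finW, of "\<lambda>z. tau (key z)"] tt by blast
    have wab: "cmod (wa z) \<le> 2" "cmod (wb z) \<le> 2" if "z \<in> W" for z
      unfolding wa_def wb_def c_def by (rule block_coefficient, rule block_pairsD [OF mem' [OF that]])+
    have weighted: "wa z * M.defect f (?a even) (tau (key z)) + wb z * M.defect f (?a odd) (tau (key z))
        = c z * (R (fst (snd z)) - Q (snd (snd z)))" if z: "z \<in> W" for z
    proof -
      note b = block_pairsD [OF mem' [OF z]]
      show ?thesis
        unfolding key_def dpq wa_def wb_def using b(1-4) by (simp add: block_weight_def field_simps)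
    qed
    have "M.defect f (?a even) (\<lambda>\<omega>. \<Sum>z\<in>W. wa z * tau (key z) \<omega>)
        + M.defect f (?a odd) (\<lambda>\<omega>. \<Sum>z\<in>W. wb z * tau (key z) \<omega>)
      = (\<Sum>z\<in>W. c z * (R (fst (snd z)) - Q (snd (snd z))))"
      unfolding dsum sum.distrib [symmetric] by (rule sum.cong [OF refl weighted])
    also have "\<dots> = H 0 - H L"
      unfolding W_def c_def H_def by (rule block_telescope)
    finally have diff: "H 0 - H L = M.defect f (?a even) (\<lambda>\<omega>. \<Sum>z\<in>W. wa z * tau (key z) \<omega>)
        + M.defect f (?a odd) (\<lambda>\<omega>. \<Sum>z\<in>W. wb z * tau (key z) \<omega>)" ..
    have "cmod (M.defect f (?a even) (\<lambda>\<omega>. \<Sum>z\<in>W. wa z * tau (key z) \<omega>)) \<le> 1 / 5"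
      "cmod (M.defect f (?a odd) (\<lambda>\<omega>. \<Sum>z\<in>W. wb z * tau (key z) \<omega>)) \<le> 1 / 5"
      by (rule half [OF wab(1) Da], assumption, rule half [OF wab(2) Db], assumption)
    then have "cmod (H 0 - H L) \<le> 1 / 5 + 1 / 5" unfolding diff by (rule norm_triangle_mono)
    moreover have "cmod (1 - H 0) \<le> 1 / 10"
    proof -
      have "cmod (M.defect f (?a even) (tau (Some (\<nu> (0, 0)), None))) \<le> 1 / 10"
        by (rule Da [rule_format, OF tt]) (simp add: tau_def)
      then show ?thesis unfolding dR by (simp add: block_weight_def H_def block_def lessThan_Suc)
    qed
    moreover have "cmod (H L) \<le> 1 / 4"
    proof -
      define \<kappa> where "\<kappa> z = (if even L then (Some (\<nu> z), None) else (None, Some (\<nu> z)))" for z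
      \<comment> \<open>A sum of 4^L indicators of different points has norm at most 1, so
        \<open>f\<close> is bounded by \<open>K\<close> on it, although its value is 4^L times the
        average over the block.\<close>
      let ?X = "\<lambda>\<omega>. \<Sum>z\<in>block L. 1 * tau (\<kappa> z) \<omega>"
      have X: "?X \<in> M.test_functions \<and> f ?X = (\<Sum>z\<in>block L. 1 * f (tau (\<kappa> z)))"
        by (rule M.linear_test_sum [OF lin block_simps(1)]) (rule tt)
      have inj_\<kappa>: "inj_on \<kappa> (block L)" using \<nu>(1) by (cases "even L") (auto simp: \<kappa>_def intro!: inj_onI dest: injD)
      have "cmod (?X \<omega>) \<le> 1" for \<omega> by (rule tau_sum_bound [OF block_simps(1) inj_\<kappa>]) simp_all
      then have "cmod (f ?X) \<le> K * 1" by (rule K [rule_format, OF X [THEN conjunct1]])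
      moreover have "f ?X = 4 ^ L * H L"
        unfolding X [THEN conjunct2] H_def by (cases "even L") (simp_all add: \<kappa>_def R_def Q_def)
      ultimately have "4 ^ L * cmod (H L) \<le> K" by (simp add: norm_mult norm_power)
      then have "4 ^ L * cmod (H L) \<le> 4 ^ L * (1 / 4)" using L by linarith
      then show ?thesis by (rule mult_left_le_imp_le) simp
    qed
    \<comment> \<open>The errors add up to 3/4, which is less than 1.\<close>
    ultimately have "cmod ((1 - H 0) + ((H 0 - H L) + H L)) \<le> 1 / 10 + ((1 / 5 + 1 / 5) + 1 / 4)"
      by (intro norm_triangle_mono)
    then show False by simp
  qed
  moreover obtain L where "4 * K < 4 ^ L" using real_arch_pow [of 4 "4 * K"] by auto
  ultimately show False by blast
qed

end

text \<open>Carriers of the two test bimodules must be placed in a sum type whose right summand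
  consists of functions on \<open>'c\<close>. Indicators of points embed \<open>'c\<close>, so an
  injection of the carrier into \<open>'c\<close> is enough.\<close>

lemma inj_Inr_indicator:
  assumes "inj h"
  shows "inj (\<lambda>x. Inr (\<lambda>\<beta>. if \<beta> = h x then 1 else 0) :: 'x + ('c \<Rightarrow> complex))"
proof (rule injI)
  fix x y assume "(Inr (\<lambda>\<beta>. if \<beta> = h x then 1 else 0) :: 'x + ('c \<Rightarrow> complex)) = Inr (\<lambda>\<beta>. if \<beta> = h y then 1 else 0)"
  then have "(\<lambda>\<beta>. if \<beta> = h x then 1 else 0 :: complex) = (\<lambda>\<beta>. if \<beta> = h y then 1 else 0)" by (rule Inr_inject)
  from fun_cong [OF this, of "h x"] have "h x = h y" by (simp split: if_splits)
  then show "x = y" using assms by (simp add: inj_eq)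
qed

lemma inj_comp_surj:
  assumes "surj h" shows "inj (\<lambda>x. x \<circ> h)"
proof (rule injI, rule ext)
  fix x y p assume "x \<circ> h = y \<circ> h"
  moreover obtain q where "p = h q" using surjD [OF assms] by blast
  ultimately show "x p = y p" by (auto dest: fun_cong [of _ _ q])
qed

theorem theorem4p6:
  fixes G :: "('g, 'm) monoid_scheme" and \<tau> :: "'g topology" and I :: "'i set"
  assumes "locally_compact_group G \<tau>" and "I \<noteq> {}"
  shows "(strong_pseudo_amenable (brandt_algebra G I) \<longleftrightarrow>
            amenable_group G (discrete_topology (carrier G)) \<and> finite I) \<and>
         (amenable_group G (discrete_topology (carrier G)) \<and> finite I \<longleftrightarrow>
            approximately_amenable
              TYPE('x + ((('g, 'i) brandt \<times> ('g, 'i) brandt \<Rightarrow> complex) \<Rightarrow> complex))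
              (brandt_algebra G I)) \<and>
         (strong_pseudo_amenable (brandt_algebra G I) \<longrightarrow> amenable_group G \<tau> \<and> finite I)"
proof -
  have group: "Group.group G" using assms(1) by (simp add: locally_compact_group_def)
  interpret brandt_semigroup G I by (rule brandt_semigroup.intro [OF group])
  let ?Y = "TYPE('x + ((('g, 'i) brandt \<times> ('g, 'i) brandt \<Rightarrow> complex) \<Rightarrow> complex))"
  have am: "amenable_group G (discrete_topology (carrier G)) \<longleftrightarrow> (\<exists>m. left_invariant_mean G (count_space (carrier G)) m)"
    by (rule amenable_discrete_iff [OF group])
  have 1: "amenable_group G (discrete_topology (carrier G)) \<and> finite I" if "strong_pseudo_amenable A"
    unfolding am using strong_pseudo_amenable_mean [OF that assms(2)] strong_pseudo_amenable_finite [OF that] by blast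
  have 2: "strong_pseudo_amenable A \<and> approximately_amenable ?Y A"
    if h: "amenable_group G (discrete_topology (carrier G)) \<and> finite I"
  proof -
    obtain m where m: "left_invariant_mean G (count_space (carrier G)) m" using h unfolding am by blast
    interpret V: virtual_diagonal BS bm "brandt_unit I" "\<lambda>\<beta>. m (local_diagonal \<beta>)" "1 + 4 * real (card I)"
      using h assms(2) m by (intro brandt_virtual_diagonal) simp_all
    show ?thesis using V.strong_pseudo_amenable V.approximately_amenable by blast
  qed
  have 3: "amenable_group G (discrete_topology (carrier G)) \<and> finite I" if AA: "approximately_amenable ?Y A"
  proof -
    \<comment> \<open>Here \<open>'c\<close> is the type of functions on pairs of semigroup
      elements; a function of one element is read as a function of the first entry.\<close>
    have "inj (\<lambda>x :: ('g, 'i) brandt \<Rightarrow> complex. x \<circ> (fst :: ('g, 'i) brandt \<times> ('g, 'i) brandt \<Rightarrow> _))"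
      by (rule inj_comp_surj) auto
    from approximately_amenable_mean [OF AA inj_Inr_indicator [OF this] assms(2)]
    have "\<exists>m. left_invariant_mean G (count_space (carrier G)) m" .
    moreover
    \<comment> \<open>For the index bimodule, points of the index set with * adjoined are labelled
      by Brandt elements: the zero stands for *, and any matrix in row i for i. Since
      \<open>lab\<close> is onto, composing with it is injective on functions of pairs.\<close>
    define lab :: "('g, 'i) brandt \<Rightarrow> 'i option" where "lab s = (case s of BZero \<Rightarrow> None | BElt g i j \<Rightarrow> Some i)" for s
    have "lab (case u of None \<Rightarrow> BZero | Some i \<Rightarrow> BElt undefined i i) = u" for u
      by (cases u) (simp_all add: lab_def)
    then have "surj lab" by (rule surjI)
    then have "inj (\<lambda>x :: 'i option \<times> 'i option \<Rightarrow> complex. x \<circ> map_prod lab lab)"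
      by (intro inj_comp_surj map_prod_surj)
    from approximately_amenable_finite [OF AA inj_Inr_indicator [OF this]] have "finite I" .
    ultimately show ?thesis unfolding am by blast
  qed
  show ?thesis
    using 1 2 3 amenable_discrete_imp_amenable [OF assms(1)] by blast
qed

end
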